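(* Let $F:[0,T]\times\mathbb{R}^d\times\mathscr{P}^2(\mathbb{R}^d)\rightrightarrows\mathbb{R}^d\times S_d^+$ be an upper semicontinuous multivalued mapping with nonempty convex values, and assume there exist nonnegative constants $C_b,C_A$ such that for every $(\beta,\Sigma)\in F(t,x,m)$ $$|\beta|\le C_b(1+|x|+\mathcal{M}_2(m)),\qquad \|\Sigma\|_F\le C_A(1+|x|^2+\mathcal{M}_2^2(m)).$$ Additionally, suppose that the real-valued functions $G$ (of $m\in\mathscr{P}^2(\mathbb{R}^d)$) and $f$ (of $(t,x,m,\beta,\Sigma)\in[0,T]\times\mathbb{R}^d\times\mathscr{P}^2(\mathbb{R}^d)\times\mathbb{R}^d\times S_d^+$) satisfy: - $G$ and $f$ are lower semicontinuous; - $G$ is bounded below on every compact subset of $\mathscr{P}^2(\mathbb{R}^d)$; - $f$ is convex with respect to $\beta$ and $\Sigma$; - $|f(t,x,m,\beta,\Sigma)|\le C_f(m)\,(1+|x|^2+|\beta|^2+\|\Sigma\|_F)$, where $C_f(m)$ is bounded on each compact subset of $\mathscr{P}^2(\mathbb{R}^d)$. For $\nu\in\mathscr{P}^2(\mathbb{R}^d)$ and $((m_t)_{t\in[0,T]},b,A)\in\mathcal{E}_F(\nu)$ put $$J[(m_t)_{t\in[0,T]},b,A]=G(m_T)+\int_0^T\int_{\mathbb{R}^d}f(t,x,m_t,b(t,x),A(t,x))\,m_t(dx)\,dt,$$ $$\operatorname{Val}(\nu)=\inf\big\{J[(m_t)_{t\in[0,T]},b,A]:\ ((m_t)_{t\in[0,T]},b,A)\in\mathcal{E}_F(\nu)\big\}.$$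 Then there exists an admissible control process $((m_t^0)_{t\in[0,T]},b^0,A^0)\in\mathcal{E}_F(\nu)$ such that $\operatorname{Val}(\nu)=J[(m_t^0)_{t\in[0,T]},b^0,A^0]$. Moreover, the function $\operatorname{Val}$ is lower semicontinuous.
   Context: $T>0$ is fixed. $S_d^+$ is the set of symmetric nonnegative (positive semidefinite) real $d\times d$ matrices, $\|\cdot\|_F$ is the Frobenius norm. $\mathscr{P}^2(\mathbb{R}^d)$ is the space of Borel probability measures on $\mathbb{R}^d$ with finite second moment, endowed with the second Wasserstein metric $W_2$, and $\mathcal{M}_2(m)=\big(\int_{\mathbb{R}^d}|x|^2m(dx)\big)^{1/2}$. Gradients $\nabla\varphi$ are taken in $x$ and are row vectors; $\nabla^\top\nabla\varphi$ is the Hessian in $x$. $C^{1,2}_c((0,T)\times\mathbb{R}^d)$ is the set of compactly supported real functions on $(0,T)\times\mathbb{R}^d$ that are $C^1$ in time and $C^2$ in $x$. For $\nu\in\mathscr{P}^2(\mathbb{R}^d)$, $\mathcal{E}_F(\nu)$ is the set of triples $((m_t)_{t\in[0,T]},b,A)$ (admissible control processes), where $(m_t)_{t\in[0,T]}$ is a flow of probabilities (a family of measures in $\mathscr{P}^2(\mathbb{R}^d)$) with $m_0=\nu$, and $b:[0,T]\times\mathbb{R}^d\to\mathbb{R}^d$, $A:[0,T]\times\mathbb{R}^d\to S_d^+$ are Borel functions such that (i) $(b(t,x),A(t,x))\in F(t,x,m_t)$ for $m_t$-a.e. $x\in\mathbb{R}^d$ and a.e. $t\in[0,T]$; (ii)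 for every $\varphi\in C^{1,2}_c((0,T)\times\mathbb{R}^d)$, $$\int_0^T\int_{\mathbb{R}^d}\Big[\partial_t\varphi(t,x)+\nabla\varphi(t,x)b(t,x)+\tfrac12\operatorname{tr}\big(\nabla^\top\nabla\varphi(t,x)A(t,x)\big)\Big]m_t(dx)\,dt=0.$$
   Formalization: The values of F are additionally assumed to be closed, and a flow of probabilities is required to be a W_2-continuous curve on [0,T]; without either of these a minimizer can fail to exist. *)

theory Defs
  imports "HOL-Analysis.Analysis" "HOL-Probability.Probability"
begin

text \<open>The norm of the type \<open>real ^ 'd ^ 'd\<close> is the Frobenius norm, and its topology is the usual
  one on matrices.\<close>

lemma norm_matrix_eq_Frobenius:
  fixes A :: "real ^ 'm ^ 'n"
  shows "norm A = sqrt (\<Sum>i\<in>UNIV. \<Sum>j\<in>UNIV. (A $ i $ j)\<^sup>2)"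
  by (simp add: norm_vec_def L2_set_def sum_nonneg)

definition sym_psd :: "(real ^ 'd ^ 'd) set" where
  "sym_psd = {A. transpose A = A \<and> (\<forall>v. 0 \<le> v \<bullet> (A *v v))}"


section \<open>The Wasserstein space\<close>

definition P2 :: "(real ^ 'd) measure set" where
  "P2 = {m. prob_space m \<and> sets m = sets borel \<and> integrable m (\<lambda>x. (norm x)\<^sup>2)}"

definition M2 :: "(real ^ 'd) measure \<Rightarrow> real" where
  "M2 m = sqrt (\<integral>x. (norm x)\<^sup>2 \<partial>m)"

definition couplings ::
    "(real ^ 'd) measure \<Rightarrow> (real ^ 'd) measure \<Rightarrow> ((real ^ 'd) \<times> (real ^ 'd)) measure set" where
  "couplings m n = {p. prob_space p \<and> sets p = sets borel \<and>
     distr p borel fst = m \<and> distr p borel snd = n}"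

text \<open>On \<^const>\<open>P2\<close> the infimum below is finite, so \<^const>\<open>enn2real\<close> loses nothing there.\<close>

definition W2 :: "(real ^ 'd) measure \<Rightarrow> (real ^ 'd) measure \<Rightarrow> real" where
  "W2 m n = sqrt (enn2real
     (INF p\<in>couplings m n. \<integral>\<^sup>+z. ennreal ((dist (fst z) (snd z))\<^sup>2) \<partial>p))"

definition P2_topology :: "(real ^ 'd) measure topology" where
  "P2_topology = Metric_space.mtopology P2 W2"


section \<open>Semicontinuity\<close>

definition lower_semicontinuous_map :: "'a topology \<Rightarrow> ('a \<Rightarrow> 'b::linorder) \<Rightarrow> bool" where
  "lower_semicontinuous_map X f \<longleftrightarrow> (\<forall>a. openin X {z \<in> topspace X. a < f z})"

text \<open>Upper semicontinuous multivalued mappings are understood to be closed-valued. For the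
  locally bounded mappings considered here this is the same as having a closed graph. Without
  closed values minima need not be attained: consider a constant mapping with a non-closed
  convex value.\<close>

definition upper_semicontinuous_multimap ::
    "'a topology \<Rightarrow> ('a \<Rightarrow> 'b::topological_space set) \<Rightarrow> bool" where
  "upper_semicontinuous_multimap X \<Phi> \<longleftrightarrow>
     (\<forall>z\<in>topspace X. closed (\<Phi> z)) \<and>
     (\<forall>V. open V \<longrightarrow> openin X {z \<in> topspace X. \<Phi> z \<subseteq> V})"


section \<open>Admissible control processes\<close>

text \<open>\<open>test_function T \<phi> \<phi>t g H\<close>: \<open>\<phi>\<close> is of class $C^{1,2}_c$ on \<open>(0,T) \<times> \<real>\<^sup>d\<close>, with time
  derivative \<open>\<phi>t\<close>, spatial gradient \<open>g\<close> and spatial Hessian \<open>H\<close>. Only the values for \<open>0 < t < T\<close>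
  are constrained.\<close>

definition test_function ::
    "real \<Rightarrow> (real \<Rightarrow> real ^ 'd \<Rightarrow> real) \<Rightarrow> (real \<Rightarrow> real ^ 'd \<Rightarrow> real) \<Rightarrow>
     (real \<Rightarrow> real ^ 'd \<Rightarrow> real ^ 'd) \<Rightarrow> (real \<Rightarrow> real ^ 'd \<Rightarrow> real ^ 'd ^ 'd) \<Rightarrow> bool" where
  "test_function T \<phi> \<phi>t g H \<longleftrightarrow>
     (\<forall>t\<in>{0<..<T}. \<forall>x.
        ((\<lambda>s. \<phi> s x) has_real_derivative \<phi>t t x) (at t) \<and>
        GDERIV (\<phi> t) x :> g t x \<and>
        (g t has_derivative (\<lambda>h. H t x *v h)) (at x)) \<and>
     continuous_on ({0<..<T} \<times> UNIV) (\<lambda>(t, x). \<phi> t x) \<and>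
     continuous_on ({0<..<T} \<times> UNIV) (\<lambda>(t, x). \<phi>t t x) \<and>
     continuous_on ({0<..<T} \<times> UNIV) (\<lambda>(t, x). g t x) \<and>
     continuous_on ({0<..<T} \<times> UNIV) (\<lambda>(t, x). H t x) \<and>
     (\<exists>K. compact K \<and> K \<subseteq> {0<..<T} \<times> UNIV \<and>
        (\<forall>t\<in>{0<..<T}. \<forall>x. (t, x) \<notin> K \<longrightarrow> \<phi> t x = 0))"

text \<open>A flow of probabilities is a curve in the metric space \<open>(P2, W2)\<close>, continuous on \<open>[0,T]\<close>.
  Continuity is what gives meaning to the initial condition and to the terminal measure: the
  Fokker--Planck equation is tested only on the open interval \<open>(0,T)\<close> and does not see the
  individual measures \<open>m 0\<close> and \<open>m T\<close>.\<close>

definition flow_of_probabilities :: "real \<Rightarrow> (real \<Rightarrow> (real ^ 'd) measure) \<Rightarrow> bool" where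
  "flow_of_probabilities T m \<longleftrightarrow> continuous_map (top_of_set {0..T}) P2_topology m"

definition admissible ::
    "real \<Rightarrow> (real \<Rightarrow> real ^ 'd \<Rightarrow> (real ^ 'd) measure \<Rightarrow> ((real ^ 'd) \<times> (real ^ 'd ^ 'd)) set) \<Rightarrow>
     (real ^ 'd) measure \<Rightarrow>
     ((real \<Rightarrow> (real ^ 'd) measure) \<times> (real \<Rightarrow> real ^ 'd \<Rightarrow> real ^ 'd) \<times>
      (real \<Rightarrow> real ^ 'd \<Rightarrow> real ^ 'd ^ 'd)) set" where
  "admissible T F \<nu> = {(m, b, A).
     flow_of_probabilities T m \<and> m 0 = \<nu> \<and>
     (\<lambda>(t, x). b t x) \<in> borel_measurable (restrict_space borel ({0..T} \<times> UNIV)) \<and>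
     (\<lambda>(t, x). A t x) \<in> borel_measurable (restrict_space borel ({0..T} \<times> UNIV)) \<and>
     (\<forall>t\<in>{0..T}. \<forall>x. A t x \<in> sym_psd) \<and>
     (AE t in lborel. t \<in> {0..T} \<longrightarrow> (AE x in m t. (b t x, A t x) \<in> F t x (m t))) \<and>
     (\<forall>\<phi> \<phi>t g H. test_function T \<phi> \<phi>t g H \<longrightarrow>
        (LBINT t:{0..T}. (\<integral>x. \<phi>t t x + g t x \<bullet> b t x + (1/2) * trace (H t x ** A t x) \<partial>m t)) = 0)}"

text \<open>Under the growth conditions of the theorem, the integrands here and in \<^const>\<open>admissible\<close> are
  integrable for every process in \<open>admissible T F \<nu>\<close>, so the convention that the Bochner
  integral of a non-integrable function is 0 plays no role.\<close>

definition cost ::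
    "real \<Rightarrow> ((real ^ 'd) measure \<Rightarrow> real) \<Rightarrow>
     (real \<Rightarrow> real ^ 'd \<Rightarrow> (real ^ 'd) measure \<Rightarrow> real ^ 'd \<Rightarrow> real ^ 'd ^ 'd \<Rightarrow> real) \<Rightarrow>
     (real \<Rightarrow> (real ^ 'd) measure) \<Rightarrow> (real \<Rightarrow> real ^ 'd \<Rightarrow> real ^ 'd) \<Rightarrow>
     (real \<Rightarrow> real ^ 'd \<Rightarrow> real ^ 'd ^ 'd) \<Rightarrow> real" where
  "cost T G f m b A =
     G (m T) + (LBINT t:{0..T}. (\<integral>x. f t x (m t) (b t x) (A t x) \<partial>m t))"

definition Val ::
    "real \<Rightarrow> (real \<Rightarrow> real ^ 'd \<Rightarrow> (real ^ 'd) measure \<Rightarrow> ((real ^ 'd) \<times> (real ^ 'd ^ 'd)) set) \<Rightarrow>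
     ((real ^ 'd) measure \<Rightarrow> real) \<Rightarrow>
     (real \<Rightarrow> real ^ 'd \<Rightarrow> (real ^ 'd) measure \<Rightarrow> real ^ 'd \<Rightarrow> real ^ 'd ^ 'd \<Rightarrow> real) \<Rightarrow>
     (real ^ 'd) measure \<Rightarrow> ereal" where
  "Val T F G f \<nu> = (INF (m, b, A)\<in>admissible T F \<nu>. ereal (cost T G f m b A))"

end

theory Submission
  imports Defs "HOL-Library.Diagonal_Subsequence"
begin

text \<open>The direct method. Testing the Fokker--Planck equation with truncated radial functions, the growth
 conditions on \<open>F\<close> and Gronwall's inequality bound the second moments and their tails uniformly over
 all admissible flows, and testing it with bump functions gives equicontinuity in time; hence the flows of
 a minimizing sequence converge in \<open>W2\<close>, uniformly in time, along a subsequence. The controls converge only in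
 law: by Skorokhod's representation of the joint laws of time, position and control value one may assume
 almost sure convergence, the closed graph of \<open>F\<close> is then passed to the limit, and the conditional expectation
 of the limiting control value given time and position stays in the convex values of \<open>F\<close> and satisfies the
 limiting equation. Carrying the running cost along as one more component of the control, with the epigraph
 of \<open>f\<close> as constraint, gives the lower semicontinuity of the cost. Admissible processes exist because random walks
 started from finitely supported laws satisfy the equation up to an error that vanishes with the step size,
 and such laws are dense. The same limit theorem, applied along converging initial laws, shows that \<open>Val\<close>
 is lower semicontinuous.\<close>

text \<open>Compactness is never sought for the functions \<open>b\<close> and \<open>A\<close>
  themselves. A controlled flow is read as a probability measure on time, position and control
  value, with time uniform on [0,T]; the equation is affine in the control and the constraint is a
  closed set with convex slices, so both survive a weak limit followed by a conditional expectation.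
  Only second moments are controlled, while costs grow like |x|^2. Fatou's lemma is therefore
  applied to the cost plus a multiple of 1+|x|^2, and the added term is removed afterwards because
  W2 convergence carries second moments with it. Tails are measured by |x|^4/(|x|^2+R): its square
  root is Lipschitz uniformly in R, hence stable under W2, and its generator is bounded by itself
  plus terms of order 1/R, so that Gronwall closes. Test functions are built from functions of |x|^2
  with cubic cut-offs, which are C^2 with explicit derivatives. The walk satisfies the inclusion at
  a delayed grid time and the equation only approximately; the limit theorem is phrased with both
  defects so that walks and admissible flows are instances of it.\<close>

type_synonym 'd state = "real \<times> (real, 'd) vec"
type_synonym 'd control = "(real, 'd) vec \<times> ((real, 'd) vec, 'd) vec"

abbreviation (input) seq_lim :: "(nat => 'a::topological_space) => 'a => bool" (infix "---->" 60) where
 "X ----> L == (X \<longlongrightarrow> L) sequentially"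

abbreviation (input) pmf_mean :: "'a pmf => ('a => 'b::{banach, second_countable_topology}) => 'b" where
 "pmf_mean p f == measure_pmf.expectation p f"

abbreviation (input) w2_cost :: "('a::metric_space \<times> 'a) measure => ennreal" where
 "w2_cost p == \<integral>\<^sup>+z. ennreal ((dist (fst z) (snd z))^2) \<partial>p"

subsection \<open>A continuous surjection of the line onto a Euclidean space\<close>

text \<open>A clipped cosine of period 2 that is 0 on [0,1/3] and 1 on [2/3,1], as in Schoenberg's
  space-filling curve: applied to 3^k times a Cantor point it reads off a ternary digit.\<close>

definition ternary_bit :: "real => real" where
 "ternary_bit x = max 0 (min 1 (1/2 - cos (pi*x)))"

lemma ternary_bit_range: "0 <= ternary_bit x" "ternary_bit x <= 1"
 by (auto simp: ternary_bit_def)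

lemma continuous_on_ternary_bit [continuous_intros]:
 fixes f :: "'a::t2_space => real"
 shows "continuous_on S f ==> continuous_on S (%x. ternary_bit (f x))"
 unfolding ternary_bit_def
 by (intro continuous_on_max continuous_on_min continuous_on_diff continuous_on_const
    continuous_on_cos continuous_on_mult_left)

lemma ternary_bit_plus_even: "ternary_bit (x+2*real n) = ternary_bit x"
proof -
 have "cos (pi*(x+2*real n)) = cos (pi*x)"
  using cos_int_2pin[of "int n"] sin_int_2pin[of "int n"]
  by (simp add: distrib_left cos_add mult.assoc mult.left_commute[of pi])
 thus ?thesis by (simp add: ternary_bit_def)
qed

lemma ternary_bit_low: "0 <= x ==> x <= 1/3 ==> ternary_bit x = 0"
proof -
 assume "0 <= x" "x <= 1/3"
 hence "pi*x <= pi/3" using pi_gt_zero by (simp add: field_simps)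
 hence "cos (pi*x) >= cos (pi/3)"
  using `0 <= x` by (intro cos_monotone_0_pi_le) auto
 thus ?thesis by (simp add: ternary_bit_def cos_60)
qed

lemma ternary_bit_high: "2/3 <= x ==> x <= 1 ==> ternary_bit x = 1"
proof -
 assume "2/3 <= x" "x <= 1"
 hence "pi*(1-x) <= pi/3" using pi_gt_zero by (simp add: field_simps)
 hence "cos (pi*(1-x)) >= cos (pi/3)"
  using `x <= 1` by (intro cos_monotone_0_pi_le) auto
 moreover have "cos (pi*(1-x)) = - cos (pi*x)"
  by (simp add: right_diff_distrib cos_diff)
 ultimately show ?thesis by (simp add: ternary_bit_def cos_60)
qed

text \<open>Only the ternary digits 0 and 2 occur, so a code and all its shifts avoid the open
  middle third, where \<open>ternary_bit\<close> is undecided.\<close>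

definition ternary_code :: "(nat => bool) => real" where
 "ternary_code a = (\<Sum>i. 2 * of_bool (a i)/3^Suc i)"

lemma summable_ternary: "summable (%i. 2 * of_bool (a i)/3^Suc i :: real)"
proof (rule summable_comparison_test')
 show "summable (%i. 2/3*(1/3::real)^i)" by (intro summable_mult summable_geometric) auto
qed (auto simp: of_bool_def field_simps)

lemma ternary_code_range: "0 <= ternary_code a" "ternary_code a <= 1"
proof -
 have s: "(%i. 2/3*(1/3::real)^i) sums (2/3*(1/(1-1/3)))"
  by (intro sums_mult geometric_sums) auto
 have "ternary_code a <= (\<Sum>i. 2/3*(1/3::real)^i)"
  unfolding ternary_code_def
  by (intro suminf_le summable_ternary sums_summable[OF s]) (auto simp: of_bool_def field_simps)
 also have "... = 1" using sums_unique[OF s] by simp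
 finally show "ternary_code a <= 1" .
 show "0 <= ternary_code a"
  unfolding ternary_code_def by (intro suminf_nonneg summable_ternary) auto
qed

lemma ternary_code_shift: "3*ternary_code a = 2 * of_bool (a 0)+ternary_code (%i. a (Suc i))"
proof -
 have "ternary_code a = 2 * of_bool (a 0)/3+(\<Sum>i. 2 * of_bool (a (Suc i))/3^Suc (Suc i))"
  using suminf_split_head[OF summable_ternary[of a]] unfolding ternary_code_def by simp
 also have "(\<Sum>i. 2 * of_bool (a (Suc i))/3^Suc (Suc i)) = ternary_code (%i. a (Suc i))/3"
  unfolding ternary_code_def by (subst suminf_divide[symmetric]) (auto intro: summable_ternary[of "%i. a (Suc i)", simplified])
 finally show ?thesis by simp
qed

text \<open>Each digit moved in front of the ternary point contributes an even integer, which the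
  period 2 of \<open>ternary_bit\<close> swallows.\<close>

lemma ternary_code_power:
 "EX m::nat. 3^k*ternary_code a = 2*real m+ternary_code (%i. a (i+k))"
proof (induction k)
 case 0
 show ?case by (intro exI[of _ 0]) simp
next
 case (Suc k)
 then obtain m where "3^k*ternary_code a = 2*real m+ternary_code (%i. a (i+k))" by blast
 hence "3^Suc k*ternary_code a = 2*real (3 * m)+3*ternary_code (%i. a (i+k))"
  by simp
 thus ?case
  using ternary_code_shift[of "%i. a (i+k)"] by (intro exI[of _ "3 * m + of_bool (a k)"]) simp
qed

lemma ternary_bit_code: "ternary_bit (3^k*ternary_code a) = of_bool (a k)"
proof -
 obtain m :: nat where m: "3^k*ternary_code a = 2*real m+ternary_code (%i. a (i+k))"
  using ternary_code_power by blast
 have "ternary_bit (3^k*ternary_code a) = ternary_bit (ternary_code (%i. a (i+k)))"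
  unfolding m by (subst add.commute) (rule ternary_bit_plus_even)
 moreover have "3*ternary_code (%i. a (i+k)) = 2 * of_bool (a k)+ternary_code (%i. a (Suc i+k))"
  using ternary_code_shift[of "%i. a (i+k)"] by simp
 ultimately show ?thesis
  using ternary_code_range[of "%i. a (Suc i+k)"]
  by (cases "a k") (auto intro!: ternary_bit_low ternary_bit_high)
qed

lemma binary_expansion:
 fixes u :: real
 assumes "0 <= u" "u < 1"
 shows "EX a. (%i. of_bool (a i)*(1/2)^Suc i) sums u"
proof -
 define q where "q n = \<lfloor>2^n*u\<rfloor>" for n :: nat
 define a where "a n \<longleftrightarrow> q (Suc n) = 2*q n+1" for n
 have step: "real_of_int (q (Suc n)) = 2*q n + of_bool (a n)" for n
 proof -
  have "q (Suc n) = 2*q n | q (Suc n) = 2*q n+1"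
   unfolding q_def by (simp add: floor_eq_iff) linarith
  thus ?thesis by (auto simp: a_def)
 qed
 have sum_eq: "(\<Sum>i<n. of_bool (a i)*(1/2)^Suc i) = real_of_int (q n)/2^n" for n
 proof (induction n)
  case 0
  have "q 0 = 0" using assms by (simp add: q_def floor_eq_iff)
  thus ?case by simp
 next
  case (Suc n)
  thus ?case using step[of n] by (simp add: field_simps)
 qed
 have "(%n. real_of_int (q n)/2^n) ----> u"
 proof (rule tendsto_sandwich)
  show "\<forall>\<^sub>F n in sequentially. u-(1/2)^n <= real_of_int (q n)/2^n"
  proof (intro always_eventually allI)
   fix n
   have "2^n*u-1 <= q n" unfolding q_def by linarith
   hence "(2^n*u-1)/2^n <= real_of_int (q n)/2^n" by (rule divide_right_mono) simp
   thus "u-(1/2)^n <= real_of_int (q n)/2^n" by (simp add: diff_divide_distrib power_divide)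
  qed
  show "\<forall>\<^sub>F n in sequentially. real_of_int (q n)/2^n <= u"
  proof (intro always_eventually allI)
   fix n
   have "q n <= 2^n*u" unfolding q_def by linarith
   thus "real_of_int (q n)/2^n <= u" by (simp add: field_simps)
  qed
  show "(%n. u-(1/2)^n) ----> u"
   using tendsto_diff[OF tendsto_const LIMSEQ_realpow_zero[of "1/2"]] by auto
 qed auto
 hence "(%i. of_bool (a i)*(1/2)^Suc i) sums u" unfolding sums_def sum_eq .
 thus ?thesis by blast
qed

text \<open>Schoenberg's construction: coordinate j is the binary number whose digits are the
  ternary digits i*N+j of the parameter, so one Cantor code prescribes all N coordinates at once.
  That balls lie in images of bounded intervals is what later transports tightness.\<close>

theorem continuous_surjection_euclidean:
 "EX c :: real => 'a::euclidean_space.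
  continuous_on UNIV c & (ALL k::nat. ball 0 (real k) \<subseteq> c ` {0..2*real k+1})"
proof -
 define N where "N = DIM('a)"
 have "N > 0" by (simp add: N_def)
 obtain e :: "nat => 'a" where e: "bij_betw e {..<N} Basis"
  unfolding N_def using ex_bij_betw_nat_finite[OF finite_Basis] atLeast0LessThan by metis
 define coord where "coord j z = (\<Sum>i. (1/2)^Suc i*ternary_bit (3^(i*N+j)*z))" for j z
 have cont_coord: "continuous_on UNIV (coord j)" for j
 proof -
  have "uniform_limit UNIV (%n z. \<Sum>i<n. (1/2)^Suc i*ternary_bit (3^(i*N+j)*z)) (coord j) sequentially"
   unfolding coord_def
  proof (rule Weierstrass_m_test)
   show "summable (%i. (1/2::real)^Suc i)" by (simp add: summable_geometric)
   show "norm ((1/2)^Suc i*ternary_bit (3^(i*N+j)*z)) <= (1/2)^Suc i" for i z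
    using ternary_bit_range by (simp add: abs_mult field_simps)
  qed
  thus ?thesis
   by (rule uniform_limit_theorem[rotated]) (auto intro!: always_eventually continuous_intros)
 qed
 \<comment> \<open>A continuous scale: on [2*k,2*k+1] the triangle wave equals half the distance to
   2*k, so \<open>kap\<close> is constantly k there and the cube of half-width k is
   traversed.\<close>
 define kap where "kap z = z/2-arccos (cos (pi*z))/(2*pi)" for z :: real
 have cont_kap: "continuous_on UNIV kap"
  unfolding kap_def by (intro continuous_intros continuous_on_arccos) auto
 have kap_eq: "kap (2*real k+t) = real k" if "0 <= t" "t <= 1" for k t
 proof -
  have "cos (pi*(2*real k+t)) = cos (pi*t)"
   using cos_int_2pin[of "int k"] sin_int_2pin[of "int k"]
   by (simp add: distrib_left cos_add mult.assoc mult.left_commute[of pi])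
  moreover have "arccos (cos (pi*t)) = pi*t"
   using that by (intro arccos_cos) auto
  ultimately show ?thesis by (simp add: kap_def field_simps)
 qed
 have coord_periodic: "coord j (2*real k+t) = coord j t" for j k t
 proof -
  have "ternary_bit (3^m*(2*real k+t)) = ternary_bit (3^m*t)" for m :: nat
   using ternary_bit_plus_even[of "3^m*t" "3^m * k"] by (simp add: algebra_simps)
  thus ?thesis unfolding coord_def by simp
 qed
 define c where "c z = (\<Sum>j<N. (kap z*(2*coord j z-1))*\<^sub>R e j)" for z
 have "continuous_on UNIV c"
  unfolding c_def by (intro continuous_intros cont_kap cont_coord)
 moreover have "ball 0 (real k) \<subseteq> c ` {0..2*real k+1}" for k
 proof
  fix x :: 'a assume "x : ball 0 (real k)"
  hence nx: "norm x < real k" by simp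
  hence k: "real k > 0" using norm_ge_zero[of x] by linarith
  define u where "u j = (x \<bullet> e j/real k+1)/2" for j
  have u: "0 <= u j & u j < 1" if "j < N" for j
  proof -
   have "e j : Basis" using e that by (auto simp: bij_betw_def)
   hence "abs(x \<bullet> e j) < real k" using Basis_le_norm[of "e j" x] nx by linarith
   thus ?thesis unfolding u_def using k by (auto simp: field_simps)
  qed
  have "ALL j:{..<N}. EX a. (%i. of_bool (a i)*(1/2)^Suc i) sums u j"
   using u by (intro ballI binary_expansion) auto
  from bchoice[OF this] obtain a where a: "!!j. j < N ==> (%i. of_bool (a j i)*(1/2)^Suc i) sums u j"
   by auto
  \<comment> \<open>The binary digits of the N coordinates are interleaved into a single
    code.\<close>
  define t where "t = ternary_code (%n. a (n mod N) (n div N))"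
  have t: "0 <= t" "t <= 1" unfolding t_def by (rule ternary_code_range)+
  have coord_t: "coord j t = u j" if "j < N" for j
   unfolding coord_def t_def ternary_bit_code using a[OF that] that `N > 0`
   by (simp add: sums_iff mult.commute)
  have "c (2*real k+t) = (\<Sum>j<N. (x \<bullet> e j)*\<^sub>R e j)"
   unfolding c_def kap_eq[OF t] coord_periodic
   by (intro sum.cong) (use k in \<open>auto simp: coord_t u_def add_divide_distrib\<close>)
  also have "... = (\<Sum>b\<in>Basis. (x \<bullet> b)*\<^sub>R b)"
   using sum.reindex_bij_betw[OF e, of "%b. (x \<bullet> b)*\<^sub>R b"] by simp
  also have "... = x" by (rule euclidean_representation)
  finally show "x : c ` {0..2*real k+1}"
   using t by (intro image_eqI[of _ _ "2*real k+t"]) auto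
 qed
 ultimately show ?thesis by blast
qed

subsection \<open>Prokhorov's theorem and Skorokhod's representation\<close>

text \<open>Reduction to the real line. The least nonnegative preimage under the surjection
  \<open>c\<close> is a Borel section \<open>s\<close> of \<open>c\<close>; balls go into bounded
  intervals, so the laws of \<open>s\<close> are tight on the line, and applying \<open>c\<close> to
  the variables that represent them undoes the section and preserves convergence.\<close>

theorem tight_Skorokhod_euclidean:
 fixes mu :: "nat => 'a::euclidean_space measure"
 assumes prob: "!!n. prob_space (mu n)" and sets_mu: "!!n. sets (mu n) = sets borel"
  and tight: "!!eps. 0 < eps ==> EX k::nat. ALL n. measure (mu n) {x. real k <= norm x} < eps"
 obtains r :: "nat => nat" and Om :: "real measure" and X Y
 where "strict_mono r" "prob_space Om"
  "!!n. X n : borel_measurable Om" "Y : borel_measurable Om"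
  "!!n. distr Om borel (X n) = mu (r n)"
  "!!om. om : space Om ==> (%n. X n om) ----> Y om"
proof -
 obtain c :: "real => 'a" where cont: "continuous_on UNIV c"
  and surj: "!!k::nat. ball 0 (real k) \<subseteq> c ` {0..2*real k+1}"
  using continuous_surjection_euclidean by blast
 define Z where "Z x = {z. 0 <= z & c z = x}" for x
 define s where "s x = Inf (Z x)" for x
 have Z_le: "EX z:Z x. z <= 2*real k+1" if "norm x < real k" for x k
 proof -
  have "x : c ` {0..2*real k+1}" using surj[of k] that by (auto simp: subset_iff)
  thus ?thesis by (auto simp: Z_def)
 qed
 have Z_ne: "Z x ~= {}" for x
  using Z_le[of x] reals_Archimedean2[of "norm x"] by auto
 have bdd: "bdd_below (Z x)" for x unfolding Z_def by (intro bdd_belowI[of _ 0]) auto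
 have "closed (Z x)" for x
 proof -
  have "Z x = {0..} \<inter> c -` {x}" by (auto simp: Z_def)
  thus ?thesis using closed_vimage[OF closed_singleton cont, of x] by auto
 qed
 hence s_Z: "s x : Z x" for x
  unfolding s_def using closed_contains_Inf[OF Z_ne bdd] by auto
 hence cs: "c (s x) = x" and s_nonneg: "0 <= s x" for x by (auto simp: Z_def)
 have s_le: "s x <= z" if "z : Z x" for x z
  unfolding s_def by (rule cInf_lower[OF that bdd])
 have s_bound: "s x <= 2*real k+1" if "norm x < real k" for x k
  using Z_le[OF that] s_le by force
 have [measurable]: "s : borel_measurable borel"
 proof (subst borel_measurable_iff_le, intro allI)
  fix a
  \<comment> \<open>The infimum is attained, so \<open>s w <= a\<close> says that \<open>w\<close>
    has a preimage in [0,a]; the continuous image of this compact interval is closed.\<close>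
  have "{w : space borel. s w <= a} = c ` {0..a}"
  proof safe
   fix w assume "s w <= a"
   thus "w : c ` {0..a}" using s_nonneg[of w] cs[of w] by (intro image_eqI[of _ _ "s w"]) auto
  next
   fix z assume "z : {0..a}"
   thus "s (c z) <= a" using s_le[of z "c z"] by (auto simp: Z_def)
  qed auto
  moreover have "compact (c ` {0..a})"
   by (intro compact_continuous_image continuous_on_subset[OF cont]) auto
  ultimately show "{w : space borel. s w <= a} : sets borel"
   using compact_imp_closed by (metis borel_closed)
 qed
 have [measurable]: "c : borel_measurable borel"
  using cont by (rule borel_measurable_continuous_onI)
 have [measurable_cong]: "sets (mu n) = sets borel" for n by (rule sets_mu)
 have sp: "space (mu n) = UNIV" for n using sets_eq_imp_space_eq[OF sets_mu] by simp
 define nu where "nu n = distr (mu n) borel s" for n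
 have nu: "real_distribution (nu n)" for n
  unfolding nu_def by (intro prob_space.real_distribution_distr prob) measurable
 have "tight nu"
  unfolding tight_def
 proof (intro conjI allI impI nu)
  fix eps :: real assume "0 < eps"
  then obtain k :: nat where k: "!!n. measure (mu n) {x. real k <= norm x} < eps" using tight by blast
  have "measure (nu n) {-1<..2*real k+1} > 1-eps" for n
  proof -
   interpret prob_space "mu n" by (rule prob)
   have [measurable]: "{x. real k <= norm x} : sets (mu n)" unfolding sets_mu by measurable
   have "measure (nu n) {-1<..2*real k+1} = prob {x. s x : {-1<..2*real k+1}}"
    unfolding nu_def by (subst measure_distr) (auto simp: sp vimage_def)
   moreover have "prob (space (mu n) - {x. real k <= norm x}) <= prob {x. s x : {-1<..2*real k+1}}"
   proof (intro finite_measure_mono)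
    show "space (mu n) - {x. real k <= norm x} \<subseteq> {x. s x : {-1<..2*real k+1}}"
    proof clarsimp
     fix x :: 'a assume "\<not> real k <= norm x"
     hence "s x <= 2*real k+1" by (intro s_bound) auto
     thus "- 1 < s x & s x <= 2*real k+1" using s_nonneg[of x] by auto
    qed
    have "{x : space (mu n). s x : {-1<..2*real k+1}} : sets (mu n)" by measurable
    thus "{x. s x : {-1<..2*real k+1}} : sets (mu n)" by (simp add: sp)
   qed
   moreover have "prob (space (mu n) - {x. real k <= norm x}) = 1-prob {x. real k <= norm x}"
    by (rule prob_compl) measurable
   ultimately show ?thesis using k[of n] by linarith
  qed
  thus "EX a b. a < b & (ALL n. 1-eps < measure (nu n) {a<..b})"
   by (intro exI[of _ "-1"] exI[of _ "2*real k+1"]) auto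
 qed
 then obtain r M where r: "strict_mono (r :: nat => nat)" and M: "real_distribution M"
  and weak: "weak_conv_m (nu \<circ> id \<circ> r) M"
  using tight_imp_convergent_subsubsequence[of nu id] strict_mono_id by blast
 obtain Om :: "real measure" and W :: "nat => real => real" and V :: "real => real"
  where *: "prob_space Om & (ALL n. W n : borel_measurable Om) &
   (ALL n. distr Om borel (W n) = (nu \<circ> id \<circ> r) n) & V : measurable Om lborel & distr Om borel V = M &
   (ALL x : space Om. (%n. W n x) ----> V x)"
  using Skorohod[of "nu \<circ> id \<circ> r" M] nu M weak by auto
 hence Om: "prob_space Om" and W[measurable]: "!!n. W n : borel_measurable Om"
  and lawW: "!!n. distr Om borel (W n) = nu (r n)" and V[measurable]: "V : borel_measurable Om"
  and conv: "!!x. x : space Om ==> (%n. W n x) ----> V x"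
  by (simp_all add: measurable_lborel2)
 show thesis
 proof (rule that[OF r Om])
  show "(%om. c (W n om)) : borel_measurable Om" for n by measurable
  show "(%om. c (V om)) : borel_measurable Om" by measurable
  show "distr Om borel (%om. c (W n om)) = mu (r n)" for n
  proof -
   have "distr Om borel (%om. c (W n om)) = distr (distr Om borel (W n)) borel c"
    by (subst distr_distr) (auto simp: comp_def)
   also have "... = distr (mu (r n)) borel (%x. c (s x))"
    unfolding lawW nu_def by (subst distr_distr) (auto simp: comp_def)
   also have "... = mu (r n)" unfolding cs by (rule distr_id2) (simp add: sets_mu)
   finally show ?thesis .
  qed
  show "(%n. c (W n om)) ----> c (V om)" if "om : space Om" for om
   using conv[OF that] cont by (auto simp: continuous_on_eq_continuous_at intro: isCont_tendsto_compose)
 qed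
qed

subsection \<open>The Wasserstein metric\<close>

text \<open>Weighted Young inequality with the weights B/A and A/B, chosen such that the two given
  bounds add up to exactly (A+B)^2.\<close>

lemma nn_integral_Minkowski:
 fixes f g :: "'a => real"
 assumes [measurable]: "f : borel_measurable M" "g : borel_measurable M"
  and f: "(\<integral>\<^sup>+x. ennreal ((f x)^2) \<partial>M) <= ennreal (A^2)" and "A > 0"
  and g: "(\<integral>\<^sup>+x. ennreal ((g x)^2) \<partial>M) <= ennreal (B^2)" and "B > 0"
 shows "(\<integral>\<^sup>+x. ennreal ((f x+g x)^2) \<partial>M) <= ennreal ((A+B)^2)"
proof -
 have pw: "(a+b)^2 <= (1+B/A)*a^2+(1+A/B)*b^2" for a b :: real
 proof -
  have "0 <= (B*a-A*b)^2/(A*B)" using `A > 0` `B > 0` by simp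
  also have "... = (1+B/A)*a^2+(1+A/B)*b^2-(a+b)^2"
   using `A > 0` `B > 0` by (simp add: field_simps power2_eq_square)
  finally show ?thesis by simp
 qed
 have "(\<integral>\<^sup>+x. ennreal ((f x+g x)^2) \<partial>M)
   <= (\<integral>\<^sup>+x. ennreal (1+B/A)*ennreal ((f x)^2)+ennreal (1+A/B)*ennreal ((g x)^2) \<partial>M)"
  using `A > 0` `B > 0`
  by (intro nn_integral_mono) (simp add: ennreal_mult[symmetric] ennreal_plus[symmetric] pw del: ennreal_plus)
 also have "... = ennreal (1+B/A)*(\<integral>\<^sup>+x. ennreal ((f x)^2) \<partial>M)+ennreal (1+A/B)*(\<integral>\<^sup>+x. ennreal ((g x)^2) \<partial>M)"
  by (subst nn_integral_add) (auto simp: nn_integral_cmult)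
 also have "... <= ennreal (1+B/A)*ennreal (A^2)+ennreal (1+A/B)*ennreal (B^2)"
  by (intro add_mono mult_left_mono f g) auto
 also have "... = ennreal ((1+B/A)*A^2+(1+A/B)*B^2)"
  using `A > 0` `B > 0` by (simp add: ennreal_mult[symmetric] ennreal_plus[symmetric] del: ennreal_plus)
 also have "(1+B/A)*A^2+(1+A/B)*B^2 = (A+B)^2"
  using `A > 0` `B > 0` by (simp add: field_simps power2_eq_square)
 finally show ?thesis .
qed

lemma sets_borel_pair:
 "sets (borel :: ('a::second_countable_topology \<times> 'b::second_countable_topology) measure) = sets (borel \<Otimes>\<^sub>M borel)"
 by (simp only: borel_prod)

lemma borel_measurable_fst:
 "fst : (borel :: ('a::second_countable_topology \<times> 'b::second_countable_topology) measure) \<rightarrow>\<^sub>M borel"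
 unfolding borel_prod[symmetric] by measurable

lemma borel_measurable_snd:
 "snd : (borel :: ('a::second_countable_topology \<times> 'b::second_countable_topology) measure) \<rightarrow>\<^sub>M borel"
 unfolding borel_prod[symmetric] by measurable

lemma P2_D:
 assumes "m : P2"
 shows "prob_space m" "sets m = sets borel" "space m = UNIV" "integrable m (%x. (norm x)^2)"
 using assms sets_eq_imp_space_eq[of m borel] by (auto simp: P2_def)

lemma coupling_distr:
 fixes X Y :: "'w => real^'d"
 assumes "prob_space Om" and [measurable]: "X : borel_measurable Om" "Y : borel_measurable Om"
 shows "distr Om borel (%om. (X om, Y om)) : couplings (distr Om borel X) (distr Om borel Y)"
proof -
 interpret prob_space Om by fact
 note [measurable] = borel_measurable_fst borel_measurable_snd
 have [measurable]: "(%om. (X om, Y om)) : Om \<rightarrow>\<^sub>M borel" by (rule borel_measurable_Pair) auto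
 show ?thesis
  unfolding couplings_def by (auto intro!: prob_space_distr simp: distr_distr comp_def)
qed

lemma couplings_D:
 assumes "p : couplings m n"
 shows "prob_space p" "sets p = sets borel" "distr p borel fst = m" "distr p borel snd = n"
 using assms by (auto simp: couplings_def)

lemma W2_le_coupling:
 assumes "p : couplings m n" "w2_cost p <= ennreal (c^2)" "0 <= c"
 shows "W2 m n <= c"
proof -
 have "(INF p\<in>couplings m n. w2_cost p) <= ennreal (c^2)"
  using assms(1,2) by (intro INF_lower2)
 hence "W2 m n <= sqrt (c^2)"
  unfolding W2_def by (intro real_sqrt_le_mono enn2real_leI) auto
 thus ?thesis using `0 <= c` by simp
qed

lemma W2_le_distr:
 fixes X Y :: "'w => real^'d"
 assumes "prob_space Om" and [measurable]: "X : borel_measurable Om" "Y : borel_measurable Om"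
  and "(\<integral>\<^sup>+om. ennreal ((dist (X om) (Y om))^2) \<partial>Om) <= ennreal (c^2)" "0 <= c"
 shows "W2 (distr Om borel X) (distr Om borel Y) <= c"
proof (rule W2_le_coupling[OF coupling_distr[OF assms(1-3)] _ `0 <= c`])
 note [measurable] = borel_measurable_fst borel_measurable_snd
 have [measurable]: "(%om. (X om, Y om)) : Om \<rightarrow>\<^sub>M borel" by (rule borel_measurable_Pair) auto
 show "(\<integral>\<^sup>+z. ennreal ((dist (fst z) (snd z))^2) \<partial>distr Om borel (%om. (X om, Y om))) <= ennreal (c^2)"
  using assms(4) by (subst nn_integral_distr) auto
qed

text \<open>The product measure is a coupling of finite cost, so the infimum is a real number,
  \<open>enn2real\<close> is harmless, and couplings of cost below c^2 exist.\<close>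

lemma W2_coupling_exists:
 fixes m n :: "(real^'d) measure"
 assumes "m : P2" "n : P2" "W2 m n < c"
 shows "EX p:couplings m n. w2_cost p <= ennreal (c^2)"
proof -
 interpret m: prob_space m by (rule P2_D[OF assms(1)])
 interpret n: prob_space n by (rule P2_D[OF assms(2)])
 interpret mn: pair_prob_space m n ..
 have [measurable_cong]: "sets m = sets borel" "sets n = sets borel" using assms P2_D by auto
 have pq: "distr (m \<Otimes>\<^sub>M n) borel fst = m" "distr (m \<Otimes>\<^sub>M n) borel snd = n"
 proof -
  have "distr (m \<Otimes>\<^sub>M n) borel fst = distr (m \<Otimes>\<^sub>M n) m fst"
   by (intro distr_cong) (auto simp: P2_D[OF assms(1)])
  also have "... = m" by (rule n.distr_pair_fst)
  finally show "distr (m \<Otimes>\<^sub>M n) borel fst = m" .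
  have "distr (m \<Otimes>\<^sub>M n) borel snd = distr (n \<Otimes>\<^sub>M m) borel fst"
   by (subst mn.distr_pair_swap, subst distr_distr) (auto simp: comp_def split_beta)
  also have "... = distr (n \<Otimes>\<^sub>M m) n fst"
   by (intro distr_cong) (auto simp: P2_D[OF assms(2)])
  also have "... = n" by (rule m.distr_pair_fst)
  finally show "distr (m \<Otimes>\<^sub>M n) borel snd = n" .
 qed
 define I where "I = (INF p\<in>couplings m n. w2_cost p)"
 have "m \<Otimes>\<^sub>M n : couplings m n"
  using coupling_distr[of "m \<Otimes>\<^sub>M n" fst snd] mn.prob_space_axioms
  by (simp add: pq distr_id2 borel_prod[symmetric] sets_pair_measure_cong[OF P2_D(2)[OF assms(1)] P2_D(2)[OF assms(2)]])
 hence "I <= (\<integral>\<^sup>+z. ennreal ((dist (fst z) (snd z))^2) \<partial>(m \<Otimes>\<^sub>M n))"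
  unfolding I_def by (rule INF_lower)
 also have "... <= (\<integral>\<^sup>+z. 2*ennreal ((norm (fst z))^2)+2*ennreal ((norm (snd z))^2) \<partial>(m \<Otimes>\<^sub>M n))"
 proof (intro nn_integral_mono)
  fix z :: "(real^'d) \<times> (real^'d)"
  have "dist (fst z) (snd z) <= norm (fst z)+norm (snd z)" by (simp add: dist_norm norm_triangle_ineq4)
  hence "(dist (fst z) (snd z))^2 <= (norm (fst z)+norm (snd z))^2" by (intro power_mono) auto
  also have "... <= 2*(norm (fst z))^2+2*(norm (snd z))^2"
   using sum_squares_bound[of "norm (fst z)" "norm (snd z)"] by (simp add: power2_sum)
  finally show "ennreal ((dist (fst z) (snd z))^2) <= 2*ennreal ((norm (fst z))^2)+2*ennreal ((norm (snd z))^2)"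
   by (simp add: ennreal_mult[of 2, simplified, symmetric] ennreal_plus[symmetric] ennreal_leI del: ennreal_plus)
 qed
 also have "... = 2*(\<integral>\<^sup>+z. ennreal ((norm (fst z))^2) \<partial>(m \<Otimes>\<^sub>M n))+2*(\<integral>\<^sup>+z. ennreal ((norm (snd z))^2) \<partial>(m \<Otimes>\<^sub>M n))"
  by (subst nn_integral_add) (auto simp: nn_integral_cmult)
 also have "... = 2*(\<integral>\<^sup>+x. ennreal ((norm x)^2) \<partial>m)+2*(\<integral>\<^sup>+x. ennreal ((norm x)^2) \<partial>n)"
  using nn_integral_distr[of fst "m \<Otimes>\<^sub>M n" borel "%x. ennreal ((norm x)^2)"]
   nn_integral_distr[of snd "m \<Otimes>\<^sub>M n" borel "%x. ennreal ((norm x)^2)"] by (simp add: pq)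
 also have "... < \<infinity>"
  using P2_D(4)[OF assms(1)] P2_D(4)[OF assms(2)]
  by (auto simp: integrable_iff_bounded ennreal_mult_less_top)
 finally have "I < \<infinity>" .
 hence "I = ennreal ((W2 m n)^2)"
  unfolding W2_def I_def[symmetric] by simp
 moreover have "0 <= W2 m n" by (simp add: W2_def)
 moreover have "(W2 m n)^2 < c^2" using assms(3) `0 <= W2 m n` by (intro power_strict_mono) auto
 ultimately have "I < ennreal (c^2)" by (simp add: ennreal_less_iff)
 thus ?thesis unfolding I_def by (auto simp: INF_less_iff intro: less_imp_le)
qed

text \<open>Instead of disintegrating along the common marginal \<open>n\<close>, the two couplings are made
 conditionally independent given a small cell that contains the middle point.\<close>

lemma approximate_gluing:
 fixes p q :: "('a::euclidean_space \<times> 'a) measure"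
 assumes p: "prob_space p" "sets p = sets borel" "distr p borel snd = n"
  and q: "prob_space q" "sets q = sets borel" "distr q borel fst = n"
  and "0 < eps"
 shows "EX \<pi>. prob_space \<pi> & sets \<pi> = sets borel & distr \<pi> borel fst = p & distr \<pi> borel snd = q &
  (AE z in \<pi>. dist (snd (fst z)) (fst (snd z)) <= eps)"
proof -
 interpret p: prob_space p by fact
 interpret q: prob_space q by fact
 interpret pq: pair_prob_space p q ..
 have [measurable_cong]: "sets p = sets borel" "sets q = sets borel" by fact+
 have sn[measurable_cong]: "sets n = sets borel" using p(3) by auto
 interpret n: prob_space n unfolding p(3)[symmetric] by (rule p.prob_space_distr) (simp add: borel_measurable_snd measurable_cong_sets[OF p(2) refl])
 have snd_p: "snd : borel_measurable p" and fst_q: "fst : borel_measurable q"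
  using borel_measurable_snd borel_measurable_fst
  by (simp_all add: measurable_cong_sets[OF p(2) refl] measurable_cong_sets[OF q(2) refl])
 obtain D :: "'a set" where D: "countable D" "!!X. open X ==> X ~= {} ==> EX d:D. d : X"
  using countable_dense_setE by (metis (no_types))
 have "D ~= {}" using D(2)[of UNIV] by auto
 define d where "d = from_nat_into D"
 have ex_d: "EX i. dist y (d i) < eps/2" for y
 proof -
  obtain e where "e : D" "e : ball y (eps/2)" using D(2)[of "ball y (eps/2)"] `0 < eps` by auto
  thus ?thesis unfolding d_def by (metis D(1) from_nat_into_surj mem_ball)
 qed
 \<comment> \<open>Cells of small diameter: a point goes to the first member of a dense sequence
   that is within eps/2.\<close>
 define \<iota> where "\<iota> y = (LEAST i. dist y (d i) < eps/2)" for y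
 have \<iota>: "dist y (d (\<iota> y)) < eps/2" for y
  unfolding \<iota>_def using ex_d[of y] by (metis (mono_tags, lifting) LeastI_ex)
 have \<iota>_meas[measurable]: "\<iota> : borel \<rightarrow>\<^sub>M count_space UNIV" unfolding \<iota>_def by measurable
 define w where "w i = emeasure n {y. \<iota> y = i}" for i
 have [measurable]: "{y. \<iota> y = i} : sets n" for i unfolding sn by measurable
 \<comment> \<open>Density relative to \<open>p\<close> times \<open>q\<close>: middle points in the
   same cell are reweighted by the inverse mass of the cell, so that integrating out either coupling
   gives 1. Cells of mass 0, where the inverse is infinite, are met with probability 0.\<close>
 define h where "h y y' = (if \<iota> y = \<iota> y' then inverse (w (\<iota> y)) else 0)" for y y'
 have h_sym: "h y y' = h y' y" for y y' by (auto simp: h_def)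
 have h_meas: "(%y'. h y y') : borel_measurable borel" for y unfolding h_def by measurable
 have h_int: "AE y in n. (\<integral>\<^sup>+y'. h y y' \<partial>n) = 1"
 proof -
  have "AE y in n. ALL i. w i = 0 --> \<iota> y ~= i"
   by (subst AE_all_countable) (auto simp: w_def intro!: AE_I[of _ _ "{y. \<iota> y = _}"])
  thus ?thesis
  proof eventually_elim
   case (elim y)
   hence nz: "w (\<iota> y) ~= 0" by auto
   have "(\<integral>\<^sup>+y'. h y y' \<partial>n) = (\<integral>\<^sup>+y'. inverse (w (\<iota> y))*indicator {y'. \<iota> y' = \<iota> y} y' \<partial>n)"
    by (intro nn_integral_cong) (auto simp: h_def)
   also have "... = inverse (w (\<iota> y))*w (\<iota> y)"
    by (subst nn_integral_cmult_indicator) (auto simp: w_def)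
   also have "... = 1"
    using nz n.emeasure_finite[of "{y'. \<iota> y' = \<iota> y}"]
    by (subst mult.commute) (auto simp: w_def divide_ennreal_def[symmetric] less_top[symmetric] intro!: ennreal_divide_self)
   finally show ?case .
  qed
 qed
 define g where "g z = h (snd (fst z)) (fst (snd z))" for z :: "('a \<times> 'a) \<times> ('a \<times> 'a)"
 have [measurable]: "g : borel_measurable (p \<Otimes>\<^sub>M q)"
 proof -
  define a where "a z = \<iota> (snd (fst z))" for z :: "('a \<times> 'a) \<times> ('a \<times> 'a)"
  define b where "b z = \<iota> (fst (snd z))" for z :: "('a \<times> 'a) \<times> ('a \<times> 'a)"
  from measurable_compose[OF measurable_compose[OF measurable_fst snd_p] \<iota>_meas]
   measurable_compose[OF measurable_compose[OF measurable_snd fst_q] \<iota>_meas]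
  have [measurable]: "a : p \<Otimes>\<^sub>M q \<rightarrow>\<^sub>M count_space UNIV" "b : p \<Otimes>\<^sub>M q \<rightarrow>\<^sub>M count_space UNIV"
   unfolding a_def[abs_def] b_def[abs_def] by auto
  have "g = (%z. if a z = b z then inverse (w (a z)) else 0)"
   by (auto simp: g_def h_def a_def b_def fun_eq_iff)
  moreover have "(%z. if a z = b z then inverse (w (a z)) else 0) : borel_measurable (p \<Otimes>\<^sub>M q)"
   by (rule measurable_compose_countable[where f="%i z. if i = b z then inverse (w i) else 0" and g=a]) measurable
  ultimately show ?thesis by simp
 qed
 define \<pi> where "\<pi> = density (p \<Otimes>\<^sub>M q) g"
 have marg1: "distr \<pi> borel fst = p"
 proof (rule measure_eqI)
  fix A assume "A : sets (distr \<pi> borel fst)"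
  hence [measurable]: "A : sets borel" by simp
  have "emeasure (distr \<pi> borel fst) A = (\<integral>\<^sup>+z. g z*indicator (fst -` A \<inter> space (p \<Otimes>\<^sub>M q)) z \<partial>(p \<Otimes>\<^sub>M q))"
   unfolding \<pi>_def by (subst emeasure_distr) (auto simp: emeasure_density)
  also have "... = (\<integral>\<^sup>+z. g z*indicator A (fst z) \<partial>(p \<Otimes>\<^sub>M q))"
   by (intro nn_integral_cong) (auto simp: indicator_def)
  also have "... = (\<integral>\<^sup>+u. \<integral>\<^sup>+v. g (u, v)*indicator A u \<partial>q \<partial>p)"
   by (subst q.nn_integral_fst[symmetric]) auto
  also have "... = (\<integral>\<^sup>+u. indicator A u \<partial>p)"
  proof (rule nn_integral_cong_AE)
   have "AE u in p. (\<integral>\<^sup>+y'. h (snd u) y' \<partial>n) = 1"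
    using h_int AE_distrD[OF snd_p, of "%y. (\<integral>\<^sup>+y'. h y y' \<partial>n) = 1"] unfolding p(3) by blast
   thus "AE u in p. (\<integral>\<^sup>+v. g (u, v)*indicator A u \<partial>q) = indicator A u"
   proof eventually_elim
    case (elim u)
    have "(\<integral>\<^sup>+v. g (u, v)*indicator A u \<partial>q) = (\<integral>\<^sup>+v. g (u, v) \<partial>q)*indicator A u"
     by (rule nn_integral_multc) (simp add: g_def measurable_compose[OF fst_q h_meas])
    also have "(\<integral>\<^sup>+v. g (u, v) \<partial>q) = (\<integral>\<^sup>+y'. h (snd u) y' \<partial>n)"
     unfolding q(3)[symmetric] g_def by (subst nn_integral_distr) (auto intro: h_meas fst_q snd_p)
    finally show ?case using elim by simp
   qed
  qed
  also have "... = emeasure p A" by simp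
  finally show "emeasure (distr \<pi> borel fst) A = emeasure p A" .
 qed (simp add: p)
 have marg2: "distr \<pi> borel snd = q"
 proof (rule measure_eqI)
  fix A assume "A : sets (distr \<pi> borel snd)"
  hence [measurable]: "A : sets borel" by simp
  have "emeasure (distr \<pi> borel snd) A = (\<integral>\<^sup>+z. g z*indicator (snd -` A \<inter> space (p \<Otimes>\<^sub>M q)) z \<partial>(p \<Otimes>\<^sub>M q))"
   unfolding \<pi>_def by (subst emeasure_distr) (auto simp: emeasure_density)
  also have "... = (\<integral>\<^sup>+z. g z*indicator A (snd z) \<partial>(p \<Otimes>\<^sub>M q))"
   by (intro nn_integral_cong) (auto simp: indicator_def)
  also have "... = (\<integral>\<^sup>+v. \<integral>\<^sup>+u. g (u, v)*indicator A v \<partial>p \<partial>q)"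
   by (subst pq.nn_integral_snd[symmetric]) auto
  also have "... = (\<integral>\<^sup>+v. indicator A v \<partial>q)"
  proof (rule nn_integral_cong_AE)
   have "AE v in q. (\<integral>\<^sup>+y'. h (fst v) y' \<partial>n) = 1"
    using h_int AE_distrD[OF fst_q, of "%y. (\<integral>\<^sup>+y'. h y y' \<partial>n) = 1"] unfolding q(3) by blast
   thus "AE v in q. (\<integral>\<^sup>+u. g (u, v)*indicator A v \<partial>p) = indicator A v"
   proof eventually_elim
    case (elim v)
    have "(\<integral>\<^sup>+u. g (u, v)*indicator A v \<partial>p) = (\<integral>\<^sup>+u. g (u, v) \<partial>p)*indicator A v"
     by (rule nn_integral_multc) (simp add: g_def h_sym[of _ "fst v"] measurable_compose[OF snd_p h_meas])
    also have "(\<integral>\<^sup>+u. g (u, v) \<partial>p) = (\<integral>\<^sup>+y'. h (fst v) y' \<partial>n)"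
     unfolding p(3)[symmetric] g_def h_sym[of _ "fst v"] fst_conv snd_conv
     by (subst nn_integral_distr) (auto intro: h_meas fst_q snd_p)
    finally show ?case using elim by simp
   qed
  qed
  also have "... = emeasure q A" by simp
  finally show "emeasure (distr \<pi> borel snd) A = emeasure q A" .
 qed (simp add: q)
 have sets_\<pi>: "sets \<pi> = sets borel"
  unfolding \<pi>_def by (simp add: borel_prod[symmetric] sets_pair_measure_cong[OF p(2) q(2)])
 have fst_m: "fst : \<pi> \<rightarrow>\<^sub>M (borel :: ('a \<times> 'a) measure)"
  unfolding \<pi>_def by measurable
 have "prob_space \<pi>"
  using p.emeasure_space_1 sets_eq_imp_space_eq[OF p(2)]
   emeasure_distr[OF fst_m, of UNIV] marg1 by (intro prob_spaceI) simp
 moreover have "AE z in \<pi>. dist (snd (fst z)) (fst (snd z)) <= eps"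
  unfolding \<pi>_def
 proof (subst AE_density, simp, intro AE_I2 impI)
  fix z assume "0 < g z"
  hence "\<iota> (snd (fst z)) = \<iota> (fst (snd z))" by (auto simp: g_def h_def split: if_splits)
  thus "dist (snd (fst z)) (fst (snd z)) <= eps"
   using \<iota>[of "snd (fst z)"] \<iota>[of "fst (snd z)"] dist_triangle_half_l[of "snd (fst z)" "d (\<iota> (snd (fst z)))" eps "fst (snd z)"]
   by (auto simp: dist_commute)
 qed
 ultimately show ?thesis using sets_\<pi> marg1 marg2 by blast
qed

section \<open>The axioms of a metric and Lipschitz functionals of the Wasserstein distance\<close>

lemma W2_nonneg: "0 <= W2 m n" by (simp add: W2_def)

text \<open>Gluing keeps both couplings but leaves the middle points up to \<open>eps\<close> apart,
  so Minkowski sees three terms. The error is split into thirds: two for near-optimality, one for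
  the gluing.\<close>

lemma W2_triangle:
 fixes m n k :: "(real^'d) measure"
 assumes "m : P2" "n : P2" "k : P2"
 shows "W2 m k <= W2 m n+W2 n k"
proof (rule field_le_epsilon)
 fix e :: real assume "0 < e"
 define eps where "eps = e/3"
 have "0 < eps" using `0 < e` by (simp add: eps_def)
 define A where "A = W2 m n+eps"
 define B where "B = W2 n k+eps"
 have AB: "A > 0" "B > 0" using W2_nonneg[of m n] W2_nonneg[of n k] `0 < eps` by (auto simp: A_def B_def)
 obtain p where p: "p : couplings m n" "w2_cost p <= ennreal (A^2)"
  using W2_coupling_exists[OF assms(1,2), of A] `0 < eps` by (auto simp: A_def)
 obtain q where q: "q : couplings n k" "w2_cost q <= ennreal (B^2)"
  using W2_coupling_exists[OF assms(2,3), of B] `0 < eps` by (auto simp: B_def)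
 note pD = couplings_D[OF p(1)] and qD = couplings_D[OF q(1)]
 obtain \<pi> where \<pi>: "prob_space \<pi>" "sets \<pi> = sets borel" "distr \<pi> borel fst = p" "distr \<pi> borel snd = q"
  "AE z in \<pi>. dist (snd (fst z)) (fst (snd z)) <= eps"
  using approximate_gluing[OF pD(1,2,4) qD(1,2,3) `0 < eps`] by blast
 interpret \<pi>: prob_space \<pi> by fact
 have [measurable_cong]: "sets \<pi> = sets (borel \<Otimes>\<^sub>M borel)" unfolding \<pi>(2) by (rule sets_borel_pair)
 note [measurable] = borel_measurable_fst borel_measurable_snd
 define X where "X z = fst (fst z)" for z :: "((real^'d) \<times> (real^'d)) \<times> ((real^'d) \<times> (real^'d))"
 define Y where "Y z = snd (fst z)" for z :: "((real^'d) \<times> (real^'d)) \<times> ((real^'d) \<times> (real^'d))"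
 define Y' where "Y' z = fst (snd z)" for z :: "((real^'d) \<times> (real^'d)) \<times> ((real^'d) \<times> (real^'d))"
 define Z where "Z z = snd (snd z)" for z :: "((real^'d) \<times> (real^'d)) \<times> ((real^'d) \<times> (real^'d))"
 have [measurable]: "X : borel_measurable \<pi>" "Y : borel_measurable \<pi>" "Y' : borel_measurable \<pi>" "Z : borel_measurable \<pi>"
  unfolding X_def Y_def Y'_def Z_def by measurable
 have lawX: "distr \<pi> borel X = m"
  unfolding pD(3)[symmetric] \<pi>(3)[symmetric] by (subst distr_distr) (auto simp: X_def[abs_def] comp_def)
 have lawZ: "distr \<pi> borel Z = k"
  unfolding qD(4)[symmetric] \<pi>(4)[symmetric] by (subst distr_distr) (auto simp: Z_def[abs_def] comp_def)
 have 1: "(\<integral>\<^sup>+z. ennreal ((dist (X z) (Y z))^2) \<partial>\<pi>) <= ennreal (A^2)"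
  using p(2) unfolding \<pi>(3)[symmetric] by (subst (asm) nn_integral_distr) (auto simp: X_def Y_def)
 have 2: "(\<integral>\<^sup>+z. ennreal ((dist (Y' z) (Z z))^2) \<partial>\<pi>) <= ennreal (B^2)"
  using q(2) unfolding \<pi>(4)[symmetric] by (subst (asm) nn_integral_distr) (auto simp: Z_def Y'_def)
 have "(\<integral>\<^sup>+z. ennreal (eps^2) \<partial>\<pi>) <= ennreal (eps^2)"
  by (simp add: \<pi>.emeasure_space_1)
 note 3 = nn_integral_Minkowski[OF _ _ nn_integral_Minkowski[OF _ _ 1 AB(1) this `0 < eps`] _ 2 AB(2)]
 have "(\<integral>\<^sup>+z. ennreal ((dist (X z) (Z z))^2) \<partial>\<pi>) <= (\<integral>\<^sup>+z. ennreal ((dist (X z) (Y z)+eps+dist (Y' z) (Z z))^2) \<partial>\<pi>)"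
 proof (rule nn_integral_mono_AE)
  show "AE z in \<pi>. ennreal ((dist (X z) (Z z))^2) <= ennreal ((dist (X z) (Y z)+eps+dist (Y' z) (Z z))^2)"
   using \<pi>(5)
  proof eventually_elim
   case (elim z)
   have "dist (X z) (Z z) <= dist (X z) (Y z)+dist (Y z) (Y' z)+dist (Y' z) (Z z)"
    using dist_triangle[of "X z" "Z z" "Y z"] dist_triangle[of "Y z" "Z z" "Y' z"] by linarith
   thus ?case using elim unfolding Y_def Y'_def by (intro ennreal_leI power_mono) auto
  qed
 qed
 also have "... <= ennreal ((A+eps+B)^2)"
  using AB `0 < eps` by (intro 3) auto
 finally have "W2 m k <= A+eps+B"
  using W2_le_distr[of \<pi> X Z "A+eps+B"] AB `0 < eps` by (simp add: lawX lawZ \<pi>(1))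
 thus "W2 m k <= W2 m n+W2 n k+e" by (simp add: A_def B_def eps_def)
qed

lemma W2_commute:
 fixes m n :: "(real^'d) measure"
 shows "W2 m n = W2 n m"
proof -
 have *: "(%p. w2_cost p) ` couplings m n \<subseteq>
  (%p. w2_cost p) ` couplings n m" for m n :: "(real^'d) measure"
 proof clarify
  note [measurable] = borel_measurable_fst borel_measurable_snd
  fix p assume p: "p : couplings m n"
  note pD = couplings_D[OF p]
  have [measurable_cong]: "sets p = sets (borel \<Otimes>\<^sub>M borel)" unfolding pD(2) by (rule sets_borel_pair)
  have [measurable]: "(%z. (snd z, fst z)) : p \<rightarrow>\<^sub>M (borel :: ((real^'d) \<times> (real^'d)) measure)"
   by (rule borel_measurable_Pair) measurable
  have "distr p borel (%z. (snd z, fst z)) : couplings n m"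
   using coupling_distr[of p snd fst] pD by simp
  moreover have "(\<integral>\<^sup>+z. ennreal ((dist (fst z) (snd z))^2) \<partial>distr p borel (%z. (snd z, fst z))) =
   w2_cost p"
   by (subst nn_integral_distr) (auto simp: dist_commute)
  ultimately show "w2_cost p :
   (%p. w2_cost p) ` couplings n m"
   by (metis (no_types, lifting) image_eqI)
 qed
 show ?thesis unfolding W2_def by (simp only: subset_antisym[OF *[of m n] *[of n m]])
qed

lemma nn_integral_le_realD:
 fixes f :: "'a => real"
 assumes [measurable]: "f : borel_measurable M" and "!!x. 0 <= f x" "0 <= c"
  and le: "(\<integral>\<^sup>+x. ennreal (f x) \<partial>M) <= ennreal c"
 shows "integrable M f" "(LINT x|M. f x) <= c"
proof -
 show i: "integrable M f"
  using le assms(2) by (auto simp: integrable_iff_bounded intro: le_less_trans)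
 have "ennreal (LINT x|M. f x) <= ennreal c"
  using le nn_integral_eq_integral[OF i] assms(2) by simp
 thus "(LINT x|M. f x) <= c" using `0 <= c` by simp
qed

lemma W2_coupling_exists_real:
 fixes m n :: "(real^'d) measure"
 assumes "m : P2" "n : P2" "W2 m n < c"
 obtains p where "p : couplings m n" "integrable p (%z. (dist (fst z) (snd z))^2)"
  "(LINT z|p. (dist (fst z) (snd z))^2) <= c^2"
proof -
 obtain p where p: "p : couplings m n" "w2_cost p <= ennreal (c^2)"
  using W2_coupling_exists[OF assms] by blast
 have [measurable_cong]: "sets p = sets (borel \<Otimes>\<^sub>M borel)"
  using couplings_D(2)[OF p(1)] sets_borel_pair by simp
 show thesis
  using nn_integral_le_realD[OF _ _ _ p(2)] p(1) by (intro that[of p]) auto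
qed

lemma W2_Lipschitz_integral:
 fixes m n :: "(real^'d) measure" and f :: "real^'d => real"
 assumes m: "m : P2" and n: "n : P2" and [measurable]: "f : borel_measurable borel"
  and bound: "!!x. abs(f x) <= B" and lip: "!!x y. abs(f x-f y) <= L*dist x y" and "0 <= L"
 shows "abs((LINT x|m. f x)-(LINT x|n. f x)) <= L*W2 m n"
proof (rule field_le_epsilon)
 fix e :: real assume "0 < e"
 define c where "c = W2 m n+e/(L+1)"
 have "0 < e/(L+1)" using `0 < e` `0 <= L` by simp
 hence c: "W2 m n < c" "0 < c" using W2_nonneg[of m n] by (auto simp: c_def)
 obtain p where p: "p : couplings m n" and i: "integrable p (%z. (dist (fst z) (snd z))^2)"
  "(LINT z|p. (dist (fst z) (snd z))^2) <= c^2"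
  using W2_coupling_exists_real[OF m n c(1)] .
 note pD = couplings_D[OF p]
 have [measurable_cong]: "sets p = sets (borel \<Otimes>\<^sub>M borel)"
  using pD(2) sets_borel_pair by simp
 interpret p: prob_space p by (rule pD)
 have int_fst: "integrable p (%z. f (fst z))" and int_snd: "integrable p (%z. f (snd z))"
  by (auto intro!: p.integrable_const_bound[of _ B] simp: bound)
 have "(LINT x|m. f x) = (LINT z|p. f (fst z))" "(LINT x|n. f x) = (LINT z|p. f (snd z))"
  unfolding pD(3)[symmetric] pD(4)[symmetric] by (auto simp: integral_distr)
 hence "abs((LINT x|m. f x)-(LINT x|n. f x)) = abs(\<integral>z. f (fst z)-f (snd z) \<partial>p)"
  using int_fst int_snd by simp
 also have "... <= (LINT z|p. abs(f (fst z)-f (snd z)))" by (rule integral_abs_bound)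
 \<comment> \<open>The inequality d <= d^2/(2*c)+c/2 replaces Cauchy-Schwarz: a quadratic cost of at
   most c^2 makes the right-hand side integrate to at most L*c.\<close>
 also have "... <= (LINT z|p. L/(2*c)*(dist (fst z) (snd z))^2+L*c/2)"
 proof (intro integral_mono)
  fix z :: "(real^'d) \<times> (real^'d)"
  have "0 <= (dist (fst z) (snd z) - c)^2/(2*c)" using c by simp
  hence "dist (fst z) (snd z) <= (dist (fst z) (snd z))^2/(2*c) + c/2"
   using c by (simp add: power2_eq_square field_simps)
  hence "L*dist (fst z) (snd z) <= L*((dist (fst z) (snd z))^2/(2*c) + c/2)"
   using `0 <= L` by (rule mult_left_mono)
  thus "abs(f (fst z)-f (snd z)) <= L/(2*c)*(dist (fst z) (snd z))^2+L*c/2"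
   using lip[of "fst z" "snd z"] by (simp add: algebra_simps)
 qed (use int_fst int_snd i in \<open>auto intro!: integrable_abs\<close>)
 also have "... = L/(2*c)*(LINT z|p. (dist (fst z) (snd z))^2)+L*c/2"
  using i by (simp add: p.prob_space)
 also have "... <= L/(2*c)*c^2+L*c/2"
  using i c `0 <= L` by (intro add_right_mono mult_left_mono) auto
 also have "... = L*c" using c by (simp add: power2_eq_square)
 also have "... = L*W2 m n+L/(L+1)*e" by (simp add: c_def algebra_simps)
 also have "... <= L*W2 m n+1*e"
  using `0 < e` `0 <= L` by (intro add_left_mono mult_right_mono) (auto simp: field_simps)
 finally show "abs((LINT x|m. f x)-(LINT x|n. f x)) <= L*W2 m n+e" by simp
qed

text \<open>Minkowski for |s| at the first point plus L times the distance. With \<open>norm\<close>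
  and with the root of \<open>sq_tail\<close> it carries second moments and tails from one measure
  to a W2-close one.\<close>

lemma W2_L2_Lipschitz:
 fixes m n :: "(real^'d) measure" and s :: "real^'d => real"
 assumes m: "m : P2" and n: "n : P2" and [measurable]: "s : borel_measurable borel"
  and lip: "!!x y. abs(s x-s y) <= L*dist x y" and "0 < L"
  and int_m: "integrable m (%x. (s x)^2)"
 shows "sqrt (LINT x|n. (s x)^2) <= sqrt (LINT x|m. (s x)^2)+L*W2 m n"
proof (rule field_le_epsilon)
 fix e :: real assume "0 < e"
 define A where "A = sqrt (LINT x|m. (s x)^2)+e/2"
 define c where "c = W2 m n+e/(2*L)"
 have A: "0 < A" using `0 < e` by (auto simp: A_def intro!: add_nonneg_pos)
 have "0 < e/(2*L)" using `0 < e` `0 < L` by simp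
 hence c: "W2 m n < c" "0 < c" using W2_nonneg[of m n] by (auto simp: c_def)
 obtain p where p: "p : couplings m n" "w2_cost p <= ennreal (c^2)"
  using W2_coupling_exists[OF m n c(1)] by blast
 note pD = couplings_D[OF p(1)]
 have [measurable_cong]: "sets p = sets (borel \<Otimes>\<^sub>M borel)"
  using pD(2) sets_borel_pair by simp
 have "(\<integral>\<^sup>+z. ennreal ((s (fst z))^2) \<partial>p) = (\<integral>\<^sup>+x. ennreal ((s x)^2) \<partial>m)"
  unfolding pD(3)[symmetric] by (subst nn_integral_distr) auto
 also have "... = ennreal (LINT x|m. (s x)^2)" using int_m by (intro nn_integral_eq_integral) auto
 also have "... <= ennreal (A^2)"
 proof (rule ennreal_leI)
  have "(LINT x|m. (s x)^2) = (sqrt (LINT x|m. (s x)^2))^2" by (simp add: integral_nonneg_AE)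
  also have "... <= A^2" unfolding A_def using `0 < e` by (intro power_mono) (auto simp: integral_nonneg_AE)
  finally show "(LINT x|m. (s x)^2) <= A^2" .
 qed
 finally have 1: "(\<integral>\<^sup>+z. ennreal (abs(s (fst z))^2) \<partial>p) <= ennreal (A^2)" by simp
 have "(\<integral>\<^sup>+z. ennreal ((L*dist (fst z) (snd z))^2) \<partial>p) = ennreal (L^2)*w2_cost p"
  by (subst nn_integral_cmult[symmetric]) (auto simp: power_mult_distrib ennreal_mult)
 also have "... <= ennreal (L^2)*ennreal (c^2)" by (intro mult_left_mono p) auto
 also have "... = ennreal ((L*c)^2)" by (simp add: power_mult_distrib ennreal_mult)
 finally have 2: "(\<integral>\<^sup>+z. ennreal ((L*dist (fst z) (snd z))^2) \<partial>p) <= ennreal ((L*c)^2)" .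
 have "(\<integral>\<^sup>+x. ennreal ((s x)^2) \<partial>n) = (\<integral>\<^sup>+z. ennreal ((s (snd z))^2) \<partial>p)"
  unfolding pD(4)[symmetric] by (subst nn_integral_distr) auto
 also have "... <= (\<integral>\<^sup>+z. ennreal ((abs(s (fst z)) + L*dist (fst z) (snd z))^2) \<partial>p)"
 proof (intro nn_integral_mono ennreal_leI)
  fix z
  have "abs(s (snd z)) <= abs(s (fst z)) + L*dist (fst z) (snd z)" using lip[of "fst z" "snd z"] by linarith
  hence "abs(s (snd z))^2 <= (abs(s (fst z)) + L*dist (fst z) (snd z))^2" by (intro power_mono) auto
  thus "(s (snd z))^2 <= (abs(s (fst z)) + L*dist (fst z) (snd z))^2" by simp
 qed
 also have "... <= ennreal ((A+L*c)^2)"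
  using A c `0 < L` by (intro nn_integral_Minkowski[OF _ _ 1 _ 2]) auto
 finally have le: "(\<integral>\<^sup>+x. ennreal ((s x)^2) \<partial>n) <= ennreal ((A+L*c)^2)" .
 have "(LINT x|n. (s x)^2) <= (A+L*c)^2"
  by (rule nn_integral_le_realD[OF _ _ _ le]) (auto simp: measurable_cong_sets[OF P2_D(2)[OF n] refl])
 hence "sqrt (LINT x|n. (s x)^2) <= A+L*c"
  using A c `0 < L` by (intro real_le_lsqrt) (auto intro!: add_nonneg_nonneg)
 also have "... = sqrt (LINT x|m. (s x)^2)+L*W2 m n+e"
  using `0 < L` by (simp add: A_def c_def field_simps)
 finally show "sqrt (LINT x|n. (s x)^2) <= sqrt (LINT x|m. (s x)^2)+L*W2 m n+e" .
qed

section \<open>Lipschitz functions determine measures and measurable kernels\<close>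

lemma sets_borel_eq_sigma_closed: "sets borel = sigma_sets UNIV {C :: 'a::topological_space set. closed C}"
proof -
 have "sets (borel :: 'a measure) = sets (sigma UNIV {C. closed C})" by (simp only: borel_eq_closed)
 thus ?thesis by simp
qed

lemma indicator_closed_Lipschitz_limit:
 fixes C :: "'a::metric_space set"
 assumes "closed C" "C ~= {}"
 defines "phi \<equiv> %k::nat. %x. max 0 (1-real k*infdist x C)"
 shows "(%k. phi k x) ----> indicator C x" "0 <= phi k x" "phi k x <= 1" "abs(phi k x-phi k y) <= real k*dist x y"
  "continuous_on UNIV (phi k)"
proof -
 show "(%k. phi k x) ----> indicator C x"
 proof (cases "x : C")
  case True
  thus ?thesis by (simp add: phi_def)
 next
  case False
  hence "0 < infdist x C" using assms infdist_pos_not_in_closed by metis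
  then obtain N :: nat where N: "1 < real N*infdist x C" using reals_Archimedean3 by blast
  have "\<forall>\<^sub>F k in sequentially. phi k x = 0"
   using eventually_ge_at_top[of N]
  proof eventually_elim
   case (elim k)
   hence "real N*infdist x C <= real k*infdist x C"
    using `0 < infdist x C` by (intro mult_right_mono) auto
   thus ?case using N by (simp add: phi_def)
  qed
  thus ?thesis using False by (simp add: tendsto_eventually)
 qed
 show "0 <= phi k x" "phi k x <= 1" by (auto simp: phi_def infdist_nonneg)
 have "abs(real k*infdist x C-real k*infdist y C) <= real k*dist x y"
  using infdist_triangle_abs[of x C y] by (simp add: right_diff_distrib[symmetric] abs_mult mult_left_mono)
 thus "abs(phi k x-phi k y) <= real k*dist x y" unfolding phi_def by linarith
 show "continuous_on UNIV (phi k)" unfolding phi_def by (intro continuous_intros)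
qed

lemma prob_space_eqI_Lipschitz:
 fixes m n :: "'a::metric_space measure"
 assumes m: "prob_space m" "sets m = sets borel" and n: "prob_space n" "sets n = sets borel"
  and eq: "!!phi L. continuous_on UNIV phi ==> (!!x. 0 <= phi x & phi x <= 1) ==> (!!x y. abs(phi x-phi y) <= L*dist x y) ==>
   0 <= L ==> (LINT x|m. phi x) = (LINT x|n. phi x)"
 shows "m = n"
proof (rule measure_eqI_generator_eq[of "{C. closed C}" UNIV m n "%_. UNIV"])
 interpret m: prob_space m by fact
 interpret n: prob_space n by fact
 show "Int_stable {C :: 'a set. closed C}" by (auto simp: Int_stable_def)
 show "sets m = sigma_sets UNIV {C. closed C}" "sets n = sigma_sets UNIV {C. closed C}"
  using m n sets_borel_eq_sigma_closed by auto
 fix C :: "'a set" assume "C : {C. closed C}"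
 hence C: "closed C" by simp
 show "emeasure m C = emeasure n C"
 proof (cases "C = {}")
  case False
  note phi = indicator_closed_Lipschitz_limit[OF C False]
  have lim: "(%k. LINT x|mu. max 0 (1-real k*infdist x C)) ----> measure mu C"
   if mu: "prob_space mu" "sets mu = sets borel" for mu :: "'a measure"
  proof -
   interpret mu: prob_space mu by fact
   have [measurable_cong]: "sets mu = sets borel" by fact
   have "(%k. LINT x|mu. max 0 (1-real k*infdist x C)) ----> (LINT x|mu. indicator C x)"
   proof (rule integral_dominated_convergence[where w="%_. 1"])
    show "(%x. max 0 (1-real k*infdist x C)) : borel_measurable mu" for k
     using borel_measurable_continuous_onI[OF phi(5)] by (simp add: measurable_cong_sets[OF mu(2) refl])
    show "(indicator C :: 'a => real) : borel_measurable mu"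
     using C by (simp add: measurable_cong_sets[OF mu(2) refl])
   qed (use phi in auto)
   moreover have "C : sets mu" using C mu by simp
   ultimately show ?thesis by simp
  qed
  have "measure m C = measure n C"
  proof (rule LIMSEQ_unique[OF lim[OF m]])
   show "(%k. LINT x|m. max 0 (1-real k*infdist x C)) ----> measure n C"
    using lim[OF n] eq[OF phi(5) conjI[OF phi(2,3)] phi(4)] by simp
  qed
  thus ?thesis by (simp add: m.emeasure_eq_measure n.emeasure_eq_measure)
 qed simp
qed (use prob_space.finite_measure[OF m(1)] in \<open>auto simp: finite_measure.emeasure_finite\<close>)

lemma measurable_prob_algebra_Lipschitz:
 fixes K :: "'b => 'a::metric_space measure"
 assumes prob: "!!x. x : space M ==> prob_space (K x)" and sets_K: "!!x. x : space M ==> sets (K x) = sets borel"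
  and meas: "!!phi L. continuous_on UNIV phi ==> (!!x. 0 <= phi x & phi x <= 1) ==> (!!x y. abs(phi x-phi y) <= L*dist x y) ==>
   0 <= L ==> (%x. LINT y|K x. phi y) : borel_measurable M"
 shows "K : M \<rightarrow>\<^sub>M prob_algebra borel"
proof (rule measurable_prob_algebra_generated[OF sets_borel_eq_sigma_closed _ _ prob sets_K])
 show "Int_stable {C :: 'a set. closed C}" by (auto simp: Int_stable_def)
 fix C :: "'a set" assume "C : {C. closed C}"
 hence C: "closed C" by simp
 show "(%a. emeasure (K a) C) : borel_measurable M"
 proof (cases "C = {}")
  case False
  note phi = indicator_closed_Lipschitz_limit[OF C False]
  have "(%a. measure (K a) C) : borel_measurable M"
  proof (rule borel_measurable_LIMSEQ_real[where u="%k a. \<integral>x. max 0 (1-real k*infdist x C) \<partial>K a"])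
   show "(%a. LINT x|K a. max 0 (1-real k*infdist x C)) : borel_measurable M" for k
    by (rule meas[OF phi(5) conjI[OF phi(2,3)] phi(4)]) simp
   fix a assume a: "a : space M"
   interpret prob_space "K a" by (rule prob[OF a])
   note sK = sets_K[OF a]
   have "(%k. LINT x|K a. max 0 (1-real k*infdist x C)) ----> (LINT x|K a. indicator C x)"
   proof (rule integral_dominated_convergence[where w="%_. 1"])
    show "(%x. max 0 (1-real k*infdist x C)) : borel_measurable (K a)" for k
     using borel_measurable_continuous_onI[OF phi(5)] by (simp add: measurable_cong_sets[OF sK refl])
    show "(indicator C :: 'a => real) : borel_measurable (K a)"
     using C by (simp add: measurable_cong_sets[OF sK refl])
   qed (use phi in auto)
   moreover have "C : sets (K a)" using C sK by simp
   ultimately show "(%k. LINT x|K a. max 0 (1-real k*infdist x C)) ----> measure (K a) C" by simp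
  qed
  hence "(%a. ennreal (measure (K a) C)) : borel_measurable M" by measurable
  moreover have "emeasure (K a) C = ennreal (measure (K a) C)" if "a : space M" for a
   using finite_measure.emeasure_eq_measure[OF prob_space.finite_measure[OF prob[OF that]]] .
  ultimately show ?thesis by (simp cong: measurable_cong)
 qed simp
qed auto

lemma W2_eq_0_imp_eq:
 fixes m n :: "(real^'d) measure"
 assumes "m : P2" "n : P2" "W2 m n = 0"
 shows "m = n"
proof (rule prob_space_eqI_Lipschitz)
 fix phi :: "real^'d => real" and L
 assume "continuous_on UNIV phi" and b: "!!x. 0 <= phi x & phi x <= 1"
  and lip: "!!x y. abs(phi x-phi y) <= L*dist x y" "0 <= L"
 have "abs((LINT x|m. phi x)-(LINT x|n. phi x)) <= L*W2 m n"
 proof (rule W2_Lipschitz_integral[OF assms(1,2) _ _ lip])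
  show "phi : borel_measurable borel" by (rule borel_measurable_continuous_onI) fact
  show "abs(phi x) <= 1" for x using b[of x] by auto
 qed
 thus "(LINT x|m. phi x) = (LINT x|n. phi x)" using assms(3) by simp
qed (use P2_D[OF assms(1)] P2_D[OF assms(2)] in auto)

lemma W2_self:
 fixes m :: "(real^'d) measure"
 assumes "m : P2" shows "W2 m m = 0"
proof -
 have *: "distr m borel (%x. x) = m" by (rule distr_id2) (simp add: P2_D(2)[OF assms])
 have "W2 (distr m borel (%x. x)) (distr m borel (%x. x)) <= 0"
  by (rule W2_le_distr) (use P2_D[OF assms] in \<open>auto simp: measurable_cong_sets[OF P2_D(2)[OF assms] refl]\<close>)
 thus ?thesis using W2_nonneg[of m m] unfolding*by simp
qed

interpretation W2: Metric_space "P2 :: (real^'d) measure set" W2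
proof
 show "0 <= W2 x y" for x y :: "(real^'d) measure" by (rule W2_nonneg)
 show "W2 x y = W2 y x" for x y :: "(real^'d) measure" by (rule W2_commute)
 show "x : P2 ==> y : P2 ==> (W2 x y = 0) = (x = y)" for x y :: "(real^'d) measure"
  using W2_eq_0_imp_eq W2_self by blast
 show "x : P2 ==> y : P2 ==> z : P2 ==> W2 x z <= W2 x y+W2 y z" for x y z :: "(real^'d) measure"
  by (rule W2_triangle)
qed

lemma limitin_P2_topology:
 "limitin P2_topology mu m F \<longleftrightarrow> m : P2 & (\<forall>\<^sub>F x in F. mu x : P2) & ((%x. W2 (mu x) m) \<longlongrightarrow> 0) F"
 unfolding P2_topology_def by (rule W2.limitin_metric_dist_null)

lemma topspace_P2_topology [simp]: "topspace P2_topology = P2"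
 unfolding P2_topology_def by simp

lemma M2_nonneg: "0 <= M2 m" by (simp add: M2_def)

lemma M2_Lipschitz:
 fixes m n :: "(real^'d) measure"
 assumes "m : P2" "n : P2"
 shows "M2 n <= M2 m+W2 m n"
 unfolding M2_def using W2_L2_Lipschitz[OF assms, of norm 1] P2_D(4)[OF assms(1)]
 by (simp add: norm_triangle_ineq3 dist_norm)

subsection \<open>Uniformly integrable second moments and compactness in the Wasserstein space\<close>

text \<open>A smooth substitute for |x|^2 cut off below |x|^2 = R: at most |x|^2 everywhere, at
  least half of it beyond R, and at most |x|^4/R.\<close>

definition sq_tail :: "real => 'a::real_normed_vector => real" where
 "sq_tail R x = (norm x)^4/((norm x)^2+R)"

definition tail_moment :: "real => (real^'d) measure => real" where
 "tail_moment R m = (LINT x|m. sq_tail R x)"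

lemma sq_tail_props:
 fixes x :: "'a::real_normed_vector"
 assumes "0 < R"
 shows "0 <= sq_tail R x" "sq_tail R x <= (norm x)^2" "(norm x)^2 <= sq_tail R x+R"
  "R <= (norm x)^2 ==> (norm x)^2 <= 2 * sq_tail R x"
proof -
 define a where "a = (norm x)^2"
 have p: "0 < a+R" using assms by (auto simp: a_def intro!: add_nonneg_pos)
 have a: "0 <= a" by (simp add: a_def)
 have e: "sq_tail R x = a*a/(a+R)"
  unfolding sq_tail_def a_def by (simp add: power2_eq_square power4_eq_xxxx)
 show "0 <= sq_tail R x" unfolding e using p a by simp
 show "sq_tail R x <= (norm x)^2"
  unfolding e a_def[symmetric] using p assms a by (simp add: divide_le_eq algebra_simps)
 show "(norm x)^2 <= sq_tail R x+R"
  unfolding e a_def[symmetric] using p assms a by (simp add: field_simps)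
 show "(norm x)^2 <= 2 * sq_tail R x" if "R <= (norm x)^2"
 proof -
  have "a*(a+R) <= a*(2*a)"
   using that a unfolding a_def[symmetric] by (intro mult_left_mono) auto
  thus ?thesis unfolding e a_def[symmetric] using p by (simp add: field_simps)
 qed
qed

lemma sq_tail_measurable [measurable]: "sq_tail R : borel_measurable borel"
 unfolding sq_tail_def by measurable

lemma continuous_on_sq_tail: "0 < R ==> continuous_on UNIV (sq_tail R)"
 unfolding sq_tail_def by (intro continuous_intros) (auto simp: add_nonneg_eq_0_iff)

text \<open>With u = sqrt(|x|^2+R) the root of \<open>sq_tail\<close> is u-R/u. The function u is
  1-Lipschitz, and so is R/u because u >= sqrt R; hence the constant 2 for every R.\<close>

lemma sq_tail_sqrt_Lipschitz:
 fixes x y :: "'a::real_normed_vector"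
 assumes "0 < R"
 shows "abs(sqrt (sq_tail R x)-sqrt (sq_tail R y)) <= 2*dist x y"
proof -
 define u where "u x = sqrt ((norm x)^2+R)" for x :: 'a
 have p: "0 < (norm x)^2+R" for x :: 'a using assms by (intro add_nonneg_pos) auto
 have u_pos: "0 < u x" for x unfolding u_def using p by simp
 have u_sq: "(u x)^2 = (norm x)^2+R" for x unfolding u_def using p[of x] by simp
 have u_ge: "norm x <= u x" "sqrt R <= u x" for x
  unfolding u_def using assms by (auto intro!: real_le_rsqrt real_sqrt_le_mono)
 have sq: "sqrt (sq_tail R x) = u x-R/u x" for x
 proof -
  have "sqrt (sq_tail R x) = (norm x)^2/u x"
   unfolding sq_tail_def u_def by (simp add: real_sqrt_divide power4_eq_xxxx power2_eq_square real_sqrt_mult)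
  also have "... = u x-R/u x"
   using u_sq[of x] u_pos[of x] by (simp add: field_simps power2_eq_square)
  finally show ?thesis .
 qed
 have du: "abs(u x-u y) <= dist x y"
 proof -
  have d: "abs(a^2-b^2) = abs(a-b)*(a+b)" if "0 <= a" "0 <= b" for a b :: real
  proof -
   have "a^2-b^2 = (a-b)*(a+b)" by (simp add: power2_eq_square algebra_simps)
   thus ?thesis using that by (simp add: abs_mult)
  qed
  have "abs(u x-u y)*(u x+u y) = abs((u x)^2-(u y)^2)"
   using u_pos[of x] u_pos[of y] by (intro d[symmetric]) auto
  also have "... = abs((norm x)^2-(norm y)^2)" unfolding u_sq by simp
  also have "... = abs(norm x-norm y)*(norm x+norm y)" by (rule d) auto
  also have "... <= abs(norm x-norm y)*(u x+u y)"
   using u_ge(1)[of x] u_ge(1)[of y] by (intro mult_left_mono) auto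
  finally have "abs(u x-u y) <= abs(norm x-norm y)"
   using u_pos[of x] u_pos[of y] by (simp add: mult_le_cancel_right)
  also have "... <= dist x y" by (simp add: norm_triangle_ineq3 dist_norm)
  finally show ?thesis .
 qed
 have "R = sqrt R * sqrt R" using assms by simp
 also have "... <= u x*u y" using assms u_ge u_pos[of x] by (intro mult_mono) auto
 finally have R: "R <= u x*u y" .
 have "\<bar>R/u x-R/u y\<bar> = R/(u x*u y)*\<bar>u x-u y\<bar>"
  using u_pos[of x] u_pos[of y] assms by (simp add: diff_frac_eq abs_mult abs_divide abs_minus_commute right_diff_distrib[symmetric])
 also have "... <= 1*\<bar>u x-u y\<bar>"
  using R u_pos[of x] u_pos[of y] by (intro mult_right_mono) auto
 finally have dR: "abs(R/u x-R/u y) <= abs(u x-u y)" by simp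
 have "abs((u x-R/u x)-(u y-R/u y)) = abs((u x-u y)-(R/u x-R/u y))" by (simp add: algebra_simps)
 also have "... <= abs(u x-u y) + abs(R/u x-R/u y)" by (rule abs_triangle_ineq4)
 also have "... <= dist x y+dist x y" using du dR by (intro add_mono) auto
 finally show ?thesis unfolding sq by simp
qed

lemma integrable_sq_tail: "m : P2 ==> 0 < R ==> integrable m (sq_tail R)"
 by (rule Bochner_Integration.integrable_bound[OF P2_D(4)])
  (auto simp: sq_tail_props measurable_cong_sets[OF P2_D(2) refl])

lemma tail_moment_nonneg: "0 < R ==> 0 <= tail_moment R m"
 unfolding tail_moment_def by (intro integral_nonneg_AE) (auto simp: sq_tail_props)

lemma M2_le_tail_moment:
 assumes "m : P2" "0 < R"
 shows "(M2 m)^2 <= tail_moment R m+R"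
proof -
 interpret prob_space m by (rule P2_D) fact
 have "(M2 m)^2 = (LINT x|m. (norm x)^2)" unfolding M2_def by (simp add: integral_nonneg_AE)
 also have "... <= (LINT x|m. sq_tail R x+R)"
  using P2_D(4)[OF assms(1)] integrable_sq_tail[OF assms] assms
  by (intro integral_mono) (auto simp: sq_tail_props(3))
 also have "... = tail_moment R m+R"
  unfolding tail_moment_def using integrable_sq_tail[OF assms] by (simp add: prob_space)
 finally show ?thesis .
qed

lemma tail_moment_Lipschitz:
 assumes "m : P2" "n : P2" "0 < R"
 shows "sqrt (tail_moment R n) <= sqrt (tail_moment R m)+2*W2 m n"
proof -
 have *: "(sqrt (sq_tail R x))^2 = sq_tail R x" for x :: "real^'a"
  by (simp add: sq_tail_props `0 < R`)
 show ?thesis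
  using W2_L2_Lipschitz[OF assms(1,2), of "%x. sqrt (sq_tail R x)" 2] integrable_sq_tail[OF assms(1,3)]
  by (simp add: * tail_moment_def sq_tail_sqrt_Lipschitz `0 < R`)
qed

lemma tail_moment_tendsto_0:
 assumes "m : P2"
 shows "((%R. tail_moment R m) \<longlongrightarrow> 0) at_top"
proof -
 have "((%R. LINT x|m. sq_tail R x) \<longlongrightarrow> (LINT x|m. 0)) at_top"
 proof (rule integral_dominated_convergence_at_top[where w="%x. (norm x)^2"])
  show "AE x in m. ((%R. sq_tail R x) \<longlongrightarrow> 0) at_top"
  proof (intro AE_I2)
   fix x
   show "((%R. sq_tail R x) \<longlongrightarrow> 0) at_top"
    unfolding sq_tail_def
    by (rule real_tendsto_divide_at_top[OF tendsto_const filterlim_tendsto_add_at_top[OF tendsto_const filterlim_ident]])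
  qed
  show "\<forall>\<^sub>F R in at_top. AE x in m. norm (sq_tail R x) <= (norm x)^2"
   using eventually_gt_at_top[of 0] by eventually_elim (auto simp: sq_tail_props)
 qed (use P2_D[OF assms] in \<open>auto simp: measurable_cong_sets[OF P2_D(2)[OF assms] refl]\<close>)
 thus ?thesis unfolding tail_moment_def by simp
qed

text \<open>A set of this form with \<open>e R \<rightarrow> 0\<close> consists of measures with uniformly integrable second
 moments; these are the relatively compact subsets of the Wasserstein space.\<close>

definition ui_set :: "(real => real) => (real^'d) measure set" where
 "ui_set e = {m : P2. ALL R>=1. tail_moment R m <= e R}"

lemma ui_setD: "m : ui_set e ==> m : P2" "m : ui_set e ==> 1 <= R ==> tail_moment R m <= e R"
 by (auto simp: ui_set_def)

text \<open>If the squared distance exceeds 4*R, one of the points has norm at least half the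
  distance, so its squared norm is at least R and \<open>sq_tail\<close> recovers it up to the
  factor 2. This separates a bounded part of the transport cost from the tails.\<close>

lemma dist_sq_le_truncation:
 fixes x y :: "'a::real_normed_vector"
 assumes "0 < R"
 shows "(dist x y)^2 <= min ((dist x y)^2) (4*R)+8 * sq_tail R x+8 * sq_tail R y"
proof (cases "(dist x y)^2 <= 4*R")
 case True
 thus ?thesis using sq_tail_props(1)[OF assms, of x] sq_tail_props(1)[OF assms, of y] by simp
next
 case False
 have *: "(dist x y)^2 <= 8 * sq_tail R z" if "dist x y <= 2*norm z" for z :: 'a
 proof -
  have "(dist x y)^2 <= (2*norm z)^2" using that by (intro power_mono) auto
  hence le: "(dist x y)^2 <= 4*(norm z)^2" by (simp add: power_mult_distrib)
  hence "R <= (norm z)^2" using False by linarith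
  thus ?thesis using sq_tail_props(4)[OF assms, of z] le by linarith
 qed
 have "dist x y <= norm x+norm y" by (simp add: dist_norm norm_triangle_ineq4)
 hence "dist x y <= 2*norm x | dist x y <= 2*norm y" by linarith
 thus ?thesis
  using *[of x] *[of y] sq_tail_props(1)[OF assms, of x] sq_tail_props(1)[OF assms, of y] False assms by linarith
qed

text \<open>Markov's inequality for the second moments gives tightness, and the almost surely
  convergent representatives are themselves a coupling. Its truncated cost vanishes by dominated
  convergence, while the tails are bounded by \<open>e R\<close>, for the limit by Fatou.\<close>

theorem ui_set_Skorokhod:
 fixes mu :: "nat => (real^'d) measure"
 assumes mu: "!!n. mu n : ui_set e" and e: "(e \<longlongrightarrow> 0) at_top"
 obtains r and l where "strict_mono r" "l : ui_set e" "(%n. W2 (mu (r n)) l) ----> 0"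
proof -
 note P = ui_setD(1)[OF mu] and tail = ui_setD(2)[OF mu]
 have sp: "space (mu n) = UNIV" for n using P2_D(3)[OF P] .
 have M2b: "(M2 (mu n))^2 <= e 1+1" for n
  using M2_le_tail_moment[OF P, of 1 n] tail[of 1 n] by simp
 have e1: "0 <= e 1" using tail[of 1 0] tail_moment_nonneg[of 1 "mu 0"] by linarith
 have tight: "EX k::nat. ALL n. measure (mu n) {x. real k <= norm x} < eps" if "0 < eps" for eps
 proof -
  obtain k :: nat where k: "(e 1+1)/eps+1 < real k" using reals_Archimedean2 by blast
  have "0 <= (e 1+1)/eps" using e1 that by (intro divide_nonneg_pos) auto
  hence k1: "1 < real k" using k by linarith
  have "measure (mu n) {x. real k <= norm x} < eps" for n
  proof -
   interpret prob_space "mu n" by (rule P2_D[OF P])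
   have "{x. real k <= norm x} = {x : space (mu n). (real k)^2 <= (norm x)^2}"
    using k1 by (auto simp: sp abs_le_square_iff[symmetric])
   moreover have "measure (mu n) {x : space (mu n). (real k)^2 <= (norm x)^2} <= (LINT x|mu n. (norm x)^2)/(real k)^2"
    using k1 P2_D[OF P] by (intro integral_Markov_inequality_measure[where A="{}"]) auto
   ultimately have "measure (mu n) {x. real k <= norm x} <= (LINT x|mu n. (norm x)^2)/(real k)^2" by simp
   also have "(LINT x|mu n. (norm x)^2) = (M2 (mu n))^2" unfolding M2_def by (simp add: integral_nonneg_AE)
   also have "(M2 (mu n))^2/(real k)^2 <= (e 1+1)/(real k)^2" using M2b by (intro divide_right_mono) auto
   also have "... <= (e 1+1)/real k"
    using k1 e1 by (intro divide_left_mono) (auto simp: power2_eq_square)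
   also have "... < eps"
   proof -
    have "(e 1+1)/eps < real k" using k by simp
    thus ?thesis using that k1 by (simp add: field_simps)
   qed
   finally show ?thesis .
  qed
  thus ?thesis by blast
 qed
 obtain r :: "nat => nat" and Om :: "real measure" and X Y
  where r: "strict_mono r" and Om: "prob_space Om"
   and [measurable]: "!!n. X n : borel_measurable Om" "Y : borel_measurable Om"
   and law: "!!n. distr Om borel (X n) = mu (r n)"
   and conv: "!!om. om : space Om ==> (%n. X n om) ----> Y om"
  using tight_Skorokhod_euclidean[of mu] P2_D(1,2)[OF P] tight by metis
 interpret prob_space Om by fact
 define l where "l = distr Om borel Y"
 have tX: "integrable Om (%om. sq_tail R (X n om))" "(LINT om|Om. sq_tail R (X n om)) <= e R" if "1 <= R" for R n
 proof -
  show "integrable Om (%om. sq_tail R (X n om))"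
  proof -
   have "integrable (mu (r n)) (sq_tail R)" using that by (intro integrable_sq_tail P) auto
   thus ?thesis unfolding law[symmetric] by (subst (asm) integrable_distr_eq) auto
  qed
  show "(LINT om|Om. sq_tail R (X n om)) <= e R"
   using tail[OF that, of "r n"] unfolding law[symmetric] tail_moment_def by (subst (asm) integral_distr) auto
 qed
 have e_nonneg: "0 <= e R" if "1 <= R" for R
  using tail[OF that, of 0] tail_moment_nonneg[of R "mu 0"] that by linarith
 have tY: "integrable Om (%om. sq_tail R (Y om))" "(LINT om|Om. sq_tail R (Y om)) <= e R" if "1 <= R" for R
 proof -
  have R: "0 < R" using that by simp
  have "(\<integral>\<^sup>+om. ennreal (sq_tail R (Y om)) \<partial>Om) = (\<integral>\<^sup>+om. liminf (%n. ennreal (sq_tail R (X n om))) \<partial>Om)"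
  proof (rule nn_integral_cong)
   fix om assume "om : space Om"
   hence "(%n. sq_tail R (X n om)) ----> sq_tail R (Y om)"
    using continuous_on_sq_tail[OF R] conv by (auto simp: continuous_on_eq_continuous_at intro: isCont_tendsto_compose)
   hence "(%n. ennreal (sq_tail R (X n om))) ----> ennreal (sq_tail R (Y om))" by (rule tendsto_ennrealI)
   thus "ennreal (sq_tail R (Y om)) = liminf (%n. ennreal (sq_tail R (X n om)))"
    by (intro lim_imp_Liminf[symmetric]) auto
  qed
  also have "... <= liminf (%n. \<integral>\<^sup>+om. ennreal (sq_tail R (X n om)) \<partial>Om)" by (rule nn_integral_liminf) measurable
  also have "... <= ennreal (e R)"
  proof (rule Liminf_le)
   show "\<forall>\<^sub>F n in sequentially. (\<integral>\<^sup>+om. ennreal (sq_tail R (X n om)) \<partial>Om) <= ennreal (e R)"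
    using tX[OF that] by (subst nn_integral_eq_integral) (auto simp: sq_tail_props R intro!: always_eventually ennreal_leI)
  qed simp
  finally have le: "(\<integral>\<^sup>+om. ennreal (sq_tail R (Y om)) \<partial>Om) <= ennreal (e R)" .
  have m: "(%om. sq_tail R (Y om)) : borel_measurable Om" by measurable
  note * = nn_integral_le_realD[OF m sq_tail_props(1)[OF R] e_nonneg[OF that] le]
  show "integrable Om (%om. sq_tail R (Y om))" by (rule *(1))
  show "(LINT om|Om. sq_tail R (Y om)) <= e R" by (rule *(2))
 qed
 have Y2: "integrable Om (%om. (norm (Y om))^2)"
 proof (rule Bochner_Integration.integrable_bound)
  show "integrable Om (%om. sq_tail 1 (Y om)+1)" using tY(1)[of 1] by simp
  show "AE om in Om. norm ((norm (Y om))^2) <= norm (sq_tail 1 (Y om)+1)"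
  proof (intro AE_I2)
   fix om
   show "norm ((norm (Y om))^2) <= norm (sq_tail 1 (Y om)+1)"
    using sq_tail_props(1,3)[of 1 "Y om"] by simp
  qed
 qed measurable
 have lP: "l : P2"
  unfolding P2_def l_def using Y2 by (auto intro!: prob_space_distr simp: integrable_distr_eq)
 have "l : ui_set e"
  unfolding ui_set_def tail_moment_def using tY lP by (auto simp: l_def integral_distr)
 moreover have "(%n. W2 (mu (r n)) l) ----> 0"
 proof (rule LIMSEQ_I)
  fix eps :: real assume "0 < eps"
  \<comment> \<open>17 = 1+8+8: the truncated cost and the two tails of
    \<open>dist_sq_le_truncation\<close>.\<close>
  define dl where "dl = (eps/2)^2/17"
  have dl: "0 < dl" using `0 < eps` by (simp add: dl_def)
  have "\<forall>\<^sub>F R in at_top. e R < dl" using order_tendstoD(2)[OF e dl] .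
  hence "\<forall>\<^sub>F R in at_top. e R < dl & 1 <= R" by (intro eventually_conj eventually_ge_at_top)
  then obtain R where R: "e R < dl" "1 <= R" using eventually_happens'[OF trivial_limit_at_top_linorder] by blast
  have R0: "0 < R" using R by simp
  have "(%n. LINT om|Om. min ((dist (X n om) (Y om))^2) (4*R)) ----> (LINT om|Om. 0)"
  proof (rule integral_dominated_convergence[where w="%_. 4*R"])
   show "AE om in Om. (%n. min ((dist (X n om) (Y om))^2) (4*R)) ----> 0"
   proof (intro AE_I2)
    fix om assume om: "om : space Om"
    have "(%n. dist (X n om) (Y om)) ----> 0"
     by (rule tendsto_dist_iff[THEN iffD1, OF conv[OF om]])
    hence "(%n. min ((dist (X n om) (Y om))^2) (4*R)) ----> min (0^2) (4*R)"
     by (intro tendsto_intros)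
    thus "(%n. min ((dist (X n om) (Y om))^2) (4*R)) ----> 0" using R0 by simp
   qed
  qed (use R0 in auto)
  hence "\<forall>\<^sub>F n in sequentially. (LINT om|Om. min ((dist (X n om) (Y om))^2) (4*R)) < dl"
   using dl by (intro order_tendstoD(2)) auto
  then obtain N where N: "!!n. n >= N ==> (LINT om|Om. min ((dist (X n om) (Y om))^2) (4*R)) < dl"
   by (auto simp: eventually_sequentially)
  show "EX no. ALL n>=no. norm (W2 (mu (r n)) l-0) < eps"
  proof (intro exI allI impI)
   fix n assume n: "n >= N"
   have im: "integrable Om (%om. min ((dist (X n om) (Y om))^2) (4*R))"
    using R0 by (intro integrable_const_bound[of _ "4*R"]) auto
   have i: "integrable Om (%om. min ((dist (X n om) (Y om))^2) (4*R)+8 * sq_tail R (X n om)+8 * sq_tail R (Y om))"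
    using im tX(1)[OF R(2)] tY(1)[OF R(2)] by auto
   have "(\<integral>\<^sup>+om. ennreal ((dist (X n om) (Y om))^2) \<partial>Om) <=
    (\<integral>\<^sup>+om. ennreal (min ((dist (X n om) (Y om))^2) (4*R)+8 * sq_tail R (X n om)+8 * sq_tail R (Y om)) \<partial>Om)"
    by (intro nn_integral_mono ennreal_leI dist_sq_le_truncation R0)
   also have "... = ennreal (LINT om|Om. min ((dist (X n om) (Y om))^2) (4*R)+8 * sq_tail R (X n om)+8 * sq_tail R (Y om))"
    using R0 by (intro nn_integral_eq_integral i) (auto simp: sq_tail_props intro!: add_nonneg_nonneg)
   also have "... <= ennreal ((eps/2)^2)"
   proof (rule ennreal_leI)
    have "(LINT om|Om. min ((dist (X n om) (Y om))^2) (4*R)+8 * sq_tail R (X n om)+8 * sq_tail R (Y om)) =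
     (LINT om|Om. min ((dist (X n om) (Y om))^2) (4*R))+8*(LINT om|Om. sq_tail R (X n om))+8*(LINT om|Om. sq_tail R (Y om))"
     using im tX(1)[OF R(2)] tY(1)[OF R(2)] by simp
    also have "... <= 17*dl"
     using N[OF n] tX(2)[OF R(2), of n] tY(2)[OF R(2)] R(1) by linarith
    finally show "(LINT om|Om. min ((dist (X n om) (Y om))^2) (4*R)+8 * sq_tail R (X n om)+8 * sq_tail R (Y om)) <= (eps/2)^2"
     by (simp add: dl_def)
   qed
   finally have "W2 (distr Om borel (X n)) (distr Om borel Y) <= eps/2"
    using `0 < eps` by (intro W2_le_distr Om) auto
   thus "norm (W2 (mu (r n)) l-0) < eps"
    using W2_nonneg[of "mu (r n)" l] `0 < eps` by (simp add: law l_def)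
  qed
 qed
 ultimately show thesis using r that by blast
qed

lemma compactin_ui_set:
 assumes "(e \<longlongrightarrow> 0) at_top"
 shows "compactin P2_topology (ui_set e :: (real^'d) measure set)"
 unfolding P2_topology_def W2.compactin_sequentially
proof (intro conjI allI impI)
 show "ui_set e \<subseteq> (P2 :: (real^'d) measure set)" by (auto simp: ui_set_def)
 fix sg :: "nat => (real^'d) measure" assume "range sg \<subseteq> ui_set e"
 hence sg: "sg n : ui_set e" for n by auto
 obtain r l where rl: "strict_mono r" "l : ui_set e" "(%n. W2 (sg (r n)) l) ----> 0"
  by (rule ui_set_Skorokhod[OF sg assms])
 hence "limitin W2.mtopology (sg \<circ> r) l sequentially"
  unfolding W2.limitin_metric_dist_null using ui_setD(1) sg by (auto simp: comp_def intro!: always_eventually)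
 thus "EX l r. l : ui_set e & strict_mono r & limitin W2.mtopology (sg \<circ> r) l sequentially"
  using rl by blast
qed

text \<open>The tails of late members are controlled by those of the limit through the Lipschitz
  estimate, and each of the finitely many others has vanishing tails by itself.\<close>

lemma W2_convergent_ui:
 fixes mu :: "nat => (real^'d) measure"
 assumes mu: "!!n. mu n : P2" and l: "l : P2" and lim: "(%n. W2 (mu n) l) ----> 0"
 shows "EX e. (e \<longlongrightarrow> 0) at_top & (ALL n. mu n : ui_set e)"
proof (intro exI conjI allI)
 define e where "e R = (SUP n. tail_moment R (mu n))" for R
 obtain B where B: "!!n. abs(W2 (mu n) l) <= B"
  using convergent_imp_Bseq[OF convergentI[OF lim]] by (auto simp: Bseq_def)
 have bound: "tail_moment R (mu n) <= (sqrt (tail_moment R l)+2*W2 (mu n) l)^2" if "0 < R" for R n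
 proof -
  have "tail_moment R (mu n) = (sqrt (tail_moment R (mu n)))^2" using tail_moment_nonneg[OF that, of "mu n"] by simp
  also have "... <= (sqrt (tail_moment R l)+2*W2 l (mu n))^2"
  proof (rule power_mono)
   show "sqrt (tail_moment R (mu n)) <= sqrt (tail_moment R l)+2*W2 l (mu n)"
    by (rule tail_moment_Lipschitz[OF l mu that])
   show "0 <= sqrt (tail_moment R (mu n))" using tail_moment_nonneg[OF that, of "mu n"] by simp
  qed
  finally show ?thesis by (simp add: W2_commute)
 qed
 have bdd: "bdd_above (range (%n. tail_moment R (mu n)))" if "0 < R" for R
 proof (rule bdd_aboveI2)
  fix n
  have "(sqrt (tail_moment R l)+2*W2 (mu n) l)^2 <= (sqrt (tail_moment R l)+2*B)^2"
   using B[of n] W2_nonneg[of "mu n" l] tail_moment_nonneg[OF that, of l] by (intro power_mono) auto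
  thus "tail_moment R (mu n) <= (sqrt (tail_moment R l)+2*B)^2" using bound[OF that, of n] by linarith
 qed
 show "mu n : ui_set e" for n
  unfolding ui_set_def e_def using mu bdd by (auto intro!: cSUP_upper)
 show "(e \<longlongrightarrow> 0) at_top"
 proof (rule tendstoI)
  fix eps :: real assume "0 < eps"
  \<comment> \<open>The root of the tail of \<open>l\<close> is at most dl and twice the distance at
    most 2*dl; (3*dl)^2 = eps/2.\<close>
  define dl where "dl = sqrt (eps/2)/3"
  have dl: "0 < dl" "(3*dl)^2 = eps/2" using `0 < eps` by (auto simp: dl_def)
  obtain N where N: "!!n. n >= N ==> W2 (mu n) l < dl"
   using order_tendstoD(2)[OF lim dl(1)] by (auto simp: eventually_sequentially)
  have 1: "\<forall>\<^sub>F R in at_top. ALL n:{..<N}. tail_moment R (mu n) < eps/2"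
   using `0 < eps` by (intro eventually_ball_finite ballI order_tendstoD(2)[OF tail_moment_tendsto_0[OF mu]]) auto
  have 2: "\<forall>\<^sub>F R in at_top. tail_moment R l < dl^2"
   using dl by (intro order_tendstoD(2)[OF tail_moment_tendsto_0[OF l]]) auto
  show "\<forall>\<^sub>F R in at_top. dist (e R) 0 < eps"
   using 1 2 eventually_gt_at_top[of 0]
  proof eventually_elim
   case (elim R)
   have "tail_moment R (mu n) <= eps/2" for n
   proof (cases "n < N")
    case True
    thus ?thesis using elim(1) by (auto intro: less_imp_le)
   next
    case False
    have "sqrt (tail_moment R l) <= dl" using elim(2) dl by (intro real_le_lsqrt) auto
    hence "(sqrt (tail_moment R l)+2*W2 (mu n) l)^2 <= (3*dl)^2"
     using N[of n] False W2_nonneg[of "mu n" l] tail_moment_nonneg[OF elim(3), of l] by (intro power_mono) auto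
    thus ?thesis using bound[OF elim(3), of n] dl by simp
   qed
   hence "e R <= eps/2" unfolding e_def by (intro cSUP_least) auto
   moreover have "0 <= e R"
    unfolding e_def by (rule cSUP_upper2[OF bdd[OF elim(3)], of 0]) (auto simp: tail_moment_nonneg elim(3))
   ultimately show ?case using `0 < eps` by simp
  qed
 qed
qed

subsection \<open>Radial bump functions determine measures\<close>

text \<open>The cube makes the function C^2 across the boundary of its support, the ball of radius
  1/sqrt k, and keeps its derivatives as a function of the squared distance elementary.\<close>

definition bump :: "real => 'a::real_normed_vector => 'a => real" where
 "bump k a x = (max 0 (1-k*(norm (x-a))^2))^3"

lemma bump_range: "0 <= k ==> 0 <= bump k a x" "0 <= k ==> bump k a x <= 1"
 unfolding bump_def by (auto intro!: power_le_one)

lemma bump_eq_0: "0 < k ==> 1/sqrt k <= norm (x-a) ==> bump k a x = 0"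
proof -
 assume k: "0 < k" and "1/sqrt k <= norm (x-a)"
 hence "(1/sqrt k)^2 <= (norm (x-a))^2" by (intro power_mono) auto
 hence "1 <= k*(norm (x-a))^2" using k by (simp add: power_divide field_simps)
 thus ?thesis by (simp add: bump_def)
qed

lemma continuous_on_bump: "continuous_on UNIV (bump k a)"
 unfolding bump_def by (intro continuous_intros)

lemma bump_measurable [measurable]:
 fixes a :: "'a::euclidean_space"
 shows "bump k a : borel_measurable borel"
 by (rule borel_measurable_continuous_onI[OF continuous_on_bump])

lemma bump_measurable2 [measurable]: "(%a. bump k a x) : borel_measurable borel"
 for x :: "'a::euclidean_space"
 unfolding bump_def by measurable

text \<open>The constant is 3, for the cube on [0,1], times 2*sqrt k, for 1-k*r^2 on 0 <= r <=
  1/sqrt k.\<close>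

lemma bump_Lipschitz:
 fixes a b x y :: "'a::real_normed_vector"
 assumes "0 < k"
 shows "abs(bump k a x-bump k b y) <= 6 * sqrt k*(dist x y+dist a b)"
proof -
 define c where "c x = min x (1/sqrt k)" for x
 define w where "w x = max 0 (1-k*x^2)" for x :: real
 have w: "w x = 1-k*(c x)^2" if "0 <= x" for x
 proof (cases "x <= 1/sqrt k")
  case True
  hence "x^2 <= (1/sqrt k)^2" using that by (intro power_mono) auto
  hence "k*x^2 <= 1" using `0 < k` by (simp add: power_divide field_simps)
  thus ?thesis using True by (simp add: w_def c_def)
 next
  case False
  hence "(1/sqrt k)^2 <= x^2" using `0 < k` by (intro power_mono) auto
  hence "1 <= k*x^2" using `0 < k` by (simp add: power_divide field_simps)
  thus ?thesis using False `0 < k` by (simp add: w_def c_def power_divide)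
 qed
 have w01: "0 <= w x" "w x <= 1" for x using `0 < k` by (auto simp: w_def)
 have wl: "\<bar>w p-w q\<bar> <= 2 * sqrt k*\<bar>p-q\<bar>" if "0 <= p" "0 <= q" for p q
 proof -
  have c0: "0 <= c p" "0 <= c q" "c p <= 1/sqrt k" "c q <= 1/sqrt k"
   using that `0 < k` by (auto simp: c_def)
  have "w p-w q = k*(c p + c q)*(c q - c p)"
   using that by (simp add: w power2_eq_square algebra_simps)
  hence "\<bar>w p-w q\<bar> = k*(c p + c q)*\<bar>c p - c q\<bar>"
   using c0 `0 < k` by (simp add: abs_mult abs_minus_commute)
  also have "... <= k*(2/sqrt k)*\<bar>p-q\<bar>"
   using c0 `0 < k` by (intro mult_mono mult_left_mono) (auto simp: c_def)
  also have "k*(2/sqrt k) = 2 * sqrt k"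
   using `0 < k` real_sqrt_mult_self[of k] by (simp add: field_simps)
  finally show ?thesis .
 qed
 have cube: "\<bar>u^3-v^3\<bar> <= 3*\<bar>u-v\<bar>" if "0 <= u" "u <= 1" "0 <= v" "v <= 1" for u v :: real
 proof -
  have "u^3-v^3 = (u*u+u * v+v * v)*(u-v)" by (simp add: power3_eq_cube algebra_simps)
  hence "\<bar>u^3-v^3\<bar> = (u*u+u * v+v * v)*\<bar>u-v\<bar>" using that by (simp add: abs_mult)
  also have "... <= 3*\<bar>u-v\<bar>"
   using that mult_mono[of u 1 u 1] mult_mono[of u 1 v 1] mult_mono[of v 1 v 1] by (intro mult_right_mono) auto
  finally show ?thesis .
 qed
 have "\<bar>bump k a x-bump k b y\<bar> <= 3*\<bar>w (norm (x-a))-w (norm (y-b))\<bar>"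
  using cube[OF w01 w01] by (simp add: bump_def w_def)
 also have "... <= 3*(2 * sqrt k*\<bar>norm (x-a)-norm (y-b)\<bar>)"
  by (intro mult_left_mono wl) auto
 also have "abs(norm (x-a)-norm (y-b)) <= dist x y+dist a b"
 proof -
  have "abs(norm (x-a)-norm (y-b)) <= norm ((x-a)-(y-b))" by (rule norm_triangle_ineq3)
  also have "(x-a)-(y-b) = (x-y)-(a-b)" by simp
  also have "norm ... <= norm (x-y)+norm (a-b)" by (rule norm_triangle_ineq4)
  finally show ?thesis by (simp add: dist_norm)
 qed
 finally show ?thesis using `0 < k` by (simp add: mult.assoc)
qed

lemma bump_integral_bounds:
 fixes x :: "'a::euclidean_space"
 assumes "0 < k"
 defines "c \<equiv> \<integral>\<^sup>+a. ennreal (bump k a (0::'a)) \<partial>lborel"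
 shows "(\<integral>\<^sup>+a. ennreal (bump k a x) \<partial>lborel) = c" "0 < c" "c < \<infinity>"
proof -
 have "(\<integral>\<^sup>+a. ennreal (bump k a x) \<partial>lborel) = (\<integral>\<^sup>+a. ennreal (bump k a x) \<partial>distr lborel borel ((+) x))"
  by (simp only: lborel_distr_plus)
 also have "... = (\<integral>\<^sup>+a. ennreal (bump k (x+a) x) \<partial>lborel)"
  by (subst nn_integral_distr) auto
 also have "... = c" unfolding c_def bump_def by (simp add: norm_minus_commute)
 finally show "(\<integral>\<^sup>+a. ennreal (bump k a x) \<partial>lborel) = c" .
 define rho where "rho = 1/sqrt k"
 have "0 < rho" using `0 < k` by (simp add: rho_def)
 have "c <= (\<integral>\<^sup>+a. indicator (cball 0 rho) a \<partial>(lborel :: 'a measure))"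
  unfolding c_def
 proof (intro nn_integral_mono)
  fix a :: 'a
  show "ennreal (bump k a 0) <= indicator (cball 0 rho) a"
   using bump_eq_0[OF `0 < k`, of 0 a] bump_range[of k a 0] `0 < k`
   by (cases "norm a <= rho") (auto simp: rho_def indicator_def)
 qed
 also have "... < \<infinity>" using emeasure_bounded_finite[OF bounded_cball, of "0::'a" rho] by simp
 finally show "c < \<infinity>" .
 have "emeasure lborel (ball (0::'a) (rho/2)) ~= 0"
 proof
  assume "emeasure lborel (ball (0::'a) (rho/2)) = 0"
  hence "measure lborel (ball (0::'a) (rho/2)) = 0" by (simp only: measure_def enn2real_0)
  thus False using `0 < rho` unfolding content_ball_eq_0_iff by simp
 qed
 hence "0 < emeasure lborel (ball (0::'a) (rho/2))*ennreal ((1/2)^3)"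
  by (simp add: ennreal_zero_less_mult_iff zero_less_iff_neq_zero)
 also have "... = (\<integral>\<^sup>+a. ennreal ((1/2)^3)*indicator (ball (0::'a) (rho/2)) a \<partial>lborel)"
  by (subst nn_integral_cmult_indicator) (auto simp: mult.commute)
 also have "... <= c"
  unfolding c_def
 proof (intro nn_integral_mono)
  fix a :: 'a
  show "ennreal ((1/2)^3)*indicator (ball (0::'a) (rho/2)) a <= ennreal (bump k a 0)"
  proof (cases "norm a < rho/2")
   case True
   hence "(norm a)^2 <= (rho/2)^2" by (intro power_mono) auto
   hence "k*(norm a)^2 <= 1/2" using `0 < k` by (simp add: rho_def power_divide field_simps)
   hence "(1/2)^3 <= bump k a 0" unfolding bump_def by (intro power_mono) auto
   thus ?thesis using True by (simp add: ennreal_leI)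
  qed (auto simp: indicator_def)
 qed
 finally show "0 < c" .
qed

lemma bump_integral:
 fixes x :: "'a::euclidean_space"
 assumes k: "0 < k"
 shows "integrable lborel (%a. bump k a x)"
  and "(LINT a|lborel. bump k a x) = (LINT a|lborel. bump k a (0::'a))" "0 < (LINT a|lborel. bump k a (0::'a))"
proof -
 have e: "(LINT a|lborel. bump k a y) = enn2real (\<integral>\<^sup>+a. ennreal (bump k a y) \<partial>lborel)" for y :: 'a
  using k by (intro integral_eq_nn_integral) (auto simp: bump_range)
 note B = bump_integral_bounds[OF k, where 'a='a]
 show "integrable lborel (%a. bump k a x)" using k B(3) by (intro integrableI_nonneg) (auto simp: bump_range B(1)[of x])
 show "(LINT a|lborel. bump k a x) = (LINT a|lborel. bump k a (0::'a))" unfolding e by (simp only: B(1)[of x])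
 show "0 < (LINT a|lborel. bump k a (0::'a))" unfolding e enn2real_positive_iff using B by simp
qed

text \<open>Mollification read backwards: by Fubini, averaging over the centre \<open>a\<close>
  turns the bump integrals of \<open>mu\<close> into the integral of \<open>phi\<close> smeared over
  distance 1/sqrt k, times the mass \<open>c\<close> of a bump.\<close>

lemma bump_average:
 fixes mu :: "'a::euclidean_space measure"
 assumes mu: "prob_space mu" "sets mu = sets borel" and k: "0 < k"
  and phi: "phi : borel_measurable borel" "!!x. abs(phi x) <= (1::real)"
  and near: "!!a x. norm (x-a) < 1/sqrt k ==> abs(phi x-phi a) <= dl"
 defines "c \<equiv> \<integral>a. bump k a (0::'a) \<partial>lborel"
 shows "abs(c*(LINT x|mu. phi x)-(LINT a|lborel. phi a*(LINT x|mu. bump k a x))) <= c*dl"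
proof -
 interpret mu: prob_space mu by fact
 interpret pair_sigma_finite mu lborel ..
 note [measurable] = phi(1) and [measurable_cong] = mu(2)
 have [measurable]: "(%z. bump k (snd z) (fst z)) : borel_measurable (mu \<Otimes>\<^sub>M lborel)"
  unfolding bump_def by measurable
 have b0: "0 <= bump k a x" for a x :: 'a using k by (simp add: bump_range)
 note I = bump_integral(1)[OF k, where 'a='a] and Ic = bump_integral(2)[OF k, where 'a='a, folded c_def]
 have P: "integrable (mu \<Otimes>\<^sub>M lborel) (%z. bump k (snd z) (fst z))"
  using I b0 by (intro Fubini_integrable) (auto simp: Ic)
 have int: "integrable (mu \<Otimes>\<^sub>M lborel) (%z. phi (fst z)*bump k (snd z) (fst z))"
  "integrable (mu \<Otimes>\<^sub>M lborel) (%z. phi (snd z)*bump k (snd z) (fst z))"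
  using phi(2) b0 by (auto intro!: Bochner_Integration.integrable_bound[OF P] AE_I2 mult_left_le_one_le simp: abs_mult)
 have int': "integrable lborel (%a. phi x*bump k a x)" "integrable lborel (%a. phi a*bump k a x)" for x
  using phi(2) b0
  by (auto intro!: Bochner_Integration.integrable_bound[OF I[of x]] AE_I2 mult_left_le_one_le simp: abs_mult)
 have "(LINT a|lborel. phi a*(LINT x|mu. bump k a x)) = (LINT x|mu. (LINT a|lborel. phi a*bump k a x))"
  using Fubini_integral[of "%x a. phi a*bump k a x"] int(2) by (simp add: split_beta')
 moreover have "c*(LINT x|mu. phi x) = (LINT x|mu. (LINT a|lborel. phi x*bump k a x))"
  by (simp add: Ic mult.commute)
 ultimately have "abs(c*(LINT x|mu. phi x)-(LINT a|lborel. phi a*(LINT x|mu. bump k a x))) =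
   abs(\<integral>x. (LINT a|lborel. (phi x-phi a)*bump k a x) \<partial>mu)"
  using integrable_fst'[OF int(1)] integrable_fst'[OF int(2)] int' by (simp add: left_diff_distrib)
 also have "... <= (LINT x|mu. abs(\<integral>a. (phi x-phi a)*bump k a x \<partial>lborel))" by (rule integral_abs_bound)
 also have "... <= (LINT x|mu. c*dl)"
 proof (rule integral_mono)
  show "integrable mu (%x. abs(\<integral>a. (phi x-phi a)*bump k a x \<partial>lborel))"
   using integrable_fst'[OF int(1)] integrable_fst'[OF int(2)] int' by (simp add: left_diff_distrib)
  fix x
  have "abs(\<integral>a. (phi x-phi a)*bump k a x \<partial>lborel) <= (LINT a|lborel. dl*bump k a x)"
  proof (rule order.trans[OF integral_abs_bound integral_mono])
   show "integrable lborel (%a. abs((phi x-phi a)*bump k a x))" using int'[of x] by (simp add: left_diff_distrib)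
   show "abs((phi x-phi a)*bump k a x) <= dl*bump k a x" for a
    using bump_eq_0[OF k, of x a] near[of x a] b0[of a x]
    by (cases "norm (x-a) < 1/sqrt k") (auto simp: abs_mult intro: mult_right_mono)
  qed (use I in auto)
  thus "abs(\<integral>a. (phi x-phi a)*bump k a x \<partial>lborel) <= c*dl" by (simp add: Ic mult.commute)
 qed auto
 finally show ?thesis by (simp add: mu.prob_space)
qed

text \<open>Centres pass from \<open>D\<close> to all points by continuity of the bump in its
  centre; as the bumps shrink, \<open>bump_average\<close> recovers every bounded Lipschitz
  integral. With a countable \<open>D\<close>, countably many numbers determine a measure, which
  suits diagonal extraction.\<close>

lemma prob_space_eqI_bump:
 fixes m n :: "'a::euclidean_space measure"
 assumes m: "prob_space m" "sets m = sets borel" and n: "prob_space n" "sets n = sets borel"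
  and dense: "closure D = UNIV"
  and eqD: "!!j a. a : D ==> (LINT x|m. bump (real (Suc j)) a x) = (LINT x|n. bump (real (Suc j)) a x)"
 shows "m = n"
proof (rule prob_space_eqI_Lipschitz[OF m n])
 fix phi :: "'a => real" and L
 assume cont: "continuous_on UNIV phi" and phi01: "!!x. 0 <= phi x & phi x <= 1"
  and lip: "!!x y. abs(phi x-phi y) <= L*dist x y" and "0 <= L"
 have eq: "(LINT x|m. bump (real (Suc j)) a x) = (LINT x|n. bump (real (Suc j)) a x)" for j a
 proof -
  have "a : closure D" using dense by simp
  then obtain b where b: "!!i. b i : D" "b ----> a" using closure_sequential by metis
  have lim: "(%i. LINT x|mu. bump (real (Suc j)) (b i) x) ----> (LINT x|mu. bump (real (Suc j)) a x)"
   if mu: "prob_space mu" "sets mu = sets borel" for mu :: "'a measure"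
  proof (rule integral_dominated_convergence[where w="%_. 1"])
   interpret mu: prob_space mu by fact
   show "integrable mu (%_. 1 :: real)" by simp
   show "AE x in mu. (%i. bump (real (Suc j)) (b i) x) ----> bump (real (Suc j)) a x"
    unfolding bump_def by (intro AE_I2 tendsto_intros b)
  qed (auto simp: bump_range measurable_cong_sets[OF mu(2) refl])
  have "(%i. LINT x|m. bump (real (Suc j)) (b i) x) ----> (LINT x|n. bump (real (Suc j)) a x)"
   using lim[OF n] by (simp only: eqD[OF b(1)])
  thus ?thesis by (rule LIMSEQ_unique[OF lim[OF m]])
 qed
 have close: "abs((LINT x|m. phi x)-(LINT x|n. phi x)) <= 2*(L/sqrt (real (Suc j)))" for j
 proof -
  define c where "c = (LINT a|lborel. bump (real (Suc j)) a (0::'a))"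
  let ?dl = "L/sqrt (real (Suc j))"
  have c: "0 < c" unfolding c_def by (rule bump_integral) simp
  have near: "abs(phi x-phi a) <= ?dl" if "norm (x-a) < 1/sqrt (real (Suc j))" for x a
   using lip[of x a] mult_left_mono[OF less_imp_le[OF that] `0 <= L`] by (simp add: dist_norm)
  have A: "abs(c*(LINT x|mu. phi x)-(LINT a|lborel. phi a*(LINT x|mu. bump (real (Suc j)) a x))) <= c * ?dl"
   if "prob_space mu" "sets mu = sets borel" for mu :: "'a measure"
   unfolding c_def using phi01 by (intro bump_average that borel_measurable_continuous_onI[OF cont] near) auto
  have "abs(c*(LINT x|m. phi x) - c*(LINT x|n. phi x)) <= c * ?dl + c * ?dl"
   using dist_triangle_le[OF add_mono[OF A[OF m, unfolded eq, folded dist_real_def] A[OF n, folded dist_real_def]]]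
   by (simp add: dist_real_def)
  hence "abs(c*(LINT x|m. phi x) - c*(LINT x|n. phi x)) <= c*(2 * ?dl)" by (simp add: mult_ac)
  hence "c*\<bar>(LINT x|m. phi x)-(LINT x|n. phi x)\<bar> <= c*(2 * ?dl)"
   using c by (simp only: right_diff_distrib[symmetric] abs_mult abs_of_pos)
  thus ?thesis using c by (simp only: mult_le_cancel_left_pos)
 qed
 have "(%j. 2*(L/sqrt (real (Suc j)))) ----> 2*0"
  by (intro tendsto_intros real_tendsto_divide_at_top[OF tendsto_const]
    filterlim_compose[OF sqrt_at_top] filterlim_compose[OF filterlim_real_sequentially filterlim_Suc])
 hence "abs((LINT x|m. phi x)-(LINT x|n. phi x)) <= 2*0" by (rule LIMSEQ_le_const) (use close in blast)
 thus "(LINT x|m. phi x) = (LINT x|n. phi x)" by simp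
qed


text \<open>Otherwise a subsequence stays away from \<open>l\<close>; compactness gives it a further
  subsequence with a W2-limit, and the bump integrals identify this limit with
  \<open>l\<close>.\<close>

lemma W2_tendsto_bump:
 fixes mu :: "nat => (real^'d) measure"
 assumes mu: "!!n. mu n : ui_set e" and e: "(e \<longlongrightarrow> 0) at_top" and l: "l : P2" and dense: "closure D = UNIV"
  and lim: "!!j a. a : D ==> (%n. LINT x|mu n. bump (real (Suc j)) a x) ----> (LINT x|l. bump (real (Suc j)) a x)"
 shows "(%n. W2 (mu n) l) ----> 0"
proof (rule ccontr)
 assume "\<not> ?thesis"
 then obtain eps where "0 < eps" and "\<not> (\<forall>\<^sub>F n in sequentially. dist (W2 (mu n) l) 0 < eps)"
  unfolding tendsto_iff by blast
 hence "\<exists>\<^sub>F n in sequentially. eps <= W2 (mu n) l"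
  by (simp add: frequently_def not_le W2_nonneg)
 hence "infinite {n. eps <= W2 (mu n) l}"
  unfolding cofinite_eq_sequentially[symmetric] by (simp add: frequently_cofinite)
 then obtain s :: "nat => nat" where s: "strict_mono s" "!!n. eps <= W2 (mu (s n)) l"
  using infinite_enumerate[of "{n. eps <= W2 (mu n) l}"] by auto
 obtain r l' where r: "strict_mono r" and l': "l' : ui_set e" and conv: "(%n. W2 (mu (s (r n))) l') ----> 0"
  by (rule ui_set_Skorokhod[OF mu e, of s])
 have "l = l'"
 proof (rule prob_space_eqI_bump[OF _ _ _ _ dense])
  fix j and a :: "real^'d" assume "a : D"
  let ?b = "%x. bump (real (Suc j)) a x"
  have "(%n. LINT x|mu (s (r n)). ?b x) ----> (LINT x|l'. ?b x)"
  proof (rule Lim_null[THEN iffD2], rule Lim_null_comparison)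
   show "\<forall>\<^sub>F n in sequentially. norm ((LINT x|mu (s (r n)). ?b x)-(LINT x|l'. ?b x)) <=
    6 * sqrt (real (Suc j))*W2 (mu (s (r n))) l'"
   proof (intro always_eventually allI)
    fix n
    show "norm ((LINT x|mu (s (r n)). ?b x)-(LINT x|l'. ?b x)) <= 6 * sqrt (real (Suc j))*W2 (mu (s (r n))) l'"
     unfolding real_norm_def
    proof (rule W2_Lipschitz_integral[OF ui_setD(1)[OF mu] ui_setD(1)[OF l']])
     show "abs(?b x) <= 1" for x using bump_range[of "real (Suc j)" a x] by simp
     show "abs(?b x - ?b y) <= 6 * sqrt (real (Suc j))*dist x y" for x y
      using bump_Lipschitz[of "real (Suc j)" a x a y] by simp
    qed simp_all
   qed
   show "(%n. 6 * sqrt (real (Suc j))*W2 (mu (s (r n))) l') ----> 0"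
    by (rule tendsto_mult_right_zero[OF conv])
  qed
  moreover have "(%n. LINT x|mu (s (r n)). ?b x) ----> (LINT x|l. ?b x)"
   using LIMSEQ_subseq_LIMSEQ[OF lim[OF `a : D`, of j] strict_mono_o[OF s(1) r]] by (simp add: comp_def)
  ultimately show "(LINT x|l. ?b x) = (LINT x|l'. ?b x)" using LIMSEQ_unique by blast
 qed (use P2_D[OF l] P2_D[OF ui_setD(1)[OF l']] in auto)
 hence "\<forall>\<^sub>F n in sequentially. W2 (mu (s (r n))) l < eps"
  using order_tendstoD(2)[OF conv `0 < eps`] by simp
 then obtain n where "W2 (mu (s (r n))) l < eps" using eventually_happens'[OF sequentially_bot] by blast
 thus False using s(2)[of "r n"] by simp
qed

subsection \<open>Compactness of curves\<close>

lemma diagonal_subsequence_real: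
 fixes u :: "nat => nat => real"
 assumes "!!i n. abs(u i n) <= B"
 obtains r :: "nat => nat" where "strict_mono r" "!!i. convergent (%n. u i (r n))"
proof -
 interpret subseqs "%i s. convergent (%n. u i (s n))"
 proof
  fix i and s :: "nat => nat" assume "strict_mono s"
  have "ALL n. u i (s n) : {-B..B}" using assms by (auto simp: abs_le_iff minus_le_iff)
  then obtain l r where "strict_mono r" "((%n. u i (s n)) \<circ> r) ----> l"
   using compact_imp_seq_compact[OF compact_Icc, of "-B" B] by (metis seq_compactE)
  thus "EX r'. strict_mono r' & convergent (%n. u i ((s \<circ> r') n))"
   by (auto simp: comp_def convergent_def)
 qed
 have "convergent (%n. u i (diagseq n))" for i
 proof -
  have "convergent (%n. u i ((diagseq \<circ> ((+) (Suc i))) n))"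
  proof (rule diagseq_holds)
   fix n s r assume "strict_mono (r :: nat => nat)" "convergent (%m. u n (s m))"
   thus "convergent (%m. u n ((s \<circ> r) m))"
    using convergent_subseq_convergent[of "%m. u n (s m)" r] by (simp add: comp_def)
  qed
  then obtain L where "(%n. u i (diagseq (n+Suc i))) ----> L" by (auto simp: convergent_def add.commute)
  hence "(%n. u i (diagseq n)) ----> L" by (rule LIMSEQ_offset)
  thus ?thesis by (auto simp: convergent_def)
 qed
 thus thesis using that[OF subseq_diagseq] by blast
qed

text \<open>Arzela-Ascoli in the Wasserstein space. Equicontinuity is asked of single bump integrals
  and up to a vanishing error \<open>err n\<close>, since interpolated random walks jump in time. In
  the last conclusion time and index vary together, which makes the convergence locally
  uniform.\<close>

theorem curve_compactness:
 fixes m :: "nat => real => (real^'d) measure"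
 assumes T: "0 < T" and m: "!!n t. t : {0..T} ==> m n t : ui_set e" and e: "(e \<longlongrightarrow> 0) at_top"
  and equi: "!!j a. EX C err. 0 <= C & err ----> 0 & (ALL n. ALL s:{0..T}. ALL t:{0..T}.
   \<bar>(LINT x|m n t. bump (real (Suc j)) a x)-(LINT x|m n s. bump (real (Suc j)) a x)\<bar> <= C*\<bar>t-s\<bar> + err n)"
 obtains r :: "nat => nat" and l where "strict_mono r" "!!t. t : {0..T} ==> l t : ui_set e" "flow_of_probabilities T l"
  "!!t eps. t : {0..T} ==> 0 < eps ==> EX N dl. 0 < dl & (ALL n>=N. ALL s:{0..T}. abs(s-t) < dl --> W2 (m (r n) s) (l t) < eps)"
proof -
 define b where "b j a mu = (LINT x|mu. bump (real (Suc j)) a x)" for j and a :: "real^'d" and mu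
 obtain D :: "(real^'d) set" where D: "countable D" "!!X. open X ==> X ~= {} ==> EX d:D. d : X"
  using countable_dense_setE by (metis (no_types))
 have dense: "closure D = UNIV"
 proof (rule ccontr)
  assume "closure D ~= UNIV"
  hence "EX d:D. d : - closure D" by (intro D(2)) auto
  thus False using closure_subset[of D] by auto
 qed
 have D_ne: "D ~= {}" using D(2)[of UNIV] by auto
 \<comment> \<open>Countably many real sequences to extract from: bump width, centre in
   \<open>D\<close>, rational time.\<close>
 define I where "I = (UNIV :: nat set) \<times> D \<times> (\<rat> \<inter> {0..T})"
 have I: "countable I" "I ~= {}"
  unfolding I_def using D(1) D_ne T countable_rat by (auto intro!: countable_SIGMA exI[of _ 0])
 have b01: "abs(b j a mu) <= 1" if "mu : P2" for j a mu
 proof -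
  interpret prob_space mu by (rule P2_D[OF that])
  have "integrable mu (bump (real (Suc j)) a)"
   by (intro integrable_const_bound[of _ 1]) (auto simp: bump_range measurable_cong_sets[OF P2_D(2)[OF that] refl])
  hence "b j a mu <= (LINT x|mu. 1)" unfolding b_def by (intro integral_mono) (auto simp: bump_range)
  moreover have "0 <= b j a mu" unfolding b_def by (intro integral_nonneg_AE) (auto simp: bump_range)
  ultimately show ?thesis by (simp add: prob_space)
 qed
 define u where "u i n = (case from_nat_into I i of (j, a, t) => b j a (m n t))" for i n
 have u1: "abs(u i n) <= 1" for i n
 proof -
  obtain j a t where i: "from_nat_into I i = (j, a, t)" by (cases "from_nat_into I i")
  hence "t : {0..T}" using from_nat_into[OF I(2), of i] by (auto simp: I_def)
  thus ?thesis unfolding u_def i using b01[OF ui_setD(1)[OF m]] by simp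
 qed
 obtain r :: "nat => nat" where r: "strict_mono r" and "!!i. convergent (%n. u i (r n))"
  by (rule diagonal_subsequence_real[of u 1, OF u1]) blast
 hence conv_rat: "convergent (%n. b j a (m (r n) t))" if "a : D" "t : \<rat>" "t : {0..T}" for j a t
 proof -
  have "(j, a, t) : I" using that by (auto simp: I_def)
  then obtain i where "from_nat_into I i = (j, a, t)" using from_nat_into_surj[OF I(1)] by blast
  thus ?thesis using `!!i. convergent (%n. u i (r n))`[of i] by (simp add: u_def)
 qed
 have equi': "EX C err. 0 <= C & err ----> 0 & (ALL n. ALL s:{0..T}. ALL t:{0..T}.
   \<bar>b j a (m (r n) t)-b j a (m (r n) s)\<bar> <= C*\<bar>t-s\<bar> + err n)" for j a
 proof -
  obtain C err where "0 <= C" "err ----> 0" and *: "!!n s t. s : {0..T} ==> t : {0..T} ==>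
   \<bar>b j a (m n t)-b j a (m n s)\<bar> <= C*\<bar>t-s\<bar> + err n"
   using equi[of j a] unfolding b_def by blast
  moreover have "(%n. err (r n)) ----> 0"
   using LIMSEQ_subseq_LIMSEQ[OF `err ----> 0` r] by (simp add: comp_def)
  ultimately show ?thesis by (intro exI[of _ C] exI[of _ "%n. err (r n)"]) auto
 qed
 have conv_all: "convergent (%n. b j a (m (r n) t))" if "a : D" "t : {0..T}" for j a t
 proof (rule Cauchy_convergent, rule metric_CauchyI)
  fix eps :: real assume "0 < eps"
  obtain C err where C: "0 <= C" and err: "err ----> 0" and *: "!!n s t. s : {0..T} ==> t : {0..T} ==>
   \<bar>b j a (m (r n) t)-b j a (m (r n) s)\<bar> <= C*\<bar>t-s\<bar> + err n"
   using equi'[of j a] by blast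
  define dl where "dl = eps/(8*(C+1))"
  have dl: "0 < dl" "C*dl <= eps/8" using `0 < eps` C by (auto simp: dl_def field_simps)
  obtain q where q: "q : \<rat>" "q : {0..T}" "abs(t-q) <= dl"
  proof -
   have "max 0 (t-dl) < min T (t+dl)" using `t : {0..T}` dl T by auto
   then obtain q where "q : \<rat>" "max 0 (t-dl) < q" "q < min T (t+dl)" using Rats_dense_in_real by blast
   thus thesis by (intro that[of q]) auto
  qed
  obtain N1 where N1: "!!n. n >= N1 ==> err n < eps/8"
   using order_tendstoD(2)[OF err, of "eps/8"] `0 < eps` by (auto simp: eventually_sequentially)
  obtain N2 where N2: "!!n k. n >= N2 ==> k >= N2 ==> dist (b j a (m (r n) q)) (b j a (m (r k) q)) < eps/4"
   using metric_CauchyD[OF convergent_Cauchy[OF conv_rat[OF `a : D` q(1,2)]], of "eps/4"] `0 < eps` by force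
  have near: "abs(b j a (m (r n) t)-b j a (m (r n) q)) <= eps/4" if "n >= N1" for n
   using *[OF q(2) `t : {0..T}`, of n] N1[OF that] mult_left_mono[OF q(3) C] dl(2) by linarith
  show "EX M. ALL n>=M. ALL k>=M. dist (b j a (m (r n) t)) (b j a (m (r k) t)) < eps"
  proof (intro exI allI impI)
   fix n k assume nk: "max N1 N2 <= n" "max N1 N2 <= k"
   have "abs(b j a (m (r n) q)-b j a (m (r k) q)) < eps/4" using N2[of n k] nk by (simp add: dist_real_def)
   with near[of n] near[of k] nk
   show "dist (b j a (m (r n) t)) (b j a (m (r k) t)) < eps"
    unfolding dist_real_def by linarith
  qed
 qed
 define l where "l t = (SOME mu. mu : ui_set e & (ALL j. ALL a:D. (%n. b j a (m (r n) t)) ----> b j a mu))" for t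
 have l: "l t : ui_set e" "!!j a. a : D ==> (%n. b j a (m (r n) t)) ----> b j a (l t)" if t: "t : {0..T}" for t
 proof -
  obtain s mu where s: "strict_mono s" and mu: "mu : ui_set e" and conv: "(%n. W2 (m (r (s n)) t) mu) ----> 0"
   by (rule ui_set_Skorokhod[OF m[OF t] e, of r])
  have "(%n. b j a (m (r n) t)) ----> b j a mu" if a: "a : D" for j a
  proof -
   obtain L where L: "(%n. b j a (m (r n) t)) ----> L" using conv_all[OF a t] by (auto simp: convergent_def)
   have "(%n. b j a (m (r (s n)) t)) ----> b j a mu"
   proof (rule Lim_null[THEN iffD2], rule Lim_null_comparison)
    show "\<forall>\<^sub>F n in sequentially. norm (b j a (m (r (s n)) t)-b j a mu) <= 6 * sqrt (real (Suc j))*W2 (m (r (s n)) t) mu"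
    proof (intro always_eventually allI)
     fix n
     show "norm (b j a (m (r (s n)) t)-b j a mu) <= 6 * sqrt (real (Suc j))*W2 (m (r (s n)) t) mu"
      unfolding real_norm_def b_def
     proof (rule W2_Lipschitz_integral[OF ui_setD(1)[OF m[OF t]] ui_setD(1)[OF mu]])
      show "abs(bump (real (Suc j)) a x) <= 1" for x using bump_range[of "real (Suc j)" a x] by simp
      show "abs(bump (real (Suc j)) a x-bump (real (Suc j)) a y) <= 6 * sqrt (real (Suc j))*dist x y" for x y
       using bump_Lipschitz[of "real (Suc j)" a x a y] by simp
     qed simp_all
    qed
    show "(%n. 6 * sqrt (real (Suc j))*W2 (m (r (s n)) t) mu) ----> 0"
     by (rule tendsto_mult_right_zero[OF conv])
   qed
   moreover have "(%n. b j a (m (r (s n)) t)) ----> L"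
    using LIMSEQ_subseq_LIMSEQ[OF L s] by (simp add: comp_def)
   ultimately show ?thesis using L LIMSEQ_unique by blast
  qed
  hence "EX mu. mu : ui_set e & (ALL j. ALL a:D. (%n. b j a (m (r n) t)) ----> b j a mu)" using mu by blast
  from someI_ex[OF this] show "l t : ui_set e" "!!j a. a : D ==> (%n. b j a (m (r n) t)) ----> b j a (l t)"
   unfolding l_def by blast+
 qed
 \<comment> \<open>Convergence along moving times and arbitrary indices tending to infinity; it
   gives both the final neighbourhood statement, by contradiction, and the continuity of
   \<open>l\<close>.\<close>
 have moving: "(%i. W2 (m (r (k i)) (s i)) (l t)) ----> 0"
  if k: "filterlim k at_top sequentially" and s: "!!i. s i : {0..T}" "s ----> t" and t: "t : {0..T}" for k :: "nat => nat" and s t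
 proof (rule W2_tendsto_bump[OF m[OF s(1)] e ui_setD(1)[OF l(1)[OF t]] dense, folded b_def])
  fix j a assume a: "a : D"
  obtain C err where C: "0 <= C" and err: "err ----> 0" and *: "!!n s t. s : {0..T} ==> t : {0..T} ==>
   \<bar>b j a (m (r n) t)-b j a (m (r n) s)\<bar> <= C*\<bar>t-s\<bar> + err n"
   using equi'[of j a] by blast
  have "(%i. b j a (m (r (k i)) (s i))-b j a (m (r (k i)) t)) ----> 0"
  proof (rule Lim_null_comparison)
   show "\<forall>\<^sub>F i in sequentially. norm (b j a (m (r (k i)) (s i))-b j a (m (r (k i)) t)) <= C*\<bar>s i-t\<bar> + err (k i)"
    using *[OF t s(1)] by simp
   have "(%i. C*\<bar>s i-t\<bar> + err (k i)) ----> C*\<bar>t-t\<bar> + 0"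
    by (intro tendsto_intros s filterlim_compose[OF err k])
   thus "(%i. C*\<bar>s i-t\<bar> + err (k i)) ----> 0" by simp
  qed
  from tendsto_add[OF this filterlim_compose[OF l(2)[OF t a, of j] k]]
  show "(%i. b j a (m (r (k i)) (s i))) ----> b j a (l t)" by simp
 qed
 show thesis
 proof (rule that[OF r])
  show "l t : ui_set e" if "t : {0..T}" for t by (rule l(1)[OF that])
  show near: "EX N dl. 0 < dl & (ALL n>=N. ALL s:{0..T}. abs(s-t) < dl --> W2 (m (r n) s) (l t) < eps)"
   if t: "t : {0..T}" and "0 < eps" for t eps
  proof (rule ccontr)
   assume "\<not> ?thesis"
   hence "ALL i::nat. EX n s. n >= i & s : {0..T} & abs(s-t) < inverse (real (Suc i)) & eps <= W2 (m (r n) s) (l t)"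
    by (metis not_le inverse_positive_iff_positive of_nat_0_less_iff zero_less_Suc)
   then obtain k s where ks: "!!i. k i >= i" "!!i. s i : {0..T}" "!!i. abs(s i-t) < inverse (real (Suc i))"
    "!!i. eps <= W2 (m (r (k i)) (s i)) (l t)"
    by metis
   have "filterlim k at_top sequentially"
    by (rule filterlim_at_top_mono[OF filterlim_ident]) (simp add: ks(1))
   moreover have "s ----> t"
    by (rule Lim_null[THEN iffD2], rule Lim_null_comparison[OF _ LIMSEQ_inverse_real_of_nat])
     (use ks(3) in \<open>auto intro!: always_eventually less_imp_le\<close>)
   ultimately have "(%i. W2 (m (r (k i)) (s i)) (l t)) ----> 0" using ks(2) t by (intro moving)
   hence "eps <= 0" using ks(4) by (intro LIMSEQ_le_const[of _ 0 eps]) auto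
   thus False using `0 < eps` by simp
  qed
  show "flow_of_probabilities T l"
   unfolding flow_of_probabilities_def P2_topology_def W2.continuous_map_to_metric
  proof (intro ballI allI impI)
   fix t assume "t : topspace (top_of_set {0..T})"
   hence t: "t : {0..T}" by (simp only: topspace_euclidean_subtopology)
   fix eps :: real assume "0 < eps"
   hence eps2: "0 < eps/2" by simp
   obtain N dl where dl: "0 < dl" and N: "!!n s. n >= N ==> s : {0..T} ==> abs(s-t) < dl ==> W2 (m (r n) s) (l t) < eps/2"
    using near[OF t eps2] by blast
   have "W2 (l t) (l s) < eps" if s: "s : {0..T}" "abs(s-t) < dl" for s
   proof -
    have "(%i. W2 (m (r i) s) (l s)) ----> 0"
     using moving[of "%i. i" "%_. s" s] s filterlim_ident by auto
    hence "\<forall>\<^sub>F i in sequentially. W2 (m (r i) s) (l s) < eps/2"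
     using `0 < eps` by (intro order_tendstoD) auto
    then obtain i where i: "i >= N" "W2 (m (r i) s) (l s) < eps/2"
     unfolding eventually_sequentially by (metis nle_le)
    have "W2 (l t) (l s) <= W2 (l t) (m (r i) s)+W2 (m (r i) s) (l s)"
     by (intro W2_triangle ui_setD(1)[OF l(1)] ui_setD(1)[OF m] t s)
    thus ?thesis using i N[OF i(1) s] by (simp add: W2_commute)
   qed
   moreover have "l s : P2" if "s : {0..T}" for s using ui_setD(1)[OF l(1)[OF that]] .
   moreover have "openin (top_of_set {0..T}) ({0..T} \<inter> ball t dl)" by (intro openin_open_Int) simp
   ultimately show "EX U. openin (top_of_set {0..T}) U & t : U & (ALL y:U. l y : W2.mball (l t) eps)"
    using t dl by (intro exI[of _ "{0..T} \<inter> ball t dl"]) (auto simp: dist_real_def abs_minus_commute)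
  qed
 qed
qed

subsection \<open>Conditional expectations take values in convex random sets\<close>

lemma integral_distr_density_weighted:
 fixes w :: "'a::topological_space => real" and v :: "'w => real"
 assumes [measurable]: "Z : borel_measurable Om" "w : borel_measurable borel" "v : borel_measurable Om"
  and "!!om. 0 <= v om"
 shows "(LINT z|distr (density Om v) borel Z. w z) = (LINT om|Om. w (Z om) * v om)"
 by (subst integral_distr) (auto simp: integral_density assms(4) mult.commute)

text \<open>The conditional expectation is obtained as a Borel function of the value of
  \<open>Z\<close>: the Radon-Nikodym density of the law of \<open>Z\<close> under the measure with
  density \<open>v\<close> with respect to the law of \<open>Z\<close> under
  \<open>Om\<close>.\<close>

lemma conditional_expectation_nonneg:
 fixes v :: "'w => real" and Z :: "'w => 'a::topological_space"
 assumes "prob_space Om" and [measurable]: "Z : borel_measurable Om" and v: "integrable Om v" "!!om. 0 <= v om"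
 obtains h :: "'a => real" where "h : borel_measurable borel" "integrable (distr Om borel Z) h"
  "!!w. w : borel_measurable borel ==> (LINT om|Om. w (Z om) * v om) = (LINT z|distr Om borel Z. w z*h z)"
proof -
 interpret prob_space Om by fact
 have [measurable]: "v : borel_measurable Om" using v by auto
 define mu where "mu = distr Om borel Z"
 define N where "N = distr (density Om v) borel Z"
 interpret mu: prob_space mu unfolding mu_def by (rule prob_space_distr) simp
 have N_UNIV: "emeasure N (space N) = (\<integral>\<^sup>+om. v om \<partial>Om)"
  unfolding N_def by (subst emeasure_distr) (auto simp: emeasure_density intro!: nn_integral_cong)
 also have "... < \<infinity>" using v by (auto simp: integrable_iff_bounded)
 finally have fin: "finite_measure N" by (intro finite_measureI) auto
 have ac: "absolutely_continuous mu N"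
  unfolding absolutely_continuous_def
 proof
  fix B assume B: "B : null_sets mu"
  hence [measurable]: "B : sets borel" and "emeasure mu B = 0" by (auto simp: mu_def null_sets_def)
  hence "emeasure Om (Z -` B \<inter> space Om) = 0" unfolding mu_def by (subst (asm) emeasure_distr) auto
  hence "AE om in Om. om ~: Z -` B \<inter> space Om" by (intro AE_I[of _ _ "Z -` B \<inter> space Om"]) auto
  hence "(\<integral>\<^sup>+om. ennreal (v om)*indicator (Z -` B \<inter> space Om) om \<partial>Om) = (\<integral>\<^sup>+om. 0 \<partial>Om)"
   by (intro nn_integral_cong_AE) (auto elim!: eventually_mono)
  hence "emeasure N B = 0"
   unfolding N_def by (subst emeasure_distr) (auto simp: emeasure_density)
  thus "B : null_sets N" by (auto simp: null_sets_def N_def)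
 qed
 obtain D where D[measurable]: "D : borel_measurable mu" and RN: "AE x in mu. RN_deriv mu N x = ennreal (D x)"
  and D0: "!!x. 0 <= D x"
  using mu.real_RN_deriv[OF fin ac] by (auto simp: N_def mu_def)
 have "density mu (RN_deriv mu N) = N" by (rule mu.density_RN_deriv[OF ac]) (auto simp: N_def mu_def)
 moreover have "density mu (RN_deriv mu N) = density mu D" by (rule density_cong) (use RN in auto)
 ultimately have dens: "N = density mu D" by simp
 have Db: "D : borel_measurable borel" using D by (simp add: mu_def)
 have "(\<integral>\<^sup>+x. D x \<partial>mu) = emeasure N (space N)" unfolding dens by (auto simp: emeasure_density intro!: nn_integral_cong)
 also have "... < \<infinity>" using finite_measure.emeasure_finite[OF fin, of "space N"] by (simp add: less_top)
 finally have "integrable mu D" using D0 by (auto simp: integrable_iff_bounded)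
 moreover have "(LINT om|Om. w (Z om) * v om) = (LINT z|mu. w z*D z)" if [measurable]: "w : borel_measurable borel" for w
 proof -
  have "w : borel_measurable mu" by (simp add: mu_def)
  hence "(LINT z|N. w z) = (LINT z|mu. w z*D z)"
   unfolding dens by (subst integral_density) (auto simp: D0 mult.commute)
  thus ?thesis using integral_distr_density_weighted[of Z Om w v] v(2) unfolding N_def by simp
 qed
 ultimately show thesis using that[OF Db] by (simp add: mu_def)
qed

lemma conditional_expectation_real:
 fixes v :: "'w => real" and Z :: "'w => 'a::topological_space"
 assumes "prob_space Om" and [measurable]: "Z : borel_measurable Om" and v: "integrable Om v"
 shows "EX h. h : borel_measurable borel & integrable (distr Om borel Z) h &
  (ALL w B. w : borel_measurable borel --> (ALL z. abs(w z) <= B) -->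
   (LINT om|Om. w (Z om) * v om) = (LINT z|distr Om borel Z. w z*h z))"
proof -
 interpret prob_space Om by fact
 interpret mu: prob_space "distr Om borel Z" by (rule prob_space_distr) simp
 obtain h1 where h1: "h1 : borel_measurable borel" "integrable (distr Om borel Z) h1"
  "!!w. w : borel_measurable borel ==> (LINT om|Om. w (Z om) * max 0 (v om)) = (LINT z|distr Om borel Z. w z*h1 z)"
  using conditional_expectation_nonneg[OF assms(1,2), of "%om. max 0 (v om)"] v by auto
 obtain h2 where h2: "h2 : borel_measurable borel" "integrable (distr Om borel Z) h2"
  "!!w. w : borel_measurable borel ==> (LINT om|Om. w (Z om) * max 0 (- v om)) = (LINT z|distr Om borel Z. w z*h2 z)"
  using conditional_expectation_nonneg[OF assms(1,2), of "%om. max 0 (- v om)"] v by auto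
 have "(LINT om|Om. w (Z om) * v om) = (LINT z|distr Om borel Z. w z*(h1 z-h2 z))"
  if [measurable]: "w : borel_measurable borel" and w: "!!z. abs(w z) <= B" for w B
 proof -
  have iv: "integrable Om (%om. w (Z om)*g om)" if "integrable Om g" for g :: "'w => real"
   by (rule Bochner_Integration.integrable_bound[OF integrable_mult_right[OF that, of B]])
    (use that w in \<open>auto simp: abs_mult intro!: AE_I2 mult_right_mono order_trans[OF w abs_ge_self]\<close>)
  have ih: "integrable (distr Om borel Z) (%z. w z*g z)" if "integrable (distr Om borel Z) g" for g
   by (rule Bochner_Integration.integrable_bound[OF integrable_mult_right[OF that, of B]])
    (use that w in \<open>auto simp: abs_mult intro!: AE_I2 mult_right_mono order_trans[OF w abs_ge_self]\<close>)
  have "(LINT om|Om. w (Z om) * v om) = (LINT om|Om. w (Z om) * max 0 (v om)-w (Z om) * max 0 (- v om))"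
   by (intro Bochner_Integration.integral_cong) (auto simp: max_def)
  also have "... = (LINT om|Om. w (Z om) * max 0 (v om))-(LINT om|Om. w (Z om) * max 0 (- v om))"
   using v by (intro Bochner_Integration.integral_diff iv) auto
  also have "... = (LINT z|distr Om borel Z. w z*h1 z)-(LINT z|distr Om borel Z. w z*h2 z)"
   by (simp add: h1(3) h2(3))
  also have "... = (LINT z|distr Om borel Z. w z*(h1 z-h2 z))"
   using ih[OF h1(2)] ih[OF h2(2)] by (simp add: right_diff_distrib)
  finally show ?thesis .
 qed
 thus ?thesis
  using h1 h2 by (intro exI[of _ "%z. h1 z-h2 z"] conjI) auto
qed

lemma conditional_expectation_vector:
 fixes V :: "'w => 'b::euclidean_space" and Z :: "'w => 'a::topological_space"
 assumes "prob_space Om" and [measurable]: "Z : borel_measurable Om" and V: "integrable Om V"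
 obtains h :: "'a => 'b" where "h : borel_measurable borel" "integrable (distr Om borel Z) h"
  "!!w B. w : borel_measurable borel ==> (!!z. norm (w z) <= B) ==>
   (LINT om|Om. w (Z om) \<bullet> V om) = (LINT z|distr Om borel Z. w z \<bullet> h z)"
proof -
 have "ALL b:Basis. EX h. h : borel_measurable borel & integrable (distr Om borel Z) h &
  (ALL w B. w : borel_measurable borel --> (ALL z. abs(w z) <= B) -->
   (LINT om|Om. w (Z om)*(V om \<bullet> b)) = (LINT z|distr Om borel Z. w z*h z))"
  using V by (intro ballI conditional_expectation_real[OF assms(1,2)] integrable_inner_left) auto
 from bchoice[OF this] obtain g where g: "!!b. b : Basis ==> g b : borel_measurable borel"
  "!!b. b : Basis ==> integrable (distr Om borel Z) (g b)"
  "!!b w B. b : Basis ==> w : borel_measurable borel ==> (ALL z. abs(w z) <= B) ==>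
   (LINT om|Om. w (Z om)*(V om \<bullet> b)) = (LINT z|distr Om borel Z. w z*g b z)"
  by blast
 define h where "h z = (\<Sum>b\<in>Basis. g b z*\<^sub>R b)" for z
 show thesis
 proof
  show hm: "h : borel_measurable borel" unfolding h_def using g(1) by (intro borel_measurable_sum borel_measurable_scaleR) auto
  show "integrable (distr Om borel Z) h" unfolding h_def using g(2) by (intro Bochner_Integration.integrable_sum integrable_scaleR_left) auto
  fix w :: "'a => 'b" and B
  assume [measurable]: "w : borel_measurable borel" and w: "!!z. norm (w z) <= B"
  have B0: "0 <= B" using w[of undefined] norm_ge_zero order_trans by blast
  have wb: "abs(w z \<bullet> b) <= B" if "b : Basis" for z b
   using Basis_le_norm[OF that, of "w z"] w[of z] by linarith
  have iV: "integrable Om (%om. (w (Z om) \<bullet> b)*(V om \<bullet> b))" if b: "b : Basis" for b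
  proof (rule Bochner_Integration.integrable_bound)
   show "integrable Om (%om. B*norm (V om))" using V by (intro integrable_mult_right integrable_norm)
   show "AE om in Om. norm ((w (Z om) \<bullet> b)*(V om \<bullet> b)) <= norm (B*norm (V om))"
   proof (intro AE_I2)
    fix om
    have "\<bar>w (Z om) \<bullet> b\<bar>*\<bar>V om \<bullet> b\<bar> <= B*norm (V om)"
     using wb[OF b, of "Z om"] Basis_le_norm[OF b, of "V om"] by (intro mult_mono) auto
    thus "norm ((w (Z om) \<bullet> b)*(V om \<bullet> b)) <= norm (B*norm (V om))"
     using B0 by (simp add: abs_mult)
   qed
  qed (use V in measurable)
  have ih: "integrable (distr Om borel Z) (%z. (w z \<bullet> b)*g b z)" if b: "b : Basis" for b
  proof (rule Bochner_Integration.integrable_bound)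
   show "integrable (distr Om borel Z) (%z. B*norm (g b z))" using g(2)[OF b] by (intro integrable_mult_right integrable_norm)
   show "AE z in distr Om borel Z. norm ((w z \<bullet> b)*g b z) <= norm (B*norm (g b z))"
   proof (intro AE_I2)
    fix z
    have "\<bar>w z \<bullet> b\<bar>*\<bar>g b z\<bar> <= B*\<bar>g b z\<bar>" using wb[OF b, of z] by (intro mult_right_mono) auto
    thus "norm ((w z \<bullet> b)*g b z) <= norm (B*norm (g b z))"
     using B0 by (simp add: abs_mult)
   qed
  qed (use g(1)[OF b] in measurable)
  have "(LINT om|Om. w (Z om) \<bullet> V om) = (LINT om|Om. (\<Sum>b\<in>Basis. (w (Z om) \<bullet> b)*(V om \<bullet> b)))"
   by (subst euclidean_inner) simp
  also have "... = (\<Sum>b\<in>Basis. LINT om|Om. (w (Z om) \<bullet> b)*(V om \<bullet> b))" by (intro Bochner_Integration.integral_sum iV)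
  also have "... = (\<Sum>b\<in>Basis. LINT z|distr Om borel Z. (w z \<bullet> b)*g b z)"
   using wb by (intro sum.cong refl g(3)[of _ "%z. w z \<bullet> _"]) auto
  also have "... = (LINT z|distr Om borel Z. (\<Sum>b\<in>Basis. (w z \<bullet> b)*g b z))"
   by (intro Bochner_Integration.integral_sum[symmetric] ih)
  also have "(%z. (\<Sum>b\<in>Basis. (w z \<bullet> b)*g b z)) = (%z. w z \<bullet> h z)"
   unfolding h_def by (simp add: inner_sum_right mult.commute)
  finally show "(LINT om|Om. w (Z om) \<bullet> V om) = (LINT z|distr Om borel Z. w z \<bullet> h z)" .
 qed
qed

text \<open>If \<open>h z\<close> left the compact convex slice over \<open>z\<close>, one of countably many half spaces would
 separate it from the slice; the set of \<open>z\<close> whose slice lies in a given open half space is the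
 complement of a projection of a closed set, hence Borel.\<close>

theorem conditional_expectation_convex:
 fixes V :: "'w => 'b::euclidean_space" and Z :: "'w => 'a::euclidean_space" and Gm :: "('a \<times> 'b) set"
 assumes Om: "prob_space Om" and [measurable]: "Z : borel_measurable Om" and V: "integrable Om V"
  and Gm: "closed Gm" "!!z. convex {v. (z, v) : Gm}" "!!z. bounded {v. (z, v) : Gm}"
  and in_Gm: "AE om in Om. (Z om, V om) : Gm"
  and h[measurable]: "h : borel_measurable borel" and int_h: "integrable (distr Om borel Z) h"
  and cond: "!!w B. w : borel_measurable borel ==> (!!z. norm (w z) <= B) ==>
   (LINT om|Om. w (Z om) \<bullet> V om) = (LINT z|distr Om borel Z. w z \<bullet> h z)"
 shows "AE z in distr Om borel Z. (z, h z) : Gm"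
proof -
 interpret prob_space Om by fact
 define mu where "mu = distr Om borel Z"
 interpret mu: prob_space mu unfolding mu_def by (rule prob_space_distr) simp
 have [measurable_cong]: "sets mu = sets borel" by (simp add: mu_def)
 have [measurable]: "V : borel_measurable Om" using V by auto
 obtain D :: "'b set" where D: "countable D" "!!X. open X ==> X ~= {} ==> EX d:D. d : X"
  using countable_dense_setE by (metis (no_types))
 \<comment> \<open>Here an open half space with normal \<open>p\<close> and level \<open>c\<close>
   contains the slice while \<open>h z\<close> lies strictly on the other side; countably many pairs
   will cover all failures.\<close>
 define A where "A p c = {z. (ALL v. (z, v) : Gm --> c < p \<bullet> v) & p \<bullet> h z < c}" for p c
 have A_meas[measurable]: "A p c : sets borel" for p c
 proof -
  define S where "S = Gm \<inter> {y. p \<bullet> snd y <= c}"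
  have "closed S" unfolding S_def by (intro closed_Int Gm closed_Collect_le continuous_intros)
  hence "compact (S \<inter> cball 0 (real n))" for n by (intro closed_Int_compact compact_cball)
  hence "compact (fst ` (S \<inter> cball 0 (real n)))" for n
   by (intro compact_continuous_image continuous_intros)
  hence "fst ` (S \<inter> cball 0 (real n)) : sets borel" for n by (intro borel_closed compact_imp_closed)
  hence "(\<Union>n. fst ` (S \<inter> cball 0 (real n))) : sets borel" by blast
  also have "(\<Union>n. fst ` (S \<inter> cball 0 (real n))) = fst ` S"
  proof
   show "fst ` S \<subseteq> (\<Union>n. fst ` (S \<inter> cball 0 (real n)))"
   proof
    fix z assume "z : fst ` S"
    then obtain y where y: "y : S" "z = fst y" by blast
    obtain n :: nat where "norm y <= real n" using real_arch_simple by blast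
    thus "z : (\<Union>n. fst ` (S \<inter> cball 0 (real n)))"
      using y by (intro UN_I[of n] image_eqI[of _ _ y]) auto
   qed
  qed auto
  finally have [measurable]: "fst ` S : sets borel" .
  have "A p c = - (fst ` S) \<inter> {z. p \<bullet> h z < c}"
   unfolding A_def S_def by (auto simp: image_iff not_le Bex_def)
  moreover have "{z. p \<bullet> h z < c} : sets borel" by measurable
  ultimately show ?thesis by auto
 qed
 \<comment> \<open>Tested with the indicator of \<open>A p c\<close> times \<open>p\<close>,
   \<open>V\<close> and \<open>h\<close> have the same integral along \<open>p\<close> over this
   set. For \<open>V\<close> it is at least c times the mass of the set, whereas the integrand for
   \<open>h\<close> is strictly below c there.\<close>
 have A_null: "AE z in mu. z ~: A p c" for p c
 proof -
  have 1: "(LINT om|Om. (indicator (A p c) (Z om)*\<^sub>R p) \<bullet> V om) = (LINT z|mu. (indicator (A p c) z*\<^sub>R p) \<bullet> h z)"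
   unfolding mu_def by (rule cond[of _ "norm p"]) (auto simp: indicator_def)
  have i1: "integrable Om (%om. (indicator (A p c) (Z om)*\<^sub>R p) \<bullet> V om)"
  proof (rule Bochner_Integration.integrable_bound)
   show "integrable Om (%om. p \<bullet> V om)" using V by (rule integrable_inner_right)
  qed (auto simp: indicator_def)
  have i2: "integrable mu (%z. (indicator (A p c) z*\<^sub>R p) \<bullet> h z)"
  proof (rule Bochner_Integration.integrable_bound)
   show "integrable mu (%z. p \<bullet> h z)" unfolding mu_def using int_h by (rule integrable_inner_right)
  qed (auto simp: indicator_def)
  have j1: "integrable Om (%om. c*indicator (A p c) (Z om))"
   by (intro integrable_const_bound[of _ "abs c"]) (auto simp: indicator_def)
  have j2: "integrable mu (%z. c*indicator (A p c) z)"
   by (intro mu.integrable_const_bound[of _ "abs c"]) (auto simp: indicator_def)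
  have 2: "(LINT om|Om. c*indicator (A p c) (Z om)) = (LINT z|mu. c*indicator (A p c) z)"
   unfolding mu_def by (subst integral_distr) auto
  have "0 <= (LINT om|Om. (indicator (A p c) (Z om)*\<^sub>R p) \<bullet> V om - c*indicator (A p c) (Z om))"
   by (rule integral_nonneg_AE) (use in_Gm in eventually_elim, auto simp: A_def indicator_def less_imp_le)
  also have "... = (LINT z|mu. (indicator (A p c) z*\<^sub>R p) \<bullet> h z - c*indicator (A p c) z)"
   using i1 i2 j1 j2 1 2 by simp
  finally have 3: "(LINT z|mu. c*indicator (A p c) z-(indicator (A p c) z*\<^sub>R p) \<bullet> h z) <= 0"
   using i2 j2 by simp
  have nonneg: "0 <= c*indicator (A p c) z-(indicator (A p c) z*\<^sub>R p) \<bullet> h z" for z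
   by (auto simp: A_def indicator_def)
  have "AE z in mu. c*indicator (A p c) z-(indicator (A p c) z*\<^sub>R p) \<bullet> h z = 0"
  proof -
   let ?q = "%z. c*indicator (A p c) z-(indicator (A p c) z*\<^sub>R p) \<bullet> h z"
   have "(LINT z|mu. ?q z) = 0" using 3 nonneg by (intro antisym integral_nonneg_AE) auto
   moreover have "integrable mu ?q" using i2 j2 by (rule Bochner_Integration.integrable_diff[rotated])
   ultimately show ?thesis using nonneg by (subst (asm) integral_nonneg_eq_0_iff_AE) auto
  qed
  thus ?thesis by eventually_elim (auto simp: A_def indicator_def split: if_splits)
 qed
 have "AE z in mu. ALL p:D. ALL c:\<rat>. z ~: A p c"
  by (subst AE_ball_countable[OF D(1)], intro ballI, subst AE_ball_countable[OF countable_rat])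
   (intro ballI A_null)
 thus ?thesis
  unfolding mu_def[symmetric]
 proof eventually_elim
  case (elim z)
  show ?case
  proof (rule ccontr)
   assume out: "(z, h z) ~: Gm"
   define S where "S = {v. (z, v) : Gm}"
   have "closed S"
   proof -
    have "S = (%v. (z, v)) -` Gm" by (auto simp: S_def)
    thus ?thesis by (simp add: closed_vimage[OF Gm(1)] continuous_intros)
   qed
   then obtain a b where ab: "a \<bullet> h z < b" "!!x. x : S ==> b < a \<bullet> x"
    using separating_hyperplane_closed_point[of S "h z"] Gm(2)[of z] out unfolding S_def by auto
   obtain R where R: "0 < R" "!!x. x : S ==> norm x <= R" "norm (h z) <= R"
   proof -
    obtain R0 where "0 < R0" "!!x. x : S ==> norm x <= R0"
     using Gm(3)[of z] unfolding S_def[symmetric] bounded_pos by blast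
    thus thesis by (intro that[of "max R0 (norm (h z))"]) (auto simp: le_max_iff_disj)
   qed
   define g where "g = b-a \<bullet> h z"
   have g: "0 < g" using ab by (simp add: g_def)
   \<comment> \<open>A normal \<open>p\<close> from the dense set within g/(4*R) of \<open>a\<close>
     changes inner products with vectors of norm at most \<open>R\<close> by at most g/4, so half of
     the gap \<open>g\<close> is left for a rational \<open>c\<close>. This is where the boundedness
     of the slices enters.\<close>
   have "0 < g/(4*R)" using g R(1) by simp
   hence "ball a (g/(4*R)) ~= {}" by simp
   then obtain p where p: "p : D" "dist a p < g/(4*R)" using D(2)[of "ball a (g/(4*R))"] by auto
   have close: "abs(p \<bullet> x-a \<bullet> x) <= g/4" if "norm x <= R" for x
   proof -
    have "abs((p-a) \<bullet> x) <= norm (p-a)*norm x" by (rule Cauchy_Schwarz_ineq2)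
    also have "... <= g/(4*R)*R"
     using p that g R by (intro mult_mono) (auto simp: dist_norm norm_minus_commute)
    also have "... = g/4" using R by simp
    finally show ?thesis by (simp add: inner_diff_left)
   qed
   have b: "b = a \<bullet> h z+g" by (simp add: g_def)
   have "a \<bullet> h z+g/4 < b-g/4" using g unfolding b by simp
   then obtain c where c: "c : \<rat>" "a \<bullet> h z+g/4 < c" "c < b-g/4"
    using Rats_dense_in_real by blast
   have "z : A p c"
    unfolding A_def
   proof (intro CollectI conjI allI impI)
    show "p \<bullet> h z < c" using close[OF R(3)] c by linarith
    fix v assume "(z, v) : Gm"
    hence v: "v : S" by (simp add: S_def)
    show "c < p \<bullet> v" using close[OF R(2)[OF v]] ab(2)[OF v] c by linarith
   qed
   thus False using elim p(1) c(1) by blast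
  qed
 qed
qed

subsection \<open>The joint law of time and position along a curve of measures\<close>

text \<open>Positive and negative parts are integrated separately as extended nonnegative functions;
  their inner integrals are finite for almost every x, and there the Bochner integral is their
  difference.\<close>

lemma integral_bind_kernel:
 fixes f :: "'b => real"
 assumes K: "K : M \<rightarrow>\<^sub>M subprob_algebra B" and f: "integrable (M \<bind> K) f" and [measurable]: "f : borel_measurable B"
 shows "integrable M (%x. LINT y|K x. f y)" "(LINT y|(M \<bind> K). f y) = (LINT x|M. \<integral>y. f y \<partial>K x)"
  "AE x in M. integrable (K x) f"
proof -
 have pos: "(\<integral>\<^sup>+y. ennreal (g y) \<partial>(M \<bind> K)) = (\<integral>\<^sup>+x. \<integral>\<^sup>+y. ennreal (g y) \<partial>K x \<partial>M)"
  if "g : borel_measurable B" for g :: "'b => real"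
  using that by (intro nn_integral_bind[OF _ K]) auto
 have sets_K: "sets (K x) = sets B" if "x : space M" for x
  using measurable_space[OF K that] by (simp add: space_subprob_algebra)
 have intm: "(%x. \<integral>\<^sup>+y. ennreal (g y) \<partial>K x) : borel_measurable M" if "g : borel_measurable B" for g :: "'b => real"
 proof -
  have "(%y. ennreal (g y)) : borel_measurable B" using that by measurable
  from measurable_compose[OF K nn_integral_measurable_subprob_algebra[OF this]] show ?thesis .
 qed
 define P where "P x = (\<integral>\<^sup>+y. ennreal (f y) \<partial>K x)" for x
 define Q where "Q x = (\<integral>\<^sup>+y. ennreal (- f y) \<partial>K x)" for x
 have [measurable]: "P : borel_measurable M" "Q : borel_measurable M"
  unfolding P_def[abs_def] Q_def[abs_def] by (auto intro!: intm)
 have Pfin: "(\<integral>\<^sup>+x. P x \<partial>M) < \<infinity>"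
 proof -
  have "(\<integral>\<^sup>+x. P x \<partial>M) = (\<integral>\<^sup>+y. ennreal (f y) \<partial>(M \<bind> K))" unfolding P_def by (rule pos[symmetric]) measurable
  also have "... < \<infinity>" using f by (auto simp: real_integrable_def less_top)
  finally show ?thesis .
 qed
 have Qfin: "(\<integral>\<^sup>+x. Q x \<partial>M) < \<infinity>"
 proof -
  have "(\<integral>\<^sup>+x. Q x \<partial>M) = (\<integral>\<^sup>+y. ennreal (- f y) \<partial>(M \<bind> K))" unfolding Q_def by (rule pos[symmetric]) measurable
  also have "... < \<infinity>" using f by (auto simp: real_integrable_def less_top)
  finally show ?thesis .
 qed
 have PQ: "AE x in M. P x ~= \<infinity>" "AE x in M. Q x ~= \<infinity>"
  using Pfin Qfin nn_integral_PInf_AE[of P M] nn_integral_PInf_AE[of Q M] by auto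
 show int_AE: "AE x in M. integrable (K x) f"
  using PQ AE_space
 proof eventually_elim
  case (elim x)
  have "f : borel_measurable (K x)"
   using assms(3) elim(3) by (simp add: measurable_cong_sets[OF sets_K refl])
  thus ?case using elim unfolding P_def Q_def real_integrable_def by simp
 qed
 have eq: "AE x in M. (LINT y|K x. f y) = enn2real (P x)-enn2real (Q x)"
  using int_AE by eventually_elim (auto simp: real_lebesgue_integral_def P_def Q_def)
 have iP: "integrable M (%x. enn2real (P x))"
 proof -
  have "(\<integral>\<^sup>+x. ennreal (enn2real (P x)) \<partial>M) = (\<integral>\<^sup>+x. P x \<partial>M)"
   using PQ(1) by (intro nn_integral_cong_AE) (auto elim!: eventually_mono simp: less_top)
  thus ?thesis using Pfin by (auto simp: integrable_iff_bounded)
 qed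
 have iQ: "integrable M (%x. enn2real (Q x))"
 proof -
  have "(\<integral>\<^sup>+x. ennreal (enn2real (Q x)) \<partial>M) = (\<integral>\<^sup>+x. Q x \<partial>M)"
   using PQ(2) by (intro nn_integral_cong_AE) (auto elim!: eventually_mono simp: less_top)
  thus ?thesis using Qfin by (auto simp: integrable_iff_bounded)
 qed
 have meas: "(%x. LINT y|K x. f y) : borel_measurable M"
  by (rule measurable_compose[OF K integral_measurable_subprob_algebra[OF assms(3)]])
 show "integrable M (%x. LINT y|K x. f y)"
  using integrable_cong_AE[OF meas _ eq] iP iQ by auto
 have vP: "(LINT x|M. enn2real (P x)) = enn2real (\<integral>\<^sup>+x. P x \<partial>M)"
  by (subst integral_eq_nn_integral)
   (use PQ(1) in \<open>auto intro!: arg_cong[where f=enn2real] nn_integral_cong_AE elim!: eventually_mono simp: less_top\<close>)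
 have vQ: "(LINT x|M. enn2real (Q x)) = enn2real (\<integral>\<^sup>+x. Q x \<partial>M)"
  by (subst integral_eq_nn_integral)
   (use PQ(2) in \<open>auto intro!: arg_cong[where f=enn2real] nn_integral_cong_AE elim!: eventually_mono simp: less_top\<close>)
 have "(LINT x|M. \<integral>y. f y \<partial>K x) = (LINT x|M. enn2real (P x)-enn2real (Q x))"
  by (rule integral_cong_AE[OF meas _ eq]) measurable
 also have "... = enn2real (\<integral>\<^sup>+x. P x \<partial>M)-enn2real (\<integral>\<^sup>+x. Q x \<partial>M)"
  using iP iQ by (simp add: vP vQ)
 also have "... = (LINT y|(M \<bind> K). f y)"
  using pos[of f] pos[of "%y. - f y"] by (simp add: real_lebesgue_integral_def[OF f] P_def Q_def)
 finally show "(LINT y|(M \<bind> K). f y) = (LINT x|M. \<integral>y. f y \<partial>K x)" by simp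
qed

text \<open>Extends a flow constantly beyond [0,T], so that measurability in time can be stated on
  the whole line.\<close>

definition clamp_time :: "real => real => real" where
 "clamp_time T t = max 0 (min T t)"

definition flow_kernel :: "real => (real => (real^'d) measure) => bool" where
 "flow_kernel T m \<longleftrightarrow> (%t. m (clamp_time T t)) : borel \<rightarrow>\<^sub>M prob_algebra borel"

text \<open>Time is normalised to a probability; hence the factor \<open>T\<close> whenever
  integrals over [0,T] are converted.\<close>

definition flow_law :: "real => (real => (real^'d) measure) => 'd state measure" where
 "flow_law T m = uniform_measure lborel {0..T} \<bind> (%t. distr (m (clamp_time T t)) borel (Pair t))"

lemma clamp_time: "0 <= T ==> clamp_time T t : {0..T}" "t : {0..T} ==> clamp_time T t = t"
 by (auto simp: clamp_time_def)

context
 fixes T :: real and m :: "real => (real^'d) measure"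
 assumes T: "0 < T" and kern: "flow_kernel T m"
begin

lemma flow_kernel_D: "t : {0..T} ==> prob_space (m t)" "t : {0..T} ==> sets (m t) = sets borel"
 using measurable_space[OF kern[unfolded flow_kernel_def], of t] clamp_time(2)[of t T]
 by (auto simp: space_prob_algebra)

lemma flow_kernel_pair:
 "(%t. distr (m (clamp_time T t)) borel (Pair t)) : borel \<rightarrow>\<^sub>M prob_algebra borel"
proof (rule measurable_distr_prob_space2[OF kern[unfolded flow_kernel_def]])
 show "(%(x, y). (x, y)) : borel \<Otimes>\<^sub>M borel \<rightarrow>\<^sub>M (borel :: 'd state measure)"
  by (simp add: borel_prod)
qed

lemma uniform_T: "prob_space (uniform_measure lborel {0..T})"
 using T by (intro prob_space_uniform_measure) auto

lemma flow_kernel_pair': "(%t. distr (m (clamp_time T t)) borel (Pair t)) : uniform_measure lborel {0..T} \<rightarrow>\<^sub>M prob_algebra borel"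
 using flow_kernel_pair by simp

lemma flow_law_prob: "prob_space (flow_law T m)" and flow_law_sets: "sets (flow_law T m) = sets borel"
proof -
 have u: "uniform_measure lborel {0..T} : space (prob_algebra borel)"
  using uniform_T by (auto simp: space_prob_algebra)
 show "prob_space (flow_law T m)" "sets (flow_law T m) = sets borel"
  unfolding flow_law_def by (rule prob_space_bind'[OF u flow_kernel_pair] sets_bind'[OF u flow_kernel_pair])+
qed

lemma Pair_measurable_kernel: "t : {0..T} ==> Pair t : m t \<rightarrow>\<^sub>M borel"
 using measurable_Pair1'[of t borel borel] 
 by (simp add: borel_prod measurable_cong_sets[OF flow_kernel_D(2) refl])

lemma AE_uniform_T: "(AE t in lborel. t : {0..T} --> P t) ==> (AE t in uniform_measure lborel {0..T}. P t)"
 by (rule AE_uniform_measureI) auto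

lemma AE_uniform_T_iff: "(AE t in uniform_measure lborel {0..T}. P t) \<longleftrightarrow> (AE t in lborel. t : {0..T} --> P t)"
 using T by (intro AE_uniform_measure) auto

lemma nn_integral_flow_law:
 assumes [measurable]: "h : borel_measurable borel"
 shows "(\<integral>\<^sup>+z. h z \<partial>flow_law T m) = (\<integral>\<^sup>+t. (\<integral>\<^sup>+x. h (t, x) \<partial>m (clamp_time T t)) \<partial>uniform_measure lborel {0..T})"
proof -
 have "(\<integral>\<^sup>+z. h z \<partial>flow_law T m) =
   (\<integral>\<^sup>+t. (\<integral>\<^sup>+z. h z \<partial>distr (m (clamp_time T t)) borel (Pair t)) \<partial>uniform_measure lborel {0..T})"
  unfolding flow_law_def by (rule nn_integral_bind[OF assms measurable_prob_algebraD[OF flow_kernel_pair']])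
 also have "... = (\<integral>\<^sup>+t. (\<integral>\<^sup>+x. h (t, x) \<partial>m (clamp_time T t)) \<partial>uniform_measure lborel {0..T})"
 proof (intro nn_integral_cong_AE AE_uniform_T AE_I2 impI)
  fix t assume t: "t : {0..T}"
  thus "(\<integral>\<^sup>+z. h z \<partial>distr (m (clamp_time T t)) borel (Pair t)) = (\<integral>\<^sup>+x. h (t, x) \<partial>m (clamp_time T t))"
   unfolding clamp_time(2)[OF t] using assms by (subst nn_integral_distr[OF Pair_measurable_kernel]) auto
 qed
 finally show ?thesis .
qed

lemma nn_integral_flow_law_le:
 assumes "h : borel_measurable borel" and "!!t. t : {0..T} ==> (\<integral>\<^sup>+x. h (t, x) \<partial>m t) <= c"
 shows "(\<integral>\<^sup>+z. h z \<partial>flow_law T m) <= c"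
proof -
 interpret U: prob_space "uniform_measure lborel {0..T}" by (rule uniform_T)
 have "(\<integral>\<^sup>+z. h z \<partial>flow_law T m) <= (\<integral>\<^sup>+t. c \<partial>uniform_measure lborel {0..T})"
  unfolding nn_integral_flow_law[OF assms(1)]
  by (intro nn_integral_mono_AE AE_uniform_T AE_I2 impI) (simp add: assms(2) clamp_time(2))
 also have "... = c" by (simp only: nn_integral_const U.emeasure_space_1 mult_1_right)
 finally show ?thesis .
qed

text \<open>The predicate is arbitrary: it can fail only inside a Borel null set, and it is this set
  that is disintegrated.\<close>

lemma AE_flow_law_D:
 assumes "AE z in flow_law T m. P z"
 shows "AE t in lborel. t : {0..T} --> (AE x in m t. P (t, x))"
proof -
 obtain N where N: "{z : space (flow_law T m). \<not> P z} \<subseteq> N" "emeasure (flow_law T m) N = 0" "N : sets (flow_law T m)"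
  using assms by (auto elim: AE_E)
 have [measurable]: "N : sets borel" using N(3) by (simp add: flow_law_sets)
 have "AE z in flow_law T m. z ~: N" using N by (intro AE_not_in) (auto simp: null_sets_def)
 hence "AE t in uniform_measure lborel {0..T}. AE z in distr (m (clamp_time T t)) borel (Pair t). z ~: N"
  unfolding flow_law_def
  by (subst (asm) AE_bind[OF measurable_prob_algebraD[OF flow_kernel_pair']]) measurable
 hence "AE t in lborel. t : {0..T} --> (AE z in distr (m (clamp_time T t)) borel (Pair t). z ~: N)"
  unfolding AE_uniform_T_iff .
 thus ?thesis
 proof eventually_elim
  case (elim t)
  show ?case
  proof
   assume t: "t : {0..T}"
   hence "AE z in distr (m t) borel (Pair t). z ~: N" using elim unfolding clamp_time(2)[OF t] by blast
   hence "AE x in m t. (t, x) ~: N" by (rule AE_distrD[OF Pair_measurable_kernel[OF t]])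
   thus "AE x in m t. P (t, x)"
   proof eventually_elim
    case (elim x)
    have "space (flow_law T m) = UNIV" using sets_eq_imp_space_eq[OF flow_law_sets] by simp
    thus ?case using elim N(1) by auto
   qed
  qed
 qed
qed

lemma AE_flow_law_I:
 assumes P: "{z. P z} : sets borel" and ae: "AE t in lborel. t : {0..T} --> (AE x in m t. P (t, x))"
 shows "AE z in flow_law T m. P z"
proof -
 have P': "Measurable.pred borel P" using P by (simp add: pred_def)
 show ?thesis
  unfolding flow_law_def
 proof (subst AE_bind[OF measurable_prob_algebraD[OF flow_kernel_pair'] P'], rule AE_uniform_T)
  show "AE t in lborel. t : {0..T} --> (AE z in distr (m (clamp_time T t)) borel (Pair t). P z)"
   using ae
  proof eventually_elim
   case (elim t)
   show ?case
   proof
    assume t: "t : {0..T}"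
    hence "AE x in m t. P (t, x)" using elim by blast
    thus "AE z in distr (m (clamp_time T t)) borel (Pair t). P z"
     unfolding clamp_time(2)[OF t] using P by (subst AE_distr_iff[OF Pair_measurable_kernel[OF t]]) auto
   qed
  qed
 qed
qed

lemma AE_flow_law_time: "AE z in flow_law T m. fst z : {0..T}"
proof (rule AE_flow_law_I)
 have "closed {z :: 'd state. fst z : {0..T}}"
  by (intro closed_vimage[OF closed_atLeastAtMost, unfolded vimage_def] continuous_intros)
 thus "{z :: 'd state. fst z : {0..T}} : sets borel" by simp
qed simp

lemma integral_uniform_T:
 fixes g :: "real => real"
 assumes "g : borel_measurable borel"
 shows "(LINT t|uniform_measure lborel {0..T}. g t) = (LBINT t:{0..T}. g t)/T"
proof -
 have "uniform_measure lborel {0..T} = density lborel (%t. ennreal (indicator {0..T} t/T))"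
  unfolding uniform_measure_def using T
  by (intro density_cong) (auto simp: indicator_def divide_ennreal[symmetric])
 thus ?thesis
  using T assms by (subst `uniform_measure lborel {0..T} = _`, subst integral_density)
   (auto simp: set_lebesgue_integral_def)
qed

lemma integral_flow_law:
 fixes h :: "('d::finite) state => real"
 assumes int: "integrable (flow_law T m) h"
 shows "(LBINT t:{0..T}. LINT x|m t. h (t, x)) = T*(LINT z|flow_law T m. h z)"
  "set_integrable lborel {0..T} (%t. LINT x|m t. h (t, x))"
  "AE t in lborel. t : {0..T} --> integrable (m t) (%x. h (t, x))"
proof -
 have hm[measurable]: "h : borel_measurable borel" using int by (auto simp: measurable_cong_sets[OF flow_law_sets refl])
 note K = measurable_prob_algebraD[OF flow_kernel_pair']
 note B = integral_bind_kernel[OF K int[unfolded flow_law_def] hm]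
 define g where "g t = (LINT z|distr (m (clamp_time T t)) borel (Pair t). h z)" for t
 have gm: "g : borel_measurable borel"
  unfolding g_def
  by (rule measurable_compose[OF measurable_prob_algebraD[OF flow_kernel_pair]]) (rule integral_measurable_subprob_algebra[OF hm])
 have g_eq: "g t = (LINT x|m t. h (t, x))" if t: "t : {0..T}" for t
  unfolding g_def clamp_time(2)[OF t] by (rule integral_distr[OF Pair_measurable_kernel[OF t] hm])
 have "(LINT z|flow_law T m. h z) = (LBINT t:{0..T}. g t)/T"
  unfolding flow_law_def B(2) g_def[symmetric] by (rule integral_uniform_T[OF gm])
 also have "(LBINT t:{0..T}. g t) = (LBINT t:{0..T}. LINT x|m t. h (t, x))"
  by (rule set_lebesgue_integral_cong) (auto simp: g_eq)
 finally show "(LBINT t:{0..T}. LINT x|m t. h (t, x)) = T*(LINT z|flow_law T m. h z)" using T by simp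
 have "integrable (uniform_measure lborel {0..T}) g" using B(1) unfolding g_def .
 moreover have "uniform_measure lborel {0..T} = density lborel (%t. ennreal (indicator {0..T} t/T))"
  unfolding uniform_measure_def using T
  by (intro density_cong) (auto simp: indicator_def divide_ennreal[symmetric])
 ultimately have "integrable lborel (%t. (indicator {0..T} t/T)*\<^sub>R g t)"
  using T gm by (subst (asm) `uniform_measure lborel {0..T} = _`, subst (asm) integrable_density) auto
 hence "integrable lborel (%t. T*((indicator {0..T} t/T)*\<^sub>R g t))" by (rule integrable_mult_right)
 hence "set_integrable lborel {0..T} g" unfolding set_integrable_def using T by simp
 thus "set_integrable lborel {0..T} (%t. LINT x|m t. h (t, x))"
  by (rule set_integrable_cong[THEN iffD1, rotated -1]) (auto simp: g_eq)
 have "AE t in lborel. t : {0..T} --> integrable (distr (m (clamp_time T t)) borel (Pair t)) h"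
  using B(3) unfolding AE_uniform_T_iff .
 thus "AE t in lborel. t : {0..T} --> integrable (m t) (%x. h (t, x))"
  by eventually_elim (auto simp: clamp_time(2) integrable_distr_eq[OF Pair_measurable_kernel])
qed

end

lemma flow_of_probabilities_D:
 assumes "flow_of_probabilities T m"
 shows "t : {0..T} ==> m t : P2"
  "(!!n. s n : {0..T}) ==> t : {0..T} ==> s ----> t ==> (%n. W2 (m (s n)) (m t)) ----> 0"
proof -
 show "m t : P2" if "t : {0..T}"
  using continuous_map_image_subset_topspace[OF assms[unfolded flow_of_probabilities_def]] that by auto
 assume s: "!!n. s n : {0..T}" "t : {0..T}" "s ----> t"
 hence "limitin (top_of_set {0..T}) s t sequentially" by (auto simp: limitin_subtopology)
 from continuous_map_limit[OF assms[unfolded flow_of_probabilities_def] this]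
 show "(%n. W2 (m (s n)) (m t)) ----> 0" by (simp add: limitin_P2_topology comp_def)
qed

lemma continuous_on_flow_integral:
 fixes f :: "real^'d => real"
 assumes m: "flow_of_probabilities T m" and f: "f : borel_measurable borel" "!!x. abs(f x) <= B"
  and lip: "!!x y. abs(f x-f y) <= L*dist x y" "0 <= L"
 shows "continuous_on {0..T} (%t. LINT x|m t. f x)"
proof (rule continuous_on_sequentiallyI)
 fix s t assume s: "ALL n. s n : {0..T}" "t : {0..T}" "s ----> t"
 show "(%n. LINT x|m (s n). f x) ----> (LINT x|m t. f x)"
 proof (rule Lim_null[THEN iffD2], rule Lim_null_comparison)
  show "\<forall>\<^sub>F n in sequentially. norm ((LINT x|m (s n). f x)-(LINT x|m t. f x)) <= L*W2 (m (s n)) (m t)"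
   unfolding real_norm_def using s
   by (intro always_eventually allI W2_Lipschitz_integral[OF _ _ f lip] flow_of_probabilities_D(1)[OF m]) auto
  show "(%n. L*W2 (m (s n)) (m t)) ----> 0"
   using s by (intro tendsto_mult_right_zero flow_of_probabilities_D(2)[OF m]) auto
 qed
qed

lemma flow_of_probabilities_kernel:
 assumes T: "0 < T" and m: "flow_of_probabilities T m"
 shows "flow_kernel T m"
 unfolding flow_kernel_def
proof (rule measurable_prob_algebra_Lipschitz)
 note P = flow_of_probabilities_D(1)[OF m clamp_time(1)[OF less_imp_le[OF T]]]
 show "prob_space (m (clamp_time T t))" "sets (m (clamp_time T t)) = sets borel" for t
  by (rule P2_D[OF P])+
 fix phi :: "real^'a => real" and L
 assume phi: "continuous_on UNIV phi" "!!x. 0 <= phi x & phi x <= 1" "!!x y. abs(phi x-phi y) <= L*dist x y" "0 <= L"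
 have "continuous_on {0..T} (%t. LINT x|m t. phi x)"
 proof (rule continuous_on_flow_integral[OF m _ _ phi(3,4)])
  show "phi : borel_measurable borel" by (rule borel_measurable_continuous_onI[OF phi(1)])
  show "abs(phi x) <= 1" for x using phi(2)[of x] by auto
 qed
 hence "continuous_on UNIV (%t. LINT x|m (clamp_time T t). phi x)"
 proof (rule continuous_on_compose2)
  show "continuous_on UNIV (clamp_time T)" unfolding clamp_time_def by (intro continuous_intros)
  show "clamp_time T ` UNIV \<subseteq> {0..T}" using clamp_time(1) T by auto
 qed
 thus "(%t. LINT x|m (clamp_time T t). phi x) : borel_measurable borel"
  by (rule borel_measurable_continuous_onI)
qed

subsection \<open>Test functions and semicontinuity\<close>

lemma matrix_transpose_inner:
 fixes H S :: "real^'d^'d"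
 shows "transpose H \<bullet> S = trace (H ** S)"
proof -
 have "transpose H \<bullet> S = (\<Sum>i\<in>UNIV. \<Sum>j\<in>UNIV. H $ j $ i*S $ i $ j)"
  by (simp add: inner_vec_def transpose_def)
 also have "... = (\<Sum>j\<in>UNIV. \<Sum>i\<in>UNIV. H $ j $ i*S $ i $ j)" by (rule sum.swap)
 also have "... = trace (H ** S)" by (simp add: trace_def matrix_matrix_mult_def)
 finally show ?thesis .
qed

lemma continuous_on_transpose [continuous_intros]:
 fixes f :: "'a::topological_space => real^'n^'m"
 assumes "continuous_on S f"
 shows "continuous_on S (%x. transpose (f x))"
 unfolding transpose_def by (intro continuous_intros assms)

lemma closed_sym_psd: "closed (sym_psd :: (real^'d^'d) set)"
proof -
 have eq: "sym_psd = {A :: real^'d^'d. transpose A = A} \<inter> (\<Inter>v. {A. 0 <= v \<bullet> (A *v v)})"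
  by (auto simp: sym_psd_def)
 have 1: "closed {A :: real^'d^'d. transpose A = A}"
  by (intro closed_Collect_eq continuous_intros)
 have 2: "closed {A :: real^'d^'d. 0 <= v \<bullet> (A *v v)}" for v
  unfolding matrix_vector_mult_def by (intro closed_Collect_le continuous_intros)
 show ?thesis unfolding eq by (intro closed_Int closed_INT ballI 1 2)
qed

lemma zero_sym_psd: "0 : sym_psd" by (simp add: sym_psd_def transpose_def vec_eq_iff)

lemma lower_semicontinuous_map_eventually:
 assumes "lower_semicontinuous_map X f" "limitin X z l F" "a < f l"
 shows "\<forall>\<^sub>F n in F. a < f (z n)"
proof -
 have "openin X {z : topspace X. a < f z}" using assms(1) by (simp add: lower_semicontinuous_map_def)
 moreover have "l : {z : topspace X. a < f z}" using assms(2,3) limitin_topspace by fastforce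
 ultimately have "\<forall>\<^sub>F n in F. z n : {z : topspace X. a < f z}" using assms(2) unfolding limitin_def by blast
 thus ?thesis by eventually_elim simp
qed

lemma limitin_top_of_set:
 "(!!n. f n : S) ==> l : S ==> (f \<longlongrightarrow> l) F ==> limitin (top_of_set S) f l F"
 by (simp add: limitin_subtopology)

text \<open>Test functions have prescribed values only for 0 < t < T; extension by zero turns them
  and their derivatives into functions on the whole space.\<close>

definition slab :: "real => (real => 'a => 'b::zero) => real \<times> 'a => 'b" where
 "slab T h z = (if fst z : {0<..<T} then h (fst z) (snd z) else 0)"

lemma continuous_on_slab:
 fixes h :: "real => 'a::t2_space => 'b::real_normed_vector"
 assumes "continuous_on ({0<..<T} \<times> UNIV) (%(t, x). h t x)" and K: "compact K"
  and zero: "!!t x. t : {0<..<T} ==> (t, x) ~: K ==> h t x = 0"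
  and sub: "K \<subseteq> {0<..<T} \<times> UNIV"
 shows "continuous_on UNIV (slab T h)" "!!z. z ~: K ==> slab T h z = 0"
  "EX B>=0. ALL z. norm (slab T h z) <= B"
proof -
 have out: "slab T h z = 0" if "z ~: K" for z
  using zero[of "fst z" "snd z"] that by (auto simp: slab_def)
 show "!!z. z ~: K ==> slab T h z = 0" by (rule out)
 have 1: "continuous_on ({0<..<T} \<times> UNIV) (slab T h)"
  using assms(1) by (rule continuous_on_eq) (auto simp: slab_def)
 have 2: "continuous_on (- K) (slab T h)"
  by (rule continuous_on_eq[of _ "%_. 0"]) (auto simp: out)
 have "continuous_on (({0<..<T} \<times> UNIV) \<union> - K) (slab T h)"
  by (rule continuous_on_open_Un[OF _ _ 1 2])
   (auto intro!: open_Times compact_imp_closed K simp: open_Compl[OF compact_imp_closed[OF K]])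
 moreover have "({0<..<T} \<times> UNIV) \<union> - K = UNIV" using sub by auto
 ultimately show c: "continuous_on UNIV (slab T h)" by simp
 have "bounded (slab T h ` K)"
  by (intro compact_imp_bounded compact_continuous_image K continuous_on_subset[OF c]) auto
 then obtain B where "0 < B" "!!z. z : K ==> norm (slab T h z) <= B" by (auto simp: bounded_pos)
 thus "EX B>=0. ALL z. norm (slab T h z) <= B"
  using out by (intro exI[of _ B]) (metis less_imp_le norm_zero)
qed

text \<open>Compact support is assumed of \<open>phi\<close> alone. Off \<open>K\<close> it vanishes
  locally, in time as well as in space, so its derivatives vanish there too and the extensions by
  zero are continuous and bounded.\<close>

lemma test_function_ext:
 fixes g :: "real => real^'d => real^'d"
 assumes tf: "test_function T phi phit g H"
 shows "continuous_on UNIV (slab T phit)" "continuous_on UNIV (slab T g)" "continuous_on UNIV (slab T H)"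
  "EX K. compact K & (ALL z. z ~: K --> slab T phit z = 0 & slab T g z = 0 & slab T H z = 0)"
  "EX B>=0. ALL z. abs(slab T phit z) <= B & norm (slab T g z) <= B & norm (slab T H z) <= B"
proof -
 have D: "((%s. phi s x) has_real_derivative phit t x) (at t)" "GDERIV (phi t) x :> g t x"
  "(g t has_derivative (%h. H t x *v h)) (at x)" if "t : {0<..<T}" for t x
  using tf that unfolding test_function_def by blast+
 have C: "continuous_on ({0<..<T} \<times> UNIV) (%(t, x). phit t x)"
  "continuous_on ({0<..<T} \<times> UNIV) (%(t, x). g t x)"
  "continuous_on ({0<..<T} \<times> UNIV) (%(t, x). H t x)"
  using tf unfolding test_function_def by blast+
 obtain K where K: "compact K" "K \<subseteq> {0<..<T} \<times> UNIV"
  and phi0: "!!t x. t : {0<..<T} ==> (t, x) ~: K ==> phi t x = 0"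
  using tf unfolding test_function_def by blast
 have oK: "open (- K)" using K(1) by (simp add: open_Compl compact_imp_closed)
 have near_t: "\<forall>\<^sub>F s in nhds t. (s, x) ~: K & s : {0<..<T}" if "t : {0<..<T}" "(t, x) ~: K" for t x
 proof -
  have "open ((%s. (s, x)) -` (- K) \<inter> {0<..<T})"
   by (intro open_Int open_vimage[OF oK] continuous_intros)
  thus ?thesis using that by (auto simp: eventually_nhds intro!: exI[of _ "(%s. (s, x)) -` (- K) \<inter> {0<..<T}"])
 qed
 have near_x: "\<forall>\<^sub>F y in nhds x. (t, y) ~: K" if "(t, x) ~: K" for t x
 proof -
  have "open ((%y. (t, y)) -` (- K))" by (intro open_vimage[OF oK] continuous_intros)
  thus ?thesis using that by (auto simp: eventually_nhds intro!: exI[of _ "(%y. (t, y)) -` (- K)"])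
 qed
 have phit0: "phit t x = 0" if t: "t : {0<..<T}" "(t, x) ~: K" for t x
 proof -
  have "\<forall>\<^sub>F s in nhds t. phi s x = 0" using near_t[OF t] by eventually_elim (simp add: phi0)
  hence "((%s. phi s x) has_real_derivative phit t x) (at t) \<longleftrightarrow> ((%s. 0) has_real_derivative phit t x) (at t)"
   by (intro DERIV_cong_ev) auto
  thus ?thesis using D(1)[OF t(1)] DERIV_unique[OF _ DERIV_const] by blast
 qed
 have g0: "g t x = 0" if t: "t : {0<..<T}" "(t, x) ~: K" for t x
 proof -
  have "\<forall>\<^sub>F y in nhds x. phi t y = 0" using near_x[OF t(2)] by eventually_elim (rule phi0[OF t(1)])
  hence ev: "\<forall>\<^sub>F y in at x. phi t y = 0" "phi t x = 0"
   using eventually_nhds_x_imp_x by (auto simp: eventually_at_filter elim: eventually_mono)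
  have "(phi t has_derivative (%h. h \<bullet> g t x)) (at x)" using D(2)[OF t(1)] by (simp add: gderiv_def inner_commute)
  hence "((%y. 0) has_derivative (%h. h \<bullet> g t x)) (at x)"
   using ev by (rule has_derivative_transform_eventually) auto
  hence "(%h. h \<bullet> g t x) = (%h. 0)"
   using has_derivative_unique[OF _ has_derivative_const] by blast
  hence "g t x \<bullet> g t x = 0" by meson
  thus ?thesis by simp
 qed
 have H0: "H t x = 0" if t: "t : {0<..<T}" "(t, x) ~: K" for t x
 proof -
  have "\<forall>\<^sub>F y in nhds x. g t y = 0" using near_x[OF t(2)] by eventually_elim (rule g0[OF t(1)])
  hence ev: "\<forall>\<^sub>F y in at x. g t y = 0" "g t x = 0"
   using eventually_nhds_x_imp_x by (auto simp: eventually_at_filter elim: eventually_mono)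
  have "((%y. 0) has_derivative (%h. H t x *v h)) (at x)"
   using D(3)[OF t(1)] ev by (rule has_derivative_transform_eventually) auto
  hence "(%h. H t x *v h) = (%h. 0)"
   using has_derivative_unique[OF _ has_derivative_const] by blast
  hence "H t x *v h = 0 *v h" for h by (simp add: fun_eq_iff)
  thus ?thesis using matrix_eq by blast
 qed
 note E2 = continuous_on_slab[OF C(1) K(1) phit0 K(2)]
 note E3 = continuous_on_slab[OF C(2) K(1) g0 K(2)]
 note E4 = continuous_on_slab[OF C(3) K(1) H0 K(2)]
 show "continuous_on UNIV (slab T phit)" "continuous_on UNIV (slab T g)" "continuous_on UNIV (slab T H)"
  using E2(1) E3(1) E4(1) by simp_all
 show "EX K. compact K & (ALL z. z ~: K --> slab T phit z = 0 & slab T g z = 0 & slab T H z = 0)"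
  using K(1) E2(2) E3(2) E4(2) by blast
 obtain B2 B3 B4 where B: "0 <= B2" "ALL z. norm (slab T phit z) <= B2"
  "0 <= B3" "ALL z. norm (slab T g z) <= B3" "0 <= B4" "ALL z. norm (slab T H z) <= B4"
  using E2(3) E3(3) E4(3) by metis
 have "abs(slab T phit z) <= B2+B3+B4 & norm (slab T g z) <= B2+B3+B4 & norm (slab T H z) <= B2+B3+B4" for z
  using B(2,4,6)[rule_format, of z] B(1,3,5) by simp
 thus "EX B>=0. ALL z. abs(slab T phit z) <= B & norm (slab T g z) <= B & norm (slab T H z) <= B"
  using B(1,3,5) by (intro exI[of _ "B2+B3+B4"]) simp
qed

section \<open>The integrand of the Fokker-Planck equation as a function of the control\<close>

definition fp_integrand :: "real => (real => real^'d => real) => (real => real^'d => real^'d) =>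
  (real => real^'d => real^'d^'d) => 'd state => 'd control => real" where
 "fp_integrand T phit g H z u = slab T phit z+slab T g z \<bullet> fst u+(1/2)*trace (slab T H z ** snd u)"

text \<open>Displays the integrand as affine in the control: the form in which the conditional
  expectation of the control can be inserted.\<close>

lemma fp_integrand_inner:
 "fp_integrand T phit g H z u = slab T phit z+(slab T g z, (1/2)*\<^sub>R transpose (slab T H z)) \<bullet> u"
 by (simp add: fp_integrand_def inner_prod_def matrix_transpose_inner[symmetric])

definition generator :: "real^'d => real^'d^'d => real^'d => real^'d^'d => real" where
 "generator p H be Sg = p \<bullet> be+(1/2)*trace (H ** Sg)"

lemma generator_bound: "abs(generator p H be Sg) <= norm p*norm be+norm (transpose H)*norm Sg/2"
 using Cauchy_Schwarz_ineq2[of p be] Cauchy_Schwarz_ineq2[of "transpose H" Sg]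
 unfolding generator_def matrix_transpose_inner[symmetric] by (simp add: abs_le_iff)

lemma norm_transpose: "norm (transpose H) = norm (H :: real^'d^'d)"
proof -
 have "transpose H \<bullet> transpose H = H \<bullet> H"
  unfolding inner_vec_def transpose_def by (simp, subst sum.swap) simp
 thus ?thesis by (simp add: norm_eq_sqrt_inner)
qed

lemma fp_integrand_generator:
 "fp_integrand T phit g H z u = slab T phit z+generator (slab T g z) (slab T H z) (fst u) (snd u)"
 by (simp add: fp_integrand_def generator_def)

lemma fp_integrand_measurable:
 assumes "test_function T phi phit g H"
 shows "(%y. fp_integrand T phit g H (fst y) (snd y)) : borel_measurable borel"
 unfolding fp_integrand_inner
 by (intro borel_measurable_continuous_onI continuous_intros test_function_ext(1-3)[OF assms, THEN continuous_on_compose2])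
  auto

text \<open>The control may grow quadratically in x, but the coefficients vanish off a compact
  set.\<close>

lemma fp_integrand_bounded:
 assumes tf: "test_function T phi phit g H" and K: "0 <= K"
 shows "EX D. ALL z v. norm v <= K*(1+(norm (snd z))^2) --> abs(fp_integrand T phit g H z v) <= D"
proof -
 obtain X where X: "compact X" and out: "!!z. z ~: X ==> slab T phit z = 0 & slab T g z = 0 & slab T H z = 0"
  using test_function_ext(4)[OF tf] by blast
 obtain B where B: "0 <= B" and bd: "!!z. abs(slab T phit z) <= B & norm (slab T g z) <= B & norm (slab T H z) <= B"
  using test_function_ext(5)[OF tf] by blast
 obtain R where R: "0 < R" "!!z. z : X ==> norm z <= R" using compact_imp_bounded[OF X] by (auto simp: bounded_pos)
 define Y where "Y = B*(K*(1+R^2))"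
 have "abs(fp_integrand T phit g H z v) <= B+(Y+Y/2)" if v: "norm v <= K*(1+(norm (snd z))^2)" for z v
 proof (cases "z : X")
  case True
  have "norm (snd z) <= R" using norm_snd_le[of "snd z" "fst z"] R(2)[OF True] by simp
  hence "(norm (snd z))^2 <= R^2" by (intro power_mono) auto
  hence "K*(1+(norm (snd z))^2) <= K*(1+R^2)" using K by (intro mult_left_mono) auto
  hence "norm (fst v) <= K*(1+R^2)" "norm (snd v) <= K*(1+R^2)"
   using v norm_fst_le[of "fst v" "snd v"] norm_snd_le[of "snd v" "fst v"] by simp_all
  hence "norm (slab T g z)*norm (fst v) <= Y" "norm (transpose (slab T H z))*norm (snd v) <= Y"
   unfolding Y_def using B bd[of z] by (auto simp: norm_transpose intro!: mult_mono)
  hence "abs(generator (slab T g z) (slab T H z) (fst v) (snd v)) <= Y+Y/2"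
   using generator_bound[of "slab T g z" "slab T H z" "fst v" "snd v"] by linarith
  thus ?thesis unfolding fp_integrand_generator using bd[of z] by linarith
 next
  case False
  have "0 <= Y" using B K by (simp add: Y_def)
  thus ?thesis using out[OF False] B by (simp add: fp_integrand_generator generator_def trace_def matrix_matrix_mult_def)
 qed
 thus ?thesis by blast
qed

lemma fp_integrand_integrable:
 assumes tf: "test_function T phi phit g H" and T: "0 < T" and kern: "flow_kernel T m" and c: "c : borel_measurable borel"
  and K: "0 <= K" "AE z in flow_law T m. norm (c z) <= K*(1+(norm (snd z))^2)"
 shows "integrable (flow_law T m) (%z. fp_integrand T phit g H z (c z))"
  "(%z. fp_integrand T phit g H z (c z)) : borel_measurable borel"
proof -
 interpret L: prob_space "flow_law T m" by (rule flow_law_prob[OF T kern])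
 have pm: "(%z. (z, c z)) : borel \<rightarrow>\<^sub>M borel" using c by (intro borel_measurable_Pair) auto
 show m: "(%z. fp_integrand T phit g H z (c z)) : borel_measurable borel"
  using measurable_compose[OF pm fp_integrand_measurable[OF tf]] by simp
 obtain D where D: "!!z v. norm v <= K*(1+(norm (snd z))^2) ==> abs(fp_integrand T phit g H z v) <= D"
  using fp_integrand_bounded[OF tf K(1)] by blast
 have "AE z in flow_law T m. norm (fp_integrand T phit g H z (c z)) <= D"
  using K(2) by eventually_elim (simp add: D)
 thus "integrable (flow_law T m) (%z. fp_integrand T phit g H z (c z))"
  using m by (intro L.integrable_const_bound) (auto simp: measurable_cong_sets[OF flow_law_sets[OF T kern] refl])
qed

lemma fokker_planck_flow_law:
 fixes m :: "real => (real^'d) measure"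
 assumes T: "0 < T" and kern: "flow_kernel T m"
  and int: "integrable (flow_law T m) (%z. fp_integrand T phit g H z (b z, A z))"
 shows "(LBINT t:{0..T}. LINT x|m t. phit t x+g t x \<bullet> b (t, x)+(1/2)*trace (H t x ** A (t, x))) =
  T*(LINT z|flow_law T m. fp_integrand T phit g H z (b z, A z))"
proof -
 note I = integral_flow_law[OF T kern int]
 have "(LBINT t:{0..T}. LINT x|m t. phit t x+g t x \<bullet> b (t, x)+(1/2)*trace (H t x ** A (t, x))) =
  (LBINT t:{0..T}. LINT x|m t. fp_integrand T phit g H (t, x) (b (t, x), A (t, x)))"
  unfolding set_lebesgue_integral_def
 proof (rule integral_cong_AE)
  let ?h = "%t. indicator {0..T} t*\<^sub>R (LINT x|m t. fp_integrand T phit g H (t, x) (b (t, x), A (t, x)))"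
  let ?h' = "%t. indicator {0..T} t*\<^sub>R (LINT x|m t. phit t x+g t x \<bullet> b (t, x)+(1/2)*trace (H t x ** A (t, x)))"
  \<comment> \<open>At t = 0 and t = T the extension by zero may differ from the given functions;
    two times form a null set.\<close>
  have eq: "?h' t = ?h t" if "t ~= 0" "t ~= T" for t
   using that by (cases "t : {0..T}") (auto simp: fp_integrand_def slab_def)
  show m1: "?h : borel_measurable lborel" using I(2) by (auto simp: set_integrable_def)
  have "{t : space lborel. ?h' t ~= ?h t} \<subseteq> {0, T}" using eq by auto
  thus "?h' : borel_measurable lborel"
   using m1 by (intro measurable_discrete_difference[OF m1, of "{0, T}"]) (use eq in force)+
  show "AE t in lborel. ?h' t = ?h t"
   using AE_lborel_singleton[of 0] AE_lborel_singleton[of T] by eventually_elim (rule eq)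
 qed
 thus ?thesis using I(1) by simp
qed

lemma le_one_plus_square: "a <= 1+(a::real)^2"
proof -
 have "0 <= (a-1/2)^2" by simp
 thus ?thesis by (simp add: power2_eq_square algebra_simps)
qed

lemma norm_prod_le: "norm u <= norm (fst u)+norm (snd u)"
 by (simp add: norm_prod_def sqrt_sum_squares_le_sum)

text \<open>The hypotheses on \<open>F\<close> alone: a priori estimates and random walks take place
  here, before any cost enters.\<close>

locale dynamics =
 fixes T C_b C_A :: real
  and F :: "real => real^'d => (real^'d) measure => 'd control set"
 assumes T_pos: "T > 0"
  and F_range: "!!t x m. t : {0..T} ==> m : P2 ==> F t x m \<subseteq> UNIV \<times> sym_psd"
  and F_usc: "upper_semicontinuous_multimap
    (prod_topology (top_of_set {0..T}) (prod_topology euclidean P2_topology))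
    (%(t, x, m). F t x m)"
  and F_nonempty: "!!t x m. t : {0..T} ==> m : P2 ==> F t x m ~= {}"
  and F_convex: "!!t x m. t : {0..T} ==> m : P2 ==> convex (F t x m)"
  and C_nonneg: "C_b >= 0" "C_A >= 0"
  and drift_growth: "!!t x m be Sg. t : {0..T} ==> m : P2 ==> (be, Sg) : F t x m ==>
    norm be <= C_b*(1+norm x+M2 m)"
  and diffusion_growth: "!!t x m be Sg. t : {0..T} ==> m : P2 ==> (be, Sg) : F t x m ==>
    norm Sg <= C_A*(1+(norm x)^2+(M2 m)^2)"
begin

text \<open>If \<open>v\<close> were outside the closed limiting value, the complement of a small
  closed ball around \<open>v\<close> would be an open set containing that value, hence also all
  nearby values, yet the points \<open>u n\<close> end up in the ball.\<close>

lemma graph_closed: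
 assumes "!!n. t n : {0..T}" "s : {0..T}" "t ----> s" "x ----> y"
  and "!!n. mu n : P2" "nu : P2" "(%n. W2 (mu n) nu) ----> 0"
  and u: "!!n. u n : F (t n) (x n) (mu n)" "u ----> v"
 shows "v : F s y nu"
proof (rule ccontr)
 assume out: "v ~: F s y nu"
 let ?X = "prod_topology (top_of_set {0..T}) (prod_topology euclidean P2_topology)"
 have lim: "limitin ?X (%n. (t n, x n, mu n)) (s, y, nu) sequentially"
  using assms by (auto simp: limitin_pairwise comp_def limitin_P2_topology intro!: limitin_top_of_set always_eventually)
 have "(s, y, nu) : topspace ?X" using assms by simp
 hence "closed (F s y nu)" using F_usc by (force simp: upper_semicontinuous_multimap_def)
 then obtain e where e: "0 < e" "ball v e \<subseteq> - F s y nu"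
  using out open_contains_ball[of "- F s y nu"] by auto
 define V where "V = - cball v (e/2)"
 have "cball v (e/2) \<subseteq> ball v e" using e(1) by auto
 hence "F s y nu \<subseteq> V" using e(2) by (auto simp: V_def)
 moreover have "open V" by (simp add: V_def open_Compl)
 hence "openin ?X {z : topspace ?X. (case z of (t, x, m) => F t x m) \<subseteq> V}"
  using F_usc by (simp add: upper_semicontinuous_multimap_def)
 moreover have "(s, y, nu) : {z : topspace ?X. (case z of (t, x, m) => F t x m) \<subseteq> V}"
  using assms `F s y nu \<subseteq> V` by simp
 ultimately have "\<forall>\<^sub>F n in sequentially. (t n, x n, mu n) : {z : topspace ?X. (case z of (t, x, m) => F t x m) \<subseteq> V}"
  using lim unfolding limitin_def by blast
 moreover have "\<forall>\<^sub>F n in sequentially. dist (u n) v < e/2"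
  using u(2) e(1) by (intro tendstoD) auto
 ultimately have "\<forall>\<^sub>F n in sequentially. False"
 proof eventually_elim
  case (elim n)
  hence "u n : V" using u(1)[of n] by auto
  thus ?case using elim(2) by (simp add: V_def dist_commute)
 qed
 thus False by simp
qed

lemma control_growth:
 assumes "s : {0..T}" "mu : P2" "M2 mu <= M" "u : F s x mu"
 shows "norm (fst u) <= C_b*(1+norm x+M)" "norm (snd u) <= C_A*(1+(norm x)^2+M^2)"
  "(norm (fst u))^2 <= 3*C_b^2*(1+(norm x)^2+M^2)"
  "norm u <= (C_b*(2+M)+C_A*(1+M^2))*(1+(norm x)^2)"
proof -
 have M0: "0 <= M" using M2_nonneg[of mu] assms(3) by linarith
 have u: "(fst u, snd u) : F s x mu" using assms(4) by simp
 have "norm (fst u) <= C_b*(1+norm x+M2 mu)" by (rule drift_growth[OF assms(1,2) u])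
 also have "... <= C_b*(1+norm x+M)" using assms(3) C_nonneg by (intro mult_left_mono) auto
 finally show 1: "norm (fst u) <= C_b*(1+norm x+M)" .
 have "norm (snd u) <= C_A*(1+(norm x)^2+(M2 mu)^2)" by (rule diffusion_growth[OF assms(1,2) u])
 also have "... <= C_A*(1+(norm x)^2+M^2)"
  using assms(3) C_nonneg M2_nonneg[of mu] by (intro mult_left_mono add_left_mono power_mono) auto
 finally show 2: "norm (snd u) <= C_A*(1+(norm x)^2+M^2)" .
 have "(norm (fst u))^2 <= (C_b*(1+norm x+M))^2" using 1 by (intro power_mono) auto
 also have "... = C_b^2*(1+norm x+M)^2" by (simp add: power_mult_distrib)
 also have "... <= C_b^2*(3*(1+(norm x)^2+M^2))"
  using sum_squares_bound[of 1 "norm x"] sum_squares_bound[of 1 M] sum_squares_bound[of "norm x" M]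
  by (intro mult_left_mono) (simp_all add: power2_eq_square algebra_simps)
 finally show "(norm (fst u))^2 <= 3*C_b^2*(1+(norm x)^2+M^2)" by (simp only: mult_ac)
 have x: "norm x <= 1+(norm x)^2" by (rule le_one_plus_square)
 have "1+norm x+M <= (2+M)*(1+(norm x)^2)"
 proof -
  have "1+norm x+M <= 2+(norm x)^2+M" using x by simp
  also have "... <= (2+M)+(2+M)*(norm x)^2"
   using M0 mult_right_mono[of 1 "2+M" "(norm x)^2"] by simp
  finally show ?thesis by (simp add: distrib_left)
 qed
 hence "C_b*(1+norm x+M) <= C_b*((2+M)*(1+(norm x)^2))" using C_nonneg by (intro mult_left_mono)
 moreover have "1+(norm x)^2+M^2 <= (1+M^2)*(1+(norm x)^2)" by (simp add: algebra_simps)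
 hence "C_A*(1+(norm x)^2+M^2) <= C_A*((1+M^2)*(1+(norm x)^2))" using C_nonneg by (intro mult_left_mono)
 ultimately show "norm u <= (C_b*(2+M)+C_A*(1+M^2))*(1+(norm x)^2)"
  using norm_prod_le[of u] 1 2 by (simp add: algebra_simps)
qed

end

locale running_cost = dynamics T C_b C_A F for T C_b C_A :: real
  and F :: "real => real^'d => (real^'d) measure => 'd control set" +
 fixes f :: "real => real^'d => (real^'d) measure => real^'d => real^'d^'d => real"
  and C_f :: "(real^'d) measure => real"
 assumes f_lsc: "lower_semicontinuous_map
    (prod_topology (top_of_set {0..T}) (prod_topology euclidean (prod_topology P2_topology
     (prod_topology euclidean (top_of_set sym_psd)))))
    (%(t, x, m, be, Sg). f t x m be Sg)"
  and f_convex: "!!t x m. t : {0..T} ==> m : P2 ==>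
    convex_on (UNIV \<times> sym_psd) (%(be, Sg). f t x m be Sg)"
  and f_growth: "!!t x m be Sg. t : {0..T} ==> m : P2 ==> Sg : sym_psd ==>
    abs(f t x m be Sg) <= C_f m*(1+(norm x)^2+(norm be)^2+norm Sg)"
  and C_f_bounded: "!!K. compactin P2_topology K ==> bounded (C_f ` K)"
begin

lemma f_eventually_greater:
 assumes "!!n. t n : {0..T}" "s : {0..T}" "t ----> s" "x ----> y"
  and "!!n. mu n : P2" "nu : P2" "(%n. W2 (mu n) nu) ----> 0"
  and "be ----> be'" "!!n. Sg n : sym_psd" "Sg ----> Sg'" "a < f s y nu be' Sg'"
 shows "\<forall>\<^sub>F n in sequentially. a < f (t n) (x n) (mu n) (be n) (Sg n)"
proof -
 have "Sg' : sym_psd" using closed_sequentially[OF closed_sym_psd] assms(9,10) by blast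
 hence "limitin (prod_topology (top_of_set {0..T}) (prod_topology euclidean (prod_topology P2_topology
     (prod_topology euclidean (top_of_set sym_psd))))) (%n. (t n, x n, mu n, be n, Sg n)) (s, y, nu, be', Sg') sequentially"
  using assms by (auto simp: limitin_pairwise comp_def limitin_P2_topology intro!: limitin_top_of_set always_eventually)
 from lower_semicontinuous_map_eventually[OF f_lsc this, of a] assms(11) show ?thesis by simp
qed

text \<open>With the flow inserted, the running cost becomes a function on a Euclidean space; the
  value 0 elsewhere makes it total.\<close>

definition f_along :: "(real => (real^'d) measure) =>
  'd state \<times> 'd control => real" where
 "f_along l y = (if fst (fst y) : {0..T} & snd (snd y) : sym_psd
  then f (fst (fst y)) (snd (fst y)) (l (fst (fst y))) (fst (snd y)) (snd (snd y)) else 0)"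

text \<open>On the closed set where \<open>f\<close> is evaluated, sublevel sets are closed, because
  \<open>l\<close> is W2-continuous and \<open>f\<close> is jointly lower semicontinuous.\<close>

lemma f_along_measurable:
 assumes l: "flow_of_probabilities T l"
 shows "f_along l : borel_measurable borel"
proof (subst borel_measurable_iff_le, intro allI)
 fix a
 define S :: "('d state \<times> 'd control) set"
  where "S = {y. fst (fst y) : {0..T} & snd (snd y) : sym_psd}"
 have "closed S"
  unfolding S_def
  by (intro closed_Collect_conj closed_vimage[OF closed_atLeastAtMost, unfolded vimage_def]
    closed_vimage[OF closed_sym_psd, unfolded vimage_def] continuous_intros)
 have "closed {y : S. f_along l y <= a}"
  unfolding closed_sequential_limits
 proof (intro allI impI, elim conjE)
  fix y Y assume y: "ALL n. y n : {y : S. f_along l y <= a}" and lim: "y ----> Y"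
  hence yS: "!!n. y n : S" and le: "!!n. f_along l (y n) <= a" by auto
  have YS: "Y : S" using closed_sequentially[OF `closed S` yS lim] .
  have "\<not> a < f_along l Y"
  proof
   assume "a < f_along l Y"
   have t: "(%n. fst (fst (y n))) ----> fst (fst Y)" by (intro tendsto_intros lim)
   have "\<forall>\<^sub>F n in sequentially. a < f (fst (fst (y n))) (snd (fst (y n))) (l (fst (fst (y n)))) (fst (snd (y n))) (snd (snd (y n)))"
   proof (rule f_eventually_greater)
    show "(%n. W2 (l (fst (fst (y n)))) (l (fst (fst Y)))) ----> 0"
     using yS YS t by (intro flow_of_probabilities_D(2)[OF l]) (auto simp: S_def)
    show "a < f (fst (fst Y)) (snd (fst Y)) (l (fst (fst Y))) (fst (snd Y)) (snd (snd Y))"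
     using `a < f_along l Y` YS by (simp add: f_along_def S_def)
   qed (use yS YS flow_of_probabilities_D(1)[OF l] in \<open>auto simp: S_def intro!: tendsto_intros lim\<close>)
   then obtain n where "a < f (fst (fst (y n))) (snd (fst (y n))) (l (fst (fst (y n)))) (fst (snd (y n))) (snd (snd (y n)))"
    using eventually_happens'[OF sequentially_bot] by blast
   thus False using le[of n] yS[of n] by (simp add: f_along_def S_def)
  qed
  thus "Y : {y : S. f_along l y <= a}" using YS by simp
 qed
 moreover have "{w : space borel. f_along l w <= a} = {y : S. f_along l y <= a} \<union> (if 0 <= a then-S else {})"
  by (auto simp: S_def f_along_def)
 moreover have "- S : sets borel" using `closed S` by (intro borel_open) auto
 ultimately show "{w : space borel. f_along l w <= a} : sets borel" by auto
qed

end

subsection \<open>Passing to the limit in controlled flows\<close>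

text \<open>No measurability of the predicate is needed because the law is carried by a Borel graph.\<close>

lemma AE_graph_transfer:
 fixes h :: "'a::euclidean_space => 'b::euclidean_space"
 assumes law: "distr Om borel X = distr mu borel (%z. (z, h z))"
  and X: "X : borel_measurable Om" and mu: "sets mu = sets borel" and h: "h : borel_measurable borel"
  and ae: "AE z in mu. Q z (h z)"
 shows "AE om in Om. Q (fst (X om)) (snd (X om)) & snd (X om) = h (fst (X om))"
proof -
 have [measurable_cong]: "sets mu = sets borel" by fact
 have [measurable]: "h : borel_measurable borel" by fact
 obtain N where N: "{z : space mu. \<not> Q z (h z)} \<subseteq> N" "emeasure mu N = 0" "N : sets mu"
  using ae by (auto elim: AE_E)
 have sp: "space mu = UNIV" using sets_eq_imp_space_eq[OF mu] by simp
 have [measurable]: "N : sets borel" using N(3) mu by simp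
 have NN: "AE z in mu. z ~: N" using N by (intro AE_not_in) (auto simp: null_sets_def)
 have pm: "(%z. (z, h z)) : mu \<rightarrow>\<^sub>M borel" by (rule borel_measurable_Pair) (auto simp: measurable_cong_sets[OF mu refl])
 have "AE y in distr mu borel (%z. (z, h z)). fst y ~: N & snd y = h (fst y)"
 proof (subst AE_distr_iff[OF pm])
  have "{y : space (borel \<Otimes>\<^sub>M borel :: ('a \<times> 'b) measure). fst y ~: N & snd y = h (fst y)} : sets (borel \<Otimes>\<^sub>M borel)"
   by measurable
  thus "{x : space borel. fst x ~: N & snd x = h (fst x)} : sets (borel :: ('a \<times> 'b) measure)"
   unfolding sets_borel_pair by (simp add: space_pair_measure)
 qed (use NN in auto)
 hence "AE om in Om. fst (X om) ~: N & snd (X om) = h (fst (X om))"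
  unfolding law[symmetric] by (rule AE_distrD[OF X])
 thus ?thesis by eventually_elim (use N(1) sp in auto)
qed

lemma flow_law_second_moment:
 assumes T: "0 < T" and kern: "flow_kernel T m"
  and m: "!!t. t : {0..T} ==> m t : P2" "!!t. t : {0..T} ==> M2 (m t) <= M"
 shows "integrable (flow_law T m) (%z. (norm (snd z))^2)" "(LINT z|flow_law T m. (norm (snd z))^2) <= M^2"
proof -
 note [measurable] = borel_measurable_snd
 have "(\<integral>\<^sup>+z. ennreal ((norm (snd z))^2) \<partial>flow_law T m) <= ennreal (M^2)"
 proof (rule nn_integral_flow_law_le[OF T kern])
  fix t assume t: "t : {0..T}"
  have "(\<integral>\<^sup>+x. ennreal ((norm (snd (t, x)))^2) \<partial>m t) = ennreal (LINT x|m t. (norm x)^2)"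
   using P2_D(4)[OF m(1)[OF t]] by (subst nn_integral_eq_integral) auto
  also have "(LINT x|m t. (norm x)^2) = (M2 (m t))^2" unfolding M2_def by (simp add: integral_nonneg_AE)
  also have "ennreal ... <= ennreal (M^2)" using m(2)[OF t] M2_nonneg[of "m t"] by (intro ennreal_leI power_mono) auto
  finally show "(\<integral>\<^sup>+x. ennreal ((norm (snd (t, x)))^2) \<partial>m t) <= ennreal (M^2)" .
 qed measurable
 note * = nn_integral_le_realD[OF _ _ _ this]
 have meas: "(%z. (norm (snd z))^2) : borel_measurable (flow_law T m)"
  unfolding measurable_cong_sets[OF flow_law_sets[OF T kern] refl] by measurable
 show "integrable (flow_law T m) (%z. (norm (snd z))^2)" "(LINT z|flow_law T m. (norm (snd z))^2) <= M^2"
  using *[OF meas] by auto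
qed

lemma flow_law_integral_tendsto:
 fixes h :: "('d::finite) state => real"
 assumes T: "0 < T" and kern: "!!n. flow_kernel T (m n)" "flow_kernel T l"
  and int: "!!n. integrable (flow_law T (m n)) h" "integrable (flow_law T l) h"
  and bd: "!!n t. t : {0..T} ==> abs(\<integral>x. h (t, x) \<partial>m n t) <= B"
  and lim: "!!t. t : {0..T} ==> (%n. LINT x|m n t. h (t, x)) ----> (LINT x|l t. h (t, x))"
 shows "(%n. LINT z|flow_law T (m n). h z) ----> (LINT z|flow_law T l. h z)"
proof -
 have "(%n. LBINT t:{0..T}. LINT x|m n t. h (t, x)) ----> (LBINT t:{0..T}. LINT x|l t. h (t, x))"
  unfolding set_lebesgue_integral_def
 proof (rule integral_dominated_convergence[where w="%t. indicator {0..T} t*B"])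
  show "(%t. indicator {0..T} t*\<^sub>R (LINT x|l t. h (t, x))) : borel_measurable lborel"
   using integral_flow_law(2)[OF T kern(2) int(2)] by (auto simp: set_integrable_def)
  show "(%t. indicator {0..T} t*\<^sub>R (LINT x|m n t. h (t, x))) : borel_measurable lborel" for n
   using integral_flow_law(2)[OF T kern(1) int(1)] by (auto simp: set_integrable_def)
  show "integrable lborel (%t. indicator {0..T} t*B)"
   using T by (intro integrable_mult_left integrable_real_indicator) auto
  show "AE t in lborel. (%n. indicator {0..T} t*\<^sub>R (LINT x|m n t. h (t, x))) ----> indicator {0..T} t*\<^sub>R (LINT x|l t. h (t, x))"
   using lim by (auto simp: indicator_def)
  show "AE t in lborel. norm (indicator {0..T} t*\<^sub>R (LINT x|m n t. h (t, x))) <= indicator {0..T} t*B" for n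
   using bd by (auto simp: indicator_def)
 qed
 hence "(%n. T*(LINT z|flow_law T (m n). h z)) ----> T*(LINT z|flow_law T l. h z)"
  using integral_flow_law(1)[OF T kern(1) int(1)] integral_flow_law(1)[OF T kern(2) int(2)] by simp
 from tendsto_mult_left[OF this, of "1/T"] T show ?thesis by simp
qed

text \<open>What the limit theorem asks of the approximating flows: the inclusion holds at a shifted
  time \<open>tau n t\<close>, the equation asymptotically, and the flows are measurable in time.
  For walks \<open>tau\<close> is the last grid time, for admissible flows the identity.\<close>

locale approximation = running_cost T C_b C_A F f C_f for T C_b C_A :: real
  and F :: "real => real^'d => (real^'d) measure => 'd control set"
  and f :: "real => real^'d => (real^'d) measure => real^'d => real^'d^'d => real"
  and C_f :: "(real^'d) measure => real" +
 fixes m :: "nat => real => (real^'d) measure" and l :: "real => (real^'d) measure"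
  and b :: "nat => 'd state => real^'d" and A :: "nat => 'd state => real^'d^'d"
  and tau :: "nat => real => real" and dl :: "nat => real" and e :: "real => real"
 assumes kern: "!!n. flow_kernel T (m n)"
  and ui: "!!n t. t : {0..T} ==> m n t : ui_set e" and e: "(e \<longlongrightarrow> 0) at_top"
  and l_flow: "flow_of_probabilities T l" and l_ui: "!!t. t : {0..T} ==> l t : ui_set e"
  and near: "!!t eps. t : {0..T} ==> 0 < eps ==>
   EX N dl. 0 < dl & (ALL n>=N. ALL s:{0..T}. abs(s-t) < dl --> W2 (m n s) (l t) < eps)"
  and b_meas: "!!n. b n : borel_measurable borel" and A_meas: "!!n. A n : borel_measurable borel"
  and A_psd: "!!n z. A n z : sym_psd"
  and incl: "!!n. AE z in flow_law T (m n). (b n z, A n z) : F (tau n (fst z)) (snd z) (m n (fst z))"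
  and tau_range: "!!n t. t : {0..T} ==> tau n t : {0..T}"
  and tau_close: "!!n t. t : {0..T} ==> abs(tau n t-t) <= dl n" and dl: "dl ----> 0"
  and fp: "!!phi phit g H. test_function T phi phit g H ==>
   (%n. LINT z|flow_law T (m n). fp_integrand T phit g H z (b n z, A n z)) ----> 0"
  and f_meas: "!!n. (%z. f_along (m n) (z, (b n z, A n z))) : borel_measurable borel"
begin

text \<open>By \<open>M2_le_tail_moment\<close> with R = 1 this bounds the square of
  \<open>M2\<close>, and being at least 1 it bounds \<open>M2\<close> as well.\<close>

definition "M = e 1+1"

lemma M_ge_1: "1 <= M"
proof -
 have "0 <= e 1"
  using ui_setD(2)[OF ui[of 0 0], of 1] tail_moment_nonneg[of 1 "m 0 0"] T_pos by auto
 thus ?thesis by (simp add: M_def)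
qed

lemma M2_le_M: "mu : ui_set e ==> M2 mu <= M"
proof -
 assume mu: "mu : ui_set e"
 have "(M2 mu)^2 <= M"
  using M2_le_tail_moment[OF ui_setD(1)[OF mu], of 1] ui_setD(2)[OF mu, of 1] by (simp add: M_def)
 also have "... <= M^2" using M_ge_1 by (simp add: power2_eq_square)
 finally show ?thesis using M_ge_1 by (auto intro: power2_le_imp_le)
qed

definition "K0 = C_b*(2+M)+C_A*(1+M^2)"

lemma K0_nonneg: "0 <= K0" using C_nonneg M_ge_1 by (simp add: K0_def)

lemma ui_growth:
 assumes "s : {0..T}" "mu : ui_set e" "u : F s x mu"
 shows "norm u <= K0*(1+(norm x)^2)"
 unfolding K0_def by (rule control_growth(4)[OF assms(1) ui_setD(1)[OF assms(2)] M2_le_M[OF assms(2)] assms(3)])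

text \<open>Two times occur since \<open>f\<close> is evaluated at the current time
  \<open>s\<close>, whereas the control belongs to \<open>F\<close> at the shifted time
  \<open>s'\<close>. The constant is uniform in the measure because \<open>ui_set e\<close> is
  compact.\<close>

lemma f_bound_exists:
 "EX K2>=0. ALL s s' x mu u. s : {0..T} --> mu : ui_set e --> s' : {0..T} --> u : F s' x mu -->
  abs(f s x mu (fst u) (snd u)) <= K2*(1+(norm x)^2)"
proof -
 have "bounded (C_f ` ui_set e)" by (rule C_f_bounded[OF compactin_ui_set[OF e]])
 then obtain Cf where Cf: "0 < Cf" "!!mu. mu : ui_set e ==> abs(C_f mu) <= Cf" by (auto simp: bounded_pos)
 define K where "K = 1+3*C_b^2+C_A"
 have K0: "0 <= K" using C_nonneg by (simp add: K_def)
 have "abs(f s x mu (fst u) (snd u)) <= (Cf*(K*(1+M^2)))*(1+(norm x)^2)"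
  if u: "s : {0..T}" "mu : ui_set e" "s' : {0..T}" "u : F s' x mu" for s s' x mu u
 proof -
  note P = ui_setD(1)[OF u(2)]
  note g = control_growth[OF u(3) P M2_le_M[OF u(2)] u(4)]
  define q where "q = 1+(norm x)^2+M^2"
  have psd: "snd u : sym_psd" using F_range[OF u(3) P, of x] u(4) by auto
  have "1+(norm x)^2+(norm (fst u))^2+norm (snd u) <= q+3*C_b^2*q+C_A*q"
   using g(2,3) zero_le_power2[of M] unfolding q_def by linarith
  hence K: "1+(norm x)^2+(norm (fst u))^2+norm (snd u) <= K*q" by (simp add: K_def distrib_right)
  have "abs(f s x mu (fst u) (snd u)) <= C_f mu*(1+(norm x)^2+(norm (fst u))^2+norm (snd u))"
   by (rule f_growth[OF u(1) P psd])
  also have "... <= Cf*(K*q)" using K Cf(1) Cf(2)[OF u(2)] by (intro mult_mono) auto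
  also have "q <= (1+M^2)*(1+(norm x)^2)" by (simp add: q_def algebra_simps)
  finally show ?thesis using Cf(1) K0 by (simp add: mult.assoc mult_left_mono)
 qed
 thus ?thesis using Cf(1) K0 by (intro exI[of _ "Cf*(K*(1+M^2))"]) auto
qed

definition "K2 = (SOME K2. 0 <= K2 & (ALL s s' x mu u. s : {0..T} --> mu : ui_set e --> s' : {0..T} --> u : F s' x mu -->
  abs(f s x mu (fst u) (snd u)) <= K2*(1+(norm x)^2)))"

lemma f_bound:
 "0 <= K2"
 "s : {0..T} ==> mu : ui_set e ==> s' : {0..T} ==> u : F s' x mu ==> abs(f s x mu (fst u) (snd u)) <= K2*(1+(norm x)^2)"
 using someI_ex[OF f_bound_exists] unfolding K2_def[symmetric] by blast+

lemma l_kern: "flow_kernel T l" by (rule flow_of_probabilities_kernel[OF T_pos l_flow])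

lemma tendsto_flow: "t : {0..T} ==> (!!n. s n : {0..T}) ==> s ----> t ==> strict_mono r ==>
 (%n. W2 (m (r n) (s n)) (l t)) ----> 0"
proof (rule LIMSEQ_I)
 fix eps :: real assume t: "t : {0..T}" and s: "!!n. s n : {0..T}" "s ----> t" and r: "strict_mono r" and "0 < eps"
 obtain N dl where N: "0 < dl" "!!n s. n >= N ==> s : {0..T} ==> abs(s-t) < dl ==> W2 (m n s) (l t) < eps"
  using near[OF t `0 < eps`] by blast
 obtain N' where N': "!!n. n >= N' ==> norm (s n-t) < dl" using LIMSEQ_D[OF s(2) N(1)] by blast
 show "EX no. ALL n>=no. norm (W2 (m (r n) (s n)) (l t)-0) < eps"
 proof (intro exI allI impI)
  fix n assume n: "max N N' <= n"
  have "N <= r n" using n seq_suble[OF r, of n] by simp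
  thus "norm (W2 (m (r n) (s n)) (l t)-0) < eps"
   using N(2)[OF _ s(1), of "r n" n] N'[of n] n W2_nonneg[of "m (r n) (s n)" "l t"] by simp
 qed
qed

lemma second_moment:
 "integrable (flow_law T (m n)) (%z. (norm (snd z))^2)" "(LINT z|flow_law T (m n). (norm (snd z))^2) <= M^2"
 "integrable (flow_law T l) (%z. (norm (snd z))^2)"
 using flow_law_second_moment[OF T_pos kern, of n M] flow_law_second_moment[OF T_pos l_kern, of M]
  ui_setD(1) M2_le_M ui l_ui by blast+

text \<open>\<open>M2\<close> is 1-Lipschitz for W2, so second moments converge at every time and
  are dominated; this pays for the term added before Fatou.\<close>

lemma second_moment_tendsto:
 "(%n. LINT z|flow_law T (m n). (norm (snd z))^2) ----> (LINT z|flow_law T l. (norm (snd z))^2)"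
proof (rule flow_law_integral_tendsto[OF T_pos kern l_kern second_moment(1,3)])
 have M2sq: "(LINT x|mu. (norm (snd (t, x)))^2) = (M2 mu)^2" for t :: real and mu :: "(real^'d) measure"
  unfolding M2_def by (simp add: integral_nonneg_AE)
 fix t assume t: "t : {0..T}"
 show "abs(\<integral>x. (norm (snd (t, x)))^2 \<partial>m n t) <= M^2" for n
  unfolding M2sq using M2_le_M[OF ui[OF t, of n]] M2_nonneg[of "m n t"] by (simp add: power_mono)
 have "(%n. W2 (m n t) (l t)) ----> 0"
  using tendsto_flow[of t "%_. t" id] t strict_mono_id by simp
 hence "(%n. M2 (m n t)-M2 (l t)) ----> 0"
 proof (rule Lim_null_comparison[rotated])
  show "\<forall>\<^sub>F n in sequentially. norm (M2 (m n t)-M2 (l t)) <= W2 (m n t) (l t)"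
  proof (intro always_eventually allI)
   fix n
   show "norm (M2 (m n t)-M2 (l t)) <= W2 (m n t) (l t)"
    using M2_Lipschitz[OF ui_setD(1)[OF ui[OF t]] ui_setD(1)[OF l_ui[OF t]], of n]
     M2_Lipschitz[OF ui_setD(1)[OF l_ui[OF t]] ui_setD(1)[OF ui[OF t]], of n] W2_commute[of "m n t" "l t"]
    by (simp add: abs_le_iff)
  qed
 qed
 hence "(%n. M2 (m n t)) ----> M2 (l t)" by (rule Lim_null[THEN iffD2])
 thus "(%n. LINT x|m n t. (norm (snd (t, x)))^2) ----> (LINT x|l t. (norm (snd (t, x)))^2)"
  unfolding M2sq by (intro tendsto_intros)
qed

definition "ctrl n z = (b n z, A n z)"

lemma ctrl_meas: "ctrl n : borel_measurable borel"
 unfolding ctrl_def[abs_def] by (rule borel_measurable_Pair[OF b_meas A_meas])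

lemma ctrl_growth: "AE z in flow_law T (m n). norm (ctrl n z) <= K0*(1+(norm (snd z))^2)"
 using incl[of n] AE_flow_law_time[OF T_pos kern, of n]
proof eventually_elim
 case (elim z)
 show ?case unfolding ctrl_def by (rule ui_growth[OF tau_range[OF elim(2)] ui[OF elim(2)] elim(1)])
qed

text \<open>Time is bounded and the control is at most a multiple of 1+|x|^2, so Markov's inequality
  for the second moments makes the joint laws tight.\<close>

lemma Skorokhod_controls:
 obtains r :: "nat => nat" and Om :: "real measure"
  and X :: "nat => real => 'd state \<times> 'd control" and Y
 where "strict_mono r" "prob_space Om" "!!n. X n : borel_measurable Om" "Y : borel_measurable Om"
  "!!n. distr Om borel (X n) = distr (flow_law T (m (r n))) borel (%z. (z, ctrl (r n) z))"
  "!!om. om : space Om ==> (%n. X n om) ----> Y om"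
proof -
 define eta where "eta n = distr (flow_law T (m n)) borel (%z. (z, ctrl n z))" for n
 have pm: "(%z. (z, ctrl n z)) : flow_law T (m n) \<rightarrow>\<^sub>M borel" for n
  using ctrl_meas by (intro borel_measurable_Pair) (auto simp: measurable_cong_sets[OF flow_law_sets[OF T_pos kern] refl])
 have prob: "prob_space (eta n)" for n
  unfolding eta_def by (rule prob_space.prob_space_distr[OF flow_law_prob[OF T_pos kern] pm])
 define K where "K = T+1+K0"
 have K: "0 < K" using T_pos K0_nonneg by (simp add: K_def)
 have tight: "EX k::nat. ALL n. measure (eta n) {x. real k <= norm x} < eps" if "0 < eps" for eps
 proof -
  define c where "c = K*(1+M^2)"
  have c: "0 < c" using K M_ge_1 by (auto simp: c_def intro!: mult_pos_pos add_pos_nonneg)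
  obtain k :: nat where k: "c/eps < real k" using reals_Archimedean2 by blast
  have k0: "0 < real k" using k c that by (meson divide_pos_pos less_trans)
  have "measure (eta n) {x. real k <= norm x} < eps" for n
  proof -
   interpret J: prob_space "flow_law T (m n)" by (rule flow_law_prob[OF T_pos kern])
   have [measurable_cong]: "sets (flow_law T (m n)) = sets borel" by (rule flow_law_sets[OF T_pos kern])
   have spJ: "space (flow_law T (m n)) = UNIV" using sets_eq_imp_space_eq[OF flow_law_sets[OF T_pos kern]] by simp
   have [measurable]: "ctrl n : borel_measurable borel" by (rule ctrl_meas)
   have cl: "{x :: 'd state \<times> 'd control. real k <= norm x} : sets borel"
    by (intro borel_closed closed_Collect_le continuous_intros)
   have "measure (eta n) {x. real k <= norm x} = measure (flow_law T (m n)) {z. real k <= norm (z, ctrl n z)}"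
    unfolding eta_def by (subst measure_distr[OF pm cl]) (simp add: spJ vimage_def)
   also have "... <= measure (flow_law T (m n)) {z : space (flow_law T (m n)). real k <= K*(1+(norm (snd z))^2)}"
   proof (rule J.finite_measure_mono_AE)
    show "AE z in flow_law T (m n). z : {z. real k <= norm (z, ctrl n z)} -->
     z : {z : space (flow_law T (m n)). real k <= K*(1+(norm (snd z))^2)}"
     using ctrl_growth[of n] AE_flow_law_time[OF T_pos kern, of n]
    proof eventually_elim
     case (elim z)
     have x: "norm (snd z) <= 1+(norm (snd z))^2" by (rule le_one_plus_square)
     have "norm (z, ctrl n z) <= norm z+norm (ctrl n z)" using norm_prod_le[of "(z, ctrl n z)"] by simp
     also have "... <= (abs(fst z) + norm (snd z))+K0*(1+(norm (snd z))^2)"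
      using norm_prod_le[of z] elim(1) by (intro add_mono) auto
     also have "... <= (T*(1+(norm (snd z))^2)+(1+(norm (snd z))^2))+K0*(1+(norm (snd z))^2)"
     proof (intro add_mono order_refl x)
      have "abs(fst z) <= T*1" using elim(2) by simp
      also have "... <= T*(1+(norm (snd z))^2)" using T_pos by (intro mult_left_mono) auto
      finally show "abs(fst z) <= T*(1+(norm (snd z))^2)" .
     qed
     also have "... = K*(1+(norm (snd z))^2)" by (simp add: K_def algebra_simps)
     finally show ?case by (auto simp: spJ)
    qed
    show "{z : space (flow_law T (m n)). real k <= K*(1+(norm (snd z))^2)} : sets (flow_law T (m n))"
     unfolding spJ flow_law_sets[OF T_pos kern]
     by (simp, intro borel_closed closed_Collect_le continuous_intros)
   qed
   also have "... <= (LINT z|flow_law T (m n). K*(1+(norm (snd z))^2))/real k"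
    using K k0 second_moment(1)[of n]
    by (intro integral_Markov_inequality_measure[where A="{}"]) auto
   also have "... <= c/real k"
   proof (rule divide_right_mono)
    have "(LINT z|flow_law T (m n). K*(1+(norm (snd z))^2)) = K*(1+(LINT z|flow_law T (m n). (norm (snd z))^2))"
     using second_moment(1)[of n] by (simp add: J.prob_space)
    also have "... <= c" unfolding c_def using K second_moment(2)[of n] by (intro mult_left_mono) auto
    finally show "(LINT z|flow_law T (m n). K*(1+(norm (snd z))^2)) <= c" .
   qed simp
   also have "... < eps" using k k0 that by (simp add: field_simps)
   finally show ?thesis .
  qed
  thus ?thesis by blast
 qed
 have sets_eta: "sets (eta n) = sets borel" for n by (simp add: eta_def)
 show thesis
 proof (rule tight_Skorokhod_euclidean[of eta, OF prob sets_eta tight])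
  fix r Om X Y
  assume *: "strict_mono (r :: nat => nat)" "prob_space (Om :: real measure)" "!!n. X n : borel_measurable Om"
   "Y : borel_measurable Om" "!!n. distr Om borel (X n) = eta (r n)"
   "!!om. om : space Om ==> (%n. X n om) ----> Y om"
  show thesis by (rule that[OF *(1-4) *(5)[unfolded eta_def] *(6)])
 qed
qed

end

section \<open>Limit law of time and position, and the constraint set of the limit\<close>

context approximation
begin

text \<open>At each time, bounded Lipschitz integrals differ from those of \<open>l\<close> by at
  most a multiple of W2, so the time and position part of the almost sure limit has the law along
  \<open>l\<close>.\<close>

lemma fst_law_limit:
 fixes Om :: "real measure"
  and X :: "nat => real => 'd state \<times> 'd control"
 assumes r: "strict_mono r" and Om: "prob_space Om" and X: "!!n. X n : borel_measurable Om" and Y: "Y : borel_measurable Om"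
  and law: "!!n. distr Om borel (X n) = distr (flow_law T (m (r n))) borel (%z. (z, ctrl (r n) z))"
  and lim: "!!om. om : space Om ==> (%n. X n om) ----> Y om"
 shows "distr Om borel (%om. fst (X n om)) = flow_law T (m (r n))" "distr Om borel (%om. fst (Y om)) = flow_law T l"
proof -
 interpret prob_space Om by fact
 note [measurable] = X Y borel_measurable_fst borel_measurable_snd
 have pm: "(%z. (z, ctrl n z)) : flow_law T (m n) \<rightarrow>\<^sub>M borel" for n
  using ctrl_meas by (intro borel_measurable_Pair) (auto simp: measurable_cong_sets[OF flow_law_sets[OF T_pos kern] refl])
 have lawX: "distr Om borel (%om. fst (X n om)) = flow_law T (m (r n))" for n
 proof -
  have "distr Om borel (%om. fst (X n om)) = distr (distr Om borel (X n)) borel fst"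
   by (subst distr_distr) (auto simp: comp_def X borel_measurable_fst)
  also have "... = distr (flow_law T (m (r n))) borel (%z. z)"
   unfolding law by (subst distr_distr) (auto simp: comp_def borel_measurable_fst pm)
  also have "... = flow_law T (m (r n))" by (rule distr_id2) (simp add: flow_law_sets[OF T_pos kern])
  finally show ?thesis .
 qed
 thus "distr Om borel (%om. fst (X n om)) = flow_law T (m (r n))" .
 show "distr Om borel (%om. fst (Y om)) = flow_law T l"
 proof (rule prob_space_eqI_Lipschitz)
  show "prob_space (distr Om borel (%om. fst (Y om)))" by (rule prob_space_distr) measurable
  show "prob_space (flow_law T l)" "sets (flow_law T l) = sets borel"
   by (rule flow_law_prob[OF T_pos l_kern] flow_law_sets[OF T_pos l_kern])+
  fix phi :: "'d state => real" and L
  assume cont: "continuous_on UNIV phi" and phi01: "!!x. 0 <= phi x & phi x <= 1"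
   and lip: "!!x y. abs(phi x-phi y) <= L*dist x y" "0 <= L"
  have [measurable]: "phi : borel_measurable borel" by (rule borel_measurable_continuous_onI[OF cont])
  have bd: "abs(phi x) <= 1" for x using phi01[of x] by auto
  have int: "integrable (flow_law T mu) phi" if "flow_kernel T mu" for mu
   using bd by (intro finite_measure.integrable_const_bound[OF prob_space.finite_measure[OF flow_law_prob[OF T_pos that]], of _ 1])
    (auto simp: measurable_cong_sets[OF flow_law_sets[OF T_pos that] refl])
  have "(%n. LINT om|Om. phi (fst (X n om))) ----> (LINT om|Om. phi (fst (Y om)))"
  proof (rule integral_dominated_convergence[where w="%_. 1"])
   show "AE om in Om. (%n. phi (fst (X n om))) ----> phi (fst (Y om))"
   proof (intro AE_I2)
    fix om assume "om : space Om"
    hence "(%n. fst (X n om)) ----> fst (Y om)" by (intro tendsto_fst lim)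
    thus "(%n. phi (fst (X n om))) ----> phi (fst (Y om))"
     by (rule continuous_on_tendsto_compose[OF cont]) auto
   qed
  qed (auto simp: bd)
  moreover have "(LINT om|Om. phi (fst (X n om))) = (LINT z|flow_law T (m (r n)). phi z)" for n
   unfolding lawX[symmetric] by (rule integral_distr[symmetric]) measurable
  ultimately have 1: "(%n. LINT z|flow_law T (m (r n)). phi z) ----> (LINT om|Om. phi (fst (Y om)))" by simp
  have 2: "(%n. LINT z|flow_law T (m (r n)). phi z) ----> (LINT z|flow_law T l. phi z)"
  proof (rule flow_law_integral_tendsto[OF T_pos kern l_kern int[OF kern] int[OF l_kern]])
   fix t assume t: "t : {0..T}"
   have mt: "(%x. phi (t, x)) : borel_measurable borel"
    using measurable_compose[OF measurable_Pair1'[of t borel borel], of phi borel] by (simp add: borel_prod)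
   have lt: "abs(phi (t, x)-phi (t, y)) <= L*dist x y" for x y using lip(1)[of "(t, x)" "(t, y)"] by (simp add: dist_Pair_Pair)
   show "abs(\<integral>x. phi (t, x) \<partial>m (r n) t) <= 1" for n
   proof -
    interpret mt: prob_space "m (r n) t" by (rule P2_D[OF ui_setD(1)[OF ui[OF t]]])
    have i: "integrable (m (r n) t) (%x. phi (t, x))"
     using bd mt by (intro mt.integrable_const_bound[of _ 1]) (auto simp: measurable_cong_sets[OF P2_D(2)[OF ui_setD(1)[OF ui[OF t]]] refl])
    have "abs(\<integral>x. phi (t, x) \<partial>m (r n) t) <= (LINT x|m (r n) t. abs(phi (t, x)))" by (rule integral_abs_bound)
    also have "... <= (LINT x|m (r n) t. 1)" using i bd by (intro integral_mono) auto
    finally show ?thesis by (simp add: mt.prob_space)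
   qed
   show "(%n. LINT x|m (r n) t. phi (t, x)) ----> (LINT x|l t. phi (t, x))"
   proof (rule Lim_null[THEN iffD2], rule Lim_null_comparison)
    show "\<forall>\<^sub>F n in sequentially. norm ((LINT x|m (r n) t. phi (t, x))-(LINT x|l t. phi (t, x))) <= L*W2 (m (r n) t) (l t)"
     unfolding real_norm_def
     by (intro always_eventually allI W2_Lipschitz_integral[OF _ _ mt bd lt lip(2)] ui_setD(1)[OF ui[OF t]] ui_setD(1)[OF l_ui[OF t]])
    show "(%n. L*W2 (m (r n) t) (l t)) ----> 0"
     using t r by (intro tendsto_mult_right_zero tendsto_flow[of t "%_. t"]) auto
   qed
  qed
  have "(LINT om|Om. phi (fst (Y om))) = (LINT z|flow_law T l. phi z)" by (rule LIMSEQ_unique[OF 1 2])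
  thus "(LINT z|distr Om borel (%om. fst (Y om)). phi z) = (LINT z|flow_law T l. phi z)"
   by (subst integral_distr) auto
 qed simp
qed

text \<open>The epigraph of the running cost over the graph of \<open>F\<close>, along the limit
  flow. The upper bound on the cost component is imposed to make the slices bounded; by
  \<open>f_bound\<close> the true cost satisfies it.\<close>

definition Gm :: "('d state \<times> ('d control \<times> real)) set" where
 "Gm = {(z, v). fst z : {0..T} & fst v : F (fst z) (snd z) (l (fst z)) & f_along l (z, fst v) <= snd v &
  snd v <= K2*(1+(norm (snd z))^2)}"

lemma psd_of_F: "s : {0..T} ==> mu : ui_set e ==> u : F s x mu ==> snd u : sym_psd"
 using subsetD[OF F_range[OF _ ui_setD(1)], of s mu e u x] by (simp add: mem_Times_iff)

text \<open>The closed graph of \<open>F\<close> handles the control component, lower semicontinuity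
  of \<open>f\<close> the epigraph inequality.\<close>

lemma closed_Gm: "closed Gm"
 unfolding closed_sequential_limits
proof (intro allI impI, elim conjE)
 fix y Y assume y: "ALL n. y n : Gm" and lim: "y ----> Y"
 define t where "t n = fst (fst (y n))" for n
 define x where "x n = snd (fst (y n))" for n
 define u where "u n = fst (snd (y n))" for n
 define rho where "rho n = snd (snd (y n))" for n
 have yn: "t n : {0..T}" "u n : F (t n) (x n) (l (t n))" "f_along l (fst (y n), u n) <= rho n"
  "rho n <= K2*(1+(norm (x n))^2)" for n
  using y by (auto simp: Gm_def t_def x_def u_def rho_def split_beta)
 have lims: "t ----> fst (fst Y)" "x ----> snd (fst Y)" "u ----> fst (snd Y)" "rho ----> snd (snd Y)"
  unfolding t_def[abs_def] x_def[abs_def] u_def[abs_def] rho_def[abs_def] by (intro tendsto_intros lim)+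
 have tY: "fst (fst Y) : {0..T}"
  using closed_sequentially[OF closed_atLeastAtMost yn(1) lims(1)] .
 have psd: "snd (u n) : sym_psd" for n by (rule psd_of_F[OF yn(1) l_ui[OF yn(1)] yn(2)])
 have Wl: "(%n. W2 (l (t n)) (l (fst (fst Y)))) ----> 0"
  by (rule flow_of_probabilities_D(2)[OF l_flow yn(1) tY lims(1)])
 have uY: "fst (snd Y) : F (fst (fst Y)) (snd (fst Y)) (l (fst (fst Y)))"
  by (rule graph_closed[OF yn(1) tY lims(1,2) ui_setD(1)[OF l_ui[OF yn(1)]] ui_setD(1)[OF l_ui[OF tY]] Wl yn(2) lims(3)])
 have psdY: "snd (fst (snd Y)) : sym_psd" by (rule psd_of_F[OF tY l_ui[OF tY] uY])
 have "f_along l (fst Y, fst (snd Y)) <= snd (snd Y)"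
 proof (rule ccontr)
  assume "\<not> ?thesis"
  then obtain a where a: "snd (snd Y) < a" "a < f_along l (fst Y, fst (snd Y))" using dense not_le by metis
  have "\<forall>\<^sub>F n in sequentially. a < f (t n) (x n) (l (t n)) (fst (u n)) (snd (u n))"
  proof (rule f_eventually_greater[OF yn(1) tY lims(1,2) ui_setD(1)[OF l_ui[OF yn(1)]] ui_setD(1)[OF l_ui[OF tY]] Wl _ psd])
   show "(%n. fst (u n)) ----> fst (fst (snd Y))" "(%n. snd (u n)) ----> snd (fst (snd Y))"
    by (intro tendsto_intros lims)+
   show "a < f (fst (fst Y)) (snd (fst Y)) (l (fst (fst Y))) (fst (fst (snd Y))) (snd (fst (snd Y)))"
    using a(2) tY psdY by (simp add: f_along_def)
  qed
  moreover have "\<forall>\<^sub>F n in sequentially. rho n < a" by (rule order_tendstoD(2)[OF lims(4) a(1)])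
  ultimately have "\<forall>\<^sub>F n in sequentially. False"
  proof eventually_elim
   case (elim n)
   have "f (t n) (x n) (l (t n)) (fst (u n)) (snd (u n)) <= rho n"
    using yn(3)[of n] yn(1)[of n] psd[of n] by (simp add: f_along_def t_def x_def)
   thus ?case using elim by simp
  qed
  thus False by simp
 qed
 moreover have "snd (snd Y) <= K2*(1+(norm (snd (fst Y)))^2)"
  by (rule LIMSEQ_le[OF lims(4), of "%n. K2*(1+(norm (x n))^2)"]) (auto intro!: tendsto_intros lims yn(4))
 ultimately show "Y : Gm" using tY uY by (simp add: Gm_def split_beta)
qed

lemma convex_Gm: "convex {v. (z, v) : Gm}"
proof (cases "fst z : {0..T}")
 case t: True
 note P = ui_setD(1)[OF l_ui[OF t]]
 show ?thesis
 proof (rule convexI)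
  fix v w and p q :: real
  assume v: "v : {v. (z, v) : Gm}" and w: "w : {v. (z, v) : Gm}" and pq: "0 <= p" "0 <= q" "p+q = 1"
  have vF: "fst v : F (fst z) (snd z) (l (fst z))" "fst w : F (fst z) (snd z) (l (fst z))"
   using v w by (auto simp: Gm_def)
  have psd: "snd (fst v) : sym_psd" "snd (fst w) : sym_psd"
   using psd_of_F[OF t l_ui[OF t]] vF by auto
  let ?u = "p*\<^sub>R fst v+q*\<^sub>R fst w"
  have uF: "?u : F (fst z) (snd z) (l (fst z))"
   by (rule convexD[OF F_convex[OF t P] vF pq])
  have upsd: "snd ?u : sym_psd" by (rule psd_of_F[OF t l_ui[OF t] uF])
  let ?f = "%u. f (fst z) (snd z) (l (fst z)) (fst u) (snd u)"
  have cv: "convex_on (UNIV \<times> sym_psd) ?f" using f_convex[OF t P, of "snd z"] by (simp add: split_beta')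
  have vw: "fst v : UNIV \<times> sym_psd" "fst w : UNIV \<times> sym_psd" using psd by (auto simp: mem_Times_iff)
  have p: "1-q = p" using pq by simp
  have "?f (p*\<^sub>R fst v+q*\<^sub>R fst w) <= p * ?f (fst v)+q * ?f (fst w)"
   using convex_onD[OF cv _ _ vw, of q] pq unfolding p by simp
  also have "... <= p * snd v+q * snd w"
   using v w pq psd t by (intro add_mono mult_left_mono) (auto simp: Gm_def f_along_def)
  finally have 1: "f_along l (z, ?u) <= p * snd v+q * snd w" using upsd t by (simp add: f_along_def)
  have "p * snd v+q * snd w <= p*(K2*(1+(norm (snd z))^2))+q*(K2*(1+(norm (snd z))^2))"
   using v w pq by (intro add_mono mult_left_mono) (auto simp: Gm_def)
  also have "... = K2*(1+(norm (snd z))^2)" using pq by (simp add: distrib_right[symmetric])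
  finally show "p*\<^sub>R v+q*\<^sub>R w : {v. (z, v) : Gm}"
   using 1 uF t by (simp add: Gm_def)
 qed
next
 case False
 hence "{v. (z, v) : Gm} = {}" by (auto simp: Gm_def)
 thus ?thesis by (simp only: convex_empty)
qed

lemma bounded_Gm: "bounded {v. (z, v) : Gm}"
proof (rule boundedI)
 fix v assume "v : {v. (z, v) : Gm}"
 hence t: "fst z : {0..T}" and v: "fst v : F (fst z) (snd z) (l (fst z))" "f_along l (z, fst v) <= snd v"
  "snd v <= K2*(1+(norm (snd z))^2)" by (auto simp: Gm_def)
 have psd: "snd (fst v) : sym_psd" by (rule psd_of_F[OF t l_ui[OF t] v(1)])
 have "abs(f_along l (z, fst v)) <= K2*(1+(norm (snd z))^2)"
  using f_bound(2)[OF t l_ui[OF t] t v(1)] t psd by (simp add: f_along_def)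
 hence "norm (snd v) <= K2*(1+(norm (snd z))^2)" using v by auto
 moreover have "norm (fst v) <= K0*(1+(norm (snd z))^2)" by (rule ui_growth[OF t l_ui[OF t] v(1)])
 ultimately show "norm v <= K0*(1+(norm (snd z))^2)+K2*(1+(norm (snd z))^2)"
  using norm_prod_le[of v] by linarith
qed

end

section \<open>The limit process: inclusion, equation and cost\<close>

context approximation
begin

text \<open>Averaging the limiting control value and its cost jointly, given time and position,
  stays in the convex slices of \<open>Gm\<close>, so the cost of the averaged control is at most
  the averaged cost: Jensen's inequality in disguise. The bounds \<open>c n\<close> may be any
  convergent majorants of the costs.\<close>

theorem closure:
 "EX b0 A0. (l, b0, A0) : admissible T F (l 0) &
  (ALL c c0. (ALL n. T*(LINT z|flow_law T (m n). f_along (m n) (z, ctrl n z)) <= c n) --> c ----> c0 -->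
    (LBINT t:{0..T}. LINT x|l t. f t x (l t) (b0 t x) (A0 t x)) <= c0)"
proof (rule Skorokhod_controls)
 fix r and Om :: "real measure"
  and X :: "nat => real => 'd state \<times> 'd control" and Y
 assume r: "strict_mono r" and Om: "prob_space Om"
  and X[measurable]: "!!n. X n : borel_measurable Om" and Y[measurable]: "Y : borel_measurable Om"
  and law: "!!n. distr Om borel (X n) = distr (flow_law T (m (r n))) borel (%z. (z, ctrl (r n) z))"
  and lim: "!!om. om : space Om ==> (%n. X n om) ----> Y om"
 interpret prob_space Om by fact
 note [measurable] = borel_measurable_fst borel_measurable_snd
 have fst_lawX: "distr Om borel (%om. fst (X n om)) = flow_law T (m (r n))" for n
  by (rule fst_law_limit(1)[OF r Om X Y law lim])
 have fst_lawY: "distr Om borel (%om. fst (Y om)) = flow_law T l"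
  by (rule fst_law_limit(2)[OF r Om X Y law lim])
 have setsJ: "sets (flow_law T (m n)) = sets borel" for n by (rule flow_law_sets[OF T_pos kern])
 have setsL: "sets (flow_law T l) = sets borel" by (rule flow_law_sets[OF T_pos l_kern])
 have pm: "(%z. (z, ctrl n z)) : flow_law T (m n) \<rightarrow>\<^sub>M borel" for n
  using ctrl_meas by (intro borel_measurable_Pair) (auto simp: measurable_cong_sets[OF setsJ refl])
 define t where "t om = fst (fst (Y om))" for om
 define x where "x om = snd (fst (Y om))" for om
 define u where "u om = snd (Y om)" for om
 define tn where "tn n om = fst (fst (X n om))" for n om
 define xn where "xn n om = snd (fst (X n om))" for n om
 define un where "un n om = snd (X n om)" for n om
 have lims: "(%n. tn n om) ----> t om" "(%n. xn n om) ----> x om" "(%n. un n om) ----> u om" if "om : space Om" for om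
  unfolding t_def x_def u_def tn_def xn_def un_def by (intro tendsto_intros lim[OF that])+

 \<comment> \<open>The facts for all \<open>n\<close> are collected on one event of full measure, so
   that limits may be taken pointwise there.\<close>
 have good: "AE om in Om. ALL n. tn n om : {0..T} & un n om : F (tau (r n) (tn n om)) (xn n om) (m (r n) (tn n om)) &
   un n om = ctrl (r n) (fst (X n om))"
 proof (subst AE_all_countable, intro allI)
  fix n
  have "AE z in flow_law T (m (r n)). fst z : {0..T} & ctrl (r n) z : F (tau (r n) (fst z)) (snd z) (m (r n) (fst z))"
   using incl[of "r n"] AE_flow_law_time[OF T_pos kern, of "r n"] by eventually_elim (simp add: ctrl_def)
  from AE_graph_transfer[where Q="%z u. fst z : {0..T} & u : F (tau (r n) (fst z)) (snd z) (m (r n) (fst z))",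
    OF law[of n] X setsJ ctrl_meas this]
  show "AE om in Om. tn n om : {0..T} & un n om : F (tau (r n) (tn n om)) (xn n om) (m (r n) (tn n om)) &
   un n om = ctrl (r n) (fst (X n om))"
   unfolding tn_def xn_def un_def by eventually_elim (elim conjE; intro conjI; assumption)
 qed
 have limit_facts: "t om : {0..T} & (%n. W2 (m (r n) (tn n om)) (l (t om))) ----> 0 & u om : F (t om) (x om) (l (t om))"
  if om: "om : space Om" and g: "ALL n. tn n om : {0..T} & un n om : F (tau (r n) (tn n om)) (xn n om) (m (r n) (tn n om)) &
   un n om = ctrl (r n) (fst (X n om))" for om
 proof (intro conjI)
  have tn: "tn n om : {0..T}" for n using g by blast
  show tom: "t om : {0..T}" using closed_sequentially[OF closed_atLeastAtMost tn lims(1)[OF om]] .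
  show W: "(%n. W2 (m (r n) (tn n om)) (l (t om))) ----> 0"
   by (rule tendsto_flow[OF tom tn lims(1)[OF om] r])
  have taulim: "(%n. tau (r n) (tn n om)) ----> t om"
  proof -
   have "(%n. tau (r n) (tn n om)-tn n om) ----> 0"
   proof (rule Lim_null_comparison)
    show "\<forall>\<^sub>F n in sequentially. norm (tau (r n) (tn n om)-tn n om) <= dl (r n)"
     using tau_close[OF tn] by simp
    show "(%n. dl (r n)) ----> 0" using LIMSEQ_subseq_LIMSEQ[OF dl r] by (simp add: comp_def)
   qed
   from tendsto_add[OF this lims(1)[OF om]] show ?thesis by simp
  qed
  show "u om : F (t om) (x om) (l (t om))"
  proof (rule graph_closed[OF tau_range[OF tn] tom taulim lims(2)[OF om] _ _ W _ lims(3)[OF om]])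
   show "m (r n) (tn n om) : P2" for n by (rule ui_setD(1)[OF ui[OF tn]])
   show "l (t om) : P2" by (rule ui_setD(1)[OF l_ui[OF tom]])
   show "un n om : F (tau (r n) (tn n om)) (xn n om) (m (r n) (tn n om))" for n using g by blast
  qed
 qed

 define rho where "rho om = f_along l (Y om)" for om
 have rho_meas[measurable]: "rho : borel_measurable Om"
  unfolding rho_def[abs_def] by (rule measurable_compose[OF Y f_along_measurable[OF l_flow]])
 have x2: "integrable Om (%om. (norm (x om))^2)" "(LINT om|Om. (norm (x om))^2) = (LINT z|flow_law T l. (norm (snd z))^2)"
 proof -
  have "integrable (distr Om borel (%om. fst (Y om))) (%z. (norm (snd z))^2)"
   unfolding fst_lawY by (rule second_moment(3))
  thus "integrable Om (%om. (norm (x om))^2)" unfolding x_def by (subst (asm) integrable_distr_eq) auto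
  show "(LINT om|Om. (norm (x om))^2) = (LINT z|flow_law T l. (norm (snd z))^2)"
   unfolding fst_lawY[symmetric] x_def by (subst integral_distr) auto
 qed
 have xn2: "integrable Om (%om. (norm (xn n om))^2)" "(LINT om|Om. (norm (xn n om))^2) = (LINT z|flow_law T (m (r n)). (norm (snd z))^2)" for n
 proof -
  have "integrable (distr Om borel (%om. fst (X n om))) (%z. (norm (snd z))^2)"
   unfolding fst_lawX by (rule second_moment(1))
  thus "integrable Om (%om. (norm (xn n om))^2)" unfolding xn_def by (subst (asm) integrable_distr_eq) auto
  show "(LINT om|Om. (norm (xn n om))^2) = (LINT z|flow_law T (m (r n)). (norm (snd z))^2)"
   unfolding fst_lawX[symmetric] xn_def by (subst integral_distr) auto
 qed
 have rho_eq: "rho om = f (t om) (x om) (l (t om)) (fst (u om)) (snd (u om)) & abs(rho om) <= K2*(1+(norm (x om))^2) &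
   norm (u om) <= K0*(1+(norm (x om))^2)"
  if "t om : {0..T}" "u om : F (t om) (x om) (l (t om))" for om
  using that psd_of_F[OF that(1) l_ui[OF that(1)] that(2)] f_bound(2)[OF that(1) l_ui[OF that(1)] that(1) that(2)]
   ui_growth[OF that(1) l_ui[OF that(1)] that(2)]
  by (simp add: rho_def f_along_def t_def x_def u_def)

 \<comment> \<open>Control and cost are averaged as one vector, whose values lie in the slices of
   \<open>Gm\<close>.\<close>
 define V where "V om = (u om, rho om)" for om
 have V_meas: "V : borel_measurable Om"
  unfolding V_def[abs_def] u_def by (rule borel_measurable_Pair) measurable
 have AE_lim: "AE om in Om. t om : {0..T} & (%n. W2 (m (r n) (tn n om)) (l (t om))) ----> 0 & u om : F (t om) (x om) (l (t om))"
  using good AE_space by eventually_elim (rule limit_facts)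
 have V_int: "integrable Om V"
 proof (rule Bochner_Integration.integrable_bound[OF _ V_meas])
  show "integrable Om (%om. (K0+K2)*(1+(norm (x om))^2))" using x2(1) by simp
  show "AE om in Om. norm (V om) <= norm ((K0+K2)*(1+(norm (x om))^2))"
   using AE_lim
  proof eventually_elim
   case (elim om)
   have "norm (V om) <= norm (u om) + abs(rho om)" using norm_prod_le[of "V om"] by (simp add: V_def)
   moreover have "norm (u om) <= K0*(1+(norm (x om))^2)" "abs(rho om) <= K2*(1+(norm (x om))^2)"
    using rho_eq[of om] elim by blast+
   ultimately have "norm (V om) <= K0*(1+(norm (x om))^2)+K2*(1+(norm (x om))^2)" by linarith
   also have "... = (K0+K2)*(1+(norm (x om))^2)" by (simp add: distrib_right)
   finally show ?case using abs_ge_self order_trans unfolding real_norm_def by blast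
  qed
 qed
 have fstY[measurable]: "(%om. fst (Y om)) : borel_measurable Om" by measurable
 have V_Gm: "AE om in Om. (fst (Y om), V om) : Gm"
  using AE_lim
 proof eventually_elim
  case (elim om)
  thus ?case
   using rho_eq[of om] unfolding Gm_def V_def t_def x_def u_def by (simp add: rho_def abs_le_iff)
 qed
 obtain h :: "'d state => 'd control \<times> real"
  where h[measurable]: "h : borel_measurable borel" and h_int: "integrable (distr Om borel (%om. fst (Y om))) h"
   and cond: "!!w B. w : borel_measurable borel ==> (!!z. norm (w z) <= B) ==>
    (LINT om|Om. w (fst (Y om)) \<bullet> V om) = (LINT z|distr Om borel (%om. fst (Y om)). w z \<bullet> h z)"
 proof (rule conditional_expectation_vector[OF Om fstY V_int])
  fix h :: "'d state => 'd control \<times> real"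
  assume *: "h : borel_measurable borel" "integrable (distr Om borel (%om. fst (Y om))) h"
   "!!w B. w : borel_measurable borel ==> (!!z. norm (w z) <= B) ==>
    (LINT om|Om. w (fst (Y om)) \<bullet> V om) = (LINT z|distr Om borel (%om. fst (Y om)). w z \<bullet> h z)"
  show thesis by (rule that[OF *])
 qed
 have h_Gm: "AE z in flow_law T l. (z, h z) : Gm"
  using conditional_expectation_convex[OF Om fstY V_int closed_Gm convex_Gm bounded_Gm V_Gm h h_int cond]
  unfolding fst_lawY .
 have h_int': "integrable (flow_law T l) h" using h_int unfolding fst_lawY .
 define b0 where "b0 z = fst (fst (h z))" for z
 \<comment> \<open>\<open>admissible\<close> wants a nonnegative symmetric matrix at every point;
   the value 0 is substituted on a null set only.\<close>
 define A0 where "A0 z = (if snd (fst (h z)) : sym_psd then snd (fst (h z)) else 0)" for z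
 have b0_meas[measurable]: "b0 : borel_measurable borel" unfolding b0_def[abs_def] by measurable
 have psd_meas[measurable]: "(sym_psd :: (real^'d^'d) set) : sets borel" by (rule borel_closed[OF closed_sym_psd])
 have A0_meas[measurable]: "A0 : borel_measurable borel"
  unfolding A0_def[abs_def] by measurable
 have A0_psd: "A0 z : sym_psd" for z by (simp add: A0_def zero_sym_psd)
 have h_good: "AE z in flow_law T l. fst z : {0..T} & (b0 z, A0 z) : F (fst z) (snd z) (l (fst z)) &
   fst (h z) = (b0 z, A0 z) & f_along l (z, (b0 z, A0 z)) <= snd (h z)"
  using h_Gm
 proof eventually_elim
  case (elim z)
  hence z: "fst z : {0..T}" "fst (h z) : F (fst z) (snd z) (l (fst z))" "f_along l (z, fst (h z)) <= snd (h z)"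
   by (auto simp: Gm_def)
  have "fst (h z) = (b0 z, A0 z)"
   using psd_of_F[OF z(1) l_ui[OF z(1)] z(2)] by (simp add: b0_def A0_def prod_eq_iff)
  thus ?case using z by simp
 qed

 have fp_limit: "(LBINT t:{0..T}. (LINT x|l t. phit t x+g t x \<bullet> b0 (t, x)+(1/2)*trace (H t x ** A0 (t, x)))) = 0"
  if tf: "test_function T phi phit g H" for phi phit g H
 proof -
  note cont = test_function_ext(1-3)[OF tf]
  obtain B where B: "0 <= B" and bd: "!!z. abs(slab T phit z) <= B & norm (slab T g z) <= B & norm (slab T H z) <= B"
   using test_function_ext(5)[OF tf] by blast
  define w where "w z = (slab T g z, (1/2)*\<^sub>R transpose (slab T H z))" for z
  define Bw where "Bw = 2*B"
  have w_cont: "continuous_on UNIV w" unfolding w_def by (intro continuous_intros cont)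
  have w_bd: "norm (w z) <= Bw" for z using norm_prod_le[of "w z"] bd[of z] B by (simp add: w_def Bw_def norm_transpose)
  have fpi: "fp_integrand T phit g H z v = slab T phit z+w z \<bullet> v" for z v
   by (simp add: fp_integrand_inner w_def)
  obtain D where fp_bd: "!!z v. norm v <= K0*(1+(norm (snd z))^2) ==> abs(fp_integrand T phit g H z v) <= D"
   using fp_integrand_bounded[OF tf K0_nonneg] by blast
  have w_meas[measurable]: "w : borel_measurable borel" by (rule borel_measurable_continuous_onI[OF w_cont])
  have phit_meas[measurable]: "slab T phit : borel_measurable borel" by (rule borel_measurable_continuous_onI[OF cont(1)])
  have fpX_meas: "(%y. fp_integrand T phit g H (fst y) (snd y)) : borel_measurable borel"
   unfolding fpi by measurable
  have "(%n. LINT om|Om. fp_integrand T phit g H (fst (X n om)) (snd (X n om))) ---->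
    (LINT om|Om. fp_integrand T phit g H (fst (Y om)) (snd (Y om)))"
  proof (rule integral_dominated_convergence[where w="%_. D"])
   show "AE om in Om. (%n. fp_integrand T phit g H (fst (X n om)) (snd (X n om))) ----> fp_integrand T phit g H (fst (Y om)) (snd (Y om))"
   proof (intro AE_I2)
    fix om assume om: "om : space Om"
    have l1: "(%n. fst (X n om)) ----> fst (Y om)" "(%n. snd (X n om)) ----> snd (Y om)"
     by (intro tendsto_intros lim[OF om])+
    show "(%n. fp_integrand T phit g H (fst (X n om)) (snd (X n om))) ----> fp_integrand T phit g H (fst (Y om)) (snd (Y om))"
     unfolding fpi
     by (intro tendsto_intros l1 continuous_on_tendsto_compose[OF cont(1) l1(1)] continuous_on_tendsto_compose[OF w_cont l1(1)]) auto
   qed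
   show "AE om in Om. norm (fp_integrand T phit g H (fst (X n om)) (snd (X n om))) <= D" for n
    using good
   proof eventually_elim
    case (elim om)
    have tnT: "tn n om : {0..T}" using elim by blast
    have "un n om : F (tau (r n) (tn n om)) (xn n om) (m (r n) (tn n om))" using elim by blast
    from ui_growth[OF tau_range[OF tnT] ui[OF tnT] this]
    show ?case unfolding real_norm_def un_def xn_def by (rule fp_bd)
   qed
   show "(%om. fp_integrand T phit g H (fst (Y om)) (snd (Y om))) : borel_measurable Om"
    by (rule measurable_compose[OF Y fpX_meas])
   show "(%om. fp_integrand T phit g H (fst (X n om)) (snd (X n om))) : borel_measurable Om" for n
    by (rule measurable_compose[OF X fpX_meas])
  qed simp
  moreover have "(LINT om|Om. fp_integrand T phit g H (fst (X n om)) (snd (X n om))) =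
   (LINT z|flow_law T (m (r n)). fp_integrand T phit g H z (b (r n) z, A (r n) z))" for n
  proof -
   have "(LINT om|Om. fp_integrand T phit g H (fst (X n om)) (snd (X n om))) =
    (LINT y|distr Om borel (X n). fp_integrand T phit g H (fst y) (snd y))"
    by (rule integral_distr[symmetric, OF X fpX_meas])
   also have "... = (LINT z|flow_law T (m (r n)). fp_integrand T phit g H z (ctrl (r n) z))"
    unfolding law using integral_distr[OF pm fpX_meas, of "r n"] by simp
   finally show ?thesis by (simp add: ctrl_def)
  qed
  moreover have "(%n. LINT z|flow_law T (m (r n)). fp_integrand T phit g H z (b (r n) z, A (r n) z)) ----> 0"
   using LIMSEQ_subseq_LIMSEQ[OF fp[OF tf] r] by (simp add: comp_def)
  ultimately have Y0: "(LINT om|Om. fp_integrand T phit g H (fst (Y om)) (snd (Y om))) = 0"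
   using LIMSEQ_unique by simp
  have i1: "integrable Om (%om. slab T phit (fst (Y om)))"
   using bd by (intro integrable_const_bound[of _ B]) auto
  have i2: "integrable Om (%om. (w (fst (Y om)), 0) \<bullet> V om)"
  proof (rule Bochner_Integration.integrable_bound)
   show "integrable Om (%om. Bw*norm (V om))" using V_int by simp
   show "AE om in Om. norm ((w (fst (Y om)), 0) \<bullet> V om) <= norm (Bw*norm (V om))"
   proof (intro AE_I2)
    fix om
    have "abs((w (fst (Y om)), 0) \<bullet> V om) <= norm (w (fst (Y om)), 0::real)*norm (V om)" by (rule Cauchy_Schwarz_ineq2)
    also have "... <= Bw*norm (V om)" using w_bd by (intro mult_right_mono) (auto simp: norm_prod_def)
    finally show "norm ((w (fst (Y om)), 0) \<bullet> V om) <= norm (Bw*norm (V om))" using B by (simp add: Bw_def)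
   qed
   have "(%om. (w (fst (Y om)), 0 :: real)) : borel_measurable Om" by (rule borel_measurable_Pair) measurable
   thus "(%om. (w (fst (Y om)), 0) \<bullet> V om) : borel_measurable Om" using V_meas by measurable
  qed
  \<comment> \<open>The coefficient (w,0) leaves out the cost component of \<open>V\<close>; by
    \<open>cond\<close> the limiting control may then be replaced by its conditional
    expectation.\<close>
  have "(LINT om|Om. fp_integrand T phit g H (fst (Y om)) (snd (Y om))) =
   (LINT om|Om. slab T phit (fst (Y om))+(w (fst (Y om)), 0) \<bullet> V om)"
   by (simp add: fpi V_def u_def inner_prod_def)
  also have "... = (LINT om|Om. slab T phit (fst (Y om)))+(LINT om|Om. (w (fst (Y om)), 0) \<bullet> V om)"
   using i1 i2 by simp
  also have "(LINT om|Om. slab T phit (fst (Y om))) = (LINT z|flow_law T l. slab T phit z)"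
   unfolding fst_lawY[symmetric] by (rule integral_distr[symmetric]) measurable
  also have "(LINT om|Om. (w (fst (Y om)), 0) \<bullet> V om) = (LINT z|flow_law T l. (w z, 0) \<bullet> h z)"
   unfolding fst_lawY[symmetric]
  proof (rule cond[of "%z. (w z, 0)" Bw])
   show "(%z. (w z, 0 :: real)) : borel_measurable borel" by (rule borel_measurable_Pair) measurable
   show "norm (w z, 0 :: real) <= Bw" for z using w_bd[of z] by (simp add: norm_prod_def)
  qed
  finally have 0: "(LINT z|flow_law T l. slab T phit z)+(LINT z|flow_law T l. (w z, 0) \<bullet> h z) = 0" using Y0 by simp
  interpret L: prob_space "flow_law T l" by (rule flow_law_prob[OF T_pos l_kern])
  have j1: "integrable (flow_law T l) (slab T phit)"
   using bd by (intro L.integrable_const_bound[of _ B]) (auto simp: measurable_cong_sets[OF setsL refl])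
  have j2: "integrable (flow_law T l) (%z. (w z, 0) \<bullet> h z)"
  proof (rule Bochner_Integration.integrable_bound)
   show "integrable (flow_law T l) (%z. Bw*norm (h z))" using h_int' by simp
   show "AE z in flow_law T l. norm ((w z, 0) \<bullet> h z) <= norm (Bw*norm (h z))"
   proof (intro AE_I2)
    fix z
    have "abs((w z, 0) \<bullet> h z) <= norm (w z, 0::real)*norm (h z)" by (rule Cauchy_Schwarz_ineq2)
    also have "... <= Bw*norm (h z)" using w_bd by (intro mult_right_mono) (auto simp: norm_prod_def)
    finally show "norm ((w z, 0) \<bullet> h z) <= norm (Bw*norm (h z))" using B by (simp add: Bw_def)
   qed
   have "(%z. (w z, 0 :: real)) : borel_measurable borel" by (rule borel_measurable_Pair) measurable
   hence "(%z. (w z, 0) \<bullet> h z) : borel_measurable borel" by measurable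
   thus "(%z. (w z, 0) \<bullet> h z) : borel_measurable (flow_law T l)" by (simp add: measurable_cong_sets[OF setsL refl])
  qed
  have eqAE: "AE z in flow_law T l. fp_integrand T phit g H z (b0 z, A0 z) = slab T phit z+(w z, 0) \<bullet> h z"
   using h_good by eventually_elim (simp add: fpi inner_prod_def)
  have mfp: "(%z. fp_integrand T phit g H z (b0 z, A0 z)) : borel_measurable (flow_law T l)"
  proof -
   have "(%z. (b0 z, A0 z)) : borel_measurable borel" by (rule borel_measurable_Pair) measurable
   hence "(%z. fp_integrand T phit g H z (b0 z, A0 z)) : borel_measurable borel" unfolding fpi by measurable
   thus ?thesis by (simp add: measurable_cong_sets[OF setsL refl])
  qed
  have j3: "integrable (flow_law T l) (%z. fp_integrand T phit g H z (b0 z, A0 z))"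
   using integrable_cong_AE[OF mfp _ eqAE] j1 j2 by auto
  have "(LINT z|flow_law T l. fp_integrand T phit g H z (b0 z, A0 z)) = (LINT z|flow_law T l. slab T phit z+(w z, 0) \<bullet> h z)"
   using j1 j2 by (intro integral_cong_AE mfp eqAE) auto
  also have "... = 0" using 0 j1 j2 by simp
  finally show ?thesis using fokker_planck_flow_law[OF T_pos l_kern j3] by simp
 qed

 have adm: "(l, %t x. b0 (t, x), %t x. A0 (t, x)) : admissible T F (l 0)"
  unfolding admissible_def
 proof (simp only: mem_Collect_eq prod.case, intro conjI)
  show "flow_of_probabilities T l" by (rule l_flow)
  have "b0 : borel_measurable (restrict_space borel ({0..T} \<times> UNIV))"
   "A0 : borel_measurable (restrict_space borel ({0..T} \<times> UNIV))"
   by (rule measurable_restrict_space1; measurable)+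
  thus "(%(t, x). b0 (t, x)) : borel_measurable (restrict_space borel ({0..T} \<times> UNIV))"
   "(%(t, x). A0 (t, x)) : borel_measurable (restrict_space borel ({0..T} \<times> UNIV))" by simp_all
  show "ALL t:{0..T}. ALL x. A0 (t, x) : sym_psd" by (simp add: A0_psd)
  show "AE t in lborel. t : {0..T} --> (AE x in l t. (b0 (t, x), A0 (t, x)) : F t x (l t))"
   using AE_flow_law_D[OF T_pos l_kern h_good]
   by eventually_elim (auto elim: eventually_mono)
  show "ALL phi phit g H. test_function T phi phit g H -->
   (LBINT t:{0..T}. (LINT x|l t. phit t x+g t x \<bullet> b0 (t, x)+(1/2)*trace (H t x ** A0 (t, x)))) = 0"
   using fp_limit by blast
 qed simp

 have cost: "(LBINT t:{0..T}. LINT x|l t. f t x (l t) (b0 (t, x)) (A0 (t, x))) <= c0"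
  if c: "!!n. T*(LINT z|flow_law T (m n). f_along (m n) (z, ctrl n z)) <= c n" and c0: "c ----> c0" for c c0
 proof -
  define rhon where "rhon n om = f_along (m (r n)) (fst (X n om), ctrl (r n) (fst (X n om)))" for n om
  have rhon_meas[measurable]: "rhon n : borel_measurable Om" for n
   unfolding rhon_def[abs_def] ctrl_def
   by (rule measurable_compose[OF _ f_meas[of "r n"]]) measurable
  have rhon: "rhon n om = f (tn n om) (xn n om) (m (r n) (tn n om)) (fst (un n om)) (snd (un n om)) &
    abs(rhon n om) <= K2*(1+(norm (xn n om))^2) & snd (un n om) : sym_psd"
   if g: "ALL n. tn n om : {0..T} & un n om : F (tau (r n) (tn n om)) (xn n om) (m (r n) (tn n om)) &
    un n om = ctrl (r n) (fst (X n om))" for n om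
  proof -
   have tnT: "tn n om : {0..T}" and unF: "un n om : F (tau (r n) (tn n om)) (xn n om) (m (r n) (tn n om))"
    and unc: "un n om = ctrl (r n) (fst (X n om))" using g by blast+
   have psd: "snd (un n om) : sym_psd" by (rule psd_of_F[OF tau_range[OF tnT] ui[OF tnT] unF])
   have "rhon n om = f (tn n om) (xn n om) (m (r n) (tn n om)) (fst (un n om)) (snd (un n om))"
    unfolding rhon_def unc[symmetric] using tnT psd by (simp add: f_along_def tn_def xn_def)
   thus ?thesis using f_bound(2)[OF tnT ui[OF tnT] tau_range[OF tnT] unF] psd by simp
  qed
  have rhon_int: "integrable Om (rhon n)" for n
  proof (rule Bochner_Integration.integrable_bound)
   show "integrable Om (%om. K2*(1+(norm (xn n om))^2))" using xn2(1) by simp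
   show "AE om in Om. norm (rhon n om) <= norm (K2*(1+(norm (xn n om))^2))"
    using good by eventually_elim (use rhon f_bound(1) in \<open>auto simp: abs_mult\<close>)
  qed measurable
  have rho_bd: "AE om in Om. abs(rho om) <= K2*(1+(norm (x om))^2)"
   using AE_lim by eventually_elim (use rho_eq in blast)
  have rho_int: "integrable Om rho"
  proof (rule Bochner_Integration.integrable_bound)
   show "integrable Om (%om. K2*(1+(norm (x om))^2))" using x2(1) by simp
   show "AE om in Om. norm (rho om) <= norm (K2*(1+(norm (x om))^2))"
    using rho_bd by eventually_elim simp
  qed measurable
  have rhon_val: "(LINT om|Om. rhon n om) <= c (r n)/T" for n
  proof -
   have "(LINT om|Om. rhon n om) = (LINT z|distr Om borel (%om. fst (X n om)). f_along (m (r n)) (z, ctrl (r n) z))"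
    unfolding rhon_def by (rule integral_distr[symmetric]) (use f_meas[of "r n"] in \<open>auto simp: ctrl_def\<close>)
   thus ?thesis using c[of "r n"] T_pos unfolding fst_lawX by (simp add: field_simps)
  qed
  \<comment> \<open>Adding K2*(1+|x|^2) makes the integrands nonnegative for Fatou; the integrals of
    the added terms converge, so the addition cancels in the end.\<close>
  define p where "p om = rho om+K2*(1+(norm (x om))^2)" for om
  define pn where "pn n om = rhon n om+K2*(1+(norm (xn n om))^2)" for n om
  have x_meas[measurable]: "x : borel_measurable Om" unfolding x_def[abs_def] by measurable
  have xn_meas[measurable]: "xn n : borel_measurable Om" for n unfolding xn_def[abs_def] by measurable
  have p_int: "integrable Om p" unfolding p_def[abs_def] using rho_int x2(1) by auto
  have pn_int: "integrable Om (pn n)" for n unfolding pn_def[abs_def] using rhon_int xn2(1) by auto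
  have p0: "AE om in Om. 0 <= p om" using rho_bd by eventually_elim (simp add: p_def abs_le_iff)
  have pn0: "AE om in Om. 0 <= pn n om" for n using good
  proof eventually_elim
   case (elim om)
   thus ?case using rhon[OF elim, of n] by (simp add: pn_def abs_le_iff)
  qed
  define Q where "Q n = c (r n)/T+K2*(1+(LINT z|flow_law T (m (r n)). (norm (snd z))^2))" for n
  define Q0 where "Q0 = c0/T+K2*(1+(LINT z|flow_law T l. (norm (snd z))^2))"
  have Q_lim: "Q ----> Q0"
   unfolding Q_def[abs_def] Q0_def
   by (intro tendsto_intros LIMSEQ_subseq_LIMSEQ[OF c0 r, unfolded comp_def]
     LIMSEQ_subseq_LIMSEQ[OF second_moment_tendsto r, unfolded comp_def]) (use T_pos in auto)
  have pn_le: "(LINT om|Om. pn n om) <= Q n" for n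
  proof -
   have "(LINT om|Om. pn n om) = (LINT om|Om. rhon n om)+K2*(1+(LINT om|Om. (norm (xn n om))^2))"
    unfolding pn_def using rhon_int xn2(1) by (simp add: prob_space)
   thus ?thesis unfolding Q_def xn2(2)[symmetric] using rhon_val[of n] by simp
  qed
  have "ennreal (LINT om|Om. p om) = (\<integral>\<^sup>+om. ennreal (p om) \<partial>Om)"
   by (rule nn_integral_eq_integral[symmetric, OF p_int p0])
  also have "... <= (\<integral>\<^sup>+om. liminf (%n. ennreal (pn n om)) \<partial>Om)"
  proof (rule nn_integral_mono_AE)
   show "AE om in Om. ennreal (p om) <= liminf (%n. ennreal (pn n om))"
    using good AE_space
   proof eventually_elim
    case (elim om)
    note lf = limit_facts[OF elim(2,1)]
    have tnT: "tn n om : {0..T}" for n using elim by blast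
    have ev: "\<forall>\<^sub>F n in sequentially. y < pn n om" if y: "y < p om" for y
    proof -
     define eps where "eps = (p om-y)/2"
     have eps: "0 < eps" using y by (simp add: eps_def)
     have 1: "\<forall>\<^sub>F n in sequentially. rho om-eps < f (tn n om) (xn n om) (m (r n) (tn n om)) (fst (un n om)) (snd (un n om))"
     proof (rule f_eventually_greater[OF tnT _ lims(1,2)[OF elim(2)]])
      show "t om : {0..T}" "(%n. W2 (m (r n) (tn n om)) (l (t om))) ----> 0" using lf by blast+
      thus "l (t om) : P2" using ui_setD(1)[OF l_ui] by blast
      show "m (r n) (tn n om) : P2" for n by (rule ui_setD(1)[OF ui[OF tnT]])
      show "(%n. fst (un n om)) ----> fst (u om)" "(%n. snd (un n om)) ----> snd (u om)"
       by (intro tendsto_intros lims(3)[OF elim(2)])+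
      show "snd (un n om) : sym_psd" for n using rhon[OF elim(1)] by blast
      show "rho om-eps < f (t om) (x om) (l (t om)) (fst (u om)) (snd (u om))" using rho_eq[of om] lf eps by simp
     qed
     have "(%n. K2*(1+(norm (xn n om))^2)) ----> K2*(1+(norm (x om))^2)"
      by (intro tendsto_intros lims(2)[OF elim(2)])
     hence 2: "\<forall>\<^sub>F n in sequentially. K2*(1+(norm (x om))^2)-eps < K2*(1+(norm (xn n om))^2)"
      using eps by (intro order_tendstoD(1)) auto
     show ?thesis using 1 2
     proof eventually_elim
      case el: (elim n)
      have "y = p om-2*eps" by (simp add: eps_def field_simps)
      thus ?case using el rhon[OF elim(1), of n] by (simp add: p_def pn_def)
     qed
    qed
    show ?case
     unfolding le_Liminf_iff
    proof (intro allI impI)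
     fix y assume y: "y < ennreal (p om)"
     then obtain y' where y': "y = ennreal y'" "0 <= y'" by (cases y) auto
     have "y' < p om" using y y' by (simp add: ennreal_less_iff)
     from ev[OF this] show "\<forall>\<^sub>F n in sequentially. y < ennreal (pn n om)"
      by eventually_elim (simp add: y' ennreal_less_iff)
    qed
   qed
  qed
  also have "... <= liminf (%n. \<integral>\<^sup>+om. ennreal (pn n om) \<partial>Om)"
   by (rule nn_integral_liminf) (simp add: pn_def[abs_def])
  also have "... <= liminf (%n. ennreal (Q n))"
   using pn_le by (intro Liminf_mono always_eventually allI) (simp add: nn_integral_eq_integral[OF pn_int pn0] ennreal_leI)
  also have "... = ennreal Q0"
   by (rule lim_imp_Liminf) (auto intro: tendsto_ennrealI Q_lim)
  finally have "ennreal (LINT om|Om. p om) <= ennreal Q0" .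
  moreover have "0 <= Q0"
  proof (rule LIMSEQ_le_const[OF Q_lim], intro exI allI impI)
   fix n
   have "0 <= (LINT om|Om. pn n om)" using pn0 by (rule integral_nonneg_AE)
   thus "0 <= Q n" using pn_le[of n] by linarith
  qed
  ultimately have "(LINT om|Om. p om) <= Q0" by simp
  moreover have "(LINT om|Om. p om) = (LINT om|Om. rho om)+K2*(1+(LINT om|Om. (norm (x om))^2))"
   unfolding p_def using rho_int x2(1) by (simp add: prob_space)
  ultimately have Erho: "(LINT om|Om. rho om) <= c0/T" unfolding Q0_def x2(2) by simp
  \<comment> \<open>The coefficient (0,1) picks out the cost component, whose conditional
    expectation dominates the running cost of \<open>b0\<close> and \<open>A0\<close> by the
    epigraph constraint.\<close>
  have "(LINT om|Om. rho om) = (LINT om|Om. (0, 1) \<bullet> V om)" by (simp add: V_def inner_prod_def)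
  also have "... = (LINT z|flow_law T l. (0, 1) \<bullet> h z)"
   unfolding fst_lawY[symmetric] by (rule cond[of "%_. (0, 1)" 1]) (auto simp: norm_prod_def)
  also have "... = (LINT z|flow_law T l. snd (h z))" by (simp add: inner_prod_def)
  finally have Eh: "(LINT z|flow_law T l. snd (h z)) <= c0/T" using Erho by simp
  have h2_int: "integrable (flow_law T l) (%z. snd (h z))"
  proof (rule Bochner_Integration.integrable_bound[OF integrable_norm[OF h_int']])
   show "(%z. snd (h z)) : borel_measurable (flow_law T l)" by (simp add: measurable_cong_sets[OF setsL refl])
   show "AE z in flow_law T l. norm (snd (h z)) <= norm (norm (h z))"
   proof (intro AE_I2)
    fix z
    show "norm (snd (h z)) <= norm (norm (h z))" using norm_snd_le[of "snd (h z)" "fst (h z)"] by simp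
   qed
  qed
  have fl_meas: "(%z. f_along l (z, (b0 z, A0 z))) : borel_measurable (flow_law T l)"
  proof -
   have "(%z. (z, (b0 z, A0 z))) : borel \<rightarrow>\<^sub>M borel" by (intro borel_measurable_Pair) measurable
   from measurable_compose[OF this f_along_measurable[OF l_flow]]
   show ?thesis by (simp add: measurable_cong_sets[OF setsL refl])
  qed
  have fl_int: "integrable (flow_law T l) (%z. f_along l (z, (b0 z, A0 z)))"
  proof (rule Bochner_Integration.integrable_bound[OF _ fl_meas])
   interpret L: prob_space "flow_law T l" by (rule flow_law_prob[OF T_pos l_kern])
   show "integrable (flow_law T l) (%z. K2*(1+(norm (snd z))^2))" using second_moment(3) by simp
   show "AE z in flow_law T l. norm (f_along l (z, (b0 z, A0 z))) <= norm (K2*(1+(norm (snd z))^2))"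
    using h_good
   proof eventually_elim
    case (elim z)
    have tz: "fst z : {0..T}" and F: "(b0 z, A0 z) : F (fst z) (snd z) (l (fst z))" using elim by blast+
    show ?case using f_bound(2)[OF tz l_ui[OF tz] tz F] tz A0_psd f_bound(1) by (simp add: f_along_def abs_mult)
   qed
  qed
  have "(LBINT t:{0..T}. LINT x|l t. f t x (l t) (b0 (t, x)) (A0 (t, x))) =
    (LBINT t:{0..T}. LINT x|l t. f_along l ((t, x), (b0 (t, x), A0 (t, x))))"
   by (rule set_lebesgue_integral_cong) (auto simp: f_along_def A0_psd)
  also have "... = T*(LINT z|flow_law T l. f_along l (z, (b0 z, A0 z)))"
   by (rule integral_flow_law(1)[OF T_pos l_kern fl_int])
  also have "... <= T*(LINT z|flow_law T l. snd (h z))"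
  proof (rule mult_left_mono)
   show "(LINT z|flow_law T l. f_along l (z, (b0 z, A0 z))) <= (LINT z|flow_law T l. snd (h z))"
    using h_good by (intro integral_mono_AE fl_int h2_int) (auto elim: eventually_mono)
  qed (use T_pos in simp)
  also have "... <= T*(c0/T)" using Eh T_pos by (intro mult_left_mono) auto
  finally show ?thesis using T_pos by simp
 qed
 show ?thesis using adm cost by (intro exI[of _ "%t x. b0 (t, x)"] exI[of _ "%t x. A0 (t, x)"]) blast
qed

end

subsection \<open>Consequences of a weak differential equation in time\<close>

lemma DERIV_pos_part_power:
 "((%y::real. (max 0 y)^Suc (Suc n)) has_real_derivative real (Suc (Suc n))*(max 0 y)^Suc n) (at y)"
proof (cases y "0::real" rule: linorder_cases)
 case less
 hence "\<forall>\<^sub>F x in nhds y. x < 0" by (intro order_tendstoD(2)[OF filterlim_ident])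
 hence ev: "\<forall>\<^sub>F x in nhds y. (max 0 x)^Suc (Suc n) = 0" by eventually_elim simp
 show ?thesis using less by (subst DERIV_cong_ev[OF refl ev refl]) (simp add: max_def)
next
 case greater
 hence "\<forall>\<^sub>F x in nhds y. 0 < x" by (intro order_tendstoD(1)[OF filterlim_ident])
 hence ev: "\<forall>\<^sub>F x in nhds y. (max 0 x)^Suc (Suc n) = x^Suc (Suc n)" by eventually_elim simp
 have "((%y. y^Suc (Suc n)) has_real_derivative real (Suc (Suc n))*y^Suc n) (at y)"
  using DERIV_pow[of "Suc (Suc n)" y] by simp
 thus ?thesis using greater by (subst DERIV_cong_ev[OF refl ev refl]) (simp add: max_def)
next
 case equal
 have "((%h. ((max 0 (0+h))^Suc (Suc n)-(max 0 0)^Suc (Suc n))/h) \<longlongrightarrow> 0) (at (0::real))"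
 proof (rule Lim_null_comparison)
  show "\<forall>\<^sub>F h in at (0::real). norm (((max 0 (0+h))^Suc (Suc n)-(max 0 0)^Suc (Suc n))/h) <= abs h^Suc n"
  proof (intro eventuallyI)
   fix h :: real
   have "(max 0 h)^Suc (Suc n) <= abs h^Suc (Suc n)" by (intro power_mono) auto
   thus "norm (((max 0 (0+h))^Suc (Suc n)-(max 0 0)^Suc (Suc n))/h) <= abs h^Suc n"
    by (cases "h = 0") (auto simp: field_simps)
  qed
  have "((%h. abs h^Suc n) \<longlongrightarrow> abs 0^Suc n) (at (0::real))" by (intro tendsto_intros)
  thus "((%h. abs h^Suc n) \<longlongrightarrow> 0) (at (0::real))" by simp
 qed
 thus ?thesis unfolding DERIV_def equal by simp
qed

text \<open>A C^1 passage from 0 to 1 over [0,1], made of two parabolas; its derivative is the hat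
  of height 2 and integral 1, which serves as an averaging kernel.\<close>

definition smooth_step :: "real => real" where
 "smooth_step y = 2*((max 0 y)^2-2*(max 0 (y-1/2))^2+(max 0 (y-1))^2)"

definition smooth_step' :: "real => real" where
 "smooth_step' y = 4*(max 0 y-2 * max 0 (y-1/2)+max 0 (y-1))"

lemma smooth_step_deriv: "(smooth_step has_real_derivative smooth_step' y) (at y)"
proof -
 have sq: "((%y::real. (max 0 (y - c))^2) has_real_derivative 2 * max 0 (y - c)) (at y)" for c y
  using DERIV_shift[of "%y. (max 0 y)^2" "2 * max 0 (y - c)" y "- c"] DERIV_pos_part_power[of 0 "y - c"]
  by (simp add: numeral_2_eq_2)
 have "((%y. 2*((max 0 (y-0))^2-2*(max 0 (y-1/2))^2+(max 0 (y-1))^2)) has_real_derivative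
  2*(2 * max 0 (y-0)-2*(2 * max 0 (y-1/2))+2 * max 0 (y-1))) (at y)"
  by (intro DERIV_cmult DERIV_add DERIV_diff sq)
 thus ?thesis unfolding smooth_step_def[abs_def] smooth_step'_def by (simp add: algebra_simps)
qed

lemma smooth_step_props:
 "0 <= smooth_step y" "smooth_step y <= 1" "y <= 0 ==> smooth_step y = 0" "1 <= y ==> smooth_step y = 1"
 "0 <= smooth_step' y" "y <= 0 ==> smooth_step' y = 0" "1 <= y ==> smooth_step' y = 0"
proof -
 consider "y <= 0" | "0 < y" "y <= 1/2" | "1/2 < y" "y <= 1" | "1 < y" by linarith
 hence "0 <= smooth_step y & smooth_step y <= 1 & 0 <= smooth_step' y"
 proof cases
  case 1
  thus ?thesis by (simp add: smooth_step_def smooth_step'_def)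
 next
  case 2
  have "y^2 <= (1/2)^2" using 2 by (intro power_mono) auto
  thus ?thesis using 2 by (simp add: smooth_step_def smooth_step'_def power2_eq_square)
 next
  case 3
  have "smooth_step y = 1-2*(1-y)^2"
   using 3 by (simp add: smooth_step_def power2_eq_square algebra_simps)
  moreover have "(1-y)^2 <= (1/2)^2" using 3 by (intro power_mono) auto
  ultimately show ?thesis using 3 by (simp add: smooth_step'_def power2_eq_square)
 next
  case 4
  thus ?thesis by (simp add: smooth_step_def smooth_step'_def power2_eq_square algebra_simps)
 qed
 thus "0 <= smooth_step y" "smooth_step y <= 1" "0 <= smooth_step' y" by auto
 show "y <= 0 ==> smooth_step y = 0" "y <= 0 ==> smooth_step' y = 0"
  by (simp_all add: smooth_step_def smooth_step'_def)
 show "1 <= y ==> smooth_step y = 1" "1 <= y ==> smooth_step' y = 0"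
  by (simp_all add: smooth_step_def smooth_step'_def power2_eq_square algebra_simps)
qed

lemma continuous_on_smooth_step' [continuous_intros]:
 fixes f :: "'a::t2_space => real"
 shows "continuous_on S f ==> continuous_on S (%x. smooth_step' (f x))"
 unfolding smooth_step'_def by (intro continuous_intros)

lemma smooth_step_scaled_deriv:
 assumes "0 < eps"
 shows "((%r. smooth_step ((r-s)/eps)) has_real_derivative smooth_step' ((r-s)/eps)/eps) (at r)"
proof -
 have "((%r. (r-s)/eps) has_real_derivative 1/eps) (at r)"
  using assms by (auto intro!: derivative_eq_intros)
 from DERIV_chain2[OF smooth_step_deriv this] show ?thesis by simp
qed

lemma smooth_step_average:
 fixes U :: "real => real"
 assumes U: "continuous_on {0..T} U" and s: "0 <= s" "0 < eps" "s+eps <= T"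
  and osc: "!!r. s <= r ==> r <= s+eps ==> abs(U r-U s) <= eta"
 shows "abs((LBINT r:{0..T}. smooth_step' ((r-s)/eps)/eps*U r)-U s) <= eta"
proof -
 define k where "k r = smooth_step' ((r-s)/eps)/eps" for r
 have k_cont: "continuous_on S k" for S unfolding k_def using s by (intro continuous_intros) auto
 have k0: "0 <= k r" for r using s smooth_step_props(5) by (simp add: k_def)
 have k_out: "k r = 0" if "r <= s | s+eps <= r" for r
  using that s smooth_step_props(6,7)[of "(r-s)/eps"] by (auto simp: k_def field_simps)
 have k_int: "(LBINT r:{0..T}. k r) = 1"
 proof -
  have d: "((%r. smooth_step ((r-s)/eps)) has_real_derivative k r) (at r)" for r
   unfolding k_def using s by (intro smooth_step_scaled_deriv)
  have "(LINT r|lborel. k r*indicator {0..T} r) = smooth_step ((T-s)/eps)-smooth_step ((0-s)/eps)"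
   using s d k_cont[of UNIV] by (intro integral_FTC_Icc_real) (auto simp: continuous_on_eq_continuous_at)
  also have "... = 1"
   using s smooth_step_props(3)[of "(0-s)/eps"] smooth_step_props(4)[of "(T-s)/eps"] by (simp add: field_simps)
  finally show ?thesis by (simp add: set_lebesgue_integral_def mult.commute)
 qed
 have kU: "set_integrable lborel {0..T} (%r. k r*U r)" and ks: "set_integrable lborel {0..T} (%r. k r*c)" for c
  by (intro borel_integrable_atLeastAtMost' continuous_intros k_cont U)+
 have kdd: "set_integrable lborel {0..T} (%r. k r*(U r-U s))"
  by (intro borel_integrable_atLeastAtMost' continuous_intros k_cont U)
 have "(LBINT r:{0..T}. k r*U r)-U s = (LBINT r:{0..T}. k r*U r)-(LBINT r:{0..T}. k r*U s)"
  using k_int by (simp add: set_integral_mult_left)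
 also have "... = (LBINT r:{0..T}. k r*(U r-U s))"
  using set_integral_diff(2)[OF kU ks] by (simp add: right_diff_distrib)
 finally have "abs((LBINT r:{0..T}. k r*U r)-U s) = abs(LBINT r:{0..T}. k r*(U r-U s))" by simp
 also have "... <= (LBINT r:{0..T}. k r*eta)"
  unfolding set_lebesgue_integral_def
 proof (rule order.trans[OF integral_abs_bound integral_mono])
  show "integrable lborel (%r. abs(indicator {0..T} r*\<^sub>R (k r*(U r-U s))))"
   "integrable lborel (%r. indicator {0..T} r*\<^sub>R (k r*eta))"
   using kdd ks[of eta] unfolding set_integrable_def by (auto intro: integrable_abs)
  show "abs(indicator {0..T} r*\<^sub>R (k r*(U r-U s))) <= indicator {0..T} r*\<^sub>R (k r*eta)" for r
   using osc[of r] k0[of r] k_out[of r]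
   by (cases "s <= r & r <= s+eps") (auto simp: abs_mult indicator_def intro: mult_left_mono)
 qed
 also have "... = eta" using k_int by (simp add: set_integral_mult_left)
 finally show ?thesis unfolding k_def .
qed

text \<open>Testing with a step up at \<open>s\<close> minus a step up at \<open>t\<close> yields
  averages of \<open>U\<close> just after \<open>s\<close> and \<open>t\<close>. Since the test
  functions must vanish near 0 and T, interior times are treated first and the endpoints by
  continuity.\<close>

lemma weak_derivative_bound:
 fixes U v D :: "real => real"
 assumes T: "0 < T" and U: "continuous_on {0..T} U" and D: "continuous_on {0..T} D"
  and v: "set_borel_measurable lborel {0..T} v" and vD: "AE r in lborel. r : {0..T} --> abs(v r) <= D r"
  and weak: "!!zt zt' a c. (!!r. (zt has_real_derivative zt' r) (at r)) ==> continuous_on UNIV zt' ==> 0 < a ==> c < T ==>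
   (!!r. r ~: {a..c} ==> zt r = 0 & zt' r = 0) ==>
   (LBINT r:{0..T}. zt' r*U r)+(LBINT r:{0..T}. zt r * v r) = 0"
  and st: "0 <= s" "s <= t" "t <= T"
 shows "abs(U t-U s) <= integral {s..t} D"
proof -
 have "bounded (D ` {0..T})" by (intro compact_imp_bounded compact_continuous_image D compact_Icc)
 then obtain B where B: "0 < B" "!!r. r : {0..T} ==> abs(D r) <= B" by (auto simp: bounded_pos)
 define Di where "Di r = integral {0..r} D" for r
 have D_int: "D integrable_on {a..c}" if "0 <= a" "c <= T" for a c
  by (rule integrable_continuous_interval[OF continuous_on_subset[OF D]]) (use that in auto)
 have Di: "integral {a..c} D = Di c-Di a" if "0 <= a" "a <= c" "c <= T" for a c
 proof -
  have "integral {0..a} D+integral {a..c} D = integral {0..c} D"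
   by (rule Henstock_Kurzweil_Integration.integral_combine) (use that D_int in auto)
  thus ?thesis by (simp add: Di_def)
 qed
 have Di_cont: "continuous_on {0..T} Di"
  unfolding Di_def[abs_def] by (rule indefinite_integral_continuous_1[OF D_int]) auto
 have interior: "abs(U t-U s) <= integral {s..t} D" if "0 < s" "s < t" "t < T" for s t
 proof (rule field_le_epsilon)
  fix e :: real assume "0 < e"
  define eta where "eta = e/3"
  have eta: "0 < eta" using `0 < e` by (simp add: eta_def)
  have osc: "EX d>0. ALL r. abs(r-p) < d --> r : {0..T} --> abs(U r-U p) <= eta" if "p : {0..T}" for p
   using U that eta unfolding continuous_on_iff dist_real_def by (metis less_imp_le)
  have "s : {0..T}" "t : {0..T}" using that by auto
  obtain d1 where d1: "0 < d1" "!!r. abs(r-s) < d1 ==> r : {0..T} ==> abs(U r-U s) <= eta" using osc[OF `s : {0..T}`] by blast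
  obtain d2 where d2: "0 < d2" "!!r. abs(r-t) < d2 ==> r : {0..T} ==> abs(U r-U t) <= eta" using osc[OF `t : {0..T}`] by blast
  \<comment> \<open>Small enough for the oscillation of \<open>U\<close> at both times, for the
    second step to end before T, and for the overhang of length \<open>eps\<close>, where
    \<open>D\<close> is at most \<open>B\<close>, to cost at most \<open>eta\<close>.\<close>
  define eps where "eps = Min {d1/2, d2/2, (T-t)/2, eta/B}"
  have eps: "0 < eps" "eps < d1" "eps < d2" "t+eps < T" "eps*B <= eta"
  proof -
   have le: "eps <= d1/2" "eps <= d2/2" "eps <= (T-t)/2" "eps <= eta/B" unfolding eps_def by (intro Min_le; simp)+
   show "0 < eps" unfolding eps_def using d1 d2 that eta B by auto
   show "eps < d1" "eps < d2" "t+eps < T" "eps*B <= eta" using le d1(1) d2(1) that B by (simp_all add: pos_le_divide_eq del: Min_insert)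
  qed
  define zt where "zt r = smooth_step ((r-s)/eps)-smooth_step ((r-t)/eps)" for r
  define k where "k p r = smooth_step' ((r-p)/eps)/eps" for p r
  have k_cont: "continuous_on S (k p)" for p S unfolding k_def using eps by (intro continuous_intros) auto
  note ord = that
  have out: "zt r = 0 & k s r-k t r = 0" if r: "r ~: {s..t+eps}" for r
  proof -
   consider "r < s" | "t+eps < r" using r by force
   thus ?thesis
   proof cases
    case 1
    hence "(r-s)/eps <= 0" "(r-t)/eps <= 0" using ord eps by (auto simp: field_simps)
    thus ?thesis by (simp add: zt_def k_def smooth_step_props)
   next
    case 2
    hence "1 <= (r-s)/eps" "1 <= (r-t)/eps" using ord eps by (auto simp: field_simps)
    thus ?thesis by (simp add: zt_def k_def smooth_step_props)
   qed
  qed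
  have z: "(LBINT r:{0..T}. (k s r-k t r)*U r)+(LBINT r:{0..T}. zt r * v r) = 0"
  proof (rule weak[where a=s and c="t+eps"])
   show "(zt has_real_derivative k s r-k t r) (at r)" for r
    unfolding k_def zt_def[abs_def] using eps by (intro DERIV_diff smooth_step_scaled_deriv)
   show "continuous_on UNIV (%r. k s r-k t r)" by (intro continuous_intros k_cont)
   show "0 < s" "t+eps < T" using that eps by auto
  qed (rule out)
  have ki: "set_integrable lborel {0..T} (%r. k p r*U r)" for p
   by (intro borel_integrable_atLeastAtMost' continuous_intros k_cont U)
  have split: "(LBINT r:{0..T}. (k s r-k t r)*U r) = (LBINT r:{0..T}. k s r*U r)-(LBINT r:{0..T}. k t r*U r)"
   using set_integral_diff(2)[OF ki ki] by (simp add: left_diff_distrib)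
  have 1: "abs((LBINT r:{0..T}. k s r*U r)-U s) <= eta"
   unfolding k_def by (rule smooth_step_average[OF U]) (use that eps in \<open>auto intro!: d1(2)\<close>)
  have 2: "abs((LBINT r:{0..T}. k t r*U r)-U t) <= eta"
   unfolding k_def by (rule smooth_step_average[OF U]) (use that eps in \<open>auto intro!: d2(2)\<close>)
  have mono: "smooth_step x <= smooth_step y" if "x <= y" for x y
   by (rule DERIV_nonneg_imp_nondecreasing[OF that]) (use smooth_step_deriv smooth_step_props(5) in blast)
  have zt01: "0 <= zt r" "zt r <= 1" for r
   using mono[of "(r-t)/eps" "(r-s)/eps"] that eps smooth_step_props(1)[of "(r-t)/eps"]
    smooth_step_props(2)[of "(r-s)/eps"] by (simp_all add: zt_def divide_right_mono)
  have siD: "set_integrable lborel {s..t+eps} D"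
   by (rule borel_integrable_atLeastAtMost'[OF continuous_on_subset[OF D]]) (use that eps in auto)
  have "abs(LBINT r:{0..T}. zt r * v r) <= (LBINT r:{s..t+eps}. D r)"
  proof -
   have "abs(LBINT r:{0..T}. zt r * v r) <= (LINT r|lborel. abs(indicator {0..T} r*\<^sub>R (zt r * v r)))"
    unfolding set_lebesgue_integral_def by (rule integral_abs_bound)
   also have "... <= (LINT r|lborel. indicator {s..t+eps} r*\<^sub>R D r)"
   proof (rule integral_mono_AE')
    show "integrable lborel (%r. indicator {s..t+eps} r*\<^sub>R D r)" using siD by (simp add: set_integrable_def)
    show "AE r in lborel. abs(indicator {0..T} r*\<^sub>R (zt r * v r)) <= indicator {s..t+eps} r*\<^sub>R D r"
     using vD
    proof eventually_elim
     case (elim r)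
     show ?case
     proof (cases "r : {s..t+eps}")
      case True
      hence rT: "r : {0..T}" using that eps by auto
      have "abs(zt r * v r) <= 1*D r"
       unfolding abs_mult using elim rT zt01(1,2)[of r] by (intro mult_mono) auto
      thus ?thesis using True rT by simp
     next
      case False
      thus ?thesis using out[OF False] by simp
     qed
    qed
    show "AE r in lborel. 0 <= indicator {s..t+eps} r*\<^sub>R D r"
     using vD by eventually_elim (use that eps in \<open>auto simp: indicator_def\<close>)
   qed
   finally show ?thesis by (simp add: set_lebesgue_integral_def)
  qed
  also have "... = integral {s..t+eps} D" by (rule set_borel_integral_eq_integral(2)[OF siD])
  also have "... = integral {s..t} D+integral {t..t+eps} D"
   using Di[of s "t+eps"] Di[of s t] Di[of t "t+eps"] that eps by simp
  also have "integral {t..t+eps} D <= eps*B"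
  proof -
   have "integral {t..t+eps} D <= integral {t..t+eps} (%_. B)"
    by (rule integral_le[OF D_int]) (use that eps B(2) in \<open>auto simp: abs_le_iff\<close>)
   thus ?thesis using eps by simp
  qed
  finally have 3: "abs(LBINT r:{0..T}. zt r * v r) <= integral {s..t} D+eta" using eps(5) by simp
  have "U t-U s = (LBINT r:{0..T}. zt r * v r)+((LBINT r:{0..T}. k s r*U r)-U s)-((LBINT r:{0..T}. k t r*U r)-U t)"
   using z split by simp
  thus "abs(U t-U s) <= integral {s..t} D+e"
   using 1 2 3 unfolding eta_def by linarith
 qed
 have cont2: "continuous_on {0..T} (%r. U r)" "continuous_on {0..T} (%r. Di r)" by (fact U, fact Di_cont)
 show ?thesis
 proof (cases "s = t")
  case True
  thus ?thesis by simp
 next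
  case False
  hence st': "s < t" using st by simp
  \<comment> \<open>At most a third of the interval, so the shrunken endpoints keep their
    order.\<close>
  define q where "q n = (t-s)/(real n+3)" for n
  define sn where "sn n = s+q n" for n
  define tn where "tn n = t-q n" for n
  have z0: "q ----> 0"
   unfolding q_def[abs_def]
   by (rule real_tendsto_divide_at_top[OF tendsto_const filterlim_at_top_mono[OF filterlim_real_sequentially]]) auto
  have sn_lim: "sn ----> s" unfolding sn_def[abs_def] using tendsto_add[OF tendsto_const z0, of s] by simp
  have tn_lim: "tn ----> t" unfolding tn_def[abs_def] using tendsto_diff[OF tendsto_const z0, of t] by simp
  have frac: "0 < q n" "q n <= (t-s)/3" for n
  proof -
   show "0 < q n" using st' by (simp add: q_def)
   show "q n <= (t-s)/3" unfolding q_def using st' by (intro divide_left_mono) simp_all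
  qed
  have ord: "0 < sn n" "sn n < tn n" "tn n < T" "sn n : {0..T}" "tn n : {0..T}" for n
   using frac[of n] st st' unfolding sn_def tn_def by auto
  have le: "abs(U (tn n)-U (sn n)) <= Di (tn n)-Di (sn n)" for n
   using interior[OF ord(1,2,3), of n] Di[of "sn n" "tn n"] ord[of n] by simp
  have "(%n. abs(U (tn n)-U (sn n))) ----> abs(U t-U s)"
   by (intro tendsto_intros continuous_on_tendsto_compose[OF cont2(1) tn_lim] continuous_on_tendsto_compose[OF cont2(1) sn_lim])
    (use st ord in auto)
  moreover have "(%n. Di (tn n)-Di (sn n)) ----> Di t-Di s"
   by (intro tendsto_intros continuous_on_tendsto_compose[OF cont2(2) tn_lim] continuous_on_tendsto_compose[OF cont2(2) sn_lim])
    (use st ord in auto)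
  ultimately have "abs(U t-U s) <= Di t-Di s" by (rule LIMSEQ_le) (use le in auto)
  thus ?thesis using Di[of s t] st by simp
 qed
qed

text \<open>With z the right-hand side of the integral inequality, z(t)*exp(-K*t) has a nonpositive
  derivative.\<close>

lemma Gronwall_integral:
 fixes y :: "real => real"
 assumes y: "continuous_on {0..T} y" and "0 <= K"
  and le: "!!t. t : {0..T} ==> y t <= a+K*integral {0..t} y" and t: "t : {0..T}" and a: "0 <= a"
 shows "y t <= a*exp (K*T)"
proof -
 define z where "z t = a+K*integral {0..t} y" for t
 define w where "w t = z t*exp (- K*t)" for t
 have w_cont: "continuous_on {0..T} w"
  unfolding w_def z_def
  by (intro continuous_intros indefinite_integral_continuous_1 integrable_continuous_interval y)
 have "w t <= w 0"
 proof (cases "t = 0")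
  case False
  show ?thesis
  proof (rule DERIV_nonpos_imp_decreasing_open[where f=w and a=0 and b=t])
   show "0 <= t" using t False by simp
   show "continuous_on {0..t} w" by (rule continuous_on_subset[OF w_cont]) (use t in auto)
   fix x assume x: "0 < x" "x < t"
   hence xT: "x : {0..T}" "x : interior {0..T}" using t by auto
   have "((%u. integral {0..u} y) has_real_derivative y x) (at x within {0..T})"
    by (rule integral_has_real_derivative[OF y xT(1)])
   hence d: "((%u. integral {0..u} y) has_real_derivative y x) (at x)"
    using at_within_interior[OF xT(2)] by simp
   have "(w has_real_derivative (K*y x)*exp (- K*x)+z x*(exp (- K*x) * - K)) (at x)"
    unfolding w_def[abs_def] z_def by (auto intro!: derivative_eq_intros d)
   moreover have "(K*y x)*exp (- K*x)+z x*(exp (- K*x) * - K) = K*exp (- K*x)*(y x-z x)"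
    by (simp add: algebra_simps)
   moreover have "... <= 0" using le[OF xT(1)] `0 <= K` by (intro mult_nonneg_nonpos) (auto simp: z_def)
   ultimately show "EX y. (w has_real_derivative y) (at x) & y <= 0" by auto
  qed
 qed simp
 hence "z t*exp (- K*t) <= a" by (simp add: w_def z_def)
 hence "z t*exp (- K*t)*exp (K*t) <= a*exp (K*t)" by (rule mult_right_mono) simp
 hence "z t <= a*exp (K*t)" by (simp add: mult.assoc exp_add[symmetric])
 also have "... <= a*exp (K*T)" using a t `0 <= K` by (intro mult_left_mono) (auto intro: mult_left_mono)
 finally show ?thesis using le[OF t] by (simp add: z_def)
qed

subsection \<open>Radial test functions\<close>

definition outer :: "real^'d => real^'d^'d" where
 "outer v = (\<chi> i j. v $ i * v $ j)"

lemma outer_mult_vec: "outer v *v h = (v \<bullet> h)*\<^sub>R v"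
 by (simp add: vec_eq_iff outer_def matrix_vector_mult_def inner_vec_def sum_distrib_right sum_distrib_left mult_ac)

lemma norm_outer: "norm (outer v) = (norm v)^2"
proof -
 have "(norm (outer v))^2 = (\<Sum>i\<in>UNIV. \<Sum>j\<in>UNIV. (v $ i)^2*(v $ j)^2)"
  by (simp add: norm_matrix_eq_Frobenius outer_def power_mult_distrib sum_nonneg)
 also have "... = (\<Sum>i\<in>UNIV. (v $ i)^2)*(\<Sum>j\<in>UNIV. (v $ j)^2)" by (simp add: sum_product)
 also have "... = ((norm v)^2)^2" by (simp add: norm_vec_def L2_set_def sum_nonneg power2_eq_square)
 finally show ?thesis by (rule power2_eq_imp_eq) auto
qed

lemma continuous_on_outer [continuous_intros]:
 fixes f :: "'a::topological_space => real^'d"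
 shows "continuous_on S f ==> continuous_on S (%x. outer (f x))"
 unfolding outer_def by (intro continuous_intros)

text \<open>Profiles are functions of |x|^2 rather than of |x|, which keeps them smooth at the
  origin; the chain rule gives a multiple of the identity plus a rank-one matrix.\<close>

definition radial_hess :: "(real => real) => (real => real) => real^'d => real^'d^'d" where
 "radial_hess th' th'' v = (2*th' ((norm v)^2))*\<^sub>R mat 1+(4*th'' ((norm v)^2))*\<^sub>R outer v"

definition radial_grad :: "(real => real) => real^'d => real^'d" where
 "radial_grad th' v = (2*th' ((norm v)^2))*\<^sub>R v"

lemma radial_generator_bound:
 fixes v be :: "real^'d" and Sg :: "real^'d^'d"
 defines "r \<equiv> (norm v)^2"
 shows "\<bar>generator (radial_grad th' v) (radial_hess th' th'' v) be Sg\<bar> <=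
  2*\<bar>th' r\<bar>*norm v * norm be+(\<bar>th' r\<bar>*norm (mat 1 :: real^'d^'d)+2*r*\<bar>th'' r\<bar>)*norm Sg"
proof -
 have t: "transpose (radial_hess th' th'' v) = radial_hess th' th'' v"
  by (simp add: radial_hess_def outer_def transpose_def vec_eq_iff mat_def mult.commute)
 have "norm (radial_hess th' th'' v) <= norm ((2*th' r)*\<^sub>R (mat 1 :: real^'d^'d))+norm ((4*th'' r)*\<^sub>R outer v)"
  unfolding radial_hess_def r_def by (rule norm_triangle_ineq)
 also have "... = 2*(\<bar>th' r\<bar>*norm (mat 1 :: real^'d^'d)+2*r*\<bar>th'' r\<bar>)"
  by (simp add: norm_outer abs_mult r_def)
 finally have "norm (transpose (radial_hess th' th'' v))*norm Sg <=
   (2*(\<bar>th' r\<bar>*norm (mat 1 :: real^'d^'d)+2*r*\<bar>th'' r\<bar>))*norm Sg"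
  unfolding t by (rule mult_right_mono) simp
 hence "norm (transpose (radial_hess th' th'' v))*norm Sg/2 <=
   (\<bar>th' r\<bar>*norm (mat 1 :: real^'d^'d)+2*r*\<bar>th'' r\<bar>)*norm Sg" by (simp only: mult.assoc)
 moreover have "norm (radial_grad th' v)*norm be = 2*\<bar>th' r\<bar>*norm v * norm be" by (simp add: radial_grad_def r_def abs_mult)
 ultimately show ?thesis
  using generator_bound[of "radial_grad th' v" "radial_hess th' th'' v" be Sg] unfolding r_def by linarith
qed

definition radial_C2 :: "(real => real) => (real => real) => (real => real) => real => bool" where
 "radial_C2 th th' th'' c \<longleftrightarrow> 0 <= c &
  (ALL r>=0. (th has_real_derivative th' r) (at r) & (th' has_real_derivative th'' r) (at r)) &
  continuous_on {0..} th'' & (ALL r>=c. th r = 0 & th' r = 0 & th'' r = 0)"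

context
 fixes th th' th'' :: "real => real" and c :: real
 assumes rad: "radial_C2 th th' th'' c"
begin

lemma radial_C2_D:
 "0 <= c" "0 <= r ==> (th has_real_derivative th' r) (at r)" "0 <= r ==> (th' has_real_derivative th'' r) (at r)"
 "continuous_on {0..} th''" "c <= r ==> th r = 0 & th' r = 0 & th'' r = 0"
 using rad unfolding radial_C2_def by auto

lemma radial_continuous: "continuous_on {0..} th" "continuous_on {0..} th'"
 by (auto intro!: continuous_at_imp_continuous_on DERIV_isCont radial_C2_D(2,3))

lemma radial_bound: obtains B where "0 <= B" "!!r. 0 <= r ==> abs(th r) <= B & abs(th' r) <= B & abs(th'' r) <= B"
proof -
 have bnd: "EX B>=0. ALL r>=0. abs(f r) <= B" if f: "continuous_on {0..} f" "!!r. c <= r ==> f r = 0" for f :: "real => real"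
 proof -
  have "bounded (f ` {0..c})"
   by (intro compact_imp_bounded compact_continuous_image continuous_on_subset[OF f(1)] compact_Icc) auto
  then obtain B where "0 < B" "!!r. r : {0..c} ==> abs(f r) <= B" by (auto simp: bounded_pos)
  hence "abs(f r) <= B" if "0 <= r" for r using f(2)[of r] that by (cases "c <= r") auto
  thus ?thesis using `0 < B` by (intro exI[of _ B]) auto
 qed
 obtain B0 where B0: "B0 >= 0" "ALL r>=0. abs(th r) <= B0"
  using bnd[OF radial_continuous(1)] radial_C2_D(5) by blast
 obtain B1 where B1: "B1 >= 0" "ALL r>=0. abs(th' r) <= B1"
  using bnd[OF radial_continuous(2)] radial_C2_D(5) by blast
 obtain B2 where B2: "B2 >= 0" "ALL r>=0. abs(th'' r) <= B2"
  using bnd[OF radial_C2_D(4)] radial_C2_D(5) by blast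
 show thesis
 proof (rule that[of "B0+B1+B2"])
  fix r :: real assume "0 <= r"
  hence "abs(th r) <= B0" "abs(th' r) <= B1" "abs(th'' r) <= B2" using B0 B1 B2 by auto
  thus "abs(th r) <= B0+B1+B2 & abs(th' r) <= B0+B1+B2 & abs(th'' r) <= B0+B1+B2"
   using B0(1) B1(1) B2(1) by auto
 qed (use B0 B1 B2 in auto)
qed

lemma radial_gderiv: "GDERIV (%x::real^'d. th ((norm (x-a))^2)) x :> radial_grad th' (x-a)"
proof -
 have q: "((%x. (norm (x-a))^2) has_derivative (%h. 2*((x-a) \<bullet> h))) (at x)"
  unfolding power2_norm_eq_inner by (auto intro!: derivative_eq_intros simp: inner_commute)
 have "(th has_derivative (%y. th' ((norm (x-a))^2)*y)) (at ((norm (x-a))^2))"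
  using radial_C2_D(2)[of "(norm (x-a))^2"] by (simp add: has_field_derivative_def)
 from has_derivative_compose[OF q this] show ?thesis
  unfolding gderiv_def radial_grad_def by (simp add: inner_commute mult_ac)
qed

lemma radial_grad_deriv:
 "((%x::real^'d. radial_grad th' (x-a)) has_derivative (%h. radial_hess th' th'' (x-a) *v h)) (at x)"
proof -
 have q: "((%x. (norm (x-a))^2) has_derivative (%h. 2*((x-a) \<bullet> h))) (at x)"
  unfolding power2_norm_eq_inner by (auto intro!: derivative_eq_intros simp: inner_commute)
 have "(th' has_derivative (%y. th'' ((norm (x-a))^2)*y)) (at ((norm (x-a))^2))"
  using radial_C2_D(3)[of "(norm (x-a))^2"] by (simp add: has_field_derivative_def)
 note d = has_derivative_compose[OF q this]
 have "((%x. (2*th' ((norm (x-a))^2))*\<^sub>R (x-a)) has_derivative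
  (%h. (2*th' ((norm (x-a))^2))*\<^sub>R h+(2*(th'' ((norm (x-a))^2)*(2*((x-a) \<bullet> h))))*\<^sub>R (x-a))) (at x)"
  by (auto intro!: derivative_eq_intros d)
 thus ?thesis
  unfolding radial_grad_def radial_hess_def
  by (simp add: matrix_vector_mult_add_rdistrib scaleR_matrix_vector_assoc[symmetric] outer_mult_vec algebra_simps)
qed

lemma radial_hess_continuous: "continuous_on UNIV (%x::real^'d. radial_hess th' th'' (x-a))"
 unfolding radial_hess_def
 by (intro continuous_intros continuous_on_compose2[OF radial_continuous(2)] continuous_on_compose2[OF radial_C2_D(4)]) auto

lemma radial_grad_continuous: "continuous_on UNIV (%x::real^'d. radial_grad th' (x-a))"
 unfolding radial_grad_def
 by (intro continuous_intros continuous_on_compose2[OF radial_continuous(2)]) auto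

lemma radial_fun_continuous: "continuous_on UNIV (%x::real^'d. th ((norm (x-a))^2))"
 by (intro continuous_intros continuous_on_compose2[OF radial_continuous(1)]) auto

lemma radial_outside:
 fixes x a :: "real^'d"
 assumes "sqrt c <= norm (x-a)"
 shows "th ((norm (x-a))^2) = 0 & radial_grad th' (x-a) = 0 & radial_hess th' th'' (x-a) = 0"
proof -
 have "(sqrt c)^2 <= (norm (x-a))^2" using assms radial_C2_D(1) by (intro power_mono) auto
 hence "c <= (norm (x-a))^2" using radial_C2_D(1) by simp
 from radial_C2_D(5)[OF this] show ?thesis by (simp add: radial_grad_def radial_hess_def)
qed

lemma radial_Lipschitz:
 obtains L where "0 <= L" "!!x y :: real^'d. abs(th ((norm (x-a))^2)-th ((norm (y-a))^2)) <= L*dist x y"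
proof -
 obtain B where B: "0 <= B" "!!r. 0 <= r ==> abs(th r) <= B & abs(th' r) <= B & abs(th'' r) <= B"
  by (rule radial_bound) (rule that)
 define L where "L = 2*B * sqrt c"
 have L0: "0 <= L" using B radial_C2_D(1) by (simp add: L_def)
 have gb: "norm (radial_grad th' (x-a)) <= L" for x :: "real^'d"
 proof (cases "sqrt c <= norm (x-a)")
  case True
  thus ?thesis using radial_outside[OF True] L0 by simp
 next
  case False
  have "norm (radial_grad th' (x-a)) = 2*\<bar>th' ((norm (x-a))^2)\<bar>*norm (x-a)" by (simp add: radial_grad_def abs_mult)
  also have "... <= 2*B * sqrt c" using B False by (intro mult_mono) auto
  finally show ?thesis by (simp add: L_def)
 qed
 show thesis
 proof (rule that[OF L0])
  fix x y :: "real^'d"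
  have "norm (th ((norm (x-a))^2)-th ((norm (y-a))^2)) <= L*norm (x-y)"
  proof (rule differentiable_bound[OF convex_UNIV])
   show "((%x. th ((norm (x-a))^2)) has_derivative (%h. h \<bullet> radial_grad th' (z-a))) (at z within UNIV)" for z
    using radial_gderiv[of a z] by (simp add: gderiv_def inner_commute)
   show "onorm (%h. h \<bullet> radial_grad th' (z-a)) <= L" for z
   proof (rule onorm_bound[OF L0])
    fix h :: "real^'d"
    have "abs(h \<bullet> radial_grad th' (z-a)) <= norm h*norm (radial_grad th' (z-a))" by (rule Cauchy_Schwarz_ineq2)
    also have "... <= norm h*L" by (intro mult_left_mono gb) auto
    finally show "norm (h \<bullet> radial_grad th' (z-a)) <= L*norm h" by (simp add: mult.commute)
   qed
  qed auto
  thus "abs(th ((norm (x-a))^2)-th ((norm (y-a))^2)) <= L*dist x y" by (simp add: dist_norm)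
 qed
qed

lemma radial_test_function:
 fixes a :: "real^'d"
 assumes zt: "!!r. (zt has_real_derivative zt' r) (at r)" "continuous_on UNIV zt'"
  and ac: "0 < t0" "t1 < T" "!!r. r ~: {t0..t1} ==> zt r = 0 & zt' r = 0"
 shows "test_function T (%t x. zt t*th ((norm (x-a))^2)) (%t x. zt' t*th ((norm (x-a))^2))
  (%t x. zt t*\<^sub>R radial_grad th' (x-a)) (%t x. zt t*\<^sub>R radial_hess th' th'' (x-a))"
 unfolding test_function_def
proof (intro conjI ballI allI)
 have zt_cont: "continuous_on UNIV zt"
  by (rule continuous_at_imp_continuous_on) (auto intro: DERIV_isCont[OF zt(1)])
 note c' = continuous_on_compose2[OF zt_cont] continuous_on_compose2[OF zt(2)]
  continuous_on_compose2[OF radial_fun_continuous] continuous_on_compose2[OF radial_grad_continuous]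
  continuous_on_compose2[OF radial_hess_continuous]
 show "continuous_on ({0<..<T} \<times> UNIV) (%(t, x :: real^'d). zt t*th ((norm (x-a))^2))"
  "continuous_on ({0<..<T} \<times> UNIV) (%(t, x :: real^'d). zt' t*th ((norm (x-a))^2))"
  "continuous_on ({0<..<T} \<times> UNIV) (%(t, x :: real^'d). zt t*\<^sub>R radial_grad th' (x-a))"
  "continuous_on ({0<..<T} \<times> UNIV) (%(t, x :: real^'d). zt t*\<^sub>R radial_hess th' th'' (x-a))"
  unfolding split_beta by (intro continuous_on_mult continuous_on_scaleR c' continuous_intros subset_UNIV)+
 show "EX K. compact K & K \<subseteq> {0<..<T} \<times> UNIV &
    (ALL t:{0<..<T}. ALL x. (t, x) ~: K --> zt t*th ((norm (x-a))^2) = 0)"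
 proof (intro exI[of _ "{t0..t1} \<times> cball a (sqrt c)"] conjI ballI allI impI)
  show "compact ({t0..t1} \<times> cball a (sqrt c))" by (intro compact_Times) auto
  show "{t0..t1} \<times> cball a (sqrt c) \<subseteq> {0<..<T} \<times> UNIV" using ac by auto
  fix t x assume "(t, x) ~: {t0..t1} \<times> cball a (sqrt c)"
  then consider "t ~: {t0..t1}" | "sqrt c <= norm (x-a)" by (force simp: dist_norm norm_minus_commute)
  thus "zt t*th ((norm (x-a))^2) = 0" by cases (use ac radial_outside in auto)
 qed
 fix t x
 show "((%s. zt s*th ((norm (x-a))^2)) has_real_derivative zt' t*th ((norm (x-a))^2)) (at t)"
  by (rule DERIV_cmult_right[OF zt(1)])
 have "((%x. zt t*th ((norm (x-a))^2)) has_derivative (%h. zt t*(h \<bullet> radial_grad th' (x-a)))) (at x)"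
  by (rule has_derivative_mult_right) (use radial_gderiv[of a x] in \<open>simp add: gderiv_def inner_commute\<close>)
 thus "GDERIV (%x. zt t*th ((norm (x-a))^2)) x :> zt t*\<^sub>R radial_grad th' (x-a)"
  by (simp add: gderiv_def inner_commute)
 have "((%x. zt t*\<^sub>R radial_grad th' (x-a)) has_derivative (%h. zt t*\<^sub>R (radial_hess th' th'' (x-a) *v h))) (at x)"
  by (rule has_derivative_scaleR_right[OF radial_grad_deriv])
 thus "((%x. zt t*\<^sub>R radial_grad th' (x-a)) has_derivative (%h. zt t*\<^sub>R radial_hess th' th'' (x-a) *v h)) (at x)"
  by (simp add: scaleR_matrix_vector_assoc)
qed

end


subsection \<open>The evolution of radial observables along admissible flows\<close>

text \<open>Controls are Borel on the closed interval [0,T], so here, unlike for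
  \<open>slab\<close>, the endpoints keep their values.\<close>

definition on_slab :: "real => (real => 'a => 'b::zero) => real \<times> 'a => 'b" where
 "on_slab T b z = (if fst z : {0..T} then b (fst z) (snd z) else 0)"

lemma on_slab_measurable:
 fixes b :: "real => 'a::euclidean_space => 'b::euclidean_space"
 assumes "(%(t, x). b t x) : borel_measurable (restrict_space borel ({0..T} \<times> UNIV))"
 shows "on_slab T b : borel_measurable borel"
proof -
 have "({0..T} \<times> UNIV :: (real \<times> 'a) set) : sets borel" by (intro borel_closed closed_Times) auto
 hence "(%z. if z : {0..T} \<times> UNIV then (case z of (t, x) => b t x) else 0) : borel_measurable borel"
  using assms by (subst measurable_restrict_space_iff[symmetric]) auto
 moreover have "(%z. if z : {0..T} \<times> UNIV then (case z of (t, x) => b t x) else 0) = on_slab T b"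
  by (auto simp: on_slab_def fun_eq_iff)
 ultimately show ?thesis by simp
qed

context dynamics
begin

lemma radial_generator_bounded:
 assumes rad: "radial_C2 th th' th'' c" and M: "0 <= M"
 shows "EX D>=0. ALL t x mu u. t : {0..T} --> mu : P2 --> M2 mu <= M --> u : F t x mu -->
   abs(generator (radial_grad th' (x-a)) (radial_hess th' th'' (x-a)) (fst u) (snd u)) <= D"
proof -
 obtain B where B: "0 <= B" "!!r. 0 <= r ==> abs(th r) <= B & abs(th' r) <= B & abs(th'' r) <= B"
  by (rule radial_bound[OF rad]) (rule that)
 note c = radial_C2_D(1)[OF rad]
 define X where "X = norm a+sqrt c"
 define D where "D = 2*B * sqrt c*(C_b*(1+X+M))+(B*norm (mat 1 :: real^'d^'d)+2*c*B)*(C_A*(1+X^2+M^2))"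
 have X0: "0 <= X" using c by (simp add: X_def)
 have D0: "0 <= D" using X0 M B c C_nonneg by (simp add: D_def)
 have "abs(generator (radial_grad th' (x-a)) (radial_hess th' th'' (x-a)) (fst u) (snd u)) <= D"
  if u: "t : {0..T}" "mu : P2" "M2 mu <= M" "u : F t x mu" for t x mu u
 proof (cases "sqrt c <= norm (x-a)")
  case True
  from radial_outside[OF rad True] show ?thesis using D0 by (simp add: generator_def trace_def matrix_matrix_mult_def)
 next
  case False
  hence n: "norm (x-a) <= sqrt c" by simp
  have "norm x <= X" using norm_triangle_ineq[of "x-a" a] n by (simp add: X_def)
  hence x: "norm x <= X" "(norm x)^2 <= X^2" by (auto intro: power_mono)
  have r: "(norm (x-a))^2 <= c" using n c power_mono[of "norm (x-a)" "sqrt c" 2] by simp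
  note g = control_growth[OF u]
  have b: "norm (fst u) <= C_b*(1+X+M)"
   using g(1) mult_left_mono[of "1+norm x+M" "1+X+M" C_b] C_nonneg x(1) by simp
  have A: "norm (snd u) <= C_A*(1+X^2+M^2)"
   using g(2) mult_left_mono[of "1+(norm x)^2+M^2" "1+X^2+M^2" C_A] C_nonneg x(2) by simp
  have t: "abs(th' ((norm (x-a))^2)) <= B" "abs(th'' ((norm (x-a))^2)) <= B" using B(2)[of "(norm (x-a))^2"] by auto
  have "2*\<bar>th' ((norm (x-a))^2)\<bar>*norm (x-a)*norm (fst u) <= 2*B * sqrt c*(C_b*(1+X+M))"
   by (intro mult_mono b t n mult_nonneg_nonneg) (use B c in auto)
  moreover have "(\<bar>th' ((norm (x-a))^2)\<bar>*norm (mat 1 :: real^'d^'d)+2*(norm (x-a))^2*\<bar>th'' ((norm (x-a))^2)\<bar>)*norm (snd u)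
    <= (B*norm (mat 1 :: real^'d^'d)+2*c*B)*(C_A*(1+X^2+M^2))"
   by (intro mult_mono add_mono A t r mult_nonneg_nonneg add_nonneg_nonneg) (use B c r in auto)
  ultimately show ?thesis
   using radial_generator_bound[of th' "x-a" th'' "fst u" "snd u"] unfolding D_def by simp
 qed
 thus ?thesis using D0 by blast
qed

lemma flow_M2_continuous:
 assumes "flow_of_probabilities T m"
 shows "continuous_on {0..T} (%t. M2 (m t))"
proof (rule continuous_on_sequentiallyI)
 fix s t assume s: "ALL n. s n : {0..T}" "t : {0..T}" "s ----> t"
 note P = flow_of_probabilities_D(1)[OF assms]
 show "(%n. M2 (m (s n))) ----> M2 (m t)"
 proof (rule Lim_null[THEN iffD2], rule Lim_null_comparison)
  show "\<forall>\<^sub>F n in sequentially. norm (M2 (m (s n))-M2 (m t)) <= W2 (m (s n)) (m t)"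
  proof (intro always_eventually allI)
   fix n
   have "m (s n) : P2" "m t : P2" using P s by auto
   thus "norm (M2 (m (s n))-M2 (m t)) <= W2 (m (s n)) (m t)"
    using M2_Lipschitz[of "m (s n)" "m t"] M2_Lipschitz[of "m t" "m (s n)"] W2_commute[of "m t" "m (s n)"]
    by (simp add: abs_le_iff)
  qed
  show "(%n. W2 (m (s n)) (m t)) ----> 0" using s by (intro flow_of_probabilities_D(2)[OF assms]) auto
 qed
qed

lemma flow_M2_bounded:
 assumes "flow_of_probabilities T m"
 obtains M where "0 <= M" "!!t. t : {0..T} ==> M2 (m t) <= M"
proof -
 have "bounded ((%t. M2 (m t)) ` {0..T})"
  by (intro compact_imp_bounded compact_continuous_image flow_M2_continuous assms compact_Icc)
 then obtain M where "0 < M" "!!t. t : {0..T} ==> abs(M2 (m t)) <= M" by (auto simp: bounded_pos)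
 thus thesis by (intro that[of M]) (auto simp: abs_le_iff)
qed

context
 fixes m b A nu
 assumes adm: "(m, b, A) : admissible T F nu"
begin

lemma admissible_flow: "flow_of_probabilities T m" "m 0 = nu"
 using adm by (auto simp: admissible_def)

lemma admissible_measurable: "on_slab T b : borel_measurable borel" "on_slab T A : borel_measurable borel"
 using adm by (auto simp: admissible_def intro: on_slab_measurable)

lemma admissible_psd: "on_slab T A z : sym_psd"
 using adm by (auto simp: admissible_def on_slab_def zero_sym_psd)

lemma admissible_kernel: "flow_kernel T m"
 by (rule flow_of_probabilities_kernel[OF T_pos admissible_flow(1)])

lemma admissible_incl_AE:
 "AE t in lborel. t : {0..T} --> (AE x in m t. (on_slab T b (t, x), on_slab T A (t, x)) : F t x (m t))"
 using adm by (auto simp: admissible_def on_slab_def)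

text \<open>To pass from almost every time and position to the joint law, the set of good points has
  to be Borel: it is the preimage of the graph of \<open>F\<close> along the continuous flow, which
  is closed.\<close>

lemma admissible_incl: "AE z in flow_law T m. (on_slab T b z, on_slab T A z) : F (fst z) (snd z) (m (fst z))"
proof -
 define Gm where "Gm = {y. fst (fst y) : {0..T} & snd y : F (fst (fst y)) (snd (fst y)) (m (fst (fst y)))}"
 have "closed Gm"
  unfolding closed_sequential_limits
 proof (intro allI impI, elim conjE)
  fix y Y assume y: "ALL n. y n : Gm" and lim: "y ----> Y"
  have t: "(%n. fst (fst (y n))) ----> fst (fst Y)" by (intro tendsto_intros lim)
  have tn: "fst (fst (y n)) : {0..T}" for n using y by (simp add: Gm_def)
  have tY: "fst (fst Y) : {0..T}" by (rule closed_sequentially[OF closed_atLeastAtMost tn t])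
  have "snd Y : F (fst (fst Y)) (snd (fst Y)) (m (fst (fst Y)))"
  proof (rule graph_closed[where t="%n. fst (fst (y n))" and x="%n. snd (fst (y n))" and mu="%n. m (fst (fst (y n)))" and u="%n. snd (y n)"])
   show "(%n. W2 (m (fst (fst (y n)))) (m (fst (fst Y)))) ----> 0"
    by (rule flow_of_probabilities_D(2)[OF admissible_flow(1) tn tY t])
   show "(%n. snd (fst (y n))) ----> snd (fst Y)" "(%n. snd (y n)) ----> snd Y" by (intro tendsto_intros lim)+
   show "snd (y n) : F (fst (fst (y n))) (snd (fst (y n))) (m (fst (fst (y n))))" for n
    using y by (simp add: Gm_def)
  qed (use tn tY t flow_of_probabilities_D(1)[OF admissible_flow(1)] in auto)
  thus "Y : Gm" using tY by (simp add: Gm_def)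
 qed
 note [measurable] = borel_measurable_fst borel_measurable_snd admissible_measurable
 have "(%z. (z, (on_slab T b z, on_slab T A z))) : borel \<rightarrow>\<^sub>M borel" by measurable
 from measurable_sets[OF this, of Gm] `closed Gm`
 have meas: "{z. (z, (on_slab T b z, on_slab T A z)) : Gm} : sets borel" by (simp add: borel_closed vimage_def)
 have "AE z in flow_law T m. (z, (on_slab T b z, on_slab T A z)) : Gm"
 proof (rule AE_flow_law_I[OF T_pos admissible_kernel meas])
  show "AE t in lborel. t : {0..T} --> (AE x in m t. ((t, x), (on_slab T b (t, x), on_slab T A (t, x))) : Gm)"
   using admissible_incl_AE by eventually_elim (auto simp: Gm_def)
 qed
 thus ?thesis by eventually_elim (simp add: Gm_def)
qed

lemma admissible_fokker_planck:
 assumes tf: "test_function T phi phit g H"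
  and int: "integrable (flow_law T m) (%z. fp_integrand T phit g H z (on_slab T b z, on_slab T A z))"
 shows "(LINT z|flow_law T m. fp_integrand T phit g H z (on_slab T b z, on_slab T A z)) = 0"
proof -
 have "(LBINT t:{0..T}. LINT x|m t. phit t x+g t x \<bullet> b t x+(1/2)*trace (H t x ** A t x)) = 0"
  using adm tf unfolding admissible_def by blast
 moreover have "(LBINT t:{0..T}. LINT x|m t. phit t x+g t x \<bullet> b t x+(1/2)*trace (H t x ** A t x)) =
  (LBINT t:{0..T}. LINT x|m t. phit t x+g t x \<bullet> on_slab T b (t, x)+(1/2)*trace (H t x ** on_slab T A (t, x)))"
  by (rule set_lebesgue_integral_cong) (auto simp: on_slab_def)
 ultimately show ?thesis using fokker_planck_flow_law[OF T_pos admissible_kernel int] T_pos by simp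
qed

lemma radial_generator_integrable:
 assumes rad: "radial_C2 th th' th'' c"
 shows "integrable (flow_law T m)
  (%z. generator (radial_grad th' (snd z-a)) (radial_hess th' th'' (snd z-a)) (on_slab T b z) (on_slab T A z))"
proof -
 interpret L: prob_space "flow_law T m" by (rule flow_law_prob[OF T_pos admissible_kernel])
 obtain M where M: "0 <= M" "!!t. t : {0..T} ==> M2 (m t) <= M"
  by (rule flow_M2_bounded[OF admissible_flow(1)]) (rule that)
 obtain D where D: "0 <= D" "ALL t x mu u. t : {0..T} --> mu : P2 --> M2 mu <= M --> u : F t x mu -->
   abs(generator (radial_grad th' (x-a)) (radial_hess th' th'' (x-a)) (fst u) (snd u)) <= D"
  using radial_generator_bounded[OF rad M(1), of a] by auto
 note [measurable] = borel_measurable_fst borel_measurable_snd admissible_measurable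
  borel_measurable_continuous_onI[OF radial_grad_continuous[OF rad]]
  borel_measurable_continuous_onI[OF continuous_on_transpose[OF radial_hess_continuous[OF rad]]]
 show ?thesis
 proof (rule L.integrable_const_bound[of _ D])
  have m1: "(%z::'d state. radial_grad th' (snd z-a)) : borel_measurable borel"
   by (rule measurable_compose[of snd borel borel "%x. radial_grad th' (x-a)"]) measurable
  have m2: "(%z::'d state. transpose (radial_hess th' th'' (snd z-a))) : borel_measurable borel"
   by (rule measurable_compose[of snd borel borel "%x. transpose (radial_hess th' th'' (x-a))"]) measurable
  note [measurable] = m1 m2
  show "(%z. generator (radial_grad th' (snd z-a)) (radial_hess th' th'' (snd z-a)) (on_slab T b z) (on_slab T A z))
   : borel_measurable (flow_law T m)"
   unfolding measurable_cong_sets[OF flow_law_sets[OF T_pos admissible_kernel] refl]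
    generator_def matrix_transpose_inner[symmetric] by measurable
  show "AE z in flow_law T m. norm (generator (radial_grad th' (snd z-a)) (radial_hess th' th'' (snd z-a)) (on_slab T b z) (on_slab T A z)) <= D"
   using admissible_incl AE_flow_law_time[OF T_pos admissible_kernel]
  proof eventually_elim
   case (elim z)
   from D(2)[rule_format, OF elim(2) flow_of_probabilities_D(1)[OF admissible_flow(1) elim(2)] M(2)[OF elim(2)] elim(1)]
   show ?case by simp
  qed
 qed
qed

text \<open>Testing with zt(t)*th(|x-a|^2) says that the integral of \<open>th\<close> has the
  integral of its generator as weak time derivative. The majorant comes in two stages,
  \<open>h\<close> pointwise and \<open>D\<close> after integration, because the pointwise bound may
  be unbounded in x.\<close>

lemma radial_evolution:
 fixes D :: "real => real"
 assumes rad: "radial_C2 th th' th'' c" and D: "continuous_on {0..T} D"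
  and h_int: "!!t. t : {0..T} ==> integrable (m t) (h t)" and h_D: "!!t. t : {0..T} ==> (LINT x|m t. h t x) <= D t"
  and h: "!!t x be Sg. t : {0..T} ==> (be, Sg) : F t x (m t) ==>
   abs(generator (radial_grad th' (x-a)) (radial_hess th' th'' (x-a)) be Sg) <= h t x"
  and st: "0 <= s" "s <= t" "t <= T"
 shows "abs((LINT x|m t. th ((norm (x-a))^2))-(LINT x|m s. th ((norm (x-a))^2))) <= integral {s..t} D"
proof (rule weak_derivative_bound[OF T_pos _ D _ _ _ st])
 define phi where "phi x = th ((norm (x-a))^2)" for x
 define gen where "gen z = generator (radial_grad th' (snd z-a)) (radial_hess th' th'' (snd z-a)) (on_slab T b z) (on_slab T A z)" for z
 have gen_int: "integrable (flow_law T m) gen" unfolding gen_def by (rule radial_generator_integrable[OF rad])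
 interpret L: prob_space "flow_law T m" by (rule flow_law_prob[OF T_pos admissible_kernel])
 note gI = integral_flow_law[OF T_pos admissible_kernel gen_int]
 define v where "v t = (LINT x|m t. gen (t, x))" for t
 obtain B where B: "0 <= B" "!!r. 0 <= r ==> abs(th r) <= B & abs(th' r) <= B & abs(th'' r) <= B"
  by (rule radial_bound[OF rad]) (rule that)
 have phi_bd: "abs(phi x) <= B" for x using B by (simp add: phi_def)
 have phi_meas: "phi : borel_measurable borel"
  unfolding phi_def by (rule borel_measurable_continuous_onI[OF radial_fun_continuous[OF rad]])
 obtain L where L: "0 <= L" "!!x y :: real^'d. abs(th ((norm (x-a))^2)-th ((norm (y-a))^2)) <= L*dist x y"
  by (rule radial_Lipschitz[OF rad, where a=a]) (rule that)
 have "continuous_on {0..T} (%t. LINT x|m t. phi x)"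
  by (rule continuous_on_flow_integral[OF admissible_flow(1) phi_meas phi_bd _ L(1)]) (use L(2) in \<open>simp add: phi_def\<close>)
 thus "continuous_on {0..T} (%t. LINT x|m t. th ((norm (x-a))^2))" unfolding phi_def .
 show "set_borel_measurable lborel {0..T} v"
  using gI(2) unfolding v_def set_integrable_def set_borel_measurable_def by (rule borel_measurable_integrable)
 show "AE r in lborel. r : {0..T} --> abs(v r) <= D r"
  using admissible_incl_AE gI(3)
 proof eventually_elim
  case (elim r)
  show ?case
  proof
   assume r: "r : {0..T}"
   have ig: "integrable (m r) (%x. gen (r, x))" using elim(2) r by simp
   have "abs(v r) <= (LINT x|m r. abs(gen (r, x)))" unfolding v_def by (rule integral_abs_bound)
   also have "... <= (LINT x|m r. h r x)"
   proof (rule integral_mono_AE[OF integrable_abs[OF ig] h_int[OF r]])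
    have "AE x in m r. (on_slab T b (r, x), on_slab T A (r, x)) : F r x (m r)" using elim(1) r by simp
    thus "AE x in m r. abs(gen (r, x)) <= h r x"
     by eventually_elim (use h[OF r] in \<open>simp add: gen_def\<close>)
   qed
   also have "... <= D r" by (rule h_D[OF r])
   finally show "abs(v r) <= D r" .
  qed
 qed
 fix zt zt' t0 t1
 assume zt: "!!r. (zt has_real_derivative zt' r) (at r)" "continuous_on UNIV zt'" "0 < t0" "t1 < T"
  "!!r. r ~: {t0..t1} ==> zt r = 0 & zt' r = 0"
 have zt_cont: "continuous_on UNIV zt"
  by (rule continuous_at_imp_continuous_on) (auto intro: DERIV_isCont[OF zt(1)])
 have bnd: "EX Z. ALL r. abs(f r) <= Z" if "continuous_on UNIV f" "!!r. r ~: {t0..t1} ==> f r = 0" for f :: "real => real"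
 proof -
  have "bounded (f ` {t0..t1})"
   by (intro compact_imp_bounded compact_continuous_image continuous_on_subset[OF that(1)] compact_Icc) auto
  then obtain Z where "0 < Z" "!!r. r : {t0..t1} ==> abs(f r) <= Z" by (auto simp: bounded_pos)
  hence "abs(f r) <= Z" for r using that(2)[of r] by (cases "r : {t0..t1}") auto
  thus ?thesis by blast
 qed
 obtain Z where Z: "!!r. abs(zt r) <= Z" using bnd[OF zt_cont] zt(5) by blast
 obtain Z' where Z': "!!r. abs(zt' r) <= Z'" using bnd[OF zt(2)] zt(5) by blast
 note tf = radial_test_function[OF rad zt, where a=a]
 let ?fp = "%z. fp_integrand T (%t x. zt' t*th ((norm (x-a))^2)) (%t x. zt t*\<^sub>R radial_grad th' (x-a))
  (%t x. zt t*\<^sub>R radial_hess th' th'' (x-a)) z (on_slab T b z, on_slab T A z)"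
 have fp: "?fp z = zt' (fst z)*phi (snd z)+zt (fst z)*gen z" for z
 proof (cases "fst z : {0<..<T}")
  case True
  have tr: "trace ((s*\<^sub>R H) ** S) = s*trace (H ** S)" for s and H S :: "real^'d^'d"
   by (simp add: matrix_transpose_inner[symmetric] transpose_scalar)
  show ?thesis using True by (simp add: fp_integrand_def slab_def phi_def gen_def generator_def tr algebra_simps)
 next
  case False
  hence "fst z ~: {t0..t1}" using zt(3,4) by auto
  thus ?thesis using False zt(5) by (simp add: fp_integrand_def slab_def trace_def matrix_matrix_mult_def)
 qed
 note [measurable] = borel_measurable_fst borel_measurable_snd
 have ztm: "(%z::'d state. zt (fst z)) : borel_measurable (flow_law T m)"
  "(%z::'d state. zt' (fst z)*phi (snd z)) : borel_measurable (flow_law T m)"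
  unfolding measurable_cong_sets[OF flow_law_sets[OF T_pos admissible_kernel] refl]
  by (intro borel_measurable_times measurable_compose[OF borel_measurable_fst borel_measurable_continuous_onI[OF zt_cont]]
    measurable_compose[OF borel_measurable_fst borel_measurable_continuous_onI[OF zt(2)]]
    measurable_compose[OF borel_measurable_snd phi_meas])+
 have i1: "integrable (flow_law T m) (%z. zt' (fst z)*phi (snd z))"
 proof (rule L.integrable_const_bound[of _ "Z'*B"])
  show "AE z in flow_law T m. norm (zt' (fst z)*phi (snd z)) <= Z'*B"
   using Z' phi_bd by (auto simp: abs_mult intro!: mult_mono intro: order_trans[OF abs_ge_zero])
 qed (rule ztm)
 have i2: "integrable (flow_law T m) (%z. zt (fst z)*gen z)"
 proof (rule Bochner_Integration.integrable_bound)
  show "integrable (flow_law T m) (%z. Z*gen z)" using gen_int by simp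
  show "(%z. zt (fst z)*gen z) : borel_measurable (flow_law T m)"
   using ztm(1) borel_measurable_integrable[OF gen_int] by (rule borel_measurable_times)
  show "AE z in flow_law T m. norm (zt (fst z)*gen z) <= norm (Z*gen z)"
   using Z by (intro always_eventually allI) (auto simp: abs_mult intro!: mult_right_mono order_trans[OF Z abs_ge_self])
 qed
 have "(LINT z|flow_law T m. ?fp z) = 0"
  by (rule admissible_fokker_planck[OF tf]) (assumption, unfold fp, rule Bochner_Integration.integrable_add[OF i1 i2])
 hence sum0: "(LINT z|flow_law T m. zt' (fst z)*phi (snd z))+(LINT z|flow_law T m. zt (fst z)*gen z) = 0"
  unfolding fp using i1 i2 by simp
 have "(LBINT r:{0..T}. zt' r*(LINT x|m r. phi x))+(LBINT r:{0..T}. zt r * v r) = 0"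
  using integral_flow_law(1)[OF T_pos admissible_kernel i1] integral_flow_law(1)[OF T_pos admissible_kernel i2] sum0
  by (simp add: v_def distrib_left[symmetric])
 thus "(LBINT r:{0..T}. zt' r*(LINT x|m r. th ((norm (x-a))^2)))+(LBINT r:{0..T}. zt r * v r) = 0"
  unfolding phi_def .
qed

end

end

subsection \<open>A priori estimates for admissible flows\<close>

lemma pos_part_affine_deriv:
 fixes k :: real
 shows "((%r. (max 0 (1-k*r))^Suc (Suc n)) has_real_derivative
  - (k*real (Suc (Suc n))*(max 0 (1-k*r))^Suc n)) (at r)"
proof -
 have "((%r. 1-k*r) has_real_derivative-k) (at r)" by (auto intro!: derivative_eq_intros)
 from DERIV_chain2[OF DERIV_pos_part_power this, of n] show ?thesis by (simp add: mult_ac)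
qed

lemma cutoff_derivs:
 fixes k :: real
 shows "((%r. (max 0 (1-k*r))^3) has_real_derivative-(3 * k*(max 0 (1-k*r))^2)) (at r)"
  "((%r. - (3 * k*(max 0 (1-k*r))^2)) has_real_derivative 6 * k^2 * max 0 (1-k*r)) (at r)"
proof -
 show "((%r. (max 0 (1-k*r))^3) has_real_derivative-(3 * k*(max 0 (1-k*r))^2)) (at r)"
  using pos_part_affine_deriv[of k 1 r] by (simp add: numeral_3_eq_3 numeral_2_eq_2 mult_ac)
 have "((%r. (max 0 (1-k*r))^2) has_real_derivative-(2 * k * max 0 (1-k*r))) (at r)"
  using pos_part_affine_deriv[of k 0 r] by (simp add: numeral_2_eq_2 mult_ac)
 from DERIV_cmult[OF this, of "- (3 * k)"]
 show "((%r. - (3 * k*(max 0 (1-k*r))^2)) has_real_derivative 6 * k^2 * max 0 (1-k*r)) (at r)"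
  by (simp add: power2_eq_square mult_ac)
qed

lemma bump_radial_C2:
 assumes "0 < k"
 shows "radial_C2 (%r. (max 0 (1-k*r))^3) (%r. - (3 * k*(max 0 (1-k*r))^2)) (%r. 6 * k^2 * max 0 (1-k*r)) (1/k)"
proof -
 have "max 0 (1-k*r) = 0" if "1/k <= r" for r using assms that by (simp add: field_simps max_def)
 thus ?thesis
  unfolding radial_C2_def using assms by (auto intro!: cutoff_derivs continuous_intros)
qed

text \<open>\<open>sq_tail\<close> as a function of r = |x|^2, times a cut-off that vanishes for r
  >= 1/k; k tends to 0 with R fixed.\<close>

definition tail_cutoff :: "real => real => real => real" where
 "tail_cutoff R k r = (r^2/(r+R))*(max 0 (1-k*r))^3"

definition tail_cutoff' :: "real => real => real => real" where
 "tail_cutoff' R k r = (1-R^2/(r+R)^2)*(max 0 (1-k*r))^3 + - (3 * k*(max 0 (1-k*r))^2)*(r^2/(r+R))"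

definition tail_cutoff'' :: "real => real => real => real" where
 "tail_cutoff'' R k r = (2*R^2/(r+R)^3)*(max 0 (1-k*r))^3 + - (3 * k*(max 0 (1-k*r))^2)*(1-R^2/(r+R)^2)
  + ((6 * k^2 * max 0 (1-k*r))*(r^2/(r+R))+(1-R^2/(r+R)^2) * - (3 * k*(max 0 (1-k*r))^2))"

lemma tail_cutoff_radial_C2:
 assumes "0 < k" "0 < R"
 shows "radial_C2 (tail_cutoff R k) (tail_cutoff' R k) (tail_cutoff'' R k) (1/k)"
proof -
 have z: "max 0 (1-k*r) = 0" if "1/k <= r" for r using assms that by (simp add: field_simps max_def)
 have p1: "((%r. r^2/(r+R)) has_real_derivative 1-R^2/(r+R)^2) (at r)" if "0 <= r" for r
 proof -
  have ne: "r+R ~= 0" using that assms(2) by simp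
  have "((%r. r^2/(r+R)) has_real_derivative ((2*r)*(r+R)-r^2*1)/((r+R)*(r+R))) (at r)"
   by (rule DERIV_divide) (use ne in \<open>auto intro!: derivative_eq_intros\<close>)
  moreover have "((2*r)*(r+R)-r^2*1)/((r+R)*(r+R)) = ((r+R)^2-R^2)/(r+R)^2"
   by (simp add: power2_eq_square algebra_simps)
  moreover have "... = 1-R^2/(r+R)^2" using ne by (simp add: diff_divide_distrib)
  ultimately show ?thesis by simp
 qed
 have p2: "((%r. 1-R^2/(r+R)^2) has_real_derivative 2*R^2/(r+R)^3) (at r)" if "0 <= r" for r
 proof -
  have ne: "r+R ~= 0" using that assms(2) by simp
  have d: "((%r. R^2/(r+R)^2) has_real_derivative (0*(r+R)^2-R^2*(2*(r+R)))/((r+R)^2*(r+R)^2)) (at r)"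
   by (rule DERIV_divide) (use ne in \<open>auto intro!: derivative_eq_intros\<close>)
  have "0-(0*w^2-R^2*(2*w))/(w^2*w^2) = 2*R^2/w^3" if "w ~= 0" for w
   using that by (simp add: field_simps power2_eq_square power3_eq_cube)
  from this[OF ne] DERIV_diff[OF DERIV_const[of 1] d] show ?thesis by (simp only:)
 qed
 show ?thesis
  unfolding radial_C2_def
 proof (intro conjI allI impI)
  show "0 <= 1/k" using assms by simp
  fix r :: real
  show "(tail_cutoff R k has_real_derivative tail_cutoff' R k r) (at r)" if "0 <= r"
   unfolding tail_cutoff_def[abs_def] tail_cutoff'_def by (rule DERIV_mult[OF p1[OF that] cutoff_derivs(1)])
  show "(tail_cutoff' R k has_real_derivative tail_cutoff'' R k r) (at r)" if "0 <= r"
   unfolding tail_cutoff'_def[abs_def] tail_cutoff''_def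
   by (rule DERIV_add[OF DERIV_mult[OF p2[OF that] cutoff_derivs(1)] DERIV_mult[OF cutoff_derivs(2) p1[OF that]]])
  show "tail_cutoff R k r = 0" "tail_cutoff' R k r = 0" "tail_cutoff'' R k r = 0" if "1/k <= r"
   using z[OF that] by (simp_all add: tail_cutoff_def tail_cutoff'_def tail_cutoff''_def)
  show "continuous_on {0..} (tail_cutoff'' R k)"
   unfolding tail_cutoff''_def[abs_def] using assms(2) by (intro continuous_intros) auto
 qed
qed

text \<open>Uniform in k: differentiating the cut-off produces factors k, each accompanied by r, and
  k*r <= 1 on the support. All terms are multiples of g = r/(r+R), with 5 = 2+3 and 20 =
  2+12+6.\<close>

lemma tail_cutoff_bounds:
 assumes k: "0 < k" and R: "0 < R" and r: "0 <= r"
 defines "g \<equiv> r/(r+R)"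
 shows "abs(tail_cutoff' R k r) <= 5*g" "r*\<bar>tail_cutoff'' R k r\<bar> <= 20*g"
  "0 <= tail_cutoff R k r" "tail_cutoff R k r <= r^2/(r+R)"
proof -
 define q where "q = max 0 (1-k*r)"
 have q: "0 <= q" "q <= 1" using k r by (auto simp: q_def)
 have krq: "k*r*q <= q" "0 <= k*r*q"
  using k r mult_right_mono[of "k*r" 1 q] q by (cases "q = 0"; auto simp: q_def max_def split: if_splits)+
 have q3: "0 <= q^3" "q^3 <= 1" using q by (auto intro: power_le_one)
 have q2: "0 <= k*r*q^2" "k*r*q^2 <= 1"
 proof -
  have "k*r*q*q <= 1*1" using krq q by (intro mult_mono) auto
  thus "k*r*q^2 <= 1" by (simp add: power2_eq_square mult_ac)
  show "0 <= k*r*q^2" using k r by simp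
 qed
 have q1: "0 <= (k*r)^2*q" "(k*r)^2*q <= 1"
 proof -
  show "(k*r)^2*q <= 1"
  proof (cases "q = 0")
   case False
   hence "k*r <= 1" by (auto simp: q_def max_def split: if_splits)
   hence "(k*r)^2 <= 1" using k r by (auto intro: power_le_one)
   hence "(k*r)^2*q <= 1*1" using q by (intro mult_mono) auto
   thus ?thesis by simp
  qed simp
  show "0 <= (k*r)^2*q" using q by simp
 qed
 have rR: "0 < r+R" using r R by simp
 have g: "0 <= g" using r rR by (simp add: g_def)
 have p: "r^2/(r+R) = g*r" by (simp add: g_def power2_eq_square)
 define u where "u = R/(r+R)"
 have u: "0 <= u" "u <= 1" "g = 1-u" using r R rR by (auto simp: u_def g_def field_simps)
 have p1: "1-R^2/(r+R)^2 = g*(1+u)"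
 proof -
  have "R^2/(r+R)^2 = u^2" by (simp add: u_def power_divide)
  thus ?thesis unfolding u(3) by (simp add: power2_eq_square algebra_simps)
 qed
 have p1b: "0 <= g*(1+u)" "g*(1+u) <= 2*g" using g u mult_left_mono[of "1+u" 2 g] by auto
 have p2: "r*(2*R^2/(r+R)^3) = 2*g*u^2"
  by (simp add: g_def u_def power2_eq_square power3_eq_cube mult_ac)
 have p2b: "0 <= 2*g*u^2" "2*g*u^2 <= 2*g"
  using g u power_le_one[of u 2] mult_left_mono[of "u^2" 1 "2*g"] by auto
 have le1: "abs(a*c) <= b" if "0 <= a" "a <= b" "0 <= c" "c <= 1" for a b c :: real
  using that mult_mono[of a b c 1] by simp
 have a1: "abs(g*(1+u)*q^3) <= 2*g" by (rule le1[OF p1b q3])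
 have a2: "abs(g*(k*r*q^2)) <= g" by (rule le1[OF g order_refl q2])
 have "tail_cutoff' R k r = g*(1+u)*q^3-3*(g*(k*r*q^2))"
  unfolding tail_cutoff'_def q_def[symmetric] p p1 by (simp add: mult_ac)
 thus "abs(tail_cutoff' R k r) <= 5*g" using a1 a2 by linarith
 have b1: "abs(2*g*u^2*q^3) <= 2*g"
  by (rule le1[OF p2b q3])
 have b2: "abs(g*(1+u)*(k*r*q^2)) <= 2*g"
  by (rule le1[OF p1b q2])
 have b3: "abs(g*((k*r)^2*q)) <= g" by (rule le1[OF g order_refl q1])
 have "r*tail_cutoff'' R k r = r*(2*R^2/(r+R)^3)*q^3-6*(g*(1+u)*(k*r*q^2))+6*(g*((k*r)^2*q))"
  unfolding tail_cutoff''_def q_def[symmetric] p p1 by (simp add: power2_eq_square algebra_simps)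
 hence "abs(r*tail_cutoff'' R k r) <= 20*g" using b1 b2 b3 unfolding p2 by linarith
 thus "r*\<bar>tail_cutoff'' R k r\<bar> <= 20*g" using r by (simp add: abs_mult)
 show "0 <= tail_cutoff R k r" unfolding tail_cutoff_def using q3 rR by (simp add: q_def)
 show "tail_cutoff R k r <= r^2/(r+R)"
  unfolding tail_cutoff_def using mult_left_mono[OF q3(2), of "r^2/(r+R)"] rR by (simp add: q_def)
qed

context dynamics
begin

text \<open>From \<open>tail_cutoff_bounds\<close>: 20 = 2*5*2 for the drift, and 5 and 40 = 2*20
  for the two parts of the Hessian.\<close>

definition "C_tail = 20*C_b+(5*norm (mat 1 :: real^'d^'d)+40)*C_A"

lemma C_tail_nonneg: "0 <= C_tail" using C_nonneg by (simp add: C_tail_def)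

text \<open>The generator is of order g*(1+|x|^2+M2^2) with g = |x|^2/(|x|^2+R). Here g*|x|^2 is
  \<open>sq_tail\<close> itself, which closes the estimate, and the rest carries the factor g <=
  |x|^2/R, small for large R. The cut-off k has disappeared.\<close>

lemma tail_generator_bound:
 assumes t: "t : {0..T}" "mu : P2" "(be, Sg) : F t x mu" and kR: "0 < k" "0 < R"
 shows "abs(generator (radial_grad (tail_cutoff' R k) (x-0)) (radial_hess (tail_cutoff' R k) (tail_cutoff'' R k) (x-0)) be Sg) <=
  C_tail*((1+(M2 mu)^2)*((norm x)^2/((norm x)^2+R))+sq_tail R x)"
proof -
 define r where "r = (norm x)^2"
 define g where "g = r/(r+R)"
 define M where "M = M2 mu"
 let ?I = "norm (mat 1 :: real^'d^'d)"
 have r0: "0 <= r" by (simp add: r_def)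
 have g0: "0 <= g" using r0 kR by (simp add: g_def)
 note b = tail_cutoff_bounds[OF kR r0, folded g_def]
 have be: "norm be <= C_b*(1+norm x+M)" using drift_growth[OF t] by (simp add: M_def)
 have Sg: "norm Sg <= C_A*(1+r+M^2)" using diffusion_growth[OF t] by (simp add: M_def r_def)
 have x1: "norm x*(1+norm x+M) <= 2*(1+r+M^2)"
 proof -
  have "2*norm x <= 1+r" "2*(norm x*M) <= r+M^2"
   using sum_squares_bound[of 1 "norm x"] sum_squares_bound[of "norm x" M] by (simp_all add: r_def)
  moreover have "norm x*(1+norm x+M) = norm x+r+norm x*M" by (simp add: r_def power2_eq_square distrib_left)
  moreover have "norm x+r+norm x*M <= 2*(1+r+M^2)"
   using calculation(1,2) r0 zero_le_power2[of M] by argo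
  ultimately show ?thesis by (simp only:)
 qed
 have "2*\<bar>tail_cutoff' R k r\<bar>*norm x*norm be <= 2*(5*g)*norm x*(C_b*(1+norm x+M))"
  by (intro mult_mono be b mult_nonneg_nonneg) (use g0 in auto)
 also have "... = 10*g*C_b*(norm x*(1+norm x+M))" by (simp add: mult_ac)
 also have "... <= 10*g*C_b*(2*(1+r+M^2))" using g0 C_nonneg by (intro mult_left_mono x1) auto
 finally have 1: "2*\<bar>tail_cutoff' R k r\<bar>*norm x*norm be <= 20*C_b*(g*(1+r+M^2))" by (simp add: mult_ac)
 have "(\<bar>tail_cutoff' R k r\<bar> * ?I+2*r*\<bar>tail_cutoff'' R k r\<bar>)*norm Sg <= (5*g * ?I+40*g)*(C_A*(1+r+M^2))"
 proof (rule mult_mono[OF add_mono Sg])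
  show "abs(tail_cutoff' R k r) * ?I <= 5*g * ?I" by (intro mult_right_mono b) auto
  show "2*r*\<bar>tail_cutoff'' R k r\<bar> <= 40*g" using b(2) by simp
 qed (use g0 in auto)
 hence 2: "(\<bar>tail_cutoff' R k r\<bar> * ?I+2*r*\<bar>tail_cutoff'' R k r\<bar>)*norm Sg <= (5 * ?I+40)*C_A*(g*(1+r+M^2))"
  by (simp add: algebra_simps)
 have "abs(generator (radial_grad (tail_cutoff' R k) x) (radial_hess (tail_cutoff' R k) (tail_cutoff'' R k) x) be Sg) <= C_tail*(g*(1+r+M^2))"
  using radial_generator_bound[of "tail_cutoff' R k" x "tail_cutoff'' R k" be Sg] 1 2
  unfolding r_def[symmetric] C_tail_def distrib_right by linarith
 also have "g*(1+r+M^2) = (1+M^2)*g+sq_tail R x"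
  by (simp add: sq_tail_def g_def r_def[symmetric] algebra_simps)
   (simp add: r_def power2_eq_square numeral_eq_Suc)
 finally show ?thesis by (simp add: g_def r_def M_def)
qed

lemma tail_moment_continuous:
 assumes m: "flow_of_probabilities T m" and R: "0 < R"
 shows "continuous_on {0..T} (%t. tail_moment R (m t))"
proof -
 have "continuous_on {0..T} (%t. sqrt (tail_moment R (m t)))"
 proof (rule continuous_on_sequentiallyI)
  fix s t assume s: "ALL n. s n : {0..T}" "t : {0..T}" "s ----> t"
  note P = flow_of_probabilities_D(1)[OF m]
  show "(%n. sqrt (tail_moment R (m (s n)))) ----> sqrt (tail_moment R (m t))"
  proof (rule Lim_null[THEN iffD2], rule Lim_null_comparison)
   show "\<forall>\<^sub>F n in sequentially. norm (sqrt (tail_moment R (m (s n)))-sqrt (tail_moment R (m t))) <= 2*W2 (m (s n)) (m t)"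
   proof (intro always_eventually allI)
    fix n
    have "m (s n) : P2" "m t : P2" using P s by auto
    thus "norm (sqrt (tail_moment R (m (s n)))-sqrt (tail_moment R (m t))) <= 2*W2 (m (s n)) (m t)"
     using tail_moment_Lipschitz[of "m (s n)" "m t" R] tail_moment_Lipschitz[of "m t" "m (s n)" R] W2_commute[of "m t" "m (s n)"] R
     by (simp add: abs_le_iff)
   qed
   show "(%n. 2*W2 (m (s n)) (m t)) ----> 0"
    using s by (intro tendsto_mult_right_zero flow_of_probabilities_D(2)[OF m]) auto
  qed
 qed
 hence "continuous_on {0..T} (%t. (sqrt (tail_moment R (m t)))^2)" by (rule continuous_on_power)
 moreover have "(sqrt (tail_moment R (m t)))^2 = tail_moment R (m t)" for t
  using tail_moment_nonneg[OF R, of "m t"] by simp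
 ultimately show ?thesis by (simp only:)
qed

text \<open>The cut-off is removed along k = 1/(n+1): the bound on the generator is free of k, and
  dominated convergence handles the observables.\<close>

lemma tail_evolution:
 assumes adm: "(m, b, A) : admissible T F nu" and R: "0 < R" and D: "continuous_on {0..T} D"
  and le: "!!t. t : {0..T} ==>
   C_tail*((1+(M2 (m t))^2)*(LINT x|m t. (norm x)^2/((norm x)^2+R))+tail_moment R (m t)) <= D t"
  and t: "t : {0..T}"
 shows "tail_moment R (m t) <= tail_moment R nu+integral {0..t} D"
proof -
 note P = flow_of_probabilities_D(1)[OF admissible_flow(1)[OF adm]]
 define I where "I n s = (LINT x|m s. tail_cutoff R (1/real (Suc n)) ((norm x)^2))" for n s
 have bnd: "I n t <= I n 0+integral {0..t} D" for n
 proof -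
  let ?k = "1/real (Suc n)"
  have "abs((LINT x|m t. tail_cutoff R ?k ((norm (x-0))^2))-(LINT x|m 0. tail_cutoff R ?k ((norm (x-0))^2))) <= integral {0..t} D"
  proof (rule radial_evolution[OF adm tail_cutoff_radial_C2[OF _ R] D])
   fix s assume s: "s : {0..T}"
   interpret prob_space "m s" by (rule P2_D(1)[OF P[OF s]])
   have gi: "integrable (m s) (%x. (norm x)^2/((norm x)^2+R))"
   proof (rule integrable_const_bound[of _ 1])
    show "AE x in m s. norm ((norm x)^2/((norm x)^2+R)) <= 1"
     using R by (intro always_eventually allI) (simp add: divide_le_eq add_nonneg_pos)
    show "(%x. (norm x)^2/((norm x)^2+R)) : borel_measurable (m s)"
     unfolding measurable_cong_sets[OF P2_D(2)[OF P[OF s]] refl] by measurable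
   qed
   note si = integrable_sq_tail[OF P[OF s] R]
   show "integrable (m s) (%x. C_tail*((1+(M2 (m s))^2)*((norm x)^2/((norm x)^2+R))+sq_tail R x))"
    by (intro integrable_mult_right Bochner_Integration.integrable_add gi si)
   have eq: "(LINT x|m s. C_tail*((1+(M2 (m s))^2)*((norm x)^2/((norm x)^2+R))+sq_tail R x)) =
    C_tail*((1+(M2 (m s))^2)*(LINT x|m s. (norm x)^2/((norm x)^2+R))+tail_moment R (m s))"
    unfolding tail_moment_def
    by (simp only: integral_mult_right_zero Bochner_Integration.integral_add[OF integrable_mult_right[OF gi] si])
   show "(LINT x|m s. C_tail*((1+(M2 (m s))^2)*((norm x)^2/((norm x)^2+R))+sq_tail R x)) <= D s"
    unfolding eq by (rule le[OF s])
   fix x be Sg assume "(be, Sg) : F s x (m s)"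
   thus "abs(generator (radial_grad (tail_cutoff' R ?k) (x-0)) (radial_hess (tail_cutoff' R ?k) (tail_cutoff'' R ?k) (x-0)) be Sg)
    <= C_tail*((1+(M2 (m s))^2)*((norm x)^2/((norm x)^2+R))+sq_tail R x)"
    by (rule tail_generator_bound[OF s P[OF s] _ _ R]) simp
  qed (use t in auto)
  thus ?thesis by (simp add: I_def)
 qed
 have lim: "(%n. I n s) ----> tail_moment R (m s)" if s: "s : {0..T}" for s
  unfolding I_def tail_moment_def
 proof (rule integral_dominated_convergence[OF _ _ integrable_sq_tail[OF P[OF s] R]])
  have sq: "sq_tail R x = ((norm x)^2)^2/((norm x)^2+R)" for x :: "real^'d" by (simp add: sq_tail_def)
  show "sq_tail R : borel_measurable (m s)"
   unfolding measurable_cong_sets[OF P2_D(2)[OF P[OF s]] refl] by measurable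
  show "(%x. tail_cutoff R (1/real (Suc n)) ((norm x)^2)) : borel_measurable (m s)" for n
   unfolding measurable_cong_sets[OF P2_D(2)[OF P[OF s]] refl] tail_cutoff_def by measurable
  show "AE x in m s. norm (tail_cutoff R (1/real (Suc n)) ((norm x)^2)) <= sq_tail R x" for n
  proof (intro always_eventually allI)
   fix x :: "real^'d"
   have "0 < 1/real (Suc n)" by simp
   from tail_cutoff_bounds(3,4)[OF this R zero_le_power2[of "norm x"]]
   show "norm (tail_cutoff R (1/real (Suc n)) ((norm x)^2)) <= sq_tail R x" by (simp only: sq real_norm_def abs_of_nonneg)
  qed
  show "AE x in m s. (%n. tail_cutoff R (1/real (Suc n)) ((norm x)^2)) ----> sq_tail R x"
  proof (intro always_eventually allI)
   fix x :: "real^'d"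
   have "(%n. (norm x)^2*inverse (real (Suc n))) ----> (norm x)^2*0"
    by (intro tendsto_mult tendsto_const LIMSEQ_inverse_real_of_nat)
   hence "(%n. (1/real (Suc n))*(norm x)^2) ----> 0" by (simp add: divide_inverse mult.commute)
   hence "(%n. sq_tail R x*(max 0 (1-(1/real (Suc n))*(norm x)^2))^3) ----> sq_tail R x*(max 0 (1-0))^3"
    by (intro tendsto_intros)
   thus "(%n. tail_cutoff R (1/real (Suc n)) ((norm x)^2)) ----> sq_tail R x"
    unfolding tail_cutoff_def sq by simp
  qed
 qed
 have "tail_moment R (m t) <= tail_moment R (m 0)+integral {0..t} D"
  by (rule LIMSEQ_le[OF lim[OF t] tendsto_add[OF lim[of 0] tendsto_const]]) (use bnd T_pos in auto)
 thus ?thesis using admissible_flow(2)[OF adm] by simp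
qed

text \<open>Gronwall twice: with R = 1 it bounds second moments by \<open>Q\<close>, and with this
  bound the source term for general R is of order 1/R, so the tails stay small uniformly over all
  admissible flows with these initial laws.\<close>

theorem admissible_ui:
 assumes e0: "(e0 \<longlongrightarrow> 0) at_top"
 shows "EX e. (e \<longlongrightarrow> 0) at_top & (ALL nu:ui_set e0. ALL m b A. (m, b, A) : admissible T F nu --> (ALL t:{0..T}. m t : ui_set e))"
proof -
 define C where "C = C_tail"
 have C0: "0 <= C" using C_tail_nonneg by (simp add: C_def)
 \<comment> \<open>For R = 1 the quotient |x|^2/(|x|^2+1) is at most 1, and the squared
   \<open>M2\<close> in front of it is again bounded by the tail moment plus 1; hence the rate
   2*C.\<close>
 define Q where "Q = 1+(e0 1+2*C*T)*exp (2*C*T)"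
 define e where "e R = (e0 R+C*((1+Q)*Q)*T/R)*exp (C*T)" for R
 have "(e \<longlongrightarrow> (0+0)*exp (C*T)) at_top"
  unfolding e_def[abs_def] by (intro tendsto_intros e0 real_tendsto_divide_at_top[OF tendsto_const filterlim_ident])
 hence e: "(e \<longlongrightarrow> 0) at_top" by simp
 moreover have "m t : ui_set e" if nu: "nu : ui_set e0" and adm: "(m, b, A) : admissible T F nu" and t: "t : {0..T}" for nu m b A t
 proof -
  note P = flow_of_probabilities_D(1)[OF admissible_flow(1)[OF adm]]
  have yc: "continuous_on {0..T} (%t. tail_moment R (m t))" if "0 < R" for R
   by (rule tail_moment_continuous[OF admissible_flow(1)[OF adm] that])
  have int_affine: "integral {0..t} (%s. p+q*tail_moment R (m s)) = p*t+q*integral {0..t} (%s. tail_moment R (m s))"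
   if "t : {0..T}" "0 < R" for p q R t
  proof -
   have i: "(%s. q*tail_moment R (m s)) integrable_on {0..t}" "(%s. p) integrable_on {0..t}"
    by (intro integrable_continuous_interval continuous_intros continuous_on_subset[OF yc[OF that(2)]]; use that in auto)+
   show ?thesis using that by (simp add: Henstock_Kurzweil_Integration.integral_add[OF i(2,1)])
  qed
  have M2Q: "(M2 (m t))^2 <= Q" if t: "t : {0..T}" for t
  proof -
   have "tail_moment 1 (m t) <= (e0 1+2*C*T)*exp (2*C*T)"
   proof (rule Gronwall_integral[OF yc])
    fix t assume t: "t : {0..T}"
    have "tail_moment 1 (m t) <= tail_moment 1 nu+integral {0..t} (%s. 2*C+2*C*tail_moment 1 (m s))"
    proof (rule tail_evolution[OF adm _ _ _ t])
     show "continuous_on {0..T} (%s. 2*C+2*C*tail_moment 1 (m s))" by (intro continuous_intros yc) simp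
     fix s assume s: "s : {0..T}"
     interpret prob_space "m s" by (rule P2_D(1)[OF P[OF s]])
     have "(LINT x|m s. (norm x)^2/((norm x)^2+1)) <= (LINT x|m s. 1)"
     proof (rule integral_mono_AE')
      show "integrable (m s) (%x. 1 :: real)" by simp
      show "AE x in m s. (norm x)^2/((norm x)^2+1) <= 1"
       by (auto simp: divide_le_eq add_nonneg_pos)
     qed simp
     hence g1: "(LINT x|m s. (norm x)^2/((norm x)^2+1)) <= 1" by (simp add: prob_space)
     have "(1+(M2 (m s))^2)*(LINT x|m s. (norm x)^2/((norm x)^2+1)) <= (1+(M2 (m s))^2)*1"
      by (rule mult_left_mono[OF g1]) simp
     also have "... <= 2+tail_moment 1 (m s)" using M2_le_tail_moment[OF P[OF s], of 1] by simp
     finally have "(1+(M2 (m s))^2)*(LINT x|m s. (norm x)^2/((norm x)^2+1))+tail_moment 1 (m s) <= 2+2*tail_moment 1 (m s)" by simp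
     from mult_left_mono[OF this C0]
     show "C_tail*((1+(M2 (m s))^2)*(LINT x|m s. (norm x)^2/((norm x)^2+1))+tail_moment 1 (m s))
      <= 2*C+2*C*tail_moment 1 (m s)"
      by (simp add: C_def algebra_simps)
    qed simp
    also have "... <= (e0 1+2*C*T)+2*C*integral {0..t} (%s. tail_moment 1 (m s))"
     using ui_setD(2)[OF nu, of 1] mult_left_mono[of t T "2*C"] t C0 by (simp add: int_affine[OF t])
    finally show "tail_moment 1 (m t) <= (e0 1+2*C*T)+2*C*integral {0..t} (%s. tail_moment 1 (m s))" .
   next
    have "0 <= e0 1" using ui_setD(2)[OF nu, of 1] tail_moment_nonneg[of 1 nu] by simp
    thus "0 <= e0 1+2*C*T" using C0 T_pos by simp
   qed (use C0 t in auto)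
   thus ?thesis using M2_le_tail_moment[OF P[OF t], of 1] by (simp add: Q_def)
  qed
  have Q0: "0 <= Q" using M2Q[OF t] zero_le_power2[of "M2 (m t)"] by linarith
  have "tail_moment R (m t) <= e R" if R: "1 <= R" for R
   unfolding e_def
  proof (rule Gronwall_integral[OF yc _ _ t])
   show "0 < R" using R by simp
   fix t assume t: "t : {0..T}"
   define p where "p = C*((1+Q)*Q)/R"
   have p0: "0 <= p" using C0 Q0 R by (simp add: p_def)
   have "tail_moment R (m t) <= tail_moment R nu+integral {0..t} (%s. p+C*tail_moment R (m s))"
   proof (rule tail_evolution[OF adm _ _ _ t])
    show "0 < R" using R by simp
    show "continuous_on {0..T} (%s. p+C*tail_moment R (m s))" by (intro continuous_intros yc) (use R in simp)
    fix s assume s: "s : {0..T}"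
    interpret prob_space "m s" by (rule P2_D(1)[OF P[OF s]])
    have "(LINT x|m s. (norm x)^2/((norm x)^2+R)) <= (LINT x|m s. (norm x)^2/R)"
    proof (rule integral_mono_AE')
     show "integrable (m s) (%x. (norm x)^2/R)" using P2_D(4)[OF P[OF s]] by simp
     show "AE x in m s. (norm x)^2/((norm x)^2+R) <= (norm x)^2/R"
      using R by (intro always_eventually allI divide_left_mono) (auto intro!: mult_pos_pos add_nonneg_pos)
    qed (use R in simp)
    also have "... = (M2 (m s))^2/R" by (simp add: M2_def)
    also have "... <= Q/R" using M2Q[OF s] R by (intro divide_right_mono) auto
    finally have "(1+(M2 (m s))^2)*(LINT x|m s. (norm x)^2/((norm x)^2+R)) <= (1+Q)*(Q/R)"
     using M2Q[OF s] Q0 R by (intro mult_mono) (auto intro!: integral_nonneg_AE)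
    hence "(1+(M2 (m s))^2)*(LINT x|m s. (norm x)^2/((norm x)^2+R))+tail_moment R (m s) <= (1+Q)*(Q/R)+tail_moment R (m s)" by simp
    from mult_left_mono[OF this C0]
    show "C_tail*((1+(M2 (m s))^2)*(LINT x|m s. (norm x)^2/((norm x)^2+R))+tail_moment R (m s)) <= p+C*tail_moment R (m s)"
     by (simp add: C_def p_def distrib_left)
   qed
   also have "... = tail_moment R nu+p*t+C*integral {0..t} (%s. tail_moment R (m s))"
    using R by (simp add: int_affine[OF t])
   also have "... <= (e0 R+C*((1+Q)*Q)*T/R)+C*integral {0..t} (%s. tail_moment R (m s))"
    using ui_setD(2)[OF nu R] mult_left_mono[of t T p] t p0 by (simp add: p_def)
   finally show "tail_moment R (m t) <= (e0 R+C*((1+Q)*Q)*T/R)+C*integral {0..t} (%s. tail_moment R (m s))" .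
  next
   have "0 <= e0 R" using ui_setD(2)[OF nu R] tail_moment_nonneg[of R nu] R by simp
   thus "0 <= e0 R+C*((1+Q)*Q)*T/R" using C0 T_pos Q0 R by simp
  qed (use C0 in auto)
  thus ?thesis using P[OF t] by (simp add: ui_set_def)
 qed
 ultimately show ?thesis by blast
qed

text \<open>A bump has compact support, so its generator is bounded by a constant that depends on
  the process only through \<open>M\<close>.\<close>

lemma admissible_bump_equicontinuous:
 assumes "0 <= M" "0 < k"
 shows "EX C>=0. ALL m b A nu. (m, b, A) : admissible T F nu --> (ALL t:{0..T}. M2 (m t) <= M) -->
  (ALL s:{0..T}. ALL t:{0..T}. \<bar>(LINT x|m t. bump k a x)-(LINT x|m s. bump k a x)\<bar> <= C*\<bar>t-s\<bar>)"
proof -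
 note rad = bump_radial_C2[OF assms(2)]
 obtain C where C: "0 <= C" "ALL t x mu u. t : {0..T} --> mu : P2 --> M2 mu <= M --> u : F t x mu -->
   abs(generator (radial_grad (%r. - (3 * k*(max 0 (1-k*r))^2)) (x-a))
    (radial_hess (%r. - (3 * k*(max 0 (1-k*r))^2)) (%r. 6 * k^2 * max 0 (1-k*r)) (x-a)) (fst u) (snd u)) <= C"
  using radial_generator_bounded[OF rad assms(1), of a] by auto
 have ordered: "abs((LINT x|m t. bump k a x)-(LINT x|m s. bump k a x)) <= C*(t-s)"
  if adm: "(m, b, A) : admissible T F nu" and M: "ALL t:{0..T}. M2 (m t) <= M" and st: "0 <= s" "s <= t" "t <= T" for m b A nu s t
 proof -
  note P = flow_of_probabilities_D(1)[OF admissible_flow(1)[OF adm]]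
  have "abs((LINT x|m t. (max 0 (1-k*(norm (x-a))^2))^3)-(LINT x|m s. (max 0 (1-k*(norm (x-a))^2))^3)) <= integral {s..t} (%_. C)"
  proof (rule radial_evolution[OF adm rad, where h="%_ _. C"])
   fix r assume r: "r : {0..T}"
   interpret prob_space "m r" by (rule P2_D(1)[OF P[OF r]])
   show "integrable (m r) (%x. C)" "(LINT x|m r. C) <= C" by (simp_all add: prob_space)
   fix x be Sg assume "(be, Sg) : F r x (m r)"
   from C(2)[rule_format, OF r P[OF r] M[rule_format, OF r] this]
   show "abs(generator (radial_grad (%r. - (3 * k*(max 0 (1-k*r))^2)) (x-a))
    (radial_hess (%r. - (3 * k*(max 0 (1-k*r))^2)) (%r. 6 * k^2 * max 0 (1-k*r)) (x-a)) be Sg) <= C" by simp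
  qed (use st in auto)
  thus ?thesis using st by (simp add: bump_def mult.commute)
 qed
 show ?thesis
 proof (intro exI[of _ C] conjI C(1) allI impI ballI)
  fix m b A nu s t
  assume *: "(m, b, A) : admissible T F nu" "ALL t:{0..T}. M2 (m t) <= M" "s : {0..T}" "t : {0..T}"
  show "\<bar>(LINT x|m t. bump k a x)-(LINT x|m s. bump k a x)\<bar> <= C*\<bar>t-s\<bar>"
  proof (cases "s <= t")
   case True
   thus ?thesis using ordered[OF *(1,2), of s t]*by simp
  next
   case False
   thus ?thesis using ordered[OF *(1,2), of t s]*by (simp add: abs_minus_commute)
  qed
 qed
qed

end

subsection \<open>Random walk approximation\<close>

text \<open>Cholesky elimination: subtracting the rank-one matrix of the normalised row i leaves the
  Schur complement, which is again nonnegative and has row i equal to zero. If the pivot vanishes,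
  so does the whole row.\<close>

lemma sym_psd_factorization_on:
 fixes S :: "real^'d^'d"
 assumes "finite J" "S : sym_psd" "!!i. i ~: J ==> S $ i = 0"
 shows "EX w. S = (\<Sum>i\<in>J. outer (w i))"
 using assms
proof (induction J arbitrary: S rule: finite_induct)
 case empty
 hence "S = 0" by (simp add: vec_eq_iff)
 thus ?case by simp
next
 case (insert i J)
 have sym: "S $ j $ k = S $ k $ j" for j k
 proof -
  have "transpose S $ k $ j = S $ k $ j" using insert.prems(1) by (simp add: sym_psd_def)
  thus ?thesis by (simp add: transpose_def)
 qed
 have psd: "0 <= v \<bullet> (S *v v)" for v using insert.prems(1) by (simp add: sym_psd_def)
 have form: "(v + c*\<^sub>R axis i 1) \<bullet> (S *v (v + c*\<^sub>R axis i 1)) = v \<bullet> (S *v v)+2*c*(v \<bullet> S $ i) + c^2*S $ i $ i" for v c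
 proof -
  have "S *v axis i 1 = S $ i" using sym by (simp add: matrix_vector_mult_def axis_def vec_eq_iff if_distrib cong: if_cong)
  moreover have "axis i 1 \<bullet> (S *v v) = v \<bullet> S $ i"
  proof -
   have "axis i 1 \<bullet> (S *v v) = (S *v v) $ i" by (simp add: inner_axis')
   thus ?thesis by (simp add: matrix_vector_mult_def inner_vec_def mult.commute)
  qed
  moreover have "axis i 1 \<bullet> S $ i = S $ i $ i" by (simp add: inner_axis')
  ultimately show ?thesis
   by (simp add: matrix_vector_right_distrib matrix_vector_mult_scaleR inner_add_left inner_add_right power2_eq_square algebra_simps)
 qed
 have Sii: "0 <= S $ i $ i" using psd[of "axis i 1"] form[of 0 1] by simp
 show ?case
 proof (cases "S $ i $ i = 0")
  case True
  have "S $ i $ j = 0" for j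
  proof (rule ccontr)
   assume ne: "S $ i $ j ~= 0"
   define q where "q = axis j 1 \<bullet> (S *v axis j 1)"
   have "0 <= q+2*c*S $ i $ j" for c
    using psd[of "axis j 1 + c*\<^sub>R axis i 1"] form[of "axis j 1" c] True by (simp add: q_def inner_axis')
   \<comment> \<open>An affine function of c that is bounded below is constant; this choice of c
     would give the value -1.\<close>
   hence "0 <= q+2*(- (q+1)/(2*S $ i $ j))*S $ i $ j" .
   moreover have "2*(- (q+1)/(2*S $ i $ j))*S $ i $ j = - (q+1)" using ne by simp
   ultimately show False by linarith
  qed
  hence "S $ i = 0" by (simp add: vec_eq_iff)
  then obtain w where w: "S = (\<Sum>j\<in>J. outer (w j))" using insert.IH[OF insert.prems(1)] insert.prems(2) by fastforce
  have z: "outer (0 :: real^'d) = 0" by (simp add: outer_def vec_eq_iff)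
  have "(\<Sum>j\<in>J. outer (w j)) = (\<Sum>j\<in>J. outer ((w(i := 0)) j))"
   using insert.hyps by (intro sum.cong) auto
  hence "S = (\<Sum>j\<in>insert i J. outer ((w(i := 0)) j))"
   using insert.hyps w z by simp
  thus ?thesis by blast
 next
  case False
  hence pos: "0 < S $ i $ i" using Sii by simp
  define u where "u = (1/sqrt (S $ i $ i))*\<^sub>R S $ i"
  have ou: "outer u $ j $ k = S $ i $ j*S $ i $ k/S $ i $ i" for j k
   using pos by (simp add: u_def outer_def)
  have "S - outer u : sym_psd"
   unfolding sym_psd_def
  proof (intro CollectI conjI allI)
   show "transpose (S - outer u) = S - outer u" using sym by (simp add: vec_eq_iff transpose_def ou mult.commute)
   fix v
   have vu: "v \<bullet> u = (v \<bullet> S $ i)/sqrt (S $ i $ i)" by (simp add: u_def)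
   have "v \<bullet> ((S - outer u) *v v) = v \<bullet> (S *v v)-(v \<bullet> u)^2"
    by (simp add: matrix_vector_mult_diff_rdistrib outer_mult_vec inner_diff_right power2_eq_square inner_commute)
   also have "(v \<bullet> u)^2 = (v \<bullet> S $ i)^2/S $ i $ i" using pos by (simp add: vu power_divide)
   \<comment> \<open>Completing the square: this is the form at \<open>v\<close> shifted along axis
     i to its minimum.\<close>
   also have "v \<bullet> (S *v v)-(v \<bullet> S $ i)^2/S $ i $ i =
    (v+(- (v \<bullet> S $ i)/S $ i $ i)*\<^sub>R axis i 1) \<bullet> (S *v (v+(- (v \<bullet> S $ i)/S $ i $ i)*\<^sub>R axis i 1))"
    unfolding form using pos by (simp add: power2_eq_square field_simps)
   also have "0 <= ..." by (rule psd)
   finally show "0 <= v \<bullet> ((S - outer u) *v v)" .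
  qed
  moreover have "(S - outer u) $ j = 0" if "j ~: J" for j
  proof (cases "j = i")
   case True
   thus ?thesis using pos by (simp add: vec_eq_iff ou)
  next
   case False
   hence "S $ j = 0" using insert.prems(2) that by simp
   thus ?thesis using sym[of i j] by (simp add: vec_eq_iff ou)
  qed
  ultimately obtain w where w: "S - outer u = (\<Sum>j\<in>J. outer (w j))" using insert.IH by blast
  have "(\<Sum>j\<in>J. outer (w j)) = (\<Sum>j\<in>J. outer ((w(i := u)) j))"
   using insert.hyps by (intro sum.cong) auto
  hence "S = (\<Sum>j\<in>insert i J. outer ((w(i := u)) j))"
   using insert.hyps w by (simp add: algebra_simps)
  thus ?thesis by blast
 qed
qed

text \<open>A family of d vectors takes the place of a matrix square root.\<close>

definition psd_factor :: "real^'d^'d => 'd => real^'d" where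
 "psd_factor S = (SOME w. S = (\<Sum>i\<in>UNIV. outer (w i)))"

lemma psd_factor:
 fixes S :: "real^'d^'d"
 assumes "S : sym_psd"
 shows "(\<Sum>i\<in>UNIV. outer (psd_factor S i)) = S"
proof -
 have "EX w. S = (\<Sum>i\<in>(UNIV :: 'd set). outer (w i))" by (rule sym_psd_factorization_on[OF _ assms]) auto
 from someI_ex[OF this] show ?thesis unfolding psd_factor_def by (rule sym)
qed

lemma trace_mult_outer: "trace (H ** outer v) = v \<bullet> (H *v v)"
 by (simp add: trace_def matrix_matrix_mult_def outer_def inner_vec_def matrix_vector_mult_def sum_distrib_left mult_ac)

lemma trace_mult_psd_factor:
 assumes "S : sym_psd"
 shows "trace (H ** S) = (\<Sum>i\<in>UNIV. psd_factor S i \<bullet> (H *v psd_factor S i))"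
proof -
 have "trace (H ** S) = transpose H \<bullet> (\<Sum>i\<in>UNIV. outer (psd_factor S i))"
  unfolding psd_factor[OF assms] by (rule matrix_transpose_inner[symmetric])
 thus ?thesis by (simp add: inner_sum_right matrix_transpose_inner trace_mult_outer)
qed

lemma norm_psd_factor:
 fixes S :: "real^'d^'d"
 assumes "S : sym_psd"
 shows "(norm (psd_factor S i))^2 <= norm (mat 1 :: real^'d^'d)*norm S"
proof -
 have "(norm (psd_factor S i))^2 <= (\<Sum>i\<in>UNIV. (norm (psd_factor S i))^2)" by (rule member_le_sum) auto
 also have "... = trace (mat 1 ** S)" using trace_mult_psd_factor[OF assms, of "mat 1"] by (simp add: power2_norm_eq_inner)
 also have "... = mat 1 \<bullet> S" using matrix_transpose_inner[of "mat 1" S] by (simp add: transpose_mat)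
 also have "... <= norm (mat 1 :: real^'d^'d)*norm S" by (rule norm_cauchy_schwarz)
 finally show ?thesis .
qed

lemma quadratic_form_bound: "abs(v \<bullet> (H *v v)) <= norm H*(norm v)^2" for H :: "real^'d^'d"
 using Cauchy_Schwarz_ineq2[of "transpose H" "outer v"]
 by (simp add: matrix_transpose_inner trace_mult_outer norm_transpose norm_outer)

lemma Taylor_second_order:
 fixes phi :: "real^'d => real"
 assumes g: "!!x. GDERIV phi x :> g x" and H: "!!x. (g has_derivative (%h. H x *v h)) (at x)"
 shows "EX s. 0 <= s & s <= 1 & phi (x+v) = phi x+g x \<bullet> v+(1/2)*(v \<bullet> (H (x+s*\<^sub>R v) *v v))"
proof -
 define psi where "psi s = phi (x+s*\<^sub>R v)" for s
 define psi' where "psi' s = g (x+s*\<^sub>R v) \<bullet> v" for s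
 define psi'' where "psi'' s = v \<bullet> (H (x+s*\<^sub>R v) *v v)" for s
 have aff: "((%s. x+s*\<^sub>R v) has_derivative (%h. h*\<^sub>R v)) (at s)" for s by (auto intro!: derivative_eq_intros)
 have d1: "(psi has_real_derivative psi' s) (at s)" for s
 proof -
  have "(phi has_derivative (%h. h \<bullet> g (x+s*\<^sub>R v))) (at (x+s*\<^sub>R v))"
   using g[of "x+s*\<^sub>R v"] by (simp add: gderiv_def inner_commute)
  from has_derivative_compose[OF aff this] show ?thesis
   unfolding psi_def psi'_def has_field_derivative_def by (simp add: inner_commute mult_commute_abs)
 qed
 have d2: "(psi' has_real_derivative psi'' s) (at s)" for s
 proof -
  have "((%s. g (x+s*\<^sub>R v) \<bullet> v) has_derivative (%h. (H (x+s*\<^sub>R v) *v (h*\<^sub>R v)) \<bullet> v)) (at s)"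
   by (rule has_derivative_inner_left[OF has_derivative_compose[OF aff H]])
  thus ?thesis
   unfolding psi'_def[abs_def] psi''_def has_field_derivative_def
   by (simp add: matrix_vector_mult_scaleR inner_commute mult_commute_abs)
 qed
 define diff where "diff m = (if m = 0 then psi else if m = 1 then psi' else psi'')" for m :: nat
 have "EX t>0. t < 1 & psi 1 = (\<Sum>m<2. diff m 0/fact m*1^m)+diff 2 t/fact 2*1^2"
 proof (rule Maclaurin)
  show "ALL m t. m < 2 & 0 <= t & t <= 1 --> DERIV (diff m) t :> diff (Suc m) t"
   using d1 d2 by (auto simp: diff_def less_2_cases_iff)
 qed (auto simp: diff_def)
 then obtain t where "0 < t" "t < 1" "psi 1 = psi 0+psi' 0+psi'' t/2" by (auto simp: diff_def numeral_2_eq_2)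
 thus ?thesis by (intro exI[of _ t]) (simp add: psi_def psi'_def psi''_def)
qed

text \<open>One step of the walk: drift plus a random sign times one of the d rank-one factors, all
  2*d choices equally likely. The factor \<open>CARD('d)\<close> under the root compensates for
  picking one factor out of d, so the covariance of the noise is h times the diffusion
  matrix.\<close>

definition spread :: "real => 'd control => real^'d => (real^'d) pmf" where
 "spread h u x = map_pmf (%(i, e). x+(h*\<^sub>R fst u+(if e then sqrt (h*CARD('d)) else-sqrt (h*CARD('d)))*\<^sub>R psd_factor (snd u) i))
  (pmf_of_set UNIV)"

lemma finite_spread: "finite (set_pmf (spread h u x))"
 by (simp add: spread_def)

lemma spread_expectation:
 fixes x :: "real^'d" and f :: "real^'d => real"
 shows "pmf_mean (spread h u x) f =
  (\<Sum>i\<in>UNIV. f (x+(h*\<^sub>R fst u+sqrt (h*CARD('d))*\<^sub>R psd_factor (snd u) i))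
      + f (x+(h*\<^sub>R fst u-sqrt (h*CARD('d))*\<^sub>R psd_factor (snd u) i)))/(2*CARD('d))"
proof -
 have "pmf_mean (spread h u x) f =
  (\<Sum>(i, e)\<in>UNIV. f (x+(h*\<^sub>R fst u+(if e then sqrt (h*CARD('d)) else-sqrt (h*CARD('d)))*\<^sub>R psd_factor (snd u) i)))/CARD('d \<times> bool)"
  unfolding spread_def by (simp add: integral_pmf_of_set case_prod_beta)
 also have "(UNIV :: ('d \<times> bool) set) = UNIV \<times> UNIV" by simp
 also have "(\<Sum>(i, e)\<in>UNIV \<times> UNIV. f (x+(h*\<^sub>R fst u+(if e then sqrt (h*CARD('d)) else-sqrt (h*CARD('d)))*\<^sub>R psd_factor (snd u) i))) =
  (\<Sum>i\<in>UNIV. \<Sum>e\<in>UNIV. f (x+(h*\<^sub>R fst u+(if e then sqrt (h*CARD('d)) else-sqrt (h*CARD('d)))*\<^sub>R psd_factor (snd u) i)))"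
  by (rule sum.cartesian_product[symmetric])
 finally show ?thesis by (simp add: UNIV_bool add.commute card_prod mult.commute)
qed

lemma spread_expectation_le:
 fixes x :: "real^'d" and f :: "real^'d => real"
 assumes "!!i. f (x+(h*\<^sub>R fst u+sqrt (h*CARD('d))*\<^sub>R psd_factor (snd u) i))
      + f (x+(h*\<^sub>R fst u-sqrt (h*CARD('d))*\<^sub>R psd_factor (snd u) i)) <= 2*c"
 shows "pmf_mean (spread h u x) f <= c"
proof -
 have "(\<Sum>i\<in>UNIV. f (x+(h*\<^sub>R fst u+sqrt (h*CARD('d))*\<^sub>R psd_factor (snd u) i))
      + f (x+(h*\<^sub>R fst u-sqrt (h*CARD('d))*\<^sub>R psd_factor (snd u) i))) <= (\<Sum>i\<in>(UNIV :: 'd set). 2*c)"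
  by (intro sum_mono assms)
 thus ?thesis unfolding spread_expectation by (simp add: divide_le_eq mult_ac)
qed

lemma spread_increment:
 fixes u :: "('d::finite) control"
 assumes "snd u : sym_psd" "0 <= h" "e = 1 | e = - 1"
 shows "(norm (h*\<^sub>R fst u+(e * sqrt (h*CARD('d)))*\<^sub>R psd_factor (snd u) i))^2 <=
  2*h^2*(norm (fst u))^2+2*h*CARD('d)*norm (mat 1 :: real^'d^'d)*norm (snd u)"
proof -
 have "(norm (a+b))^2 <= 2*(norm a)^2+2*(norm b)^2" for a b :: "real^'d"
  using norm_triangle_ineq[of a b] power_mono[of "norm (a+b)" "norm a+norm b" 2] sum_squares_bound[of "norm a" "norm b"]
  by (simp add: power2_sum)
 from this[of "h*\<^sub>R fst u" "(e * sqrt (h*CARD('d)))*\<^sub>R psd_factor (snd u) i"]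
 have "(norm (h*\<^sub>R fst u+(e * sqrt (h*CARD('d)))*\<^sub>R psd_factor (snd u) i))^2 <=
  2*(h^2*(norm (fst u))^2)+2*(h*CARD('d)*(norm (psd_factor (snd u) i))^2)"
  using assms by (auto simp: power_mult_distrib)
 also have "h*CARD('d)*(norm (psd_factor (snd u) i))^2 <= h*CARD('d)*(norm (mat 1 :: real^'d^'d)*norm (snd u))"
  using assms by (intro mult_left_mono norm_psd_factor) auto
 finally show ?thesis by (simp add: mult_ac)
qed

text \<open>The first-order terms in the noise cancel in the average over the two signs, and the
 second-order terms add up to the diffusion matrix.\<close>

lemma spread_Taylor:
 fixes u :: "('d::finite) control"
 assumes g: "!!x. GDERIV phi x :> g x" and H: "!!x. (g has_derivative (%h. H x *v h)) (at x)"
  and H_mod: "!!x y. norm (H y-H x) <= eps+C*(norm (y-x))^2" and C: "0 <= C" and eps: "0 <= eps"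
  and u: "snd u : sym_psd" "0 <= h"
  and V: "2*h^2*(norm (fst u))^2+2*h*CARD('d)*norm (mat 1 :: real^'d^'d)*norm (snd u) <= V"
 shows "abs(pmf_mean (spread h u x) phi-phi x-h*generator (g x) (H x) (fst u) (snd u)) <=
  (h^2*norm (H x)*(norm (fst u))^2+(eps+C*V)*V)/2"
proof -
 let ?d = "real CARD('d)"
 define w where "w = psd_factor (snd u)"
 define c where "c = sqrt (h * ?d)"
 define v where "v e i = h*\<^sub>R fst u+(e*c)*\<^sub>R w i" for e :: real and i
 define R where "R = (eps+C*V)*V/2"
 have V0: "0 <= V" using V u by (intro order_trans[OF _ V]) auto
 have vV: "(norm (v e i))^2 <= V" if "e = 1 | e = -1" for e i
  using spread_increment[OF u that, of i] V unfolding v_def c_def w_def by linarith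
 \<comment> \<open>The Hessian at the intermediate Taylor point differs from that at x by at most
   eps+C*V, since the squared increment is at most V.\<close>
 have tay: "abs(phi (x+v e i)-(phi x+g x \<bullet> v e i+(1/2)*(v e i \<bullet> (H x *v v e i)))) <= R" if e: "e = 1 | e = -1" for e i
 proof -
  obtain s where s: "0 <= s" "s <= 1" and eq: "phi (x+v e i) = phi x+g x \<bullet> v e i+(1/2)*(v e i \<bullet> (H (x+s*\<^sub>R v e i) *v v e i))"
   using Taylor_second_order[OF g H, of x "v e i"] by blast
  have "norm (H (x+s*\<^sub>R v e i)-H x) <= eps+C*(norm (s*\<^sub>R v e i))^2" using H_mod[of "x+s*\<^sub>R v e i" x] by simp
  also have "... <= eps+C*V"
  proof (intro add_left_mono mult_left_mono C)
   have "s^2 <= 1" using s by (simp add: power_le_one)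
   hence "s^2*(norm (v e i))^2 <= 1*V" using vV[OF e, of i] V0 by (intro mult_mono) auto
   thus "(norm (s*\<^sub>R v e i))^2 <= V" by (simp add: power_mult_distrib)
  qed
  finally have Hd: "norm (H (x+s*\<^sub>R v e i)-H x) <= eps+C*V" .
  have "abs(v e i \<bullet> ((H (x+s*\<^sub>R v e i)-H x) *v v e i)) <= norm (H (x+s*\<^sub>R v e i)-H x)*(norm (v e i))^2"
   by (rule quadratic_form_bound)
  also have "... <= (eps+C*V)*V" using Hd vV[OF e, of i] C eps V0 by (intro mult_mono) auto
  finally have "abs(v e i \<bullet> (H (x+s*\<^sub>R v e i) *v v e i)-v e i \<bullet> (H x *v v e i)) <= (eps+C*V)*V"
   by (simp add: matrix_vector_mult_diff_rdistrib inner_diff_right)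
  thus ?thesis unfolding eq R_def by linarith
 qed
 have pair: "abs(phi (x+v 1 i)+phi (x+v (-1) i)-2*(phi x+h*(g x \<bullet> fst u))-(h^2*(fst u \<bullet> (H x *v fst u))+(h * ?d)*(w i \<bullet> (H x *v w i)))) <= 2*R" for i
 proof -
  have cc: "c*c = h * ?d" using u by (simp add: c_def)
  have "v 1 i \<bullet> (H x *v v 1 i)+v (-1) i \<bullet> (H x *v v (-1) i) = 2*(h^2*(fst u \<bullet> (H x *v fst u))+(c*c)*(w i \<bullet> (H x *v w i)))"
   by (simp add: v_def matrix_vector_right_distrib matrix_vector_mult_diff_distrib matrix_vector_mult_scaleR inner_add_left inner_add_right inner_diff_left inner_diff_right power2_eq_square algebra_simps)
  moreover have "g x \<bullet> v 1 i+g x \<bullet> v (-1) i = 2*(h*(g x \<bullet> fst u))" by (simp add: v_def inner_add_right inner_diff_right)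
  ultimately show ?thesis using tay[of 1 i] tay[of "-1" i] unfolding cc by (simp add: abs_le_iff algebra_simps)
 qed
 have "abs((\<Sum>i\<in>UNIV. phi (x+v 1 i)+phi (x+v (-1) i))-(\<Sum>i\<in>UNIV. 2*(phi x+h*(g x \<bullet> fst u))+(h^2*(fst u \<bullet> (H x *v fst u))+(h * ?d)*(w i \<bullet> (H x *v w i)))))
  <= (\<Sum>i\<in>(UNIV :: 'd set). 2*R)"
  unfolding sum_subtractf[symmetric] by (rule order_trans[OF sum_abs sum_mono]) (use pair in \<open>simp add: algebra_simps\<close>)
 moreover have "(\<Sum>i\<in>(UNIV :: 'd set). 2*(phi x+h*(g x \<bullet> fst u))+(h^2*(fst u \<bullet> (H x *v fst u))+(h * ?d)*(w i \<bullet> (H x *v w i))))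
  = 2 * ?d*(phi x+h*generator (g x) (H x) (fst u) (snd u)+h^2*(fst u \<bullet> (H x *v fst u))/2)"
  by (simp add: sum.distrib sum_distrib_left[symmetric] trace_mult_psd_factor[OF u(1), folded w_def, symmetric] generator_def field_simps)
 moreover have "(\<Sum>i\<in>UNIV. phi (x+v 1 i)+phi (x+v (-1) i)) = 2 * ?d * pmf_mean (spread h u x) phi"
  unfolding spread_expectation v_def w_def c_def by simp
 ultimately have "abs(2 * ?d*(pmf_mean (spread h u x) phi-(phi x+h*generator (g x) (H x) (fst u) (snd u)+h^2*(fst u \<bullet> (H x *v fst u))/2))) <= 2 * ?d*R"
  by (simp add: algebra_simps)
 hence "abs(pmf_mean (spread h u x) phi-(phi x+h*generator (g x) (H x) (fst u) (snd u)+h^2*(fst u \<bullet> (H x *v fst u))/2)) <= R"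
  by (simp add: abs_mult)
 moreover have "abs(h^2*(fst u \<bullet> (H x *v fst u))/2) <= h^2*norm (H x)*(norm (fst u))^2/2"
  using mult_left_mono[OF quadratic_form_bound[of "fst u" "H x"], of "h^2"] by (simp add: abs_mult mult.assoc)
 ultimately show ?thesis unfolding R_def add_divide_distrib by linarith
qed

text \<open>The term linear in v is kept exact, because averaging over the two signs leaves only its
  drift part; the others are at least of second order in v.\<close>

lemma norm_add_power4_le:
 fixes x v :: "'a::real_inner"
 shows "(norm (x+v))^4 <= (norm x)^4+4*(norm x)^2*(x \<bullet> v)+8*(norm x)^2*(norm v)^2+3*(norm v)^4"
proof -
 define a s b where "a = (norm x)^2" and "s = x \<bullet> v" and "b = (norm v)^2"
 have n: "(norm (x+v))^2 = a+2 * s+b"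
  by (simp add: a_def s_def b_def power2_norm_eq_inner inner_add_left inner_add_right inner_commute)
 have "s^2 <= a*b"
  using Cauchy_Schwarz_ineq[of x v] by (simp add: a_def s_def b_def power2_norm_eq_inner)
 moreover have "2*(s*b) <= s^2+b^2" using sum_squares_bound[of s b] by (simp add: mult_ac)
 moreover have "(a+2 * s+b)^2 = a^2+4 * s^2+b^2+4*(a * s)+2*(a*b)+2*(2*(s*b))"
  by (simp add: power2_eq_square algebra_simps)
 ultimately have "(a+2 * s+b)^2 <= a^2+4*(a * s)+8*(a*b)+3*b^2" by linarith
 moreover have "y^4 = (y^2)^2" for y :: real by simp
 ultimately show ?thesis by (simp only: n a_def[symmetric] s_def[symmetric] b_def[symmetric] mult.assoc)
qed

text \<open>A pmf lives on the full power set; this is its Borel version, as \<open>P2\<close>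
  requires.\<close>

definition law :: "(real^'d) pmf => (real^'d) measure" where
 "law p = distr (measure_pmf p) borel (%x. x)"

lemma integrable_pmf [simp]: "finite (set_pmf p) ==> integrable (measure_pmf p) (f :: _ => real)"
 by (rule integrable_measure_pmf_finite)

lemma law_prob: "prob_space (law p)" and law_sets: "sets (law p) = sets borel"
 unfolding law_def by (auto intro!: measure_pmf.prob_space_distr)

lemma law_integral: "f : borel_measurable borel ==> (LINT x|law p. f x) = pmf_mean p (f :: _ => real)"
 unfolding law_def by (subst integral_distr) auto

lemma law_P2: "finite (set_pmf p) ==> law p : P2"
 unfolding P2_def using law_prob law_sets by (auto simp: law_def integrable_distr_eq)

lemma law_M2: "(M2 (law p))^2 = pmf_mean p (%x. (norm x)^2)"
 unfolding M2_def by (simp add: law_integral)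

lemma AE_law: "set_pmf p \<subseteq> S ==> S : sets borel ==> AE x in law p. x : S"
 unfolding law_def by (subst AE_distr_iff) (auto simp: AE_measure_pmf_iff)

lemma expectation_bind_finite:
 fixes g :: "'b => real"
 assumes "finite (set_pmf p)" "!!x. finite (set_pmf (f x))"
 shows "pmf_mean (bind_pmf p f) g = pmf_mean p (%x. pmf_mean (f x) g)"
 by (subst pmf_expectation_bind[OF assms(1) assms(2) order_refl], subst integral_measure_pmf[OF assms(1)]) auto

lemma expectation_mono_finite:
 fixes f g :: "'a => real"
 assumes "finite (set_pmf p)" "!!x. x : set_pmf p ==> f x <= g x"
 shows "pmf_mean p f <= pmf_mean p g"
 using assms by (intro integral_mono_AE) (auto simp: AE_measure_pmf_iff)

lemma expectation_abs_le_finite: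
 fixes f g :: "'a => real"
 assumes "finite (set_pmf p)" "!!x. x : set_pmf p ==> abs(f x) <= g x"
 shows "abs(pmf_mean p f) <= pmf_mean p g"
 by (rule order_trans[OF integral_abs_bound expectation_mono_finite[OF assms]])

lemma expectation_square_le:
 fixes f :: "'a => real"
 assumes "finite (set_pmf p)"
 shows "(pmf_mean p f)^2 <= pmf_mean p (%x. (f x)^2)"
proof -
 define a where "a = pmf_mean p f"
 have "0 <= pmf_mean p (%x. (f x-a)^2)" by simp
 also have "... = pmf_mean p (%x. (f x)^2-2*a*f x+a^2)"
  by (simp add: power2_diff algebra_simps)
 also have "... = pmf_mean p (%x. (f x)^2)-2*a*a+a^2"
  using assms by (simp add: a_def)
 finally show ?thesis by (simp add: a_def power2_eq_square)
qed

section \<open>The controlled random walk and its fourth moments\<close>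

context dynamics
begin

text \<open>An arbitrary choice: each step of the walk visits finitely many points, and the
  resulting control becomes Borel after extension by zero.\<close>

definition select :: "real => real^'d => (real^'d) measure => 'd control" where
 "select s x mu = (SOME u. u : F s x mu)"

lemma select:
 assumes "s : {0..T}" "mu : P2"
 shows "select s x mu : F s x mu" "snd (select s x mu) : sym_psd"
proof -
 show "select s x mu : F s x mu" unfolding select_def using F_nonempty[OF assms] by (simp add: some_in_eq)
 thus "snd (select s x mu) : sym_psd" using F_range[OF assms, of x] by auto
qed

primrec walk :: "real => (real^'d) pmf => nat => (real^'d) pmf" where
 "walk h p 0 = p"
| "walk h p (Suc k) = bind_pmf (walk h p k) (%x. spread h (select (real k*h) x (law (walk h p k))) x)"

definition "walk_control h p k x = select (real k*h) x (law (walk h p k))"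

text \<open>Squared increments of one step are at most h*kap*q with q = 1+|x|^2+M2^2; one factor h
  of the drift part is estimated by T.\<close>

definition "kap = 6*T*C_b^2+2*CARD('d)*norm (mat 1 :: real^'d^'d)*C_A"

text \<open>8*C_b comes from the drift in the linear term, the rest from the last two terms of
  \<open>norm_add_power4_le\<close>.\<close>

definition "K4 = 8*C_b+8 * kap+3*T * kap^2"

lemma kap_nonneg: "0 <= kap" using C_nonneg T_pos by (simp add: kap_def)

lemma K4_nonneg: "0 <= K4" using C_nonneg T_pos kap_nonneg by (simp add: K4_def)

lemma walk_growth:
 assumes "s : {0..T}" "mu : P2" "u : F s x mu" and h: "0 <= h" "h <= T"
 defines "q \<equiv> 1+(norm x)^2+(M2 mu)^2"
 shows "(norm (fst u))^2 <= 3*C_b^2*q" "norm (snd u) <= C_A*q"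
  "2*h^2*(norm (fst u))^2+2*h*CARD('d)*norm (mat 1 :: real^'d^'d)*norm (snd u) <= h * kap*q"
  "norm x*norm (fst u) <= 2*C_b*q"
proof -
 define M where "M = M2 mu"
 note g = control_growth[OF assms(1,2) order_refl assms(3)]
 have q0: "0 <= q" by (simp add: q_def)
 show b: "(norm (fst u))^2 <= 3*C_b^2*q" and A: "norm (snd u) <= C_A*q" using g(2,3) by (simp_all add: q_def)
 have "2*h^2*(norm (fst u))^2 <= 2*(h*T)*(3*C_b^2*q)"
  using h q0 by (intro mult_mono b) (auto simp: power2_eq_square intro!: mult_left_mono)
 moreover have "2*h*CARD('d)*norm (mat 1 :: real^'d^'d)*norm (snd u) <= 2*h*CARD('d)*norm (mat 1 :: real^'d^'d)*(C_A*q)"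
  using h by (intro mult_left_mono A) auto
 ultimately show "2*h^2*(norm (fst u))^2+2*h*CARD('d)*norm (mat 1 :: real^'d^'d)*norm (snd u) <= h * kap*q"
  by (simp add: kap_def algebra_simps)
 have "norm x*(1+norm x+M) = norm x+(norm x)^2+norm x*M" by (simp add: power2_eq_square distrib_left)
 moreover have "2*norm x <= 1+(norm x)^2" "2*(norm x*M) <= (norm x)^2+M^2"
  using sum_squares_bound[of 1 "norm x"] sum_squares_bound[of "norm x" M] by simp_all
 moreover have "q = 1+(norm x)^2+M^2" "0 <= M^2" "0 <= (norm x)^2" by (simp_all add: q_def M_def)
 ultimately have "norm x*(1+norm x+M) <= 2*q" by argo
 hence "C_b*(norm x*(1+norm x+M)) <= C_b*(2*q)" using C_nonneg by (intro mult_left_mono)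
 moreover have "norm x*norm (fst u) <= norm x*(C_b*(1+norm x+M))" using g(1) by (intro mult_left_mono) (auto simp: M_def)
 ultimately show "norm x*norm (fst u) <= 2*C_b*q" by (simp add: mult_ac)
qed

text \<open>Fourth moments are propagated because Taylor errors are quadratic in |x|^2, and because
  they bound the tails of all walk laws by a multiple of 1/R. They start finite since the initial
  law has finite support.\<close>

lemma spread_fourth_moment:
 assumes "s : {0..T}" "mu : P2" "u : F s x mu" and h: "0 <= h" "h <= T"
 defines "q \<equiv> 1+(norm x)^2+(M2 mu)^2"
 shows "pmf_mean (spread h u x) (%y. (norm y)^4) <= (norm x)^4+h*K4*q^2"
proof (rule spread_expectation_le)
 fix i :: 'd
 note G = walk_growth[OF assms(1-5), folded q_def]
 have psd: "snd u : sym_psd" using F_range[OF assms(1,2), of x] assms(3) by auto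
 have q1: "1 <= q" by (simp add: q_def)
 have xq: "(norm x)^2 <= q" by (simp add: q_def)
 define v where "v e = h*\<^sub>R fst u+(e * sqrt (h*CARD('d)))*\<^sub>R psd_factor (snd u) i" for e :: real
 have V: "(norm (v e))^2 <= h * kap*q" if "e = 1 | e = -1" for e
  using spread_increment[OF psd h(1) that, of i] G(3) unfolding v_def by linarith
 have one: "(norm (x+v e))^4 <= (norm x)^4+4*(norm x)^2*(x \<bullet> v e)+h*(8 * kap+3*T * kap^2)*q^2" if e: "e = 1 | e = -1" for e
 proof -
  have "(norm x)^2*(norm (v e))^2 <= q*(h * kap*q)" using xq V[OF e] q1 by (intro mult_mono) auto
  moreover have "(norm (v e))^4 <= h*T * kap^2*q^2"
  proof -
   have "(norm (v e))^4 = ((norm (v e))^2)^2" by simp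
   also have "... <= (h * kap*q)^2" by (rule power_mono[OF V[OF e]]) simp
   also have "... = h*h*(kap^2*q^2)" by (simp add: power2_eq_square)
   also have "... <= h*T*(kap^2*q^2)" using h by (intro mult_right_mono mult_left_mono) auto
   finally show ?thesis by (simp add: mult_ac)
  qed
  moreover have "h*(8 * kap+3*T * kap^2)*q^2 = 8*(q*(h * kap*q))+3*(h*T * kap^2*q^2)"
   by (simp add: power2_eq_square algebra_simps)
  ultimately show ?thesis using norm_add_power4_le[of x "v e"] by (simp add: mult.assoc)
 qed
 have lin: "x \<bullet> v 1+x \<bullet> v (-1) = 2*(h*(x \<bullet> fst u))" by (simp add: v_def inner_add_right inner_diff_right)
 have "4*(norm x)^2*(x \<bullet> v 1)+4*(norm x)^2*(x \<bullet> v (-1)) = 4*(norm x)^2*(x \<bullet> v 1+x \<bullet> v (-1))"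
  by (rule distrib_left[symmetric])
 also have "... = 8*h*((norm x)^2*(x \<bullet> fst u))" unfolding lin by simp
 also have "... <= 8*h*(q*(2*C_b*q))"
 proof (intro mult_left_mono)
  have "x \<bullet> fst u <= 2*C_b*q" using norm_cauchy_schwarz[of x "fst u"] G(4) by linarith
  moreover have "0 <= 2*C_b*q" using C_nonneg q1 by simp
  ultimately have "(norm x)^2*(x \<bullet> fst u) <= (norm x)^2*(2*C_b*q)" by (intro mult_left_mono) auto
  also have "... <= q*(2*C_b*q)" using xq `0 <= 2*C_b*q` by (intro mult_right_mono)
  finally show "(norm x)^2*(x \<bullet> fst u) <= q*(2*C_b*q)" .
 qed (use h in auto)
 also have "... = 2*(h*(8*C_b)*q^2)" by (simp add: power2_eq_square)
 finally have "(norm (x+v 1))^4+(norm (x+v (-1)))^4 <= 2*((norm x)^4+h*K4*q^2)"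
  using one[of 1] one[of "-1"] by (simp add: K4_def algebra_simps)
 thus "(norm (x+(h*\<^sub>R fst u+sqrt (h*CARD('d))*\<^sub>R psd_factor (snd u) i)))^4
  + (norm (x+(h*\<^sub>R fst u-sqrt (h*CARD('d))*\<^sub>R psd_factor (snd u) i)))^4 <= 2*((norm x)^4+h*K4*q^2)"
  by (simp add: v_def)
qed

context
 fixes p0 :: "(real^'d) pmf"
 assumes fin: "finite (set_pmf p0)"
begin

lemma finite_walk: "finite (set_pmf (walk h p0 k))"
 by (induction k) (auto simp: fin set_bind_pmf finite_spread)

lemma walk_P2: "law (walk h p0 k) : P2"
 by (rule law_P2[OF finite_walk])

lemma walk_Suc_expectation:
 "pmf_mean (walk h p0 (Suc k)) f =
  pmf_mean (walk h p0 k) (%x. pmf_mean (spread h (walk_control h p0 k x) x) (f :: _ => real))"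
 unfolding walk.simps walk_control_def by (rule expectation_bind_finite[OF finite_walk finite_spread])

definition walk_q :: "real => nat => real^'d => real" where
 "walk_q h k x = 1+(norm x)^2+(M2 (law (walk h p0 k)))^2"

text \<open>Discrete Gronwall: by \<open>walk_q_square\<close> one step adds at most h*K4*3*(1+2*E)
  <= 6*h*K4*(1+E) to the fourth moment E.\<close>

definition "G4 = (1+pmf_mean p0 (%x. (norm x)^4))*exp (6*T*K4)"

definition "Q4 = 3*(1+2*G4)"

lemma G4_nonneg: "0 <= G4" by (simp add: G4_def add_nonneg_nonneg)

lemma Q4_nonneg: "0 <= Q4" using G4_nonneg by (simp add: Q4_def)

lemma walk_q_square:
 "pmf_mean (walk h p0 k) (%x. (walk_q h k x)^2) <=
  3*(1+2 * pmf_mean (walk h p0 k) (%x. (norm x)^4))"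
proof -
 define M where "M = (M2 (law (walk h p0 k)))^2"
 have "M^2 <= pmf_mean (walk h p0 k) (%x. ((norm x)^2)^2)"
  unfolding M_def law_M2 by (rule expectation_square_le[OF finite_walk])
 hence M: "M^2 <= pmf_mean (walk h p0 k) (%x. (norm x)^4)" by simp
 have "pmf_mean (walk h p0 k) (%x. (walk_q h k x)^2) <=
  pmf_mean (walk h p0 k) (%x. 3*(1+(norm x)^4+M^2))"
 proof (rule expectation_mono_finite[OF finite_walk])
  fix x :: "real^'d"
  define r where "r = (norm x)^2"
  have "(1+r+M)^2 <= 3*(1+r^2+M^2)"
   using sum_squares_bound[of 1 r] sum_squares_bound[of 1 M] sum_squares_bound[of r M]
   by (simp add: power2_eq_square algebra_simps)
  thus "(walk_q h k x)^2 <= 3*(1+(norm x)^4+M^2)" by (simp add: walk_q_def M_def r_def)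
 qed
 also have "... = 3*(1+pmf_mean (walk h p0 k) (%x. (norm x)^4)+M^2)"
  using finite_walk by simp
 finally show ?thesis using M by simp
qed

lemma walk_time:
 assumes h: "0 < h" "real k*h <= T" "0 < k"
 shows "h <= T"
proof -
 have "1*h <= real k*h" using h by (intro mult_right_mono) auto
 thus ?thesis using h by linarith
qed

lemma walk_fourth_moment:
 assumes h: "0 < h" "real k*h <= T"
 shows "1+pmf_mean (walk h p0 k) (%x. (norm x)^4) <=
  (1+pmf_mean p0 (%x. (norm x)^4))*exp (6*(real k*h)*K4)"
 using h(2)
proof (induction k)
 case (Suc k)
 have hT: "h <= T" by (rule walk_time[OF h(1) Suc.prems]) simp
 have kT: "real k*h <= T" "real k*h : {0..T}" using Suc.prems h(1) by (auto simp: algebra_simps)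
 define E where "E = pmf_mean (walk h p0 k) (%x. (norm x)^4)"
 have E0: "0 <= E" by (simp add: E_def)
 have "pmf_mean (walk h p0 (Suc k)) (%x. (norm x)^4) <=
  pmf_mean (walk h p0 k) (%x. (norm x)^4+h*K4*(walk_q h k x)^2)"
  unfolding walk_Suc_expectation
 proof (rule expectation_mono_finite[OF finite_walk])
  fix x
  show "pmf_mean (spread h (walk_control h p0 k x) x) (%x. (norm x)^4) <= (norm x)^4+h*K4*(walk_q h k x)^2"
   unfolding walk_q_def
   by (rule spread_fourth_moment[OF kT(2) walk_P2]) (use h hT select(1)[OF kT(2) walk_P2] in \<open>auto simp: walk_control_def\<close>)
 qed
 also have "... = E+h*K4 * pmf_mean (walk h p0 k) (%x. (walk_q h k x)^2)"
  using finite_walk by (simp add: E_def)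
 also have "... <= E+h*K4*(3*(1+2*E))"
  using walk_q_square[of h k] h K4_nonneg by (intro add_left_mono mult_left_mono) (auto simp: E_def)
 finally have "1+pmf_mean (walk h p0 (Suc k)) (%x. (norm x)^4) <= 1+E+h*K4*(3*(1+2*E))" by simp
 also have "... <= (1+E)*(1+6*h*K4)"
  using h K4_nonneg by (simp add: algebra_simps)
 also have "... <= ((1+pmf_mean p0 (%x. (norm x)^4))*exp (6*(real k*h)*K4))*exp (6*h*K4)"
  using Suc.IH[OF kT(1)] h K4_nonneg E0 exp_ge_add_one_self[of "6*h*K4"] unfolding E_def[symmetric] by (intro mult_mono) auto
 also have "... = (1+pmf_mean p0 (%x. (norm x)^4))*exp (6*(real (Suc k)*h)*K4)"
  by (simp add: mult_exp_exp algebra_simps)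
 finally show ?case .
qed simp

lemma walk_moments:
 assumes h: "0 < h" "real k*h <= T"
 shows "pmf_mean (walk h p0 k) (%x. (norm x)^4) <= G4"
  "pmf_mean (walk h p0 k) (%x. (walk_q h k x)^2) <= Q4"
  "pmf_mean (walk h p0 k) (walk_q h k) <= Q4"
proof -
 have "(1+pmf_mean p0 (%x. (norm x)^4))*exp (6*(real k*h)*K4) <= G4"
  unfolding G4_def using mult_right_mono[OF h(2) K4_nonneg]
  by (intro mult_left_mono) (auto intro!: add_nonneg_nonneg simp: mult_ac)
 thus G: "pmf_mean (walk h p0 k) (%x. (norm x)^4) <= G4"
  using walk_fourth_moment[OF h] by linarith
 show Q: "pmf_mean (walk h p0 k) (%x. (walk_q h k x)^2) <= Q4"
  by (rule order_trans[OF walk_q_square]) (use G in \<open>simp add: Q4_def\<close>)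
 have "pmf_mean (walk h p0 k) (walk_q h k) <= pmf_mean (walk h p0 k) (%x. (walk_q h k x)^2)"
  by (rule expectation_mono_finite[OF finite_walk]) (auto simp: walk_q_def intro!: self_le_power)
 thus "pmf_mean (walk h p0 k) (walk_q h k) <= Q4" using Q by linarith
qed

lemma walk_control:
 assumes "real k*h : {0..T}"
 shows "walk_control h p0 k x : F (real k*h) x (law (walk h p0 k))" "snd (walk_control h p0 k x) : sym_psd"
 unfolding walk_control_def by (rule select[OF assms walk_P2])+

text \<open>\<open>spread_Taylor\<close> averaged over the current law: the error of one step is of
  order h*(h+eps), and its growth in x is absorbed by the fourth moments.\<close>

lemma walk_Taylor:
 fixes phi :: "real^'d => real" and g :: "real^'d => real^'d" and H :: "real^'d => real^'d^'d"
 assumes g: "!!x. GDERIV phi x :> g x" and H: "!!x. (g has_derivative (%h. H x *v h)) (at x)"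
  and H_mod: "!!x y. norm (H y-H x) <= eps+C*(norm (y-x))^2" and C: "0 <= C" and eps: "0 <= eps"
  and B: "!!x. norm (H x) <= B"
  and h: "0 < h" "real (Suc k)*h <= T"
 shows "abs(pmf_mean (walk h p0 (Suc k)) phi-pmf_mean (walk h p0 k) phi
   - h * pmf_mean (walk h p0 k) (%x. generator (g x) (H x) (fst (walk_control h p0 k x)) (snd (walk_control h p0 k x))))
  <= h*(h*(3*B*C_b^2+C * kap^2)+eps * kap)*Q4"
proof -
 have hT: "h <= T" by (rule walk_time[OF h]) simp
 have kT: "real k*h <= T" "real k*h : {0..T}" using h by (auto simp: algebra_simps)
 have B0: "0 <= B" using B[of 0] norm_ge_zero order_trans by blast
 let ?c = "h*(h*(3*B*C_b^2+C * kap^2)+eps * kap)"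
 have c0: "0 <= ?c" using h B0 C eps kap_nonneg by simp
 let ?u = "walk_control h p0 k"
 let ?gen = "%x. generator (g x) (H x) (fst (?u x)) (snd (?u x))"
 have pt: "abs(pmf_mean (spread h (?u x) x) phi-phi x-h * ?gen x) <= ?c*(walk_q h k x)^2" for x
 proof -
  define q where "q = walk_q h k x"
  have q1: "1 <= q" by (simp add: q_def walk_q_def)
  note gr = walk_growth[OF kT(2) walk_P2 walk_control(1)[OF kT(2), of x] less_imp_le[OF h(1)] hT, folded walk_q_def, folded q_def]
  have "abs(pmf_mean (spread h (?u x) x) phi-phi x-h * ?gen x)
   <= (h^2*norm (H x)*(norm (fst (?u x)))^2+(eps+C*(h * kap*q))*(h * kap*q))/2"
   by (rule spread_Taylor[OF g H H_mod C eps walk_control(2)[OF kT(2)] less_imp_le[OF h(1)] gr(3)])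
  also have "... <= h^2*norm (H x)*(norm (fst (?u x)))^2+(eps+C*(h * kap*q))*(h * kap*q)"
   using h C eps kap_nonneg q1 by simp
  also have "h^2*norm (H x)*(norm (fst (?u x)))^2 <= h^2*B*(3*C_b^2*q)"
   using gr(1) h B[of x] B0 by (intro mult_mono) auto
  also have "h^2*B*(3*C_b^2*q) <= h^2*B*(3*C_b^2*q^2)"
   using q1 B0 by (intro mult_left_mono self_le_power) auto
  also have "(eps+C*(h * kap*q))*(h * kap*q) <= eps*(h * kap*q^2)+C*(h * kap*q)*(h * kap*q)"
  proof -
   have "eps*(h * kap*q) <= eps*(h * kap*q^2)"
    using q1 eps h kap_nonneg by (intro mult_left_mono self_le_power) auto
   thus ?thesis by (simp add: distrib_right)
  qed
  also have "h^2*B*(3*C_b^2*q^2)+(eps*(h * kap*q^2)+C*(h * kap*q)*(h * kap*q)) = ?c*q^2"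
   by (simp add: power2_eq_square algebra_simps)
  finally show ?thesis by (simp add: q_def)
 qed
 have "abs(pmf_mean (walk h p0 k) (%x. pmf_mean (spread h (?u x) x) phi-phi x-h * ?gen x))
  <= pmf_mean (walk h p0 k) (%x. ?c*(walk_q h k x)^2)"
  by (rule expectation_abs_le_finite[OF finite_walk pt])
 also have "... = ?c * pmf_mean (walk h p0 k) (%x. (walk_q h k x)^2)" by simp
 also have "... <= ?c*Q4" by (rule mult_left_mono[OF walk_moments(2)[OF h(1) kT(1)] c0])
 finally show ?thesis unfolding walk_Suc_expectation using finite_walk by simp
qed

lemma walk_generator_bound:
 fixes g :: "real^'d => real^'d" and H :: "real^'d => real^'d^'d"
 assumes g: "!!x. norm (g x) <= B" and H: "!!x. norm (H x) <= B" and h: "0 < h" "real k*h <= T"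
 shows "abs(pmf_mean (walk h p0 k) (%x. generator (g x) (H x) (fst (walk_control h p0 k x)) (snd (walk_control h p0 k x))))
  <= B*(1+3*C_b^2+C_A)*Q4"
proof -
 have kT: "real k*h : {0..T}" using h by auto
 let ?u = "walk_control h p0 k"
 have B0: "0 <= B" using g[of 0] norm_ge_zero order_trans by blast
 have "abs(pmf_mean (walk h p0 k) (%x. generator (g x) (H x) (fst (?u x)) (snd (?u x))))
  <= pmf_mean (walk h p0 k) (%x. B*(1+3*C_b^2+C_A)*walk_q h k x)"
 proof (rule expectation_abs_le_finite[OF finite_walk])
  fix x
  define q where "q = walk_q h k x"
  have q1: "1 <= q" by (simp add: q_def walk_q_def)
  have gr: "(norm (fst (?u x)))^2 <= 3*C_b^2*q" "norm (snd (?u x)) <= C_A*q"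
   using walk_growth(1,2)[OF kT walk_P2 walk_control(1)[OF kT], of 0] T_pos by (auto simp: q_def walk_q_def)
  have n1: "norm (fst (?u x)) <= (1+3*C_b^2)*q"
   using le_one_plus_square[of "norm (fst (?u x))"] gr(1) q1 by (simp add: distrib_right)
  have "norm (g x)*norm (fst (?u x)) <= B*((1+3*C_b^2)*q)" using g B0 n1 by (intro mult_mono) auto
  moreover have "norm (transpose (H x))*norm (snd (?u x)) <= B*(C_A*q)"
   using H B0 gr(2) by (intro mult_mono) (auto simp: norm_transpose)
  moreover have "0 <= B*(C_A*q)" using B0 C_nonneg q1 by simp
  ultimately have "abs(generator (g x) (H x) (fst (?u x)) (snd (?u x))) <= B*((1+3*C_b^2)*q)+B*(C_A*q)"
   using generator_bound[of "g x" "H x" "fst (?u x)" "snd (?u x)"] by linarith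
  thus "abs(generator (g x) (H x) (fst (?u x)) (snd (?u x))) <= B*(1+3*C_b^2+C_A)*walk_q h k x"
   by (simp add: q_def algebra_simps)
 qed
 also have "... = B*(1+3*C_b^2+C_A) * pmf_mean (walk h p0 k) (walk_q h k)" by simp
 also have "... <= B*(1+3*C_b^2+C_A)*Q4"
  using B0 C_nonneg by (intro mult_left_mono walk_moments(3)[OF h]) auto
 finally show ?thesis .
qed

end

end

text \<open>The support is a compact subset of the open slab, so at t = 0 and t = T the extension
  vanishes locally in time and the derivatives persist.\<close>

lemma test_function_ext_derivs:
 fixes g :: "real => real^'d => real^'d"
 assumes tf: "test_function T phi phit g H"
 shows "((%s. slab T phi (s, x)) has_real_derivative slab T phit (t, x)) (at t)"
  "GDERIV (%x. slab T phi (t, x)) x :> slab T g (t, x)"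
  "((%x. slab T g (t, x)) has_derivative (%h. slab T H (t, x) *v h)) (at x)"
proof -
 have D: "((%s. phi s x) has_real_derivative phit t x) (at t)" "GDERIV (phi t) x :> g t x"
  "(g t has_derivative (%h. H t x *v h)) (at x)" if "t : {0<..<T}"
  using tf that unfolding test_function_def by blast+
 show "((%s. slab T phi (s, x)) has_real_derivative slab T phit (t, x)) (at t)"
 proof (cases "t : {0<..<T}")
  case True
  have "\<forall>\<^sub>F s in nhds t. s : {0<..<T}" using True by (intro eventually_nhds_in_open) auto
  hence ev: "\<forall>\<^sub>F s in nhds t. slab T phi (s, x) = phi s x" by eventually_elim (simp add: slab_def)
  show ?thesis using D(1)[OF True] True by (subst DERIV_cong_ev[OF refl ev refl]) (simp add: slab_def)
 next
  case False
  obtain K where K: "compact K" "K \<subseteq> {0<..<T} \<times> UNIV"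
   and phi0: "!!t x. t : {0<..<T} ==> (t, x) ~: K ==> phi t x = 0"
   using tf unfolding test_function_def by blast
  have "open ((%s. (s, x)) -` (- K))"
   by (intro open_vimage continuous_intros) (simp add: open_Compl compact_imp_closed K)
  moreover have "t : (%s. (s, x)) -` (- K)" using K(2) False by auto
  ultimately have "\<forall>\<^sub>F s in nhds t. s : (%s. (s, x)) -` (- K)" by (rule eventually_nhds_in_open)
  hence ev: "\<forall>\<^sub>F s in nhds t. slab T phi (s, x) = 0" by eventually_elim (auto simp: slab_def phi0)
  show ?thesis using False by (subst DERIV_cong_ev[OF refl ev refl]) (auto simp: slab_def)
 qed
 show "GDERIV (%x. slab T phi (t, x)) x :> slab T g (t, x)"
  using D(2) by (cases "t : {0<..<T}") (auto simp: slab_def GDERIV_const)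
 have H0: "(%h :: real^'d. 0 *v h) = (%h. 0 :: real^'d)" by (simp add: fun_eq_iff)
 show "((%x. slab T g (t, x)) has_derivative (%h. slab T H (t, x) *v h)) (at x)"
  using D(3) by (cases "t : {0<..<T}") (auto simp: slab_def H0)
qed

text \<open>Uniform continuity in a quadratic form: beyond a fixed distance the bound 2*B on
  differences is absorbed by the squared distance. Such a modulus can be integrated against squared
  increments.\<close>

lemma quadratic_modulus:
 fixes f :: "'a::euclidean_space => 'b::real_normed_vector"
 assumes f: "continuous_on UNIV f" and K: "compact K" and zero: "!!z. z ~: K ==> f z = 0" and "0 < eps"
 shows "EX C>=0. ALL z w. norm (f z-f w) <= eps+C*(dist z w)^2"
proof -
 have "bounded (f ` K)" by (intro compact_imp_bounded compact_continuous_image K continuous_on_subset[OF f]) auto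
 then obtain B where B: "0 < B" "!!z. z : K ==> norm (f z) <= B" by (auto simp: bounded_pos)
 have fB: "norm (f z) <= B" for z using B zero[of z] by (cases "z : K") auto
 obtain R where R: "0 < R" "!!z. z : K ==> norm z <= R" using compact_imp_bounded[OF K] by (auto simp: bounded_pos)
 have "uniformly_continuous_on (cball 0 (R+1)) f"
  by (intro compact_uniformly_continuous continuous_on_subset[OF f]) auto
 then obtain dl where dl: "0 < dl" "!!z w. z : cball 0 (R+1) ==> w : cball 0 (R+1) ==> dist w z < dl ==> dist (f w) (f z) < eps"
  using `0 < eps` unfolding uniformly_continuous_on_def by blast
 define dl' where "dl' = min dl 1"
 have dl': "0 < dl'" "dl' <= dl" "dl' <= 1" using dl(1) by (auto simp: dl'_def)
 have "norm (f z-f w) <= eps+2*B/dl'^2*(dist z w)^2" for z w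
 proof (cases "dist z w < dl'")
  case True
  have "norm (f z-f w) <= eps"
  proof (cases "z : K | w : K")
   case in_K: True
   have "z : cball 0 (R+1) & w : cball 0 (R+1)"
    using in_K R(2)[of z] R(2)[of w] True dl'(3) norm_triangle_ineq2[of z w] norm_triangle_ineq2[of w z]
    by (auto simp: dist_norm norm_minus_commute)
   thus ?thesis using dl(2)[of w z] True dl'(2) by (simp add: dist_norm)
  next
   case False
   thus ?thesis using zero `0 < eps` by simp
  qed
  thus ?thesis using B(1) by (simp add: add_increasing2)
 next
  case False
  hence "dl'^2 <= (dist z w)^2" using dl'(1) by (intro power_mono) auto
  hence "1 <= (dist z w)^2/dl'^2" using dl'(1) by simp
  hence "2*B*1 <= 2*B*((dist z w)^2/dl'^2)" using B(1) by (intro mult_left_mono) auto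
  moreover have "norm (f z-f w) <= 2*B" using norm_triangle_ineq4[of "f z" "f w"] fB[of z] fB[of w] by simp
  ultimately show ?thesis using `0 < eps` by simp
 qed
 thus ?thesis using B(1) by (intro exI[of _ "2*B/dl'^2"]) auto
qed

lemma generator_diff: "generator (p-p') (H-H') be Sg = generator p H be Sg-generator p' H' be Sg"
proof -
 have "transpose (H-H') = transpose H-transpose H'" by (simp add: transpose_def vec_eq_iff)
 hence "transpose (H-H') \<bullet> Sg = transpose H \<bullet> Sg-transpose H' \<bullet> Sg" by (simp only: inner_diff_left)
 thus ?thesis
  unfolding generator_def matrix_transpose_inner[symmetric] by (simp add: inner_diff_left)
qed

lemma continuous_on_generator:
 fixes p :: "'a::t2_space => real^'d"
 assumes "continuous_on S p" "continuous_on S H"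
 shows "continuous_on S (%t. generator (p t) (H t) be Sg)"
 unfolding generator_def matrix_transpose_inner[symmetric] by (intro continuous_intros assms)

section \<open>The Fokker-Planck equation over one step of the walk\<close>

context dynamics
begin

context
 fixes p0 :: "(real^'d) pmf"
 assumes fin: "finite (set_pmf p0)"
begin

text \<open>The time derivative is integrated exactly, so only the Taylor remainder and the time dependence
 of the generator contribute to the error.\<close>

lemma walk_fokker_planck_step:
 assumes tf: "test_function T phi phit g H" and eps: "0 <= eps" and C: "0 <= C"
  and g_mod: "!!z w. norm (slab T g z-slab T g w) <= eps+C*(dist z w)^2"
  and H_mod: "!!z w. norm (slab T H z-slab T H w) <= eps+C*(dist z w)^2"
  and B: "!!z. norm (slab T H z) <= B"
  and h: "0 < h" "real (Suc k)*h <= T"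
 defines "E \<equiv> %k f. pmf_mean (walk h p0 k) f"
 shows "EX I. ((%t. E k (%x. fp_integrand T phit g H (t, x) (walk_control h p0 k x))) has_integral I) {real k*h..real (Suc k)*h} &
  abs(I-(E (Suc k) (%x. slab T phi (real (Suc k)*h, x))-E k (%x. slab T phi (real k*h, x))))
  <= h*((h*(3*B*C_b^2+C * kap^2)+eps * kap)*Q4 p0+(eps+C*h^2)*(1+3*C_b^2+C_A)*Q4 p0)"
proof -
 note c = test_function_ext(1-3)[OF tf]
 define s where "s = real k*h"
 define s' where "s' = real (Suc k)*h"
 have ss: "s' = s+h" "s <= s'" "s' <= T" using h by (auto simp: s_def s'_def algebra_simps)
 have kT: "real k*h <= T" using h by (auto simp: algebra_simps)
 let ?S = "set_pmf (walk h p0 k)"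
 let ?u = "walk_control h p0 k"
 have Esum: "E k f = (\<Sum>x\<in>?S. pmf (walk h p0 k) x*f x)" for f
  unfolding E_def by (subst integral_measure_pmf[OF finite_walk[OF fin]]) auto
 define gen where "gen t x = generator (slab T g (t, x)) (slab T H (t, x)) (fst (?u x)) (snd (?u x))" for t x
 have slice: "continuous_on X (%t::real. (t, x))" for X and x :: "real^'d" by (intro continuous_intros)
 have gen_cont: "continuous_on {s..s'} (%t. E k (gen t))"
  unfolding Esum gen_def
  by (intro continuous_intros continuous_on_generator continuous_on_compose2[OF c(2) slice] continuous_on_compose2[OF c(3) slice]) auto
 obtain J where J: "((%t. E k (gen t)) has_integral J) {s..s'}"
  using integrable_continuous_interval[OF gen_cont] by (auto simp: integrable_on_def)
 have d: "((%t. E k (%x. slab T phi (t, x))) has_real_derivative E k (%x. slab T phit (t, x))) (at t)" for t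
  unfolding Esum by (intro DERIV_sum DERIV_cmult test_function_ext_derivs(1)[OF tf])
 have ftc: "((%t. E k (%x. slab T phit (t, x))) has_integral
   (E k (%x. slab T phi (s', x))-E k (%x. slab T phi (s, x)))) {s..s'}"
  by (rule fundamental_theorem_of_calculus[OF ss(2)])
   (auto intro: has_field_derivative_at_within[OF d] simp: has_real_derivative_iff_has_vector_derivative[symmetric])
 have "((%t. E k (%x. slab T phit (t, x))+E k (gen t)) has_integral
   (E k (%x. slab T phi (s', x))-E k (%x. slab T phi (s, x)))+J) {s..s'}"
  by (rule has_integral_add[OF ftc J])
 moreover have "E k (%x. slab T phit (t, x))+E k (gen t) = E k (%x. fp_integrand T phit g H (t, x) (?u x))" for t
  unfolding Esum fp_integrand_generator gen_def by (simp add: sum.distrib[symmetric] distrib_left)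
 ultimately have int: "((%t. E k (%x. fp_integrand T phit g H (t, x) (?u x))) has_integral
   (E k (%x. slab T phi (s', x))-E k (%x. slab T phi (s, x)))+J) {s..s'}" by simp
 \<comment> \<open>The increment over a step splits into a change of law with \<open>phi\<close>
   frozen at the end time s' and a change of time under the old law. The first is this Taylor
   estimate, the second was integrated exactly.\<close>
 have tayl: "abs(E (Suc k) (%x. slab T phi (s', x))-E k (%x. slab T phi (s', x))-h*E k (gen s'))
  <= h*(h*(3*B*C_b^2+C * kap^2)+eps * kap)*Q4 p0"
  unfolding E_def gen_def
 proof (rule walk_Taylor[OF fin test_function_ext_derivs(2,3)[OF tf] _ C eps B h])
  show "norm (slab T H (s', y)-slab T H (s', x)) <= eps+C*(norm (y-x))^2" for x y
   using H_mod[of "(s', y)" "(s', x)"] by (simp add: dist_norm dist_Pair_Pair)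
 qed
 have gen_diff: "norm (E k (gen t)-E k (gen s')) <= (eps+C*h^2)*(1+3*C_b^2+C_A)*Q4 p0" if t: "t : {s..s'}" for t
 proof -
  have near: "eps+C*(dist (t, x) (s', x))^2 <= eps+C*h^2" for x :: "real^'d"
   using t ss C by (intro add_left_mono mult_left_mono power_mono) (auto simp: dist_Pair_Pair dist_real_def)
  have "E k (gen t)-E k (gen s') = E k (%x. gen t x-gen s' x)"
   unfolding Esum by (simp add: sum_subtractf right_diff_distrib)
  also have "abs(...) <= (eps+C*h^2)*(1+3*C_b^2+C_A)*Q4 p0"
   unfolding E_def gen_def generator_diff[symmetric]
  proof (rule walk_generator_bound[OF fin _ _ h(1) kT])
   show "norm (slab T g (t, x)-slab T g (s', x)) <= eps+C*h^2" for x by (rule order_trans[OF g_mod near])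
   show "norm (slab T H (t, x)-slab T H (s', x)) <= eps+C*h^2" for x by (rule order_trans[OF H_mod near])
  qed
  finally show ?thesis by simp
 qed
 have "((%t. E k (gen t)-E k (gen s')) has_integral J-(s'-s)*\<^sub>R E k (gen s')) {s..s'}"
  using has_integral_diff[OF J has_integral_const_real[of "E k (gen s')" s s']] ss by simp
 note Ji = this
 have "norm (J-(s'-s)*\<^sub>R E k (gen s')) <= ((eps+C*h^2)*(1+3*C_b^2+C_A)*Q4 p0) * measure lborel {s..s'}"
  by (rule has_integral_bound_real[OF _ finite.emptyI Ji]) (use gen_diff C eps C_nonneg Q4_nonneg[OF fin] in auto)
 hence Jb: "abs(J-h*E k (gen s')) <= h*((eps+C*h^2)*(1+3*C_b^2+C_A)*Q4 p0)"
  using ss h by (simp add: mult.commute)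
 define X where "X = h*(3*B*C_b^2+C * kap^2)+eps * kap"
 define Y where "Y = (eps+C*h^2)*(1+3*C_b^2+C_A)*Q4 p0"
 have "h*X*Q4 p0+h*Y = h*(X*Q4 p0+Y)" by (simp add: algebra_simps)
 hence "abs(((E k (%x. slab T phi (s', x))-E k (%x. slab T phi (s, x)))+J)-(E (Suc k) (%x. slab T phi (s', x))-E k (%x. slab T phi (s, x))))
  <= h*(X*Q4 p0+Y)"
  using tayl[folded X_def] Jb[folded Y_def] by linarith
 thus ?thesis using int unfolding s_def s'_def X_def Y_def by blast
qed


section \<open>The walk as a flow in continuous time\<close>

definition "mesh n = T/real (Suc n)"

text \<open>At t = T the index is \<open>Suc n\<close>, one more than that of the last interval, so
  the flow ends with the law after all \<open>Suc n\<close> steps.\<close>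

definition "cell n t = nat \<lfloor>t/mesh n\<rfloor>"

definition "walk_flow n t = law (walk (mesh n) p0 (cell n t))"

text \<open>The value 0 off the finite support of the current law makes this Borel whatever
  \<open>select\<close> is; within [0,T] it differs from the control of the walk only where the law
  has no mass.\<close>

definition walk_field :: "nat => 'd state => 'd control" where
 "walk_field n z = (if fst z : {0..T} then
  if snd z : set_pmf (walk (mesh n) p0 (cell n (fst z))) then walk_control (mesh n) p0 (cell n (fst z)) (snd z) else 0 else 0)"

lemma mesh: "0 < mesh n" "mesh n <= T" "real (Suc n) * mesh n = T"
 using T_pos by (auto simp: mesh_def field_simps)

lemma mesh_tendsto: "mesh ----> 0"
 using tendsto_mult[OF tendsto_const[of T] LIMSEQ_inverse_real_of_nat] by (simp add: mesh_def[abs_def] divide_inverse)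

lemma cell_eq: "real k * mesh n <= t ==> t < real (Suc k) * mesh n ==> cell n t = k"
proof -
 assume "real k * mesh n <= t" "t < real (Suc k) * mesh n"
 hence "real k <= t/mesh n" "t/mesh n < real k+1" using mesh(1)[of n] by (simp_all add: field_simps)
 hence "\<lfloor>t/mesh n\<rfloor> = int k" by (simp add: floor_eq_iff)
 thus ?thesis by (simp add: cell_def)
qed

lemma cell_bounds:
 assumes "t : {0..T}"
 shows "real (cell n t) * mesh n <= t" "t < real (Suc (cell n t)) * mesh n" "real (cell n t) * mesh n : {0..T}" "cell n t <= Suc n"
proof -
 have q: "0 <= t/mesh n" using assms mesh(1)[of n] by simp
 hence c: "real (cell n t) = of_int \<lfloor>t/mesh n\<rfloor>" by (simp add: cell_def)
 have "real (cell n t) <= t/mesh n" "t/mesh n < real (cell n t)+1" unfolding c by linarith+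
 thus a: "real (cell n t) * mesh n <= t" "t < real (Suc (cell n t)) * mesh n"
  using mesh(1)[of n] by (simp_all add: field_simps)
 thus "real (cell n t) * mesh n : {0..T}" using assms mesh(1)[of n] by auto
 have "real (cell n t) * mesh n <= real (Suc n) * mesh n" using a(1) assms mesh(3)[of n] by simp
 thus "cell n t <= Suc n" using mesh(1)[of n] by simp
qed

lemma cell_measurable [measurable]: "cell n : borel \<rightarrow>\<^sub>M count_space UNIV"
 unfolding cell_def by measurable

lemma walk_flow_kernel: "flow_kernel T (walk_flow n)"
 unfolding flow_kernel_def walk_flow_def
proof (rule measurable_compose[where f="%t. cell n (clamp_time T t)" and N="count_space UNIV"])
 have [measurable]: "clamp_time T : borel_measurable borel" unfolding clamp_time_def by measurable
 show "(%t. cell n (clamp_time T t)) : borel \<rightarrow>\<^sub>M count_space UNIV" by measurable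
 show "(%k. law (walk (mesh n) p0 k)) : count_space UNIV \<rightarrow>\<^sub>M prob_algebra borel"
  by (auto simp: space_prob_algebra law_prob law_sets)
qed

lemma finite_support_measurable:
 fixes c :: "'a::euclidean_space => 'b::euclidean_space"
 assumes "finite S"
 shows "(%x. if x : S then c x else 0) : borel_measurable borel"
proof -
 have "(%x. if x : S then c x else 0) = (%x. \<Sum>y\<in>S. indicator {y} x*\<^sub>R c y)"
 proof
  fix x
  have "(\<Sum>y\<in>S. indicator {y} x*\<^sub>R c y) = (\<Sum>y\<in>S. if y = x then c y else 0)"
   by (intro sum.cong) (auto simp: indicator_def)
  thus "(if x : S then c x else 0) = (\<Sum>y\<in>S. indicator {y} x*\<^sub>R c y)" using assms by (simp add: sum.delta')
 qed
 thus ?thesis by simp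
qed

lemma walk_field_measurable: "walk_field n : borel_measurable borel"
proof -
 let ?f = "%k x. if x : set_pmf (walk (mesh n) p0 k) then walk_control (mesh n) p0 k x else 0"
 have "(%z::'d state. ?f (cell n (fst z)) (snd z)) : borel_measurable borel"
 proof (rule measurable_compose_countable'[where I=UNIV and f="%k z. ?f k (snd z)"])
  show "(%z::'d state. ?f k (snd z)) : borel_measurable borel" for k
   by (rule measurable_compose[OF borel_measurable_snd finite_support_measurable[OF finite_walk[OF fin]]])
  show "(%z::'d state. cell n (fst z)) : borel \<rightarrow>\<^sub>M count_space UNIV"
   by (rule measurable_compose[OF borel_measurable_fst cell_measurable])
 qed auto
 note 1 = this
 have 2: "{z::'d state. fst z : {0..T}} : sets borel"
  using measurable_sets[OF borel_measurable_fst, of "{0..T}"] by (simp add: vimage_def)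
 have "(%z::'d state. if fst z : {0..T} then ?f (cell n (fst z)) (snd z) else 0) : borel_measurable borel"
  by (rule measurable_If[OF 1 measurable_const]) (use 2 in simp_all)
 thus ?thesis unfolding walk_field_def[abs_def] .
qed

lemma walk_field_psd: "snd (walk_field n z) : sym_psd"
 using walk_control(2)[OF fin cell_bounds(3)] by (simp add: walk_field_def zero_sym_psd)

lemma walk_field_AE: "AE z in flow_law T (walk_flow n).
  fst z : {0..T} & snd z : set_pmf (walk (mesh n) p0 (cell n (fst z)))"
proof -
 have "AE z in flow_law T (walk_flow n). snd z : set_pmf (walk (mesh n) p0 (cell n (fst z)))"
 proof (rule AE_flow_law_I[OF T_pos walk_flow_kernel])
  have "{z::'d state. snd z : set_pmf (walk (mesh n) p0 (cell n (fst z)))} =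
   (\<Union>k. (%z. cell n (fst z)) -` {k} \<inter> snd -` set_pmf (walk (mesh n) p0 k))" by auto
  also have "... : sets borel"
  proof -
   have a: "(%z::'d state. cell n (fst z)) -` {k} : sets borel" for k
    using measurable_sets[OF measurable_compose[OF borel_measurable_fst cell_measurable], of "{k}" n] by simp
   have b: "snd -` set_pmf (walk (mesh n) p0 k) : sets (borel :: 'd state measure)" for k
    using measurable_sets[OF borel_measurable_snd, of "set_pmf (walk (mesh n) p0 k)"] finite_walk[OF fin] by (simp add: finite_imp_closed)
   have "(%z. cell n (fst z)) -` {k} \<inter> snd -` set_pmf (walk (mesh n) p0 k) : sets (borel :: 'd state measure)" for k
    by (rule sets.Int[OF a b])
   thus ?thesis by (intro sets.countable_UN) auto
  qed
  finally show "{z::'d state. snd z : set_pmf (walk (mesh n) p0 (cell n (fst z)))} : sets borel" .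
  have "AE x in walk_flow n t. snd (t, x) : set_pmf (walk (mesh n) p0 (cell n (fst (t, x))))" for t
   unfolding walk_flow_def fst_conv snd_conv
   by (rule AE_law) (auto intro!: borel_closed finite_imp_closed finite_walk fin)
  thus "AE t in lborel. t : {0..T} --> (AE x in walk_flow n t. snd (t, x) : set_pmf (walk (mesh n) p0 (cell n (fst (t, x)))))"
   by simp
 qed
 thus ?thesis using AE_flow_law_time[OF T_pos walk_flow_kernel] by eventually_elim simp
qed

lemma walk_field_incl: "AE z in flow_law T (walk_flow n).
  walk_field n z : F (real (cell n (fst z)) * mesh n) (snd z) (walk_flow n (fst z))"
 using walk_field_AE
 by eventually_elim (auto simp: walk_field_def walk_flow_def intro!: walk_control(1)[OF fin] cell_bounds(3))

definition "walk_e R = G4 p0/R"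

lemma walk_e: "(walk_e \<longlongrightarrow> 0) at_top"
 unfolding walk_e_def[abs_def] by (intro real_tendsto_divide_at_top[OF tendsto_const filterlim_ident])

lemma walk_flow_ui:
 assumes "t : {0..T}"
 shows "walk_flow n t : ui_set walk_e"
 unfolding ui_set_def walk_flow_def
proof (intro CollectI conjI allI impI walk_P2[OF fin])
 fix R :: real assume R: "1 <= R"
 let ?p = "walk (mesh n) p0 (cell n t)"
 have "tail_moment R (law ?p) = pmf_mean ?p (sq_tail R)"
  unfolding tail_moment_def by (rule law_integral) measurable
 also have "... <= pmf_mean ?p (%x. (norm x)^4/R)"
 proof (rule expectation_mono_finite[OF finite_walk[OF fin]])
  fix x :: "real^'d"
  show "sq_tail R x <= (norm x)^4/R" unfolding sq_tail_def using R by (intro divide_left_mono) (auto intro!: mult_pos_pos add_nonneg_pos)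
 qed
 also have "... = pmf_mean ?p (%x. (norm x)^4)/R" by simp
 also have "... <= walk_e R"
  unfolding walk_e_def using R cell_bounds(3)[OF assms, of n] by (intro divide_right_mono walk_moments(1)[OF fin mesh(1)]) auto
 finally show "tail_moment R (law ?p) <= walk_e R" .
qed

text \<open>Each step moves a bump integral by at most C times the mesh; the error
  \<open>err\<close> accounts for rounding times to the grid.\<close>

lemma walk_bump_equicontinuous:
 assumes "0 < k"
 shows "EX C err. 0 <= C & err ----> 0 & (ALL n. ALL s:{0..T}. ALL t:{0..T}.
   \<bar>(LINT x|walk_flow n t. bump k a x)-(LINT x|walk_flow n s. bump k a x)\<bar> <= C*\<bar>t-s\<bar> + err n)"
proof -
 note rad = bump_radial_C2[OF assms]
 define g where "g x = radial_grad (%r. - (3 * k*(max 0 (1-k*r))^2)) (x-a)" for x :: "real^'d"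
 define H where "H x = radial_hess (%r. - (3 * k*(max 0 (1-k*r))^2)) (%r. 6 * k^2 * max 0 (1-k*r)) (x-a)" for x :: "real^'d"
 have bump: "bump k a = (%x. (max 0 (1-k*(norm (x-a))^2))^3)" by (simp add: bump_def fun_eq_iff)
 have bounded: "EX B>=0. ALL x. norm (f x) <= B" if f: "continuous_on UNIV f" "!!x. sqrt (1/k) <= norm (x-a) ==> f x = 0"
  for f :: "real^'d => 'b::real_normed_vector"
 proof -
  have "bounded (f ` cball a (sqrt (1/k)))"
   by (intro compact_imp_bounded compact_continuous_image continuous_on_subset[OF f(1)] compact_cball) auto
  then obtain B where B: "0 < B" "!!x. x : cball a (sqrt (1/k)) ==> norm (f x) <= B" by (auto simp: bounded_pos)
  have "norm (f x) <= B" for x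
  proof (cases "sqrt (1/k) <= norm (x-a)")
   case True
   thus ?thesis using f(2)[OF True] B(1) by simp
  next
   case False
   thus ?thesis by (intro B(2)) (simp add: dist_norm norm_minus_commute)
  qed
  thus ?thesis using B(1) by (intro exI[of _ B]) auto
 qed
 obtain B1 where B1: "B1 >= 0" "!!x. norm (g x) <= B1"
  using bounded[of g] radial_grad_continuous[OF rad, of a] radial_outside[OF rad] unfolding g_def by blast
 obtain B2 where B2: "B2 >= 0" "!!x. norm (H x) <= B2"
  using bounded[of H] radial_hess_continuous[OF rad, of a] radial_outside[OF rad] unfolding H_def by blast
 define B where "B = B1+B2"
 have B: "0 <= B" "!!x. norm (g x) <= B" "!!x. norm (H x) <= B"
 proof -
  show "0 <= B" using B1(1) B2(1) by (simp add: B_def)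
  show "norm (g x) <= B" "norm (H x) <= B" for x
   using B1(1) B1(2)[of x] B2(1) B2(2)[of x] by (simp_all add: B_def)
 qed
 define C where "C = (T*(3*B*C_b^2)+2*B * kap)*Q4 p0+B*(1+3*C_b^2+C_A)*Q4 p0"
 have C0: "0 <= C" using B(1) T_pos kap_nonneg Q4_nonneg[OF fin] C_nonneg by (simp add: C_def)
 define U where "U n j = pmf_mean (walk (mesh n) p0 j) (bump k a)" for n j
 have step: "abs(U n (Suc j)-U n j) <= mesh n*C" if j: "real (Suc j) * mesh n <= T" for n j
 proof -
  have jT: "real j * mesh n <= T" using j mesh(1)[of n] by (simp add: algebra_simps)
  let ?gen = "pmf_mean (walk (mesh n) p0 j) (%x. generator (g x) (H x) (fst (walk_control (mesh n) p0 j x)) (snd (walk_control (mesh n) p0 j x)))"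
  \<comment> \<open>The crude modulus 2*B with C = 0 suffices: an error of order
    \<open>mesh n\<close> per step is just what equicontinuity allows.\<close>
  have "abs(U n (Suc j)-U n j-mesh n * ?gen) <= mesh n*(mesh n*(3*B*C_b^2+0 * kap^2)+(2*B) * kap)*Q4 p0"
   unfolding U_def
  proof (rule walk_Taylor[OF fin _ _ _ _ _ B(3) mesh(1) j])
   show "GDERIV (bump k a) x :> g x" for x unfolding bump g_def by (rule radial_gderiv[OF rad])
   show "(g has_derivative (*v) (H x)) (at x)" for x
    unfolding g_def[abs_def] H_def by (rule radial_grad_deriv[OF rad])
   show "norm (H y-H x) <= 2*B+0*(norm (y-x))^2" for x y
    using norm_triangle_ineq4[of "H y" "H x"] B(3)[of x] B(3)[of y] by simp
  qed (use B in auto)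
  also have "... <= mesh n*((T*(3*B*C_b^2)+2*B * kap)*Q4 p0)"
   unfolding mult.assoc[of "mesh n"]
  proof (intro mult_left_mono mult_right_mono)
   show "mesh n*(3*B*C_b^2+0 * kap^2)+2*B * kap <= T*(3*B*C_b^2)+2*B * kap"
    using mult_right_mono[OF mesh(2)[of n], of "3*B*C_b^2"] B(1) by simp
  qed (use Q4_nonneg[OF fin] mesh(1)[of n] in auto)
  finally have "abs(U n (Suc j)-U n j-mesh n * ?gen) <= mesh n*((T*(3*B*C_b^2)+2*B * kap)*Q4 p0)" .
  moreover have gb: "abs(?gen) <= B*(1+3*C_b^2+C_A)*Q4 p0" by (rule walk_generator_bound[OF fin B(2,3) mesh(1) jT])
  have "abs(mesh n * ?gen) <= mesh n*(B*(1+3*C_b^2+C_A)*Q4 p0)"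
   unfolding abs_mult abs_of_pos[OF mesh(1)] by (rule mult_left_mono[OF gb less_imp_le[OF mesh(1)]])
  ultimately show ?thesis unfolding C_def distrib_left by linarith
 qed
 have steps: "abs(U n (j+i)-U n j) <= real i * mesh n*C" if "real (j+i) * mesh n <= T" for n i j
  using that
 proof (induction i)
  case (Suc i)
  have "real (j+i) * mesh n <= T" using Suc.prems mesh(1)[of n] by (simp add: algebra_simps)
  from Suc.IH[OF this] step[of "j+i" n] Suc.prems have "abs(U n (j+Suc i)-U n j) <= real i * mesh n*C+mesh n*C" by simp
  thus ?case by (simp add: algebra_simps)
 qed simp
 have ordered: "abs(U n (cell n t)-U n (cell n s)) <= C*(t-s)+C * mesh n" if st: "s : {0..T}" "t : {0..T}" "s <= t" for n s t
 proof -
  note cs = cell_bounds[OF st(1), of n] and ct = cell_bounds[OF st(2), of n]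
  have le: "cell n s <= cell n t" unfolding cell_def using st mesh(1)[of n] by (intro nat_mono floor_mono divide_right_mono) auto
  have "abs(U n (cell n s+(cell n t - cell n s))-U n (cell n s)) <= real (cell n t - cell n s) * mesh n*C"
   by (rule steps) (use le ct(3) in auto)
  also have "... <= (t-s+mesh n)*C"
  proof (rule mult_right_mono[OF _ C0])
   show "real (cell n t - cell n s) * mesh n <= t-s+mesh n"
    using le cs(2) ct(1) by (simp add: of_nat_diff algebra_simps)
  qed
  finally show ?thesis using le by (simp add: algebra_simps)
 qed
 have eq: "(LINT x|walk_flow n t. bump k a x) = U n (cell n t)" for n t
  unfolding walk_flow_def U_def by (rule law_integral) measurable
 show ?thesis
 proof (intro exI[of _ C] exI[of _ "%n. C * mesh n"] conjI C0 allI ballI)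
  show "(%n. C * mesh n) ----> 0" by (intro tendsto_mult_right_zero mesh_tendsto)
  fix n s t assume st: "s : {0..T}" "t : {0..T}"
  show "\<bar>(LINT x|walk_flow n t. bump k a x)-(LINT x|walk_flow n s. bump k a x)\<bar> <= C*\<bar>t-s\<bar> + C * mesh n"
  proof (cases "s <= t")
   case True
   thus ?thesis using ordered[OF st True, of n] unfolding eq by simp
  next
   case False
   thus ?thesis using ordered[OF st(2,1), of n] unfolding eq by (simp add: abs_minus_commute)
  qed
 qed
qed

end

end

section \<open>Existence of admissible processes for finitely supported initial laws\<close>

context dynamics
begin

context
 fixes p0 :: "(real^'d) pmf"
 assumes fin: "finite (set_pmf p0)"
begin

lemma walk_fp_integrable:
 assumes tf: "test_function T phi phit g H"
 shows "integrable (flow_law T (walk_flow p0 n)) (%z. fp_integrand T phit g H z (walk_field p0 n z))"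
  "(%z. fp_integrand T phit g H z (walk_field p0 n z)) : borel_measurable borel"
proof -
 define M where "M = 1+G4 p0"
 have M: "0 <= M" "M2 (walk_flow p0 n t) <= M" if "t : {0..T}" for t
 proof -
  show "0 <= M" using G4_nonneg[OF fin] by (simp add: M_def)
  note ui = walk_flow_ui[OF fin that, of n]
  have "(M2 (walk_flow p0 n t))^2 <= M"
   using M2_le_tail_moment[OF ui_setD(1)[OF ui], of 1] ui_setD(2)[OF ui, of 1] by (simp add: walk_e_def[OF fin] M_def)
  also have "... <= M^2" using G4_nonneg[OF fin] by (simp add: M_def power2_eq_square algebra_simps)
  finally show "M2 (walk_flow p0 n t) <= M" using `0 <= M` by (auto intro: power2_le_imp_le)
 qed
 have K: "0 <= C_b*(2+M)+C_A*(1+M^2)" using C_nonneg M(1)[of 0] T_pos by simp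
 have "AE z in flow_law T (walk_flow p0 n). norm (walk_field p0 n z) <= (C_b*(2+M)+C_A*(1+M^2))*(1+(norm (snd z))^2)"
  using walk_field_incl[OF fin] walk_field_AE[OF fin]
 proof eventually_elim
  case (elim z)
  hence t: "fst z : {0..T}" by blast
  show ?case by (rule control_growth(4)[OF cell_bounds(3)[OF fin t] ui_setD(1)[OF walk_flow_ui[OF fin t]] M(2)[OF t] elim(1)])
 qed
 note I = fp_integrand_integrable[OF tf T_pos walk_flow_kernel[OF fin] walk_field_measurable[OF fin] K this]
 show "integrable (flow_law T (walk_flow p0 n)) (%z. fp_integrand T phit g H z (walk_field p0 n z))"
  "(%z. fp_integrand T phit g H z (walk_field p0 n z)) : borel_measurable borel" by (rule I)+
qed

text \<open>The errors of the single steps add up to at most T times \<open>eta n\<close>; the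
  boundary terms drop out because the extended test function vanishes at the times 0 and T.\<close>

lemma walk_fokker_planck_bound:
 assumes tf: "test_function T phi phit g H" and eps: "0 <= eps" and C: "0 <= C"
  and g_mod: "!!z w. norm (slab T g z-slab T g w) <= eps+C*(dist z w)^2"
  and H_mod: "!!z w. norm (slab T H z-slab T H w) <= eps+C*(dist z w)^2"
  and B: "!!z. norm (slab T H z) <= B"
 defines "eta \<equiv> %n. (mesh n*(3*B*C_b^2+C * kap^2)+eps * kap)*Q4 p0+(eps+C*(mesh n)^2)*(1+3*C_b^2+C_A)*Q4 p0"
 shows "abs(\<integral>z. fp_integrand T phit g H z (walk_field p0 n z) \<partial>flow_law T (walk_flow p0 n)) <= eta n"
proof -
 let ?h = "mesh n"
 let ?E = "%k f. pmf_mean (walk ?h p0 k) f"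
 define G where "G t = (LINT x|walk_flow p0 n t. fp_integrand T phit g H (t, x) (walk_field p0 n (t, x)))" for t
 have G_eq: "G t = ?E k (%x. fp_integrand T phit g H (t, x) (walk_control ?h p0 k x))"
  if t: "t : {0..T}" "real k * ?h <= t" "t < real (Suc k) * ?h" for k t
 proof -
  have c: "cell n t = k" by (rule cell_eq[OF fin t(2,3)])
  have "G t = ?E k (%x. fp_integrand T phit g H (t, x) (walk_field p0 n (t, x)))"
   unfolding G_def walk_flow_def[OF fin] c
  proof (rule law_integral)
   have "(%x::real^'d. (t, x)) : borel \<rightarrow>\<^sub>M borel" by (intro borel_measurable_Pair) auto
   from measurable_compose[OF this walk_fp_integrable(2)[OF tf, of n]]
   show "(%x. fp_integrand T phit g H (t, x) (walk_field p0 n (t, x))) : borel_measurable borel" .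
  qed
  also have "... = ?E k (%x. fp_integrand T phit g H (t, x) (walk_control ?h p0 k x))"
   by (rule integral_cong_AE) (use t c in \<open>auto simp: AE_measure_pmf_iff walk_field_def[OF fin]\<close>)
  finally show ?thesis .
 qed
 have main: "EX I. (G has_integral I) {0..real k * ?h} & abs(I - ?E k (%x. slab T phi (real k * ?h, x))) <= real k * ?h*eta n"
  if "k <= Suc n" for k
  using that
 proof (induction k)
  case 0
  have "(G has_integral 0) {0..0}" using has_integral_refl(2)[of G 0] by simp
  thus ?case by (auto simp: slab_def intro!: exI[of _ 0])
 next
  case (Suc k)
  then obtain I where I: "(G has_integral I) {0..real k * ?h}" "abs(I - ?E k (%x. slab T phi (real k * ?h, x))) <= real k * ?h*eta n"
   by auto
  have "real (Suc k) * ?h <= real (Suc n) * ?h"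
   using Suc.prems mesh(1)[OF fin, of n] by (intro mult_right_mono) auto
  hence SkT: "real (Suc k) * ?h <= T" using mesh(3)[OF fin, of n] by simp
  obtain J where J: "((%t. ?E k (%x. fp_integrand T phit g H (t, x) (walk_control ?h p0 k x))) has_integral J) {real k * ?h..real (Suc k) * ?h}"
   and Jb: "abs(J-(?E (Suc k) (%x. slab T phi (real (Suc k) * ?h, x)) - ?E k (%x. slab T phi (real k * ?h, x)))) <= ?h*eta n"
   using walk_fokker_planck_step[OF fin tf eps C g_mod H_mod B mesh(1)[OF fin] SkT] unfolding eta_def by blast
  have GJ: "(G has_integral J) {real k * ?h..real (Suc k) * ?h}"
  \<comment> \<open>At the right end of the interval \<open>cell\<close> has already moved on; a
    single point does not affect the integral.\<close>
  proof (rule has_integral_spike_finite[OF _ _ J, of "{real (Suc k) * ?h}"])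
   fix t assume t: "t : {real k * ?h..real (Suc k) * ?h} - {real (Suc k) * ?h}"
   have "0 <= real k * ?h" using mesh(1)[OF fin, of n] by simp
   thus "G t = ?E k (%x. fp_integrand T phit g H (t, x) (walk_control ?h p0 k x))"
    using t SkT by (intro G_eq) auto
  qed simp
  have "(G has_integral I+J) {0..real (Suc k) * ?h}"
   by (rule has_integral_combine[OF _ _ I(1) GJ]) (use mesh(1)[OF fin, of n] in \<open>auto simp: algebra_simps\<close>)
  moreover have "abs(I+J - ?E (Suc k) (%x. slab T phi (real (Suc k) * ?h, x))) <= real k * ?h*eta n + ?h*eta n"
   using I(2) Jb by linarith
  moreover have "real k * ?h*eta n + ?h*eta n = real (Suc k) * ?h*eta n" by (simp add: algebra_simps)
  ultimately show ?case by metis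
 qed
 note Th = mesh(3)[OF fin, of n]
 obtain I where I: "(G has_integral I) {0..T}" "abs(I - ?E (Suc n) (%x. slab T phi (T, x))) <= T*eta n"
  using main[OF order_refl] unfolding Th by blast
 note fl = integral_flow_law[OF T_pos walk_flow_kernel[OF fin] walk_fp_integrable(1)[OF tf, of n], folded G_def]
 have "(LBINT t:{0..T}. G t) = I"
  using set_borel_integral_eq_integral(2)[OF fl(2)] I(1) by (simp add: integral_unique)
 hence "abs(T*(LINT z|flow_law T (walk_flow p0 n). fp_integrand T phit g H z (walk_field p0 n z))) <= T*eta n"
  using I(2) fl(1) by (simp add: slab_def)
 thus ?thesis using T_pos by (simp add: abs_mult)
qed

text \<open>First \<open>eps\<close> is chosen small against constants independent of the mesh,
  which fixes \<open>C\<close>; then the mesh is refined.\<close>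

lemma walk_fokker_planck_tendsto:
 assumes tf: "test_function T phi phit g H"
 shows "(%n. LINT z|flow_law T (walk_flow p0 n). fp_integrand T phit g H z (walk_field p0 n z)) ----> 0"
proof (rule tendstoI)
 fix e :: real assume e: "0 < e"
 obtain K where K: "compact K" and K0: "!!z. z ~: K ==> slab T g z = 0" "!!z. z ~: K ==> slab T H z = 0"
  using test_function_ext(4)[OF tf] by blast
 obtain B where B: "!!z. norm (slab T H z) <= B" using test_function_ext(5)[OF tf] by blast
 define c where "c = (kap+(1+3*C_b^2+C_A))*Q4 p0"
 have c0: "0 <= c" using kap_nonneg C_nonneg Q4_nonneg[OF fin] by (simp add: c_def)
 define eps where "eps = e/(c+1)"
 have eps: "0 < eps" "eps*c < e" using e c0 by (auto simp: eps_def field_simps)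
 obtain C1 where C1: "0 <= C1" "!!z w. norm (slab T g z-slab T g w) <= eps+C1*(dist z w)^2"
  using quadratic_modulus[OF test_function_ext(2)[OF tf] K K0(1) eps(1)] by blast
 obtain C2 where C2: "0 <= C2" "!!z w. norm (slab T H z-slab T H w) <= eps+C2*(dist z w)^2"
  using quadratic_modulus[OF test_function_ext(3)[OF tf] K K0(2) eps(1)] by blast
 define C where "C = C1+C2"
 have C: "0 <= C" "eps+C1*(dist z w)^2 <= eps+C*(dist z w)^2" "eps+C2*(dist z w)^2 <= eps+C*(dist z w)^2" for z w :: "'d state"
  using C1(1) C2(1) by (auto simp: C_def intro!: mult_right_mono)
 note bnd = walk_fokker_planck_bound[OF tf less_imp_le[OF eps(1)] C(1) order_trans[OF C1(2) C(2)] order_trans[OF C2(2) C(3)] B]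
 have "(%n. (mesh n*(3*B*C_b^2+C * kap^2)+eps * kap)*Q4 p0+(eps+C*(mesh n)^2)*(1+3*C_b^2+C_A)*Q4 p0)
  ----> (0*(3*B*C_b^2+C * kap^2)+eps * kap)*Q4 p0+(eps+C*0^2)*(1+3*C_b^2+C_A)*Q4 p0"
  by (intro tendsto_intros mesh_tendsto[OF fin])
 also have "(0*(3*B*C_b^2+C * kap^2)+eps * kap)*Q4 p0+(eps+C*0^2)*(1+3*C_b^2+C_A)*Q4 p0 = eps*c"
  by (simp add: c_def algebra_simps)
 finally have "\<forall>\<^sub>F n in sequentially. (mesh n*(3*B*C_b^2+C * kap^2)+eps * kap)*Q4 p0+(eps+C*(mesh n)^2)*(1+3*C_b^2+C_A)*Q4 p0 < e"
  using eps(2) by (rule order_tendstoD)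
 thus "\<forall>\<^sub>F n in sequentially. dist (LINT z|flow_law T (walk_flow p0 n). fp_integrand T phit g H z (walk_field p0 n z)) 0 < e"
 proof eventually_elim
  case (elim n)
  thus ?case using bnd[of n] by (simp add: dist_real_def)
 qed
qed

lemma lower_semicontinuous_map_const: "lower_semicontinuous_map X (%_. c)"
 unfolding lower_semicontinuous_map_def
proof
 fix a
 show "openin X {z : topspace X. a < c}" by (cases "a < c") auto
qed

text \<open>The walks are fed into the limit theorem with zero cost. The equation becomes exact in
  the limit, and the initial law is recovered from the convergence at time 0.\<close>

lemma admissible_law_nonempty: "admissible T F (law p0) ~= {}"
proof -
 interpret running_cost T C_b C_A F "%_ _ _ _ _. 0" "%_. 0"
 proof
  show "lower_semicontinuous_map (prod_topology (top_of_set {0..T}) (prod_topology euclidean (prod_topology P2_topology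
     (prod_topology euclidean (top_of_set sym_psd))))) (%(t :: real, x :: real^'d, m :: (real^'d) measure, be :: real^'d, Sg :: real^'d^'d). 0 :: real)"
  proof -
   have "(%(t :: real, x :: real^'d, m :: (real^'d) measure, be :: real^'d, Sg :: real^'d^'d). 0 :: real) = (%_. 0)" by auto
   thus ?thesis by (simp only: lower_semicontinuous_map_const)
  qed
  show "bounded ((%_. 0 :: real) ` K)" for K :: "(real^'d) measure set"
   by (rule bounded_subset[of "{0}"]) auto
  show "convex_on (UNIV \<times> sym_psd) (%(be :: real^'d, Sg :: real^'d^'d). 0 :: real)"
  proof -
   have "convex (sym_psd :: (real^'d^'d) set)"
    unfolding convex_def sym_psd_def
    by (auto simp: vec_eq_iff transpose_def matrix_vector_mult_add_rdistrib scaleR_matrix_vector_assoc[symmetric] inner_add_right)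
   thus ?thesis by (intro convex_onI) (auto intro: convex_Times)
  qed
 qed auto
 have equi: "EX C err. 0 <= C & err ----> 0 & (ALL n. ALL s:{0..T}. ALL t:{0..T}.
   \<bar>(LINT x|walk_flow p0 n t. bump (real (Suc j)) a x)-(LINT x|walk_flow p0 n s. bump (real (Suc j)) a x)\<bar> <= C*\<bar>t-s\<bar> + err n)" for j a
  by (rule walk_bump_equicontinuous[OF fin]) simp
 show ?thesis
 proof (rule curve_compactness[OF T_pos walk_flow_ui[OF fin] walk_e[OF fin] equi])
  fix r :: "nat => nat" and l
  assume r: "strict_mono r" and l_ui: "!!t. t : {0..T} ==> l t : ui_set (walk_e p0)" and l_flow: "flow_of_probabilities T l"
   and near: "!!t eps. t : {0..T} ==> 0 < eps ==> EX N dl. 0 < dl & (ALL n>=N. ALL s:{0..T}. abs(s-t) < dl --> W2 (walk_flow p0 (r n) s) (l t) < eps)"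
  \<comment> \<open>The control is selected at the last grid time and used up to
    \<open>mesh (r n)\<close> later; this delay is the shift \<open>tau\<close>.\<close>
  interpret approximation T C_b C_A F "%_ _ _ _ _. 0" "%_. 0" "%n. walk_flow p0 (r n)" l
   "%n z. fst (walk_field p0 (r n) z)" "%n z. snd (walk_field p0 (r n) z)"
   "%n t. real (cell (r n) t) * mesh (r n)" "%n. mesh (r n)" "walk_e p0"
  proof
   show "(%z. fst (walk_field p0 (r n) z)) : borel_measurable borel" "(%z. snd (walk_field p0 (r n) z)) : borel_measurable borel" for n
    by (intro measurable_compose[OF walk_field_measurable[OF fin]] borel_measurable_fst borel_measurable_snd)+
   show "AE z in flow_law T (walk_flow p0 (r n)). (fst (walk_field p0 (r n) z), snd (walk_field p0 (r n) z))
    : F (real (cell (r n) (fst z)) * mesh (r n)) (snd z) (walk_flow p0 (r n) (fst z))" for n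
    using walk_field_incl[OF fin] by simp
   show "abs(real (cell (r n) t) * mesh (r n)-t) <= mesh (r n)" if "t : {0..T}" for n t
    using cell_bounds(1,2)[OF fin that, of "r n"] by (simp add: algebra_simps abs_le_iff)
   show "(%n. mesh (r n)) ----> 0" using LIMSEQ_subseq_LIMSEQ[OF mesh_tendsto[OF fin] r] by (simp add: comp_def)
   show "(%n. LINT z|flow_law T (walk_flow p0 (r n)). fp_integrand T phit g H z (fst (walk_field p0 (r n) z), snd (walk_field p0 (r n) z))) ----> 0"
    if "test_function T phi phit g H" for phi phit g H
    using LIMSEQ_subseq_LIMSEQ[OF walk_fokker_planck_tendsto[OF that] r] by (simp add: comp_def)
  qed (use walk_flow_kernel[OF fin] walk_flow_ui[OF fin] walk_e[OF fin] l_flow l_ui near walk_field_psd[OF fin] cell_bounds(3)[OF fin] in \<open>auto simp: f_along_def\<close>)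
  have "l 0 = law p0"
  proof -
   have P: "law p0 : P2" "l 0 : P2" using law_P2[OF fin] ui_setD(1)[OF l_ui[of 0]] T_pos by auto
   have "cell n 0 = 0" for n using mesh(1)[OF fin, of n] by (intro cell_eq[OF fin]) auto
   hence w0: "walk_flow p0 n 0 = law p0" for n by (simp add: walk_flow_def[OF fin])
   have "W2 (law p0) (l 0) < eps" if eps: "0 < eps" for eps
   proof -
    have "0 : {0..T}" using T_pos by simp
    then obtain N dl where dl: "0 < dl" "ALL n>=N. ALL s:{0..T}. abs(s-0) < dl --> W2 (walk_flow p0 (r n) s) (l 0) < eps"
     using near[OF _ eps] by blast
    from dl(2)[rule_format, of N 0] dl(1) T_pos show ?thesis by (simp add: w0)
   qed
   hence "W2 (law p0) (l 0) <= 0" by (meson dense_ge less_imp_le)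
   hence "W2 (law p0) (l 0) = 0" using W2_nonneg[of "law p0" "l 0"] by simp
   thus ?thesis using W2.zero[OF P] by simp
  qed
  moreover obtain b0 A0 where "(l, b0, A0) : admissible T F (l 0)" using closure by blast
  ultimately show ?thesis by auto
 qed
qed

end

end

subsection \<open>Limits of admissible processes and the main theorem\<close>

text \<open>A pmf is a measure almost all of whose points are atoms; in a finite range the points
  without mass form a null set.\<close>

lemma simple_distr_eq_law:
 fixes X :: "real^'d => real^'d"
 assumes nu: "prob_space nu" "space nu = UNIV" and X: "simple_function nu X"
 obtains p where "finite (set_pmf p)" "law p = distr nu borel X"
proof -
 interpret prob_space nu by fact
 have Xm: "X : nu \<rightarrow>\<^sub>M count_space UNIV" by (rule measurable_simple_function[OF X])
 define N where "N = distr nu (count_space UNIV) X"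
 have finR: "finite (range X)" using X nu(2) by (simp add: simple_function_def)
 interpret N: prob_space N unfolding N_def by (rule prob_space_distr[OF Xm])
 have mN: "measure N {y} = 0" if "y ~: range X" for y
 proof -
  have "X -` {y} \<inter> space nu = {}" using that by auto
  thus ?thesis unfolding N_def by (subst measure_distr[OF Xm]) auto
 qed
 have AEr: "AE y in N. y : range X" unfolding N_def by (subst AE_distr_iff[OF Xm]) auto
 have null: "{y : range X. measure N {y} = 0} : null_sets N"
 proof -
  have "emeasure N {y : range X. measure N {y} = 0} = (\<Sum>y\<in>{y : range X. measure N {y} = 0}. emeasure N {y})"
   using finR by (intro emeasure_eq_sum_singleton) (auto simp: N_def)
  also have "... = 0" by (rule sum.neutral) (auto simp: N.emeasure_eq_measure)
  finally show ?thesis by (simp add: null_sets_def N_def)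
 qed
 have "AE y in N. measure N {y} ~= 0"
  using AEr AE_not_in[OF null] by eventually_elim auto
 moreover have "sets N = UNIV" by (simp add: N_def)
 ultimately have "N : {M. prob_space M & sets M = UNIV & (AE x in M. measure M {x} ~= 0)}"
  using N.prob_space_axioms by (intro CollectI conjI)
 from Abs_pmf_inverse[OF this] have p: "measure_pmf (Abs_pmf N) = N" .
 show thesis
 proof (rule that)
  show "finite (set_pmf (Abs_pmf N))"
   by (rule finite_subset[OF _ finR]) (use mN in \<open>auto simp: set_pmf.rep_eq p\<close>)
  show "law (Abs_pmf N) = distr nu borel X"
   unfolding law_def p unfolding N_def by (subst distr_distr[OF _ Xm]) (auto simp: comp_def)
 qed
qed

text \<open>Simple functions converging to the identity and bounded by 2*|x| are coupled with the
  identity itself; the squared distance is at most 9*|x|^2, so dominated convergence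
  applies.\<close>

lemma finite_support_dense:
 assumes nu: "nu : P2"
 obtains p where "!!n. finite (set_pmf (p n))" "(%n. W2 (law (p n)) nu) ----> 0"
proof -
 note D = P2_D[OF nu]
 have id: "(%x. x) : borel_measurable nu" by (simp add: measurable_cong_sets[OF D(2) refl])
 obtain X where X: "!!i. simple_function nu (X i)" "!!x. (%i. X i x) ----> x" "!!i x. norm (X i x) <= 2*norm x"
  using borel_measurable_implies_sequence_metric[OF id, of 0] D(3) by (auto simp: dist_norm)
 have XB: "X i : borel_measurable nu" for i by (rule borel_measurable_simple_function[OF X(1)])
 have "EX p. finite (set_pmf p) & law p = distr nu borel (X i)" for i
  using simple_distr_eq_law[OF D(1,3) X(1)[of i]] by metis
 then obtain p where p: "!!i. finite (set_pmf (p i))" "!!i. law (p i) = distr nu borel (X i)" by metis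
 have bound: "(dist (X i x) x)^2 <= 9*(norm x)^2" for i x
 proof -
  have "dist (X i x) x <= 3*norm x" using norm_triangle_ineq4[of "X i x" x] X(3)[of i x] by (simp add: dist_norm)
  hence "(dist (X i x) x)^2 <= (3*norm x)^2" by (intro power_mono) auto
  thus ?thesis by (simp add: power_mult_distrib)
 qed
 have dm: "(%x. (dist (X i x) x)^2) : borel_measurable nu" for i using XB[of i] id by measurable
 have dint: "integrable nu (%x. (dist (X i x) x)^2)" for i
  by (rule Bochner_Integration.integrable_bound[OF integrable_mult_right[OF D(4), of 9] dm]) (use bound in auto)
 define c where "c i = (LINT x|nu. (dist (X i x) x)^2)" for i
 have "c ----> (LINT x|nu. 0)"
  unfolding c_def[abs_def]
 proof (rule integral_dominated_convergence[OF _ dm integrable_mult_right[OF D(4), of 9]])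
  show "AE x in nu. (%i. (dist (X i x) x)^2) ----> 0"
  proof (intro always_eventually allI)
   fix x
   have "(%i. (dist (X i x) x)^2) ----> (dist x x)^2" by (intro tendsto_intros X(2))
   thus "(%i. (dist (X i x) x)^2) ----> 0" by simp
  qed
  show "AE x in nu. norm ((dist (X i x) x)^2) <= 9*(norm x)^2" for i using bound by auto
 qed simp
 hence c: "(%i. sqrt (c i)) ----> 0" using tendsto_real_sqrt[of c 0] by simp
 have c0: "0 <= c i" for i by (simp add: c_def)
 have nu_id: "distr nu borel (%x. x) = nu" by (rule distr_id2) (simp add: D(2))
 have "W2 (law (p i)) nu <= sqrt (c i)" for i
  using W2_le_distr[OF D(1) XB[of i] id, of "sqrt (c i)"] c0[of i]
  by (simp add: nu_id p(2) nn_integral_eq_integral[OF dint] c_def)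
 hence "(%i. W2 (law (p i)) nu) ----> 0"
  by (intro Lim_null_comparison[OF _ c] always_eventually allI) (simp add: W2_nonneg)
 thus thesis using that p(1) by blast
qed

context dynamics
begin

lemma admissible_fokker_planck_0:
 assumes adm: "(m, b, A) : admissible T F nu" and tf: "test_function T phi phit g H"
 shows "(LINT z|flow_law T m. fp_integrand T phit g H z (on_slab T b z, on_slab T A z)) = 0"
proof (rule admissible_fokker_planck[OF adm tf])
 note fl = admissible_flow(1)[OF adm]
 obtain M where M: "0 <= M" "!!t. t : {0..T} ==> M2 (m t) <= M" by (rule flow_M2_bounded[OF fl]) (rule that)
 have K: "0 <= C_b*(2+M)+C_A*(1+M^2)" using C_nonneg M(1) by simp
 show "integrable (flow_law T m) (%z. fp_integrand T phit g H z (on_slab T b z, on_slab T A z))"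
 proof (rule fp_integrand_integrable(1)[OF tf T_pos admissible_kernel[OF adm] _ K])
  show "(%z. (on_slab T b z, on_slab T A z)) : borel_measurable borel"
   using admissible_measurable[OF adm] by (intro borel_measurable_Pair) auto
  show "AE z in flow_law T m. norm (on_slab T b z, on_slab T A z) <= (C_b*(2+M)+C_A*(1+M^2))*(1+(norm (snd z))^2)"
   using admissible_incl[OF adm] AE_flow_law_time[OF T_pos admissible_kernel[OF adm]]
   by eventually_elim (rule control_growth(4)[OF _ flow_of_probabilities_D(1)[OF fl] M(2)])
 qed
qed

end

context approximation
begin

lemma f_along_integrable:
 "integrable (flow_law T (m n)) (%z. f_along (m n) (z, ctrl n z))"
 "abs(\<integral>z. f_along (m n) (z, ctrl n z) \<partial>flow_law T (m n)) <= K2*(1+M^2)"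
proof -
 interpret L: prob_space "flow_law T (m n)" by (rule flow_law_prob[OF T_pos kern])
 have bd: "AE z in flow_law T (m n). abs(f_along (m n) (z, ctrl n z)) <= K2*(1+(norm (snd z))^2)"
  using incl[of n] AE_flow_law_time[OF T_pos kern, of n]
 proof eventually_elim
  case (elim z)
  have "snd (ctrl n z) : sym_psd" using A_psd by (simp add: ctrl_def)
  hence "f_along (m n) (z, ctrl n z) = f (fst z) (snd z) (m n (fst z)) (fst (ctrl n z)) (snd (ctrl n z))"
   using elim(2) by (simp add: f_along_def)
  thus ?case
   using f_bound(2)[OF elim(2) ui[OF elim(2)] tau_range[OF elim(2)] elim(1)] by (simp add: ctrl_def)
 qed
 have i: "integrable (flow_law T (m n)) (%z. K2*(1+(norm (snd z))^2))" using second_moment(1) by simp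
 show int: "integrable (flow_law T (m n)) (%z. f_along (m n) (z, ctrl n z))"
 proof (rule Bochner_Integration.integrable_bound[OF i])
  show "(%z. f_along (m n) (z, ctrl n z)) : borel_measurable (flow_law T (m n))"
   unfolding measurable_cong_sets[OF flow_law_sets[OF T_pos kern] refl] using f_meas[of n] by (simp add: ctrl_def)
  show "AE z in flow_law T (m n). norm (f_along (m n) (z, ctrl n z)) <= norm (K2*(1+(norm (snd z))^2))"
   using bd by eventually_elim simp
 qed
 have "abs(\<integral>z. f_along (m n) (z, ctrl n z) \<partial>flow_law T (m n)) <= (LINT z|flow_law T (m n). abs(f_along (m n) (z, ctrl n z)))"
  by (rule integral_abs_bound)
 also have "... <= (LINT z|flow_law T (m n). K2*(1+(norm (snd z))^2))"
  by (rule integral_mono_AE[OF integrable_abs[OF int] i bd])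
 also have "... = K2*(1+(LINT z|flow_law T (m n). (norm (snd z))^2))"
  using second_moment(1) by (simp add: L.prob_space)
 also have "... <= K2*(1+M^2)" using second_moment(2)[of n] f_bound(1) by (intro mult_left_mono) auto
 finally show "abs(\<integral>z. f_along (m n) (z, ctrl n z) \<partial>flow_law T (m n)) <= K2*(1+M^2)" .
qed

end

context running_cost
begin

definition "run m b A = (LBINT t:{0..T}. LINT x|m t. f t x (m t) (b t x) (A t x))"

lemma run_eq:
 assumes adm: "(m, b, A) : admissible T F nu"
  and int: "integrable (flow_law T m) (%z. f_along m (z, (on_slab T b z, on_slab T A z)))"
 shows "T*(LINT z|flow_law T m. f_along m (z, (on_slab T b z, on_slab T A z))) = run m b A"
 unfolding run_def integral_flow_law(1)[OF T_pos admissible_kernel[OF adm] int, symmetric]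
proof (rule set_lebesgue_integral_cong)
 have "A t x : sym_psd" if "t : {0..T}" for t x
  using admissible_psd[OF adm, of "(t, x)"] that by (simp add: on_slab_def)
 thus "ALL t. t : {0..T} --> (LINT x|m t. f_along m ((t, x), (on_slab T b (t, x), on_slab T A (t, x)))) =
  (LINT x|m t. f t x (m t) (b t x) (A t x))"
  by (simp add: f_along_def on_slab_def)
qed simp

text \<open>The boundedness of the running costs is part of the conclusion, so that the statement can be
 applied once more to a subsequence along which the running costs converge.\<close>

lemma admissible_limit:
 assumes nu: "!!n. nu n : P2" "nu0 : P2" "(%n. W2 (nu n) nu0) ----> 0"
  and adm: "!!n. (m n, b n, A n) : admissible T F (nu n)"
 shows "EX r l b0 A0 K. strict_mono (r :: nat => nat) & (l, b0, A0) : admissible T F nu0 &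
  (%n. W2 (m (r n) T) (l T)) ----> 0 & (ALL n. abs(run (m (r n)) (b (r n)) (A (r n))) <= K) &
  (ALL c0. (%n. run (m (r n)) (b (r n)) (A (r n))) ----> c0 --> run l b0 A0 <= c0)"
proof -
 obtain e0 where e0: "(e0 \<longlongrightarrow> 0) at_top" "!!n. nu n : ui_set e0" using W2_convergent_ui[OF nu] by blast
 obtain e where e: "(e \<longlongrightarrow> 0) at_top" and e_ui: "ALL nu:ui_set e0. ALL m b A. (m, b, A) : admissible T F nu --> (ALL t:{0..T}. m t : ui_set e)"
  using admissible_ui[OF e0(1)] by blast
 have ui: "m n t : ui_set e" if "t : {0..T}" for n t using e_ui e0(2) adm that by blast
 define M where "M = sqrt (e 1+1)"
 have M2M: "M2 (m n t) <= M" if "t : {0..T}" for n t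
  using M2_le_tail_moment[OF ui_setD(1)[OF ui[OF that, of n]], of 1] ui_setD(2)[OF ui[OF that, of n], of 1]
  unfolding M_def by (intro real_le_rsqrt) simp
 have "0 : {0..T}" using T_pos by simp
 hence M0: "0 <= M" using M2M[of 0 0] M2_nonneg[of "m 0 0"] by linarith
 have equi: "EX C err. 0 <= C & err ----> 0 & (ALL n. ALL s:{0..T}. ALL t:{0..T}.
   \<bar>(LINT x|m n t. bump (real (Suc j)) a x)-(LINT x|m n s. bump (real (Suc j)) a x)\<bar> <= C*\<bar>t-s\<bar> + err n)" for j a
 proof -
  have "0 < real (Suc j)" by simp
  from admissible_bump_equicontinuous[OF M0 this, of a]
  obtain C where C: "0 <= C" "ALL m b A nu. (m, b, A) : admissible T F nu --> (ALL t:{0..T}. M2 (m t) <= M) -->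
   (ALL s:{0..T}. ALL t:{0..T}. \<bar>(LINT x|m t. bump (real (Suc j)) a x)-(LINT x|m s. bump (real (Suc j)) a x)\<bar> <= C*\<bar>t-s\<bar>)"
   by auto
  show ?thesis
  proof (intro exI[of _ C] exI[of _ "%_. 0"] conjI C(1) allI ballI)
   fix n s t assume "s : {0..T}" "t : {0..T}"
   thus "\<bar>(LINT x|m n t. bump (real (Suc j)) a x)-(LINT x|m n s. bump (real (Suc j)) a x)\<bar> <= C*\<bar>t-s\<bar> + 0"
    using C(2)[rule_format, OF adm] M2M by simp
  qed simp
 qed
 show ?thesis
 proof (rule curve_compactness[OF T_pos ui e equi])
  fix r :: "nat => nat" and l
  assume r: "strict_mono r" and l_ui: "!!t. t : {0..T} ==> l t : ui_set e" and l_flow: "flow_of_probabilities T l"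
   and near: "!!t eps. t : {0..T} ==> 0 < eps ==> EX N dl. 0 < dl & (ALL n>=N. ALL s:{0..T}. abs(s-t) < dl --> W2 (m (r n) s) (l t) < eps)"
  \<comment> \<open>Admissible flows are exact solutions: no time shift, and the equation holds for
    each \<open>n\<close>.\<close>
  interpret approximation T C_b C_A F f C_f "%n. m (r n)" l "%n. on_slab T (b (r n))" "%n. on_slab T (A (r n))" "%_ t. t" "%_. 0" e
  proof
   show "flow_kernel T (m (r n))" for n by (rule admissible_kernel[OF adm])
   show "on_slab T (b (r n)) : borel_measurable borel" "on_slab T (A (r n)) : borel_measurable borel" for n
    by (rule admissible_measurable[OF adm])+
   show "on_slab T (A (r n)) z : sym_psd" for n z by (rule admissible_psd[OF adm])
   show "AE z in flow_law T (m (r n)). (on_slab T (b (r n)) z, on_slab T (A (r n)) z) : F (fst z) (snd z) (m (r n) (fst z))" for n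
    by (rule admissible_incl[OF adm])
   show "(%n. LINT z|flow_law T (m (r n)). fp_integrand T phit g H z (on_slab T (b (r n)) z, on_slab T (A (r n)) z)) ----> 0"
    if "test_function T phi phit g H" for phi phit g H
    by (simp add: admissible_fokker_planck_0[OF adm that])
   show "(%z. f_along (m (r n)) (z, on_slab T (b (r n)) z, on_slab T (A (r n)) z)) : borel_measurable borel" for n
   proof (rule measurable_compose[OF _ f_along_measurable[OF admissible_flow(1)[OF adm]]])
    show "(%z. (z, on_slab T (b (r n)) z, on_slab T (A (r n)) z)) : borel \<rightarrow>\<^sub>M borel"
     using admissible_measurable[OF adm, of "r n"] by (intro borel_measurable_Pair) auto
   qed
  qed (use ui e l_flow l_ui near in auto)
  have run_n: "T*(LINT z|flow_law T (m (r n)). f_along (m (r n)) (z, ctrl n z)) = run (m (r n)) (b (r n)) (A (r n))" for n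
   unfolding ctrl_def by (rule run_eq[OF adm f_along_integrable(1)[of n, unfolded ctrl_def]])
  have W2T: "(%n. W2 (m (r n) t) (l t)) ----> 0" if t: "t : {0..T}" for t
   using tendsto_flow[OF t, of "%_. t" "%n. n"] t by (simp add: strict_mono_def)
  have "l 0 = nu0"
  proof -
   have P: "l 0 : P2" using ui_setD(1)[OF l_ui[OF `0 : {0..T}`]] .
   have "(%n. W2 (nu (r n)) (l 0)) ----> 0" using W2T[OF `0 : {0..T}`] by (simp add: admissible_flow(2)[OF adm])
   hence "limitin P2_topology (%n. nu (r n)) (l 0) sequentially" using P nu(1) by (simp add: limitin_P2_topology)
   moreover have "limitin P2_topology (%n. nu (r n)) nu0 sequentially"
    using LIMSEQ_subseq_LIMSEQ[OF nu(3) r] nu(1,2) by (simp add: limitin_P2_topology comp_def)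
   ultimately show ?thesis
    unfolding P2_topology_def by (rule W2.limitin_metric_unique) simp
  qed
  moreover obtain b0 A0 where "(l, b0, A0) : admissible T F (l 0)"
   and lim: "ALL c c0. (ALL n. T*(LINT z|flow_law T (m (r n)). f_along (m (r n)) (z, ctrl n z)) <= c n) --> c ----> c0 -->
    (LBINT t:{0..T}. LINT x|l t. f t x (l t) (b0 t x) (A0 t x)) <= c0"
   using closure by blast
  moreover have "abs(run (m (r n)) (b (r n)) (A (r n))) <= T*(K2*(1+approximation.M e^2))" for n
   unfolding run_n[symmetric] abs_mult using f_along_integrable(2)[of n] T_pos by simp
  moreover have "run l b0 A0 <= c0" if "(%n. run (m (r n)) (b (r n)) (A (r n))) ----> c0" for c0
   using lim[rule_format, of "%n. run (m (r n)) (b (r n)) (A (r n))" c0] that unfolding run_n run_def[of l] by simp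
  moreover have "(%n. W2 (m (r n) T) (l T)) ----> 0" using T_pos by (intro W2T) simp
  ultimately show ?thesis using r by blast
 qed
qed

text \<open>Processes started from finitely supported laws that converge to \<open>nu\<close> have a
  limit, and it starts at \<open>nu\<close>.\<close>

lemma admissible_nonempty:
 assumes "nu : P2"
 shows "admissible T F nu ~= {}"
proof -
 obtain p where p: "!!n. finite (set_pmf (p n))" "(%n. W2 (law (p n)) nu) ----> 0"
  by (rule finite_support_dense[OF assms]) (rule that)
 have "EX x. x : admissible T F (law (p n))" for n using admissible_law_nonempty[OF p(1)] by blast
 then obtain x where "!!n. x n : admissible T F (law (p n))" by metis
 hence "(fst (x n), fst (snd (x n)), snd (snd (x n))) : admissible T F (law (p n))" for n by simp
 from admissible_limit[OF law_P2[OF p(1)] assms p(2) this] show ?thesis by blast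
qed

text \<open>Existence of a minimizer and lower semicontinuity of \<open>Val\<close> are both
  instances: constant initial laws with a minimizing sequence, or converging initial laws with a
  constant bound.\<close>

lemma cost_limit:
 assumes G: "lower_semicontinuous_map P2_topology G"
  and nu: "!!n. nu n : P2" "nu0 : P2" "(%n. W2 (nu n) nu0) ----> 0"
  and adm: "!!n. (m n, b n, A n) : admissible T F (nu n)"
  and a: "!!n. ereal (cost T G f (m n) (b n) (A n)) <= a n" "a ----> a0"
 shows "EX l b0 A0. (l, b0, A0) : admissible T F nu0 & ereal (cost T G f l b0 A0) <= a0"
proof -
 have cost: "cost T G f m b A = G (m T)+run m b A" for m b A by (simp add: cost_def run_def)
 define R where "R n = run (m n) (b n) (A n)" for n
 \<comment> \<open>From the first application only the bound on the running costs is taken; it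
   yields a subsequence along which they converge, and the second application, along that
   subsequence, compares with the limit.\<close>
 obtain r K where r: "strict_mono (r :: nat => nat)" and K: "!!n. abs(R (r n)) <= K"
  using admissible_limit[OF nu adm] unfolding R_def by blast
 have "bounded (range (%n. R (r n)))" using K by (auto simp: bounded_iff)
 from bounded_imp_convergent_subsequence[OF this]
 obtain c0 s where s: "strict_mono (s :: nat => nat)" and c0: "(%n. R (r (s n))) ----> c0" by (auto simp: comp_def)
 have rs: "strict_mono (%n. r (s n))" using strict_mono_o[OF r s] by (simp add: comp_def)
 have "(%n. W2 (nu (r (s n))) nu0) ----> 0" using LIMSEQ_subseq_LIMSEQ[OF nu(3) rs] by (simp add: comp_def)
 from admissible_limit[OF nu(1,2) this adm]
 obtain r' l b0 A0 where r': "strict_mono (r' :: nat => nat)" and l: "(l, b0, A0) : admissible T F nu0"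
  and lT: "(%n. W2 (m (r (s (r' n))) T) (l T)) ----> 0"
  and lim: "ALL c0. (%n. R (r (s (r' n)))) ----> c0 --> run l b0 A0 <= c0"
  unfolding R_def by blast
 define k where "k n = r (s (r' n))" for n
 have k: "strict_mono k" using strict_mono_o[OF rs r'] by (simp add: comp_def k_def[abs_def])
 have Rk: "(%n. R (k n)) ----> c0" using LIMSEQ_subseq_LIMSEQ[OF c0 r'] by (simp add: comp_def k_def)
 have runl: "run l b0 A0 <= c0" using lim Rk unfolding k_def by blast
 have T: "T : {0..T}" using T_pos by simp
 have limT: "limitin P2_topology (%n. m (k n) T) (l T) sequentially"
  using lT flow_of_probabilities_D(1)[OF admissible_flow(1)[OF l] T] flow_of_probabilities_D(1)[OF admissible_flow(1)[OF adm] T]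
  by (simp add: limitin_P2_topology k_def)
 have ak: "(%n. a (k n)) ----> a0" using LIMSEQ_subseq_LIMSEQ[OF a(2) k] by (simp add: comp_def)
 \<comment> \<open>Lower semicontinuity gives the terminal cost only up to \<open>dl\<close>, which
   is removed afterwards.\<close>
 have G0: "ereal (G (l T)-dl + c0) <= a0" if dl: "0 < dl" for dl
 proof -
  have lhs: "(%n. ereal (G (l T)-dl+R (k n))) ----> ereal (G (l T)-dl + c0)"
   unfolding lim_ereal by (intro tendsto_intros Rk)
  have "\<forall>\<^sub>F n in sequentially. G (l T)-dl < G (m (k n) T)"
   by (rule lower_semicontinuous_map_eventually[OF G limT]) (use dl in simp)
  hence "\<forall>\<^sub>F n in sequentially. ereal (G (l T)-dl+R (k n)) <= a (k n)"
  proof eventually_elim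
   case (elim n)
   hence "ereal (G (l T)-dl+R (k n)) <= ereal (cost T G f (m (k n)) (b (k n)) (A (k n)))"
    by (simp add: cost R_def)
   also have "... <= a (k n)" by (rule a(1))
   finally show ?case .
  qed
  with ak lhs show ?thesis by (intro tendsto_le[OF sequentially_bot ak lhs])
 qed
 have "ereal (G (l T) + c0) <= a0"
 proof (rule ereal_le_epsilon2)
  fix dl :: real assume "0 < dl"
  have "ereal (G (l T) + c0) = ereal (G (l T)-dl + c0)+ereal dl" by simp
  also have "... <= a0+ereal dl" by (intro add_right_mono G0 `0 < dl`)
  finally show "ereal (G (l T) + c0) <= a0+ereal dl" .
 qed
 moreover have "ereal (cost T G f l b0 A0) <= ereal (G (l T) + c0)" using runl by (simp add: cost)
 ultimately show ?thesis using l order_trans by blast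
qed

end

theorem theorem3p5:
  fixes T C_b C_A :: real
    and F :: "real \<Rightarrow> real ^ 'd \<Rightarrow> (real ^ 'd) measure \<Rightarrow> ((real ^ 'd) \<times> (real ^ 'd ^ 'd)) set"
    and G C_f :: "(real ^ 'd) measure \<Rightarrow> real"
    and f :: "real \<Rightarrow> real ^ 'd \<Rightarrow> (real ^ 'd) measure \<Rightarrow> real ^ 'd \<Rightarrow> real ^ 'd ^ 'd \<Rightarrow> real"
  assumes T_pos: "T > 0"
    and F_range: "\<And>t x m. t \<in> {0..T} \<Longrightarrow> m \<in> P2 \<Longrightarrow> F t x m \<subseteq> UNIV \<times> sym_psd"
    and F_usc: "upper_semicontinuous_multimap
        (prod_topology (top_of_set {0..T}) (prod_topology euclidean P2_topology))
        (\<lambda>(t, x, m). F t x m)"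
    and F_nonempty: "\<And>t x m. t \<in> {0..T} \<Longrightarrow> m \<in> P2 \<Longrightarrow> F t x m \<noteq> {}"
    and F_convex: "\<And>t x m. t \<in> {0..T} \<Longrightarrow> m \<in> P2 \<Longrightarrow> convex (F t x m)"
    and C_nonneg: "C_b \<ge> 0" "C_A \<ge> 0"
    and drift_growth: "\<And>t x m \<beta> \<Sigma>. t \<in> {0..T} \<Longrightarrow> m \<in> P2 \<Longrightarrow> (\<beta>, \<Sigma>) \<in> F t x m \<Longrightarrow>
        norm \<beta> \<le> C_b * (1 + norm x + M2 m)"
    and diffusion_growth: "\<And>t x m \<beta> \<Sigma>. t \<in> {0..T} \<Longrightarrow> m \<in> P2 \<Longrightarrow> (\<beta>, \<Sigma>) \<in> F t x m \<Longrightarrow>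
        norm \<Sigma> \<le> C_A * (1 + (norm x)\<^sup>2 + (M2 m)\<^sup>2)"
    and G_lsc: "lower_semicontinuous_map P2_topology G"
    and f_lsc: "lower_semicontinuous_map
        (prod_topology (top_of_set {0..T}) (prod_topology euclidean (prod_topology P2_topology
          (prod_topology euclidean (top_of_set sym_psd)))))
        (\<lambda>(t, x, m, \<beta>, \<Sigma>). f t x m \<beta> \<Sigma>)"
    and G_bdd_below: "\<And>K. compactin P2_topology K \<Longrightarrow> bdd_below (G ` K)"
    and f_convex: "\<And>t x m. t \<in> {0..T} \<Longrightarrow> m \<in> P2 \<Longrightarrow>
        convex_on (UNIV \<times> sym_psd) (\<lambda>(\<beta>, \<Sigma>). f t x m \<beta> \<Sigma>)"
    and f_growth: "\<And>t x m \<beta> \<Sigma>. t \<in> {0..T} \<Longrightarrow> m \<in> P2 \<Longrightarrow> \<Sigma> \<in> sym_psd \<Longrightarrow>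
        \<bar>f t x m \<beta> \<Sigma>\<bar> \<le> C_f m * (1 + (norm x)\<^sup>2 + (norm \<beta>)\<^sup>2 + norm \<Sigma>)"
    and C_f_bounded: "\<And>K. compactin P2_topology K \<Longrightarrow> bounded (C_f ` K)"
  shows "(\<forall>\<nu>\<in>P2. \<exists>m0 b0 A0. (m0, b0, A0) \<in> admissible T F \<nu> \<and>
            Val T F G f \<nu> = ereal (cost T G f m0 b0 A0)) \<and>
         lower_semicontinuous_map P2_topology (Val T F G f)"
proof -
 interpret running_cost T C_b C_A F f C_f
  by unfold_locales (fact T_pos F_range F_usc F_nonempty F_convex C_nonneg drift_growth diffusion_growth
   f_lsc f_convex f_growth C_f_bounded)+
 have minimizer: "EX m0 b0 A0. (m0, b0, A0) : admissible T F nu & Val T F G f nu = ereal (cost T G f m0 b0 A0)"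
  if nu: "nu : P2" for nu
 proof -
  let ?J = "%(m, b, A). ereal (cost T G f m b A)"
  have "?J ` admissible T F nu ~= {}" using admissible_nonempty[OF nu] by simp
  from Inf_as_limit[OF this] obtain u where u: "!!n. u n : ?J ` admissible T F nu" "u ----> Val T F G f nu"
   unfolding Val_def by blast
  have "EX x. x : admissible T F nu & u n = ?J x" for n using u(1)[of n] by blast
  then obtain x where x: "!!n. x n : admissible T F nu" "!!n. u n = ?J (x n)" by metis
  have "EX l b0 A0. (l, b0, A0) : admissible T F nu & ereal (cost T G f l b0 A0) <= Val T F G f nu"
  proof (rule cost_limit[OF G_lsc _ nu _ _ _ u(2)])
   show "nu : P2" by fact
   show "(%n. W2 nu nu) ----> 0" by (simp add: W2_self[OF nu])
   show "(fst (x n), fst (snd (x n)), snd (snd (x n))) : admissible T F nu" for n using x(1) by simp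
   show "ereal (cost T G f (fst (x n)) (fst (snd (x n))) (snd (snd (x n)))) <= u n" for n
    using x(2)[of n] by (simp add: case_prod_beta)
  qed
  then obtain l b0 A0 where l: "(l, b0, A0) : admissible T F nu" "ereal (cost T G f l b0 A0) <= Val T F G f nu" by blast
  have "Val T F G f nu <= ereal (cost T G f l b0 A0)" unfolding Val_def by (rule INF_lower2[OF l(1)]) simp
  hence "Val T F G f nu = ereal (cost T G f l b0 A0)" using l(2) by simp
  thus ?thesis using l(1) by blast
 qed
 moreover have "lower_semicontinuous_map P2_topology (Val T F G f)"
  unfolding lower_semicontinuous_map_def
 proof
  fix a :: ereal
  \<comment> \<open>Sublevel sets are sequentially closed: exact minimizers along the sequence have
    costs at most \<open>a\<close>, and \<open>cost_limit\<close> produces a competitor at the limit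
    law.\<close>
  have "closedin P2_topology {nu : P2. Val T F G f nu <= a}"
   unfolding P2_topology_def W2.metric_closedin_iff_sequentially_closed
  proof (intro conjI allI impI)
   fix sg nu assume *: "range sg \<subseteq> {nu : P2. Val T F G f nu <= a} & limitin W2.mtopology sg nu sequentially"
   hence sg: "range sg \<subseteq> {nu : P2. Val T F G f nu <= a}" and lim: "limitin W2.mtopology sg nu sequentially" by blast+
   have sgP: "sg n : P2" "Val T F G f (sg n) <= a" for n using sg by auto
   have nu: "nu : P2" "(%n. W2 (sg n) nu) ----> 0"
    using lim unfolding P2_topology_def[symmetric] limitin_P2_topology by blast+
   obtain m b A where mbA: "!!n. (m n, b n, A n) : admissible T F (sg n)" "!!n. Val T F G f (sg n) = ereal (cost T G f (m n) (b n) (A n))"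
    using minimizer[OF sgP(1)] by metis
   have "ereal (cost T G f (m n) (b n) (A n)) <= a" for n using sgP(2)[of n] mbA(2)[of n] by simp
   hence "EX l b0 A0. (l, b0, A0) : admissible T F nu & ereal (cost T G f l b0 A0) <= a"
    by (rule cost_limit[OF G_lsc sgP(1) nu mbA(1) _ tendsto_const])
   then obtain l b0 A0 where l: "(l, b0, A0) : admissible T F nu" "ereal (cost T G f l b0 A0) <= a" by blast
   have "Val T F G f nu <= a" unfolding Val_def by (rule INF_lower2[OF l(1)]) (use l(2) in simp)
   thus "nu : {nu : P2. Val T F G f nu <= a}" using nu(1) by simp
  qed auto
  hence "openin P2_topology (topspace P2_topology - {nu : P2. Val T F G f nu <= a})" by (rule openin_diff[OF openin_topspace])
  moreover have "topspace P2_topology - {nu : P2. Val T F G f nu <= a} = {nu : topspace P2_topology. a < Val T F G f nu}" by auto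
  ultimately show "openin P2_topology {nu : topspace P2_topology. a < Val T F G f nu}" by simp
 qed
 ultimately show ?thesis by blast
qed

end
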